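(* Let $\Gamma$ be a finite subgroup of $\mathrm{SL}_2(\mathbb{C})$. The functors $\mathcal{F}:\mathbf{Rep}\to\mathbf{McK}$ and $\mathcal{G}:\mathbf{McK}\to\mathbf{Rep}$, between the category of representations of the double framed McKay quiver of $\Gamma$ and the category $\mathbf{McK}$ of $\Gamma$-module data, define an equivalence of categories.
   Context: **Notation.** All modules and vector spaces are finite-dimensional over $\mathbb{C}$. $\mathrm{Irr}$ is the set of irreducible characters of $\Gamma$; $X_\chi$ is an irreducible $\Gamma$-module with character $\chi$, $X_0=X_{\chi_0}$ the trivial one; $\delta_\chi=\dim X_\chi$; $X_{\mathrm{std}}=\mathbb{C}^2$ is the standard representation with character $\chi_{\mathrm{std}}$. The McKay multigraph $G_\Gamma$ has vertex set $\mathrm{Irr}$ and $\langle\chi\chi_{\mathrm{std}}|\chi'\rangle$ edges between $\chi$ and $\chi'$. $\overline{E}$ is the set of arrows of its double quiver (each edge replaced by two opposite arrows); for $h\in\overline{E}$, $h'$ and $h''$ are its source and target, $\bar h$ the reversed arrow, and $X_{h'},X_{h''}$ the corresponding modules. **Choices.** If $\Gamma\neq\mu_2$ (cyclic of order two), for each $h\in\overline{E}$ choose a nonzero $y_h\in\mathrm{Hom}_\Gamma(X_{\mathrm{std}}\otimes X_{h'},X_{h''})$ and a $\Gamma$-equivariant section $\tilde y_h\in\mathrm{Hom}_\Gamma(X_{h''},X_{\mathrm{std}}\otimes X_{h'})$ of $y_h$. If $\Gamma=\mu_2$, with nontrivial irreducible $X_1$, $X_{\mathrm{std}}=X_1\oplus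 X_1$, the arrows are $h_1,h_2:\chi_0\to\chi_1$ and $h_3,h_4:\chi_1\to\chi_0$ with $\bar h_1=h_4$, $\bar h_3=h_2$, and one takes $y_{h_1}((a,b)\otimes1)=a$, $y_{h_2}((a,b)\otimes1)=b$, $y_{h_3}((a,b)\otimes c)=ac$, $y_{h_4}((a,b)\otimes c)=bc$, $\tilde y_{h_1}(1)=(1,0)\otimes1=\tilde y_{h_3}(1)$, $\tilde y_{h_2}(1)=(0,1)\otimes1=\tilde y_{h_4}(1)$. **$\mathbf{Rep}$.** Objects: tuples $(V,V^f,x,v^1,v^2)$ with $V=\bigoplus_\chi V_\chi$, $V^f=\bigoplus_\chi V^f_\chi$ $\mathrm{Irr}$-graded vector spaces, linear maps $x_h:V_{h'}\to V_{h''}$ ($h\in\overline{E}$), $v^1_\chi:V^f_\chi\to V_\chi$, $v^2_\chi:V_\chi\to V^f_\chi$. Morphisms: families $\phi_\chi:V_\chi\to\tilde V_\chi$, $\psi_\chi:V^f_\chi\to\tilde V^f_\chi$ commuting with $x$, $v^1$, $v^2$. **$\mathbf{McK}$.** Objects: tuples $(M,M^f,\Delta,Z_1,Z_2)$ with $M,M^f$ $\Gamma$-modules and $\Gamma$-equivariant maps $\Delta:X_{\mathrm{std}}\otimes M\to M$, $Z_1:M^f\to M$, $Z_2:M\to M^f$. Morphisms: pairs $(\Phi,\Psi)$ of $\Gamma$-equivariant maps $\Phi:M\to\tilde M$, $\Psi:M^f\to\tilde M^f$ with $\Phi\Delta=\tilde\Delta(\mathrm{id}\otimes\Phi)$, $\Psi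 Z_2=\tilde Z_2\Phi$, $\Phi Z_1=\tilde Z_1\Psi$. **$\mathcal{F}$.** $\mathcal{F}(V,V^f,x,v^1,v^2)=(M,M^f,\Delta,Z_1,Z_2)$ where $M=\bigoplus_\chi V_\chi\otimes X_\chi$, $M^f=\bigoplus_\chi V^f_\chi\otimes X_\chi$, $\Delta=\sum_{h\in\overline{E}}y_h\otimes x_h$ (via $X_{\mathrm{std}}\otimes V_\chi\otimes X_\chi\cong(X_{\mathrm{std}}\otimes X_\chi)\otimes V_\chi$), $Z_1=\sum_\chi v^1_\chi\otimes\frac1{\delta_\chi}\mathrm{id}_{X_\chi}$, $Z_2=\sum_\chi v^2_\chi\otimes\mathrm{id}_{X_\chi}$; on morphisms $(\phi,\psi)\mapsto(\bigoplus\phi_\chi\otimes\mathrm{id}_{X_\chi},\bigoplus\psi_\chi\otimes\mathrm{id}_{X_\chi})$. **$\mathcal{G}$.** $\mathcal{G}(M,M^f,\Delta,Z_1,Z_2)=(V,V^f,x,v^1,v^2)$ where $V_\chi=\mathrm{Hom}_\Gamma(X_\chi,M)$, $V^f_\chi=\mathrm{Hom}_\Gamma(X_\chi,M^f)$, $x_h(f)=\Delta\circ(\mathrm{id}_{X_{\mathrm{std}}}\otimes f)\circ\tilde y_h$, $v^1_\chi(f)=\delta_\chi Z_1\circ f$, $v^2_\chi(f)=Z_2\circ f$; on morphisms $(\Phi,\Psi)\mapsto(\Phi\circ-,\Psi\circ-)$.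
   Formalization: The trivial group is excluded: for it the McKay graph is one vertex with two loops, so the double quiver has four arrows whose maps y_h on C^2 are linearly dependent, and F is then not an equivalence. *)

theory Defs
  imports "Jordan_Normal_Form.VS_Connect" "Graph_Theory.Digraph"
begin

section \<open>Categories\<close>

text \<open>Hom-sets are indexed by source and target and need not be disjoint; identities and
  composition therefore take the objects as arguments: \<open>Cmp C X Y Z g f\<close> is the composite
  of \<open>f : X \<rightarrow> Y\<close> and \<open>g : Y \<rightarrow> Z\<close>.\<close>

record ('o, 'm) cat =
  Ob :: "'o set"
  Mor :: "'o \<Rightarrow> 'o \<Rightarrow> 'm set"
  Idt :: "'o \<Rightarrow> 'm"
  Cmp :: "'o \<Rightarrow> 'o \<Rightarrow> 'o \<Rightarrow> 'm \<Rightarrow> 'm \<Rightarrow> 'm"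

definition category :: "('o, 'm) cat \<Rightarrow> bool" where
  "category C \<longleftrightarrow>
    (\<forall>X\<in>Ob C. Idt C X \<in> Mor C X X) \<and>
    (\<forall>X\<in>Ob C. \<forall>Y\<in>Ob C. \<forall>Z\<in>Ob C. \<forall>f\<in>Mor C X Y. \<forall>g\<in>Mor C Y Z. Cmp C X Y Z g f \<in> Mor C X Z) \<and>
    (\<forall>X\<in>Ob C. \<forall>Y\<in>Ob C. \<forall>f\<in>Mor C X Y.
        Cmp C X X Y f (Idt C X) = f \<and> Cmp C X Y Y (Idt C Y) f = f) \<and>
    (\<forall>W\<in>Ob C. \<forall>X\<in>Ob C. \<forall>Y\<in>Ob C. \<forall>Z\<in>Ob C. \<forall>f\<in>Mor C W X. \<forall>g\<in>Mor C X Y. \<forall>h\<in>Mor C Y Z.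
        Cmp C W Y Z h (Cmp C W X Y g f) = Cmp C W X Z (Cmp C X Y Z h g) f)"

text \<open>A functor is given by its object part and its morphism part, the latter taking source and
  target as arguments.\<close>

record ('o1, 'm1, 'o2, 'm2) fctr =
  onOb :: "'o1 \<Rightarrow> 'o2"
  onMor :: "'o1 \<Rightarrow> 'o1 \<Rightarrow> 'm1 \<Rightarrow> 'm2"

definition is_functor :: "('o1, 'm1) cat \<Rightarrow> ('o2, 'm2) cat \<Rightarrow> ('o1, 'm1, 'o2, 'm2) fctr \<Rightarrow> bool" where
  "is_functor C D F \<longleftrightarrow>
    (\<forall>X\<in>Ob C. onOb F X \<in> Ob D) \<and>
    (\<forall>X\<in>Ob C. \<forall>Y\<in>Ob C. \<forall>f\<in>Mor C X Y. onMor F X Y f \<in> Mor D (onOb F X) (onOb F Y)) \<and>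
    (\<forall>X\<in>Ob C. onMor F X X (Idt C X) = Idt D (onOb F X)) \<and>
    (\<forall>X\<in>Ob C. \<forall>Y\<in>Ob C. \<forall>Z\<in>Ob C. \<forall>f\<in>Mor C X Y. \<forall>g\<in>Mor C Y Z.
        onMor F X Z (Cmp C X Y Z g f) =
        Cmp D (onOb F X) (onOb F Y) (onOb F Z) (onMor F Y Z g) (onMor F X Y f))"

definition id_functor :: "('o, 'm, 'o, 'm) fctr" where
  "id_functor = \<lparr>onOb = (\<lambda>X. X), onMor = (\<lambda>X Y f. f)\<rparr>"

definition comp_functor ::
  "('o2, 'm2, 'o3, 'm3) fctr \<Rightarrow> ('o1, 'm1, 'o2, 'm2) fctr \<Rightarrow> ('o1, 'm1, 'o3, 'm3) fctr" where
  "comp_functor G F =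
    \<lparr>onOb = (\<lambda>X. onOb G (onOb F X)),
     onMor = (\<lambda>X Y f. onMor G (onOb F X) (onOb F Y) (onMor F X Y f))\<rparr>"

definition is_iso :: "('o, 'm) cat \<Rightarrow> 'o \<Rightarrow> 'o \<Rightarrow> 'm \<Rightarrow> bool" where
  "is_iso C X Y f \<longleftrightarrow> f \<in> Mor C X Y \<and>
    (\<exists>g\<in>Mor C Y X. Cmp C X Y X g f = Idt C X \<and> Cmp C Y X Y f g = Idt C Y)"

definition naturally_isomorphic ::
  "('o1, 'm1) cat \<Rightarrow> ('o2, 'm2) cat \<Rightarrow> ('o1, 'm1, 'o2, 'm2) fctr \<Rightarrow> ('o1, 'm1, 'o2, 'm2) fctr \<Rightarrow> bool"
where
  "naturally_isomorphic C D F G \<longleftrightarrow> (\<exists>\<eta>.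
    (\<forall>X\<in>Ob C. is_iso D (onOb F X) (onOb G X) (\<eta> X)) \<and>
    (\<forall>X\<in>Ob C. \<forall>Y\<in>Ob C. \<forall>f\<in>Mor C X Y.
        Cmp D (onOb F X) (onOb F Y) (onOb G Y) (\<eta> Y) (onMor F X Y f) =
        Cmp D (onOb F X) (onOb G X) (onOb G Y) (onMor G X Y f) (\<eta> X)))"

definition equivalence_of_categories ::
  "('o1, 'm1) cat \<Rightarrow> ('o2, 'm2) cat \<Rightarrow> ('o1, 'm1, 'o2, 'm2) fctr \<Rightarrow> ('o2, 'm2, 'o1, 'm1) fctr \<Rightarrow> bool"
where
  "equivalence_of_categories C D F G \<longleftrightarrow>
    category C \<and> category D \<and> is_functor C D F \<and> is_functor D C G \<and>
    naturally_isomorphic C C id_functor (comp_functor G F) \<and>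
    naturally_isomorphic D D (comp_functor F G) id_functor"


section \<open>Finite-dimensional complex vector spaces\<close>

text \<open>Vector spaces are records with a carrier; the ring fields \<open>mult\<close> and \<open>one\<close> that a
  module record inherits are irrelevant. Linear maps are extensional functions, so that two of
  them are equal as soon as they agree on the carrier.\<close>

abbreviation Cf :: "complex ring" where
  "Cf \<equiv> class_ring"

definition fdvs :: "(complex, 'a, 'x) module_scheme \<Rightarrow> bool" where
  "fdvs V \<longleftrightarrow> vectorspace Cf V \<and> vectorspace.fin_dim Cf V"

definition Lin ::
  "(complex, 'a, 'x) module_scheme \<Rightarrow> (complex, 'b, 'y) module_scheme \<Rightarrow> ('a \<Rightarrow> 'b) set" where
  "Lin V W = LinearCombinations.module_hom Cf V W \<inter> extensional (carrier V)"

definition Lin_space ::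
  "(complex, 'a, 'x) module_scheme \<Rightarrow> (complex, 'b, 'y) module_scheme \<Rightarrow> (complex, 'a \<Rightarrow> 'b) module" where
  "Lin_space V W = \<lparr>carrier = Lin V W, mult = undefined, one = undefined,
     zero = (\<lambda>v\<in>carrier V. \<zero>\<^bsub>W\<^esub>),
     add = (\<lambda>f g. \<lambda>v\<in>carrier V. f v \<oplus>\<^bsub>W\<^esub> g v),
     smult = (\<lambda>c f. \<lambda>v\<in>carrier V. c \<odot>\<^bsub>W\<^esub> f v)\<rparr>"

definition Cline :: "(complex, complex) module" where
  "Cline = \<lparr>carrier = UNIV, mult = (*), one = 1, zero = 0, add = (+), smult = (*)\<rparr>"

text \<open>The trace of an endomorphism, computed in an arbitrary basis.\<close>

definition coords :: "(complex, 'a, 'x) module_scheme \<Rightarrow> 'a set \<Rightarrow> 'a \<Rightarrow> 'a \<Rightarrow> complex" where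
  "coords V B v = (THE a. a \<in> extensional B \<and> module.lincomb V a B = v)"

definition vtrace :: "(complex, 'a, 'x) module_scheme \<Rightarrow> ('a \<Rightarrow> 'a) \<Rightarrow> complex" where
  "vtrace V f = (let B = (SOME B. vectorspace.basis Cf V B) in \<Sum>b\<in>B. coords V B (f b) b)"

text \<open>Tensor products of finite-dimensional spaces, realised as the dual of the space of bilinear
  forms. A bilinear form on \<open>V \<times> W\<close> is a linear map from \<open>V\<close> to the dual of \<open>W\<close>; the pure
  tensor of \<open>v\<close> and \<open>w\<close> is evaluation at \<open>(v, w)\<close>.\<close>

type_synonym ('a, 'b) tens = "('a \<Rightarrow> 'b \<Rightarrow> complex) \<Rightarrow> complex"

definition bilin_forms ::
  "(complex, 'a, 'x) module_scheme \<Rightarrow> (complex, 'b, 'y) module_scheme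
    \<Rightarrow> (complex, 'a \<Rightarrow> 'b \<Rightarrow> complex) module" where
  "bilin_forms V W = Lin_space V (Lin_space W Cline)"

definition tensor ::
  "(complex, 'a, 'x) module_scheme \<Rightarrow> (complex, 'b, 'y) module_scheme
    \<Rightarrow> (complex, ('a, 'b) tens) module" where
  "tensor V W = Lin_space (bilin_forms V W) Cline"

definition pure ::
  "(complex, 'a, 'x) module_scheme \<Rightarrow> (complex, 'b, 'y) module_scheme \<Rightarrow> 'a \<Rightarrow> 'b \<Rightarrow> ('a, 'b) tens" where
  "pure V W v w = (\<lambda>B\<in>carrier (bilin_forms V W). B v w)"

text \<open>The linear map on \<open>V \<otimes> W\<close> induced by a bilinear map \<open>b\<close>, by the universal property.\<close>

definition tlift ::
  "(complex, 'a, 'x) module_scheme \<Rightarrow> (complex, 'b, 'y) module_scheme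
    \<Rightarrow> (complex, 'c, 'z) module_scheme \<Rightarrow> ('a \<Rightarrow> 'b \<Rightarrow> 'c) \<Rightarrow> ('a, 'b) tens \<Rightarrow> 'c" where
  "tlift V W Z b = (THE f. f \<in> Lin (tensor V W) Z \<and>
     (\<forall>v\<in>carrier V. \<forall>w\<in>carrier W. f (pure V W v w) = b v w))"

text \<open>\<open>f \<otimes> g : V \<otimes> W \<rightarrow> V' \<otimes> W'\<close>\<close>

definition tmap ::
  "(complex, 'a, 'x) module_scheme \<Rightarrow> (complex, 'b, 'y) module_scheme
    \<Rightarrow> (complex, 'c, 'z) module_scheme \<Rightarrow> (complex, 'd, 'w) module_scheme
    \<Rightarrow> ('a \<Rightarrow> 'c) \<Rightarrow> ('b \<Rightarrow> 'd) \<Rightarrow> ('a, 'b) tens \<Rightarrow> ('c, 'd) tens" where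
  "tmap V W V' W' f g = tlift V W (tensor V' W') (\<lambda>v w. pure V' W' (f v) (g w))"


section \<open>Modules over a finite subgroup of the special linear group\<close>

definition SL2 :: "complex mat monoid" where
  "SL2 = \<lparr>carrier = {A \<in> carrier_mat 2 2. det A = 1}, mult = (*), one = 1\<^sub>m 2\<rparr>"

record 'a gmod = "(complex, 'a) module" +
  act :: "complex mat \<Rightarrow> 'a \<Rightarrow> 'a"

definition with_act :: "(complex, 'a) module \<Rightarrow> (complex mat \<Rightarrow> 'a \<Rightarrow> 'a) \<Rightarrow> 'a gmod" where
  "with_act V a = module.extend V (gmod.fields a)"

definition is_gmod :: "complex mat set \<Rightarrow> 'a gmod \<Rightarrow> bool" where
  "is_gmod \<Gamma> M \<longleftrightarrow> fdvs M \<and>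
    (\<forall>g\<in>\<Gamma>. act M g \<in> LinearCombinations.module_hom Cf M M) \<and>
    (\<forall>m\<in>carrier M. act M (1\<^sub>m 2) m = m) \<and>
    (\<forall>g\<in>\<Gamma>. \<forall>h\<in>\<Gamma>. \<forall>m\<in>carrier M. act M (g * h) m = act M g (act M h m))"

definition GHom :: "complex mat set \<Rightarrow> 'a gmod \<Rightarrow> 'b gmod \<Rightarrow> ('a \<Rightarrow> 'b) set" where
  "GHom \<Gamma> M N = {f \<in> Lin M N. \<forall>g\<in>\<Gamma>. \<forall>m\<in>carrier M. f (act M g m) = act N g (f m)}"

definition GHom_space :: "complex mat set \<Rightarrow> 'a gmod \<Rightarrow> 'b gmod \<Rightarrow> (complex, 'a \<Rightarrow> 'b) module" where
  "GHom_space \<Gamma> M N = (Lin_space M N)\<lparr>carrier := GHom \<Gamma> M N\<rparr>"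

definition irreducible_gmod :: "complex mat set \<Rightarrow> 'a gmod \<Rightarrow> bool" where
  "irreducible_gmod \<Gamma> M \<longleftrightarrow> is_gmod \<Gamma> M \<and> carrier M \<noteq> {\<zero>\<^bsub>M\<^esub>} \<and>
    (\<forall>W. VectorSpace.subspace Cf W M \<and> (\<forall>g\<in>\<Gamma>. act M g ` W \<subseteq> W) \<longrightarrow> W = {\<zero>\<^bsub>M\<^esub>} \<or> W = carrier M)"

definition gtensor :: "'a gmod \<Rightarrow> 'b gmod \<Rightarrow> ('a, 'b) tens gmod" where
  "gtensor M N = with_act (tensor M N) (\<lambda>g. tmap M N M N (act M g) (act N g))"

definition triv :: "(complex, 'a) module \<Rightarrow> 'a gmod" where
  "triv V = with_act V (\<lambda>g v. v)"

definition gsum :: "'i set \<Rightarrow> ('i \<Rightarrow> 'a gmod) \<Rightarrow> ('i \<Rightarrow> 'a) gmod" where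
  "gsum I M = \<lparr>carrier = (\<Pi>\<^sub>E i\<in>I. carrier (M i)), mult = undefined, one = undefined,
     zero = (\<lambda>i\<in>I. \<zero>\<^bsub>M i\<^esub>),
     add = (\<lambda>m n. \<lambda>i\<in>I. m i \<oplus>\<^bsub>M i\<^esub> n i),
     smult = (\<lambda>c m. \<lambda>i\<in>I. c \<odot>\<^bsub>M i\<^esub> m i),
     act = (\<lambda>g m. \<lambda>i\<in>I. act (M i) g (m i))\<rparr>"

definition Xstd :: "complex vec gmod" where
  "Xstd = with_act (module_vec TYPE(complex) 2) (\<lambda>g v. g *\<^sub>v v)"


section \<open>Characters and the McKay quiver\<close>

type_synonym cfun = "complex mat \<Rightarrow> complex"

definition character :: "complex mat set \<Rightarrow> 'a gmod \<Rightarrow> cfun" where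
  "character \<Gamma> M = (\<lambda>g\<in>\<Gamma>. vtrace M (act M g))"

text \<open>The characters of the irreducible modules whose carrier lies in the type \<open>'u\<close>. These are all
  the irreducible characters as soon as \<open>'u\<close> has at least the cardinality of the continuum, since
  then every finite-dimensional module is isomorphic to one with carrier in \<open>'u\<close>.\<close>

definition Irr :: "'u itself \<Rightarrow> complex mat set \<Rightarrow> cfun set" where
  "Irr _ \<Gamma> = {character \<Gamma> M | M :: 'u gmod. irreducible_gmod \<Gamma> M}"

definition char_inner :: "complex mat set \<Rightarrow> cfun \<Rightarrow> cfun \<Rightarrow> complex" where
  "char_inner \<Gamma> \<chi> \<psi> = (\<Sum>g\<in>\<Gamma>. \<chi> g * cnj (\<psi> g)) / of_nat (card \<Gamma>)"

definition mckay_mult :: "complex mat set \<Rightarrow> cfun \<Rightarrow> cfun \<Rightarrow> nat" where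
  "mckay_mult \<Gamma> \<chi> \<chi>' =
    (THE n. of_nat n = char_inner \<Gamma> (\<lambda>g. \<chi> g * character \<Gamma> Xstd g) \<chi>')"

definition mckay_edges :: "'u itself \<Rightarrow> complex mat set \<Rightarrow> (cfun set \<times> nat) set" where
  "mckay_edges T \<Gamma> = {({\<chi>, \<chi>'}, i) | \<chi> \<chi>' i. \<chi> \<in> Irr T \<Gamma> \<and> \<chi>' \<in> Irr T \<Gamma> \<and> i < mckay_mult \<Gamma> \<chi> \<chi>'}"

text \<open>The arrow \<open>(\<chi>, \<chi>', i)\<close> is the edge \<open>({\<chi>, \<chi>'}, i)\<close> oriented from \<open>\<chi>\<close> to \<open>\<chi>'\<close>. By
  symmetry of the multiplicity these are the arrows of the double quiver, as long as there are no
  loops; the McKay graph has loops only if \<open>\<Gamma>\<close> is trivial.\<close>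

type_synonym arrow = "cfun \<times> cfun \<times> nat"

definition mckay_quiver :: "'u itself \<Rightarrow> complex mat set \<Rightarrow> (cfun, arrow) pre_digraph" where
  "mckay_quiver T \<Gamma> = \<lparr>verts = Irr T \<Gamma>,
     arcs = {(\<chi>, \<chi>', i). ({\<chi>, \<chi>'}, i) \<in> mckay_edges T \<Gamma>},
     tail = (\<lambda>(\<chi>, \<chi>', i). \<chi>), head = (\<lambda>(\<chi>, \<chi>', i). \<chi>')\<rparr>"

definition arr_rev :: "arrow \<Rightarrow> arrow" where
  "arr_rev = (\<lambda>(\<chi>, \<chi>', i). (\<chi>', \<chi>, i))"

definition irr_choice :: "complex mat set \<Rightarrow> (cfun \<Rightarrow> 'u gmod) \<Rightarrow> bool" where
  "irr_choice \<Gamma> X \<longleftrightarrow>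
    (\<forall>\<chi>\<in>Irr TYPE('u) \<Gamma>. irreducible_gmod \<Gamma> (X \<chi>) \<and> character \<Gamma> (X \<chi>) = \<chi>)"

definition generic_choice ::
  "complex mat set \<Rightarrow> (cfun \<Rightarrow> 'u gmod)
    \<Rightarrow> (arrow \<Rightarrow> (complex vec, 'u) tens \<Rightarrow> 'u) \<Rightarrow> (arrow \<Rightarrow> 'u \<Rightarrow> (complex vec, 'u) tens) \<Rightarrow> bool" where
  "generic_choice \<Gamma> X y yt \<longleftrightarrow> (let Q = mckay_quiver TYPE('u) \<Gamma> in
    \<forall>h\<in>arcs Q.
      y h \<in> GHom \<Gamma> (gtensor Xstd (X (tail Q h))) (X (head Q h)) \<and>
      (\<exists>t\<in>carrier (gtensor Xstd (X (tail Q h))). y h t \<noteq> \<zero>\<^bsub>X (head Q h)\<^esub>) \<and>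
      yt h \<in> GHom \<Gamma> (X (head Q h)) (gtensor Xstd (X (tail Q h))) \<and>
      (\<forall>w\<in>carrier (X (head Q h)). y h (yt h w) = w))"

text \<open>For the group of order two, the vectors \<open>e0\<close> and \<open>e1\<close> identify the one-dimensional modules
  \<open>X \<chi>0\<close> and \<open>X \<chi>1\<close> with the complex line.\<close>

definition mu2_choice ::
  "complex mat set \<Rightarrow> (cfun \<Rightarrow> 'u gmod)
    \<Rightarrow> (arrow \<Rightarrow> (complex vec, 'u) tens \<Rightarrow> 'u) \<Rightarrow> (arrow \<Rightarrow> 'u \<Rightarrow> (complex vec, 'u) tens) \<Rightarrow> bool" where
  "mu2_choice \<Gamma> X y yt \<longleftrightarrow> (let Q = mckay_quiver TYPE('u) \<Gamma>; \<chi>0 = (\<lambda>g\<in>\<Gamma>. 1) in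
    \<exists>\<chi>1 h1 h2 h3 h4 e0 e1.
      \<chi>1 \<in> Irr TYPE('u) \<Gamma> \<and> \<chi>1 \<noteq> \<chi>0 \<and>
      arcs Q = {h1, h2, h3, h4} \<and> distinct [h1, h2, h3, h4] \<and>
      tail Q h1 = \<chi>0 \<and> head Q h1 = \<chi>1 \<and> tail Q h2 = \<chi>0 \<and> head Q h2 = \<chi>1 \<and>
      tail Q h3 = \<chi>1 \<and> head Q h3 = \<chi>0 \<and> tail Q h4 = \<chi>1 \<and> head Q h4 = \<chi>0 \<and>
      arr_rev h1 = h4 \<and> arr_rev h3 = h2 \<and>
      e0 \<in> carrier (X \<chi>0) \<and> e0 \<noteq> \<zero>\<^bsub>X \<chi>0\<^esub> \<and> e1 \<in> carrier (X \<chi>1) \<and> e1 \<noteq> \<zero>\<^bsub>X \<chi>1\<^esub> \<and>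
      (\<forall>h\<in>arcs Q. y h \<in> GHom \<Gamma> (gtensor Xstd (X (tail Q h))) (X (head Q h)) \<and>
                  yt h \<in> GHom \<Gamma> (X (head Q h)) (gtensor Xstd (X (tail Q h)))) \<and>
      (\<forall>s\<in>carrier Xstd.
         y h1 (pure Xstd (X \<chi>0) s e0) = (s $ 0) \<odot>\<^bsub>X \<chi>1\<^esub> e1 \<and>
         y h2 (pure Xstd (X \<chi>0) s e0) = (s $ 1) \<odot>\<^bsub>X \<chi>1\<^esub> e1 \<and>
         (\<forall>c. y h3 (pure Xstd (X \<chi>1) s (c \<odot>\<^bsub>X \<chi>1\<^esub> e1)) = (s $ 0 * c) \<odot>\<^bsub>X \<chi>0\<^esub> e0 \<and>
              y h4 (pure Xstd (X \<chi>1) s (c \<odot>\<^bsub>X \<chi>1\<^esub> e1)) = (s $ 1 * c) \<odot>\<^bsub>X \<chi>0\<^esub> e0)) \<and>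
      yt h1 e1 = pure Xstd (X \<chi>0) (unit_vec 2 0) e0 \<and>
      yt h3 e0 = pure Xstd (X \<chi>1) (unit_vec 2 0) e1 \<and>
      yt h2 e1 = pure Xstd (X \<chi>0) (unit_vec 2 1) e0 \<and>
      yt h4 e0 = pure Xstd (X \<chi>1) (unit_vec 2 1) e1)"

definition arrow_choice ::
  "complex mat set \<Rightarrow> (cfun \<Rightarrow> 'u gmod)
    \<Rightarrow> (arrow \<Rightarrow> (complex vec, 'u) tens \<Rightarrow> 'u) \<Rightarrow> (arrow \<Rightarrow> 'u \<Rightarrow> (complex vec, 'u) tens) \<Rightarrow> bool" where
  "arrow_choice \<Gamma> X y yt \<longleftrightarrow>
    (if \<Gamma> = {1\<^sub>m 2, - (1\<^sub>m 2)} then mu2_choice \<Gamma> X y yt else generic_choice \<Gamma> X y yt)"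


section \<open>The category of representations of the double framed McKay quiver\<close>

record 'u qrep =
  RV :: "cfun \<Rightarrow> (complex, 'u) module"
  RVf :: "cfun \<Rightarrow> (complex, 'u) module"
  Rx :: "arrow \<Rightarrow> 'u \<Rightarrow> 'u"
  Rv1 :: "cfun \<Rightarrow> 'u \<Rightarrow> 'u"
  Rv2 :: "cfun \<Rightarrow> 'u \<Rightarrow> 'u"

type_synonym 'u qmor = "(cfun \<Rightarrow> 'u \<Rightarrow> 'u) \<times> (cfun \<Rightarrow> 'u \<Rightarrow> 'u)"

definition is_qrep :: "complex mat set \<Rightarrow> 'u qrep \<Rightarrow> bool" where
  "is_qrep \<Gamma> R \<longleftrightarrow> (let I = Irr TYPE('u) \<Gamma>; Q = mckay_quiver TYPE('u) \<Gamma> in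
    RV R \<in> (\<Pi>\<^sub>E \<chi>\<in>I. {V. fdvs V}) \<and>
    RVf R \<in> (\<Pi>\<^sub>E \<chi>\<in>I. {V. fdvs V}) \<and>
    Rx R \<in> (\<Pi>\<^sub>E h\<in>arcs Q. Lin (RV R (tail Q h)) (RV R (head Q h))) \<and>
    Rv1 R \<in> (\<Pi>\<^sub>E \<chi>\<in>I. Lin (RVf R \<chi>) (RV R \<chi>)) \<and>
    Rv2 R \<in> (\<Pi>\<^sub>E \<chi>\<in>I. Lin (RV R \<chi>) (RVf R \<chi>)))"

definition qrep_mor :: "complex mat set \<Rightarrow> 'u qrep \<Rightarrow> 'u qrep \<Rightarrow> 'u qmor set" where
  "qrep_mor \<Gamma> R R' = (let I = Irr TYPE('u) \<Gamma>; Q = mckay_quiver TYPE('u) \<Gamma> in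
    {(\<phi>, \<psi>). \<phi> \<in> (\<Pi>\<^sub>E \<chi>\<in>I. Lin (RV R \<chi>) (RV R' \<chi>)) \<and>
              \<psi> \<in> (\<Pi>\<^sub>E \<chi>\<in>I. Lin (RVf R \<chi>) (RVf R' \<chi>)) \<and>
              (\<forall>h\<in>arcs Q. \<forall>v\<in>carrier (RV R (tail Q h)).
                 \<phi> (head Q h) (Rx R h v) = Rx R' h (\<phi> (tail Q h) v)) \<and>
              (\<forall>\<chi>\<in>I. \<forall>v\<in>carrier (RVf R \<chi>). \<phi> \<chi> (Rv1 R \<chi> v) = Rv1 R' \<chi> (\<psi> \<chi> v)) \<and>
              (\<forall>\<chi>\<in>I. \<forall>v\<in>carrier (RV R \<chi>). \<psi> \<chi> (Rv2 R \<chi> v) = Rv2 R' \<chi> (\<phi> \<chi> v))})"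

definition Rep :: "complex mat set \<Rightarrow> ('u qrep, 'u qmor) cat" where
  "Rep \<Gamma> = (let I = Irr TYPE('u) \<Gamma> in
    \<lparr>Ob = {R. is_qrep \<Gamma> R},
     Mor = qrep_mor \<Gamma>,
     Idt = (\<lambda>R. (\<lambda>\<chi>\<in>I. \<lambda>v\<in>carrier (RV R \<chi>). v, \<lambda>\<chi>\<in>I. \<lambda>v\<in>carrier (RVf R \<chi>). v)),
     Cmp = (\<lambda>R R' R'' (\<phi>', \<psi>') (\<phi>, \<psi>).
       (\<lambda>\<chi>\<in>I. compose (carrier (RV R \<chi>)) (\<phi>' \<chi>) (\<phi> \<chi>),
        \<lambda>\<chi>\<in>I. compose (carrier (RVf R \<chi>)) (\<psi>' \<chi>) (\<psi> \<chi>)))\<rparr>)"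


section \<open>The category of module data\<close>

record 'u mck =
  MM :: "'u gmod"
  MMf :: "'u gmod"
  MD :: "(complex vec, 'u) tens \<Rightarrow> 'u"
  MZ1 :: "'u \<Rightarrow> 'u"
  MZ2 :: "'u \<Rightarrow> 'u"

type_synonym 'u mmor = "('u \<Rightarrow> 'u) \<times> ('u \<Rightarrow> 'u)"

definition is_mck :: "complex mat set \<Rightarrow> 'u mck \<Rightarrow> bool" where
  "is_mck \<Gamma> N \<longleftrightarrow> is_gmod \<Gamma> (MM N) \<and> is_gmod \<Gamma> (MMf N) \<and>
    MD N \<in> GHom \<Gamma> (gtensor Xstd (MM N)) (MM N) \<and>
    MZ1 N \<in> GHom \<Gamma> (MMf N) (MM N) \<and>
    MZ2 N \<in> GHom \<Gamma> (MM N) (MMf N)"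

definition mck_mor :: "complex mat set \<Rightarrow> 'u mck \<Rightarrow> 'u mck \<Rightarrow> 'u mmor set" where
  "mck_mor \<Gamma> N N' =
    {(\<Phi>, \<Psi>). \<Phi> \<in> GHom \<Gamma> (MM N) (MM N') \<and> \<Psi> \<in> GHom \<Gamma> (MMf N) (MMf N') \<and>
       (\<forall>t\<in>carrier (gtensor Xstd (MM N)).
          \<Phi> (MD N t) = MD N' (tmap Xstd (MM N) Xstd (MM N') (\<lambda>s. s) \<Phi> t)) \<and>
       (\<forall>m\<in>carrier (MM N). \<Psi> (MZ2 N m) = MZ2 N' (\<Phi> m)) \<and>
       (\<forall>m\<in>carrier (MMf N). \<Phi> (MZ1 N m) = MZ1 N' (\<Psi> m))}"

definition McK :: "complex mat set \<Rightarrow> ('u mck, 'u mmor) cat" where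
  "McK \<Gamma> =
    \<lparr>Ob = {N. is_mck \<Gamma> N},
     Mor = mck_mor \<Gamma>,
     Idt = (\<lambda>N. (\<lambda>m\<in>carrier (MM N). m, \<lambda>m\<in>carrier (MMf N). m)),
     Cmp = (\<lambda>N N' N'' (\<Phi>', \<Psi>') (\<Phi>, \<Psi>).
       (compose (carrier (MM N)) \<Phi>' \<Phi>, compose (carrier (MMf N)) \<Psi>' \<Psi>))\<rparr>"


section \<open>Transport into the universe\<close>

text \<open>The vector spaces of both categories have carriers in one type \<open>'u\<close>, whereas sums of tensor
  products and Hom-spaces are built in other types. They are copied back into \<open>'u\<close> along a chosen
  injection of their carrier, which is thereby an isomorphism onto the copy. Such an injection
  exists for every finite-dimensional complex space if \<open>'u\<close> has at least the cardinality of the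
  continuum.\<close>

definition enc :: "(complex, 'b, 'x) module_scheme \<Rightarrow> 'b \<Rightarrow> 'u" where
  "enc V = (SOME c. inj_on c (carrier V))"

definition dec :: "(complex, 'b, 'x) module_scheme \<Rightarrow> 'u \<Rightarrow> 'b" where
  "dec V = inv_into (carrier V) (enc V)"

definition copy :: "(complex, 'b, 'x) module_scheme \<Rightarrow> (complex, 'u) module" where
  "copy V = \<lparr>carrier = enc V ` carrier V, mult = undefined, one = undefined,
     zero = enc V \<zero>\<^bsub>V\<^esub>,
     add = (\<lambda>a b. enc V (dec V a \<oplus>\<^bsub>V\<^esub> dec V b)),
     smult = (\<lambda>c a. enc V (c \<odot>\<^bsub>V\<^esub> dec V a))\<rparr>"

definition gcopy :: "'b gmod \<Rightarrow> 'u gmod" where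
  "gcopy M = with_act (copy M) (\<lambda>g a. enc M (act M g (dec M a)))"


section \<open>The functor from quiver representations to module data\<close>

definition delta :: "(cfun \<Rightarrow> 'u gmod) \<Rightarrow> cfun \<Rightarrow> complex" where
  "delta X \<chi> = of_nat (vectorspace.dim Cf (X \<chi>))"

text \<open>\<open>\<Oplus>\<^sub>\<chi> V\<^sub>\<chi> \<otimes> X\<^sub>\<chi>\<close>, before transport into the universe\<close>

definition total :: "complex mat set \<Rightarrow> (cfun \<Rightarrow> 'u gmod) \<Rightarrow> (cfun \<Rightarrow> (complex, 'u) module)
    \<Rightarrow> (cfun \<Rightarrow> ('u, 'u) tens) gmod" where
  "total \<Gamma> X V = gsum (Irr TYPE('u) \<Gamma>) (\<lambda>\<chi>. gtensor (triv (V \<chi>)) (X \<chi>))"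

text \<open>The rearrangements \<open>S \<otimes> (V \<otimes> X) \<rightarrow> (S \<otimes> X) \<otimes> V\<close> and \<open>X \<otimes> V \<rightarrow> V \<otimes> X\<close>\<close>

definition rearrange ::
  "(complex, 's, 'x) module_scheme \<Rightarrow> (complex, 'a, 'y) module_scheme \<Rightarrow> (complex, 'b, 'z) module_scheme
    \<Rightarrow> ('s, ('a, 'b) tens) tens \<Rightarrow> (('s, 'b) tens, 'a) tens" where
  "rearrange S V X = tlift S (tensor V X) (tensor (tensor S X) V)
     (\<lambda>s. tlift V X (tensor (tensor S X) V) (\<lambda>v w. pure (tensor S X) V (pure S X s w) v))"

definition flip ::
  "(complex, 'b, 'z) module_scheme \<Rightarrow> (complex, 'a, 'y) module_scheme \<Rightarrow> ('b, 'a) tens \<Rightarrow> ('a, 'b) tens" where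
  "flip X V = tlift X V (tensor V X) (\<lambda>w v. pure V X v w)"

text \<open>The summand of \<open>\<Delta>\<close> belonging to the arrow \<open>h : i \<rightarrow> j\<close>, as a map
  \<open>X\<^sub>s\<^sub>t\<^sub>d \<otimes> (V\<^sub>i \<otimes> X\<^sub>i) \<rightarrow> V\<^sub>j \<otimes> X\<^sub>j\<close>.\<close>

definition arrow_map ::
  "complex mat set \<Rightarrow> (cfun \<Rightarrow> 'u gmod) \<Rightarrow> (arrow \<Rightarrow> (complex vec, 'u) tens \<Rightarrow> 'u) \<Rightarrow> 'u qrep
    \<Rightarrow> arrow \<Rightarrow> (complex vec, ('u, 'u) tens) tens \<Rightarrow> ('u, 'u) tens" where
  "arrow_map \<Gamma> X y R h t = (let Q = mckay_quiver TYPE('u) \<Gamma>; i = tail Q h; j = head Q h in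
    flip (X j) (RV R j)
      (tmap (tensor Xstd (X i)) (RV R i) (X j) (RV R j) (y h) (Rx R h)
        (rearrange Xstd (RV R i) (X i) t)))"

definition total_Delta ::
  "complex mat set \<Rightarrow> (cfun \<Rightarrow> 'u gmod) \<Rightarrow> (arrow \<Rightarrow> (complex vec, 'u) tens \<Rightarrow> 'u) \<Rightarrow> 'u qrep
    \<Rightarrow> (complex vec, cfun \<Rightarrow> ('u, 'u) tens) tens \<Rightarrow> cfun \<Rightarrow> ('u, 'u) tens" where
  "total_Delta \<Gamma> X y R t = (let Q = mckay_quiver TYPE('u) \<Gamma> in
    (\<lambda>\<chi>\<in>Irr TYPE('u) \<Gamma>. finsum (tensor (RV R \<chi>) (X \<chi>))
      (\<lambda>h. arrow_map \<Gamma> X y R h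
             (tmap Xstd (total \<Gamma> X (RV R)) Xstd (tensor (RV R (tail Q h)) (X (tail Q h)))
               (\<lambda>s. s) (\<lambda>m. m (tail Q h)) t))
      {h \<in> arcs Q. head Q h = \<chi>}))"

text \<open>\<open>\<Oplus>\<^sub>\<chi> f\<^sub>\<chi> \<otimes> g\<^sub>\<chi>\<close> for \<open>f\<^sub>\<chi> : V\<^sub>\<chi> \<rightarrow> W\<^sub>\<chi>\<close> and endomorphisms \<open>g\<^sub>\<chi>\<close> of \<open>X\<^sub>\<chi>\<close>, as a map between the
  transported modules\<close>

definition total_map ::
  "complex mat set \<Rightarrow> (cfun \<Rightarrow> 'u gmod)
    \<Rightarrow> (cfun \<Rightarrow> (complex, 'u) module) \<Rightarrow> (cfun \<Rightarrow> (complex, 'u) module)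
    \<Rightarrow> (cfun \<Rightarrow> 'u \<Rightarrow> 'u) \<Rightarrow> (cfun \<Rightarrow> 'u \<Rightarrow> 'u) \<Rightarrow> 'u \<Rightarrow> 'u" where
  "total_map \<Gamma> X V W f g =
    (\<lambda>a\<in>carrier (gcopy (total \<Gamma> X V) :: 'u gmod). enc (total \<Gamma> X W)
       (\<lambda>\<chi>\<in>Irr TYPE('u) \<Gamma>. tmap (V \<chi>) (X \<chi>) (W \<chi>) (X \<chi>) (f \<chi>) (g \<chi>) (dec (total \<Gamma> X V) a \<chi>)))"

definition F_ob ::
  "complex mat set \<Rightarrow> (cfun \<Rightarrow> 'u gmod) \<Rightarrow> (arrow \<Rightarrow> (complex vec, 'u) tens \<Rightarrow> 'u)
    \<Rightarrow> 'u qrep \<Rightarrow> 'u mck" where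
  "F_ob \<Gamma> X y R = (let B = total \<Gamma> X (RV R); M = gcopy B :: 'u gmod in
    \<lparr>MM = M,
     MMf = gcopy (total \<Gamma> X (RVf R)),
     MD = (\<lambda>t\<in>carrier (gtensor Xstd M).
             enc B (total_Delta \<Gamma> X y R (tmap Xstd M Xstd B (\<lambda>s. s) (dec B) t))),
     MZ1 = total_map \<Gamma> X (RVf R) (RV R) (Rv1 R) (\<lambda>\<chi> w. (1 / delta X \<chi>) \<odot>\<^bsub>X \<chi>\<^esub> w),
     MZ2 = total_map \<Gamma> X (RV R) (RVf R) (Rv2 R) (\<lambda>\<chi> w. w)\<rparr>)"

definition F_functor ::
  "complex mat set \<Rightarrow> (cfun \<Rightarrow> 'u gmod) \<Rightarrow> (arrow \<Rightarrow> (complex vec, 'u) tens \<Rightarrow> 'u)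
    \<Rightarrow> ('u qrep, 'u qmor, 'u mck, 'u mmor) fctr" where
  "F_functor \<Gamma> X y =
    \<lparr>onOb = F_ob \<Gamma> X y,
     onMor = (\<lambda>R R' (\<phi>, \<psi>).
       (total_map \<Gamma> X (RV R) (RV R') \<phi> (\<lambda>\<chi> w. w),
        total_map \<Gamma> X (RVf R) (RVf R') \<psi> (\<lambda>\<chi> w. w)))\<rparr>"


section \<open>The functor from module data to quiver representations\<close>

definition copy_map ::
  "(complex, 'b, 'x) module_scheme \<Rightarrow> (complex, 'c, 'y) module_scheme \<Rightarrow> ('b \<Rightarrow> 'c) \<Rightarrow> 'u \<Rightarrow> 'u" where
  "copy_map V W T = (\<lambda>a\<in>carrier (copy V :: (complex, 'u) module). enc W (T (dec V a)))"

definition G_ob ::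
  "complex mat set \<Rightarrow> (cfun \<Rightarrow> 'u gmod) \<Rightarrow> (arrow \<Rightarrow> 'u \<Rightarrow> (complex vec, 'u) tens)
    \<Rightarrow> 'u mck \<Rightarrow> 'u qrep" where
  "G_ob \<Gamma> X yt N = (let I = Irr TYPE('u) \<Gamma>; Q = mckay_quiver TYPE('u) \<Gamma>;
      H = (\<lambda>\<chi>. GHom_space \<Gamma> (X \<chi>) (MM N)); Hf = (\<lambda>\<chi>. GHom_space \<Gamma> (X \<chi>) (MMf N)) in
    \<lparr>RV = (\<lambda>\<chi>\<in>I. copy (H \<chi>)),
     RVf = (\<lambda>\<chi>\<in>I. copy (Hf \<chi>)),
     Rx = (\<lambda>h\<in>arcs Q. copy_map (H (tail Q h)) (H (head Q h))
       (\<lambda>f. \<lambda>w\<in>carrier (X (head Q h)).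
          MD N (tmap Xstd (X (tail Q h)) Xstd (MM N) (\<lambda>s. s) f (yt h w)))),
     Rv1 = (\<lambda>\<chi>\<in>I. copy_map (Hf \<chi>) (H \<chi>)
       (\<lambda>f. \<lambda>w\<in>carrier (X \<chi>). delta X \<chi> \<odot>\<^bsub>MM N\<^esub> MZ1 N (f w))),
     Rv2 = (\<lambda>\<chi>\<in>I. copy_map (H \<chi>) (Hf \<chi>)
       (\<lambda>f. \<lambda>w\<in>carrier (X \<chi>). MZ2 N (f w)))\<rparr>)"

definition G_functor ::
  "complex mat set \<Rightarrow> (cfun \<Rightarrow> 'u gmod) \<Rightarrow> (arrow \<Rightarrow> 'u \<Rightarrow> (complex vec, 'u) tens)
    \<Rightarrow> ('u mck, 'u mmor, 'u qrep, 'u qmor) fctr" where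
  "G_functor \<Gamma> X yt =
    \<lparr>onOb = G_ob \<Gamma> X yt,
     onMor = (\<lambda>N N' (\<Phi>, \<Psi>).
       (\<lambda>\<chi>\<in>Irr TYPE('u) \<Gamma>. copy_map (GHom_space \<Gamma> (X \<chi>) (MM N)) (GHom_space \<Gamma> (X \<chi>) (MM N'))
          (\<lambda>f. compose (carrier (X \<chi>)) \<Phi> f),
        \<lambda>\<chi>\<in>Irr TYPE('u) \<Gamma>. copy_map (GHom_space \<Gamma> (X \<chi>) (MMf N)) (GHom_space \<Gamma> (X \<chi>) (MMf N'))
          (\<lambda>f. compose (carrier (X \<chi>)) \<Psi> f)))\<rparr>"

end

theory Submission
  imports Defs "Jordan_Normal_Form.Schur_Decomposition" "Jordan_Normal_Form.Spectral_Radius"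
begin

text \<open>
  The unit at \<open>V\<close> sends \<open>v \<in> V\<^sub>\<chi>\<close> to \<open>w \<mapsto> v \<otimes> w\<close> in \<open>Hom\<^sub>\<Gamma>(X\<^sub>\<chi>, \<Oplus>\<^sub>\<kappa> V\<^sub>\<kappa> \<otimes> X\<^sub>\<kappa>)\<close>, and the counit at \<open>M\<close> is the
  evaluation \<open>f \<otimes> w \<mapsto> f w\<close>; by Schur's lemma and complete reducibility both are bijective. They are
  compatible with the framings because the factors \<open>1 / \<delta>\<^sub>\<chi>\<close> and \<open>\<delta>\<^sub>\<chi>\<close> cancel, and with \<open>x\<close> and \<open>\<Delta>\<close> because of

    \<^item> \<open>y\<^sub>g \<circ> yt\<^sub>h = 0\<close> for distinct arrows \<open>g\<close>, \<open>h\<close> with the same source (for the unit), and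
    \<^item> \<open>\<Sum>\<^sub>h yt\<^sub>h \<circ> y\<^sub>h = id\<close> on \<open>X\<^sub>s\<^sub>t\<^sub>d \<otimes> X\<^sub>\<chi>\<close>, summed over the arrows \<open>h\<close> with source \<open>\<chi>\<close> (for the counit).

  If \<open>\<Gamma>\<close> is neither trivial nor of order two, the first identity is Schur's lemma, since then the McKay graph has no
  multiple edges. The second follows from the first: the sum is an idempotent whose trace is the dimension
  of \<open>X\<^sub>s\<^sub>t\<^sub>d \<otimes> X\<^sub>\<chi>\<close>.
\<close>

text \<open>The spaces live in many types: duals of spaces of bilinear forms, families indexed by
  characters, copies in \<open>'u\<close>. Each construction is therefore described once by its
  values on generators, tensor products by \<open>pure\<close> and the transported sum of the
  \<open>V \<chi> \<otimes> X \<chi>\<close> by \<open>inn\<close>; maps out of it may be prescribed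
  on these generators and are determined there. Coordinates enter only through pairs of dual bases,
  which also show that \<open>vtrace\<close> does not depend on the basis it selects.

  The absence of multiple edges is an estimate of characters. \<open>chi_std\<close> is real and of
  modulus at most 2, with equality only at the identity matrix and its negative. A double edge would
  confine two irreducible characters to these two elements, and comparison with the trivial
  character leaves only groups of order at most two. The trivial group is excluded because its
  quiver has two arrows from the only vertex to itself, and \<open>generic_choice\<close> does not
  make the maps chosen for them independent; in order two the explicit choice provides the
  independence.\<close>

abbreviation vs :: "(complex, 'a, 'x) module_scheme \<Rightarrow> bool" where
  "vs V \<equiv> vectorspace Cf V"

abbreviation mhom :: "(complex, 'a, 'x) module_scheme \<Rightarrow> (complex, 'b, 'y) module_scheme \<Rightarrow> ('a \<Rightarrow> 'b) set" where
  "mhom V W \<equiv> LinearCombinations.module_hom Cf V W"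

section \<open>Calculation in complex vector spaces and with linear maps\<close>

lemma vs_module: "vs V \<Longrightarrow> Module.module Cf V"
  by (simp add: vectorspace_def)

context
  fixes V :: "(complex, 'a, 'x) module_scheme"
  assumes V: "vs V"
begin

interpretation V: vectorspace Cf V by (rule V)

text \<open>The locale facts are restated with the operations of the complex numbers in place of
  those of the ring record and with \<open>vs V\<close> as a premise, so that several spaces can be
  handled in one proof without interpreting the locale for each of them.\<close>

lemma vadd_closed [simp]: "a \<in> carrier V \<Longrightarrow> b \<in> carrier V \<Longrightarrow> a \<oplus>\<^bsub>V\<^esub> b \<in> carrier V"
  by simp
lemma vzero_closed [simp]: "\<zero>\<^bsub>V\<^esub> \<in> carrier V" by simp
lemma vsmult_closed [simp]: "a \<in> carrier V \<Longrightarrow> c \<odot>\<^bsub>V\<^esub> a \<in> carrier V"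
  by simp
lemma vfinsum_closed [simp]: "f \<in> A \<rightarrow> carrier V \<Longrightarrow> finsum V f A \<in> carrier V"
  by simp
lemma vadd_ac: "a \<in> carrier V \<Longrightarrow> b \<in> carrier V \<Longrightarrow> c \<in> carrier V \<Longrightarrow> (a \<oplus>\<^bsub>V\<^esub> b) \<oplus>\<^bsub>V\<^esub> c = a \<oplus>\<^bsub>V\<^esub> (b \<oplus>\<^bsub>V\<^esub> c)"
  "a \<in> carrier V \<Longrightarrow> b \<in> carrier V \<Longrightarrow> a \<oplus>\<^bsub>V\<^esub> b = b \<oplus>\<^bsub>V\<^esub> a"
  "a \<in> carrier V \<Longrightarrow> b \<in> carrier V \<Longrightarrow> c \<in> carrier V \<Longrightarrow> a \<oplus>\<^bsub>V\<^esub> (b \<oplus>\<^bsub>V\<^esub> c) = b \<oplus>\<^bsub>V\<^esub> (a \<oplus>\<^bsub>V\<^esub> c)"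
  by (simp_all add: V.a_ac)
lemma vzero_add [simp]: "a \<in> carrier V \<Longrightarrow> \<zero>\<^bsub>V\<^esub> \<oplus>\<^bsub>V\<^esub> a = a" "a \<in> carrier V \<Longrightarrow> a \<oplus>\<^bsub>V\<^esub> \<zero>\<^bsub>V\<^esub> = a"
  by simp_all
lemma vsmult_add: "a \<in> carrier V \<Longrightarrow> b \<in> carrier V \<Longrightarrow> c \<odot>\<^bsub>V\<^esub> (a \<oplus>\<^bsub>V\<^esub> b) = c \<odot>\<^bsub>V\<^esub> a \<oplus>\<^bsub>V\<^esub> c \<odot>\<^bsub>V\<^esub> b"
  using V.smult_r_distr by simp
lemma vadd_smult: "a \<in> carrier V \<Longrightarrow> (c + d) \<odot>\<^bsub>V\<^esub> a = c \<odot>\<^bsub>V\<^esub> a \<oplus>\<^bsub>V\<^esub> d \<odot>\<^bsub>V\<^esub> a"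
  using V.smult_l_distr by simp
lemma vsmult_smult [simp]: "a \<in> carrier V \<Longrightarrow> c \<odot>\<^bsub>V\<^esub> (d \<odot>\<^bsub>V\<^esub> a) = (c * d) \<odot>\<^bsub>V\<^esub> a"
  using V.smult_assoc1 by simp
lemma vsmult_one [simp]: "a \<in> carrier V \<Longrightarrow> 1 \<odot>\<^bsub>V\<^esub> a = a"
  using V.smult_one by simp
lemma vsmult_zero [simp]: "a \<in> carrier V \<Longrightarrow> 0 \<odot>\<^bsub>V\<^esub> a = \<zero>\<^bsub>V\<^esub>"
  using V.lmult_0 by simp
lemma vsmult_zero2 [simp]: "c \<odot>\<^bsub>V\<^esub> \<zero>\<^bsub>V\<^esub> = \<zero>\<^bsub>V\<^esub>"
  using V.rmult_0 by simp
lemma vfinsum_empty [simp]: "finsum V f {} = \<zero>\<^bsub>V\<^esub>"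
  by simp
lemma vfinsum_insert: "finite A \<Longrightarrow> x \<notin> A \<Longrightarrow> f \<in> A \<rightarrow> carrier V \<Longrightarrow> f x \<in> carrier V \<Longrightarrow>
    finsum V f (insert x A) = f x \<oplus>\<^bsub>V\<^esub> finsum V f A"
  by simp
lemma vfinsum_smult: "f \<in> A \<rightarrow> carrier V \<Longrightarrow> c \<odot>\<^bsub>V\<^esub> finsum V f A = finsum V (\<lambda>i. c \<odot>\<^bsub>V\<^esub> f i) A"
  using V.finsum_smult[of c f A] by (simp add: o_def)
lemma vfinsum_cong: "A = B \<Longrightarrow> (\<And>i. i \<in> B \<Longrightarrow> f i = g i) \<Longrightarrow> (\<And>i. i \<in> B \<Longrightarrow> g i \<in> carrier V) \<Longrightarrow>
    finsum V f A = finsum V g B"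
  by (rule V.finsum_cong') auto
lemma vfinsum_add: "f \<in> A \<rightarrow> carrier V \<Longrightarrow> g \<in> A \<rightarrow> carrier V \<Longrightarrow>
    finsum V (\<lambda>i. f i \<oplus>\<^bsub>V\<^esub> g i) A = finsum V f A \<oplus>\<^bsub>V\<^esub> finsum V g A"
  by (rule V.finsum_addf)
lemma vfinsum_smult_left:
  "finite A \<Longrightarrow> a \<in> carrier V \<Longrightarrow> finsum V (\<lambda>i. f i \<odot>\<^bsub>V\<^esub> a) A = sum f A \<odot>\<^bsub>V\<^esub> a"
  by (induction A rule: finite_induct) (simp_all add: vadd_smult)
lemma vfinsum_zero: "(\<And>i. i \<in> A \<Longrightarrow> f i = \<zero>\<^bsub>V\<^esub>) \<Longrightarrow> finsum V f A = \<zero>\<^bsub>V\<^esub>"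
  by (rule V.add.finprod_one_eqI)
lemma vfinsum_single: "finite A \<Longrightarrow> i \<in> A \<Longrightarrow> f i \<in> carrier V \<Longrightarrow> (\<And>j. j \<in> A \<Longrightarrow> j \<noteq> i \<Longrightarrow> f j = \<zero>\<^bsub>V\<^esub>) \<Longrightarrow>
   finsum V f A = f i"
proof -
  assume a: "finite A" "i \<in> A" "f i \<in> carrier V" "\<And>j. j \<in> A \<Longrightarrow> j \<noteq> i \<Longrightarrow> f j = \<zero>\<^bsub>V\<^esub>"
  have A: "A = insert i (A - {i})" using a by auto
  have "f j \<in> carrier V" if "j \<in> A" for j using a that by (cases "j = i") auto
  then have f: "f \<in> A - {i} \<rightarrow> carrier V" by auto
  have "finsum V f A = f i \<oplus>\<^bsub>V\<^esub> finsum V f (A - {i})"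
    using vfinsum_insert[of "A - {i}" i f] a f by (simp add: insert_absorb)
  also have "finsum V f (A - {i}) = \<zero>\<^bsub>V\<^esub>" by (rule vfinsum_zero) (use a in auto)
  finally show ?thesis using a by simp
qed
lemma vfinsum_reindex: "inj_on h A \<Longrightarrow> f \<in> h ` A \<rightarrow> carrier V \<Longrightarrow> finsum V f (h ` A) = finsum V (\<lambda>x. f (h x)) A"
  using V.finsum_reindex[of f h A] by simp
lemma vfinsum_Un: "finite A \<Longrightarrow> finite B \<Longrightarrow> A \<inter> B = {} \<Longrightarrow> f \<in> A \<rightarrow> carrier V \<Longrightarrow> f \<in> B \<rightarrow> carrier V \<Longrightarrow>
   finsum V f (A \<union> B) = finsum V f A \<oplus>\<^bsub>V\<^esub> finsum V f B"
  by (rule V.finsum_Un_disjoint)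
text \<open>Differences are written with the scalar -1 throughout, so that linear maps pass through
  them by \<open>mhom_add\<close> and \<open>mhom_smult\<close> alone.\<close>

lemma vneg: "a \<in> carrier V \<Longrightarrow> a \<oplus>\<^bsub>V\<^esub> (-1) \<odot>\<^bsub>V\<^esub> a = \<zero>\<^bsub>V\<^esub>"
  using vadd_smult[of a 1 "-1"] by simp
lemma vsub_eq_zero: "a \<in> carrier V \<Longrightarrow> b \<in> carrier V \<Longrightarrow> a \<oplus>\<^bsub>V\<^esub> (-1) \<odot>\<^bsub>V\<^esub> b = \<zero>\<^bsub>V\<^esub> \<longleftrightarrow> a = b"
proof
  assume a: "a \<in> carrier V" "b \<in> carrier V" "a \<oplus>\<^bsub>V\<^esub> (-1) \<odot>\<^bsub>V\<^esub> b = \<zero>\<^bsub>V\<^esub>"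
  have "b \<oplus>\<^bsub>V\<^esub> (a \<oplus>\<^bsub>V\<^esub> (-1) \<odot>\<^bsub>V\<^esub> b) = a \<oplus>\<^bsub>V\<^esub> (b \<oplus>\<^bsub>V\<^esub> (-1) \<odot>\<^bsub>V\<^esub> b)" using a(1,2) by (simp add: vadd_ac)
  then show "a = b" using a vneg by simp
next
  assume "a \<in> carrier V" "b \<in> carrier V" "a = b" then show "a \<oplus>\<^bsub>V\<^esub> (-1) \<odot>\<^bsub>V\<^esub> b = \<zero>\<^bsub>V\<^esub>" by (simp add: vneg)
qed
lemma vsmult_eq_zero: "a \<in> carrier V \<Longrightarrow> c \<odot>\<^bsub>V\<^esub> a = \<zero>\<^bsub>V\<^esub> \<Longrightarrow> c = 0 \<or> a = \<zero>\<^bsub>V\<^esub>"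
proof (rule ccontr)
  assume a: "a \<in> carrier V" "c \<odot>\<^bsub>V\<^esub> a = \<zero>\<^bsub>V\<^esub>" and "\<not> (c = 0 \<or> a = \<zero>\<^bsub>V\<^esub>)"
  then have "(1/c) \<odot>\<^bsub>V\<^esub> (c \<odot>\<^bsub>V\<^esub> a) = a" "a \<noteq> \<zero>\<^bsub>V\<^esub>" by (subst vsmult_smult, auto)
  then show False using a by simp
qed
end

lemma vsI:
  assumes "\<zero>\<^bsub>V\<^esub> \<in> carrier V" "\<And>v w. v \<in> carrier V \<Longrightarrow> w \<in> carrier V \<Longrightarrow> v \<oplus>\<^bsub>V\<^esub> w \<in> carrier V"
    "\<And>c v. v \<in> carrier V \<Longrightarrow> c \<odot>\<^bsub>V\<^esub> v \<in> carrier V"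
    "\<And>v w. v \<in> carrier V \<Longrightarrow> w \<in> carrier V \<Longrightarrow> v \<oplus>\<^bsub>V\<^esub> w = w \<oplus>\<^bsub>V\<^esub> v"
    "\<And>v w x. v \<in> carrier V \<Longrightarrow> w \<in> carrier V \<Longrightarrow> x \<in> carrier V \<Longrightarrow> (v \<oplus>\<^bsub>V\<^esub> w) \<oplus>\<^bsub>V\<^esub> x = v \<oplus>\<^bsub>V\<^esub> (w \<oplus>\<^bsub>V\<^esub> x)"
    "\<And>v. v \<in> carrier V \<Longrightarrow> v \<oplus>\<^bsub>V\<^esub> \<zero>\<^bsub>V\<^esub> = v"
    "\<And>v. v \<in> carrier V \<Longrightarrow> v \<oplus>\<^bsub>V\<^esub> (-1) \<odot>\<^bsub>V\<^esub> v = \<zero>\<^bsub>V\<^esub>"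
    "\<And>a b v. v \<in> carrier V \<Longrightarrow> (a * b) \<odot>\<^bsub>V\<^esub> v = a \<odot>\<^bsub>V\<^esub> (b \<odot>\<^bsub>V\<^esub> v)"
    "\<And>v. v \<in> carrier V \<Longrightarrow> 1 \<odot>\<^bsub>V\<^esub> v = v"
    "\<And>a b v. v \<in> carrier V \<Longrightarrow> (a + b) \<odot>\<^bsub>V\<^esub> v = a \<odot>\<^bsub>V\<^esub> v \<oplus>\<^bsub>V\<^esub> b \<odot>\<^bsub>V\<^esub> v"
    "\<And>a v w. v \<in> carrier V \<Longrightarrow> w \<in> carrier V \<Longrightarrow> a \<odot>\<^bsub>V\<^esub> (v \<oplus>\<^bsub>V\<^esub> w) = a \<odot>\<^bsub>V\<^esub> v \<oplus>\<^bsub>V\<^esub> a \<odot>\<^bsub>V\<^esub> w"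
  shows "vs V"
proof (rule vs_criteria)
  show "field Cf" by unfold_locales
  show "\<forall>v\<in>carrier V. \<exists>neg_v\<in>carrier V. v \<oplus>\<^bsub>V\<^esub> neg_v = \<zero>\<^bsub>V\<^esub>"
    using assms(3,7) by blast
qed (use assms in simp_all)

lemma mhomI:
  assumes "\<And>v. v \<in> carrier V \<Longrightarrow> f v \<in> carrier W"
    "\<And>v w. v \<in> carrier V \<Longrightarrow> w \<in> carrier V \<Longrightarrow> f (v \<oplus>\<^bsub>V\<^esub> w) = f v \<oplus>\<^bsub>W\<^esub> f w"
    "\<And>c v. v \<in> carrier V \<Longrightarrow> f (c \<odot>\<^bsub>V\<^esub> v) = c \<odot>\<^bsub>W\<^esub> f v"
  shows "f \<in> mhom V W"
  using assms by (auto simp: LinearCombinations.module_hom_def)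

lemma mhom_closed: "f \<in> mhom V W \<Longrightarrow> v \<in> carrier V \<Longrightarrow> f v \<in> carrier W"
  and mhom_add: "f \<in> mhom V W \<Longrightarrow> v \<in> carrier V \<Longrightarrow> w \<in> carrier V \<Longrightarrow> f (v \<oplus>\<^bsub>V\<^esub> w) = f v \<oplus>\<^bsub>W\<^esub> f w"
  and mhom_smult: "f \<in> mhom V W \<Longrightarrow> v \<in> carrier V \<Longrightarrow> f (c \<odot>\<^bsub>V\<^esub> v) = c \<odot>\<^bsub>W\<^esub> f v"
  by (auto simp: LinearCombinations.module_hom_def)

lemma mhom_zero: "vs V \<Longrightarrow> vs W \<Longrightarrow> f \<in> mhom V W \<Longrightarrow> f \<zero>\<^bsub>V\<^esub> = \<zero>\<^bsub>W\<^esub>"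
  using mhom_smult[of f V W "\<zero>\<^bsub>V\<^esub>" 0] mhom_closed[of f V W "\<zero>\<^bsub>V\<^esub>"] by simp

lemma mhom_finsum:
  assumes "vs V" "vs W" "f \<in> mhom V W" "finite A" "F \<in> A \<rightarrow> carrier V"
  shows "f (finsum V F A) = finsum W (\<lambda>i. f (F i)) A"
  using assms(4,5)
  by (induction A rule: finite_induct)
     (use assms(1-3) in \<open>auto simp: vfinsum_insert mhom_zero mhom_add mhom_closed Pi_iff\<close>)

lemma mhom_cong: "(\<And>v. v \<in> carrier V \<Longrightarrow> f v = g v) \<Longrightarrow> vs V \<Longrightarrow> f \<in> mhom V W \<Longrightarrow> g \<in> mhom V W"
  by (auto simp: LinearCombinations.module_hom_def Pi_iff) 

lemma Lin_iff: "f \<in> Lin V W \<longleftrightarrow> f \<in> mhom V W \<and> f \<in> extensional (carrier V)"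
  by (simp add: Lin_def)

lemma Lin_mhom: "f \<in> Lin V W \<Longrightarrow> f \<in> mhom V W"
  by (simp add: Lin_def)

lemma Lin_eqI: "f \<in> Lin V W \<Longrightarrow> g \<in> Lin V W' \<Longrightarrow> (\<And>v. v \<in> carrier V \<Longrightarrow> f v = g v) \<Longrightarrow> f = g"
  by (auto simp: Lin_iff intro: extensionalityI)

text \<open>\<open>mhom\<close> leaves values off the carrier open and is closed under plain
  composition of functions; \<open>Lin\<close> is entered by restriction where a definition asks for
  it or two maps have to be equal as functions.\<close>

lemma restrict_Lin: "vs V \<Longrightarrow> f \<in> mhom V W \<Longrightarrow> restrict f (carrier V) \<in> Lin V W"
  by (auto simp: Lin_iff mhom_closed mhom_add mhom_smult intro!: mhomI)

lemma mhom_id: "(\<lambda>v. v) \<in> mhom V V"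
  by (auto intro: mhomI)

lemma mhom_comp: "f \<in> mhom U V \<Longrightarrow> g \<in> mhom V W \<Longrightarrow> (\<lambda>x. g (f x)) \<in> mhom U W"
  by (rule mhomI) (auto simp: mhom_closed mhom_add mhom_smult)

lemma mhom_const_smult: "vs W \<Longrightarrow> f \<in> mhom U W \<Longrightarrow> (\<lambda>x. c \<odot>\<^bsub>W\<^esub> f x) \<in> mhom U W"
  by (rule mhomI) (auto simp: mhom_closed mhom_add mhom_smult vsmult_add mult.commute)

lemma mhom_const_zero: "vs W \<Longrightarrow> (\<lambda>x. \<zero>\<^bsub>W\<^esub>) \<in> mhom U W"
  by (rule mhomI) auto

lemma mhom_plus: "vs W \<Longrightarrow> f \<in> mhom U W \<Longrightarrow> g \<in> mhom U W \<Longrightarrow> (\<lambda>x. f x \<oplus>\<^bsub>W\<^esub> g x) \<in> mhom U W"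
  by (rule mhomI) (auto simp: mhom_closed mhom_add mhom_smult vsmult_add vadd_ac)

lemma mhom_sum:
  assumes W: "vs W" and "finite A" "\<And>i. i \<in> A \<Longrightarrow> f i \<in> mhom U W"
  shows "(\<lambda>x. finsum W (\<lambda>i. f i x) A) \<in> mhom U W"
proof (rule mhomI)
  have c: "\<And>i x. i \<in> A \<Longrightarrow> x \<in> carrier U \<Longrightarrow> f i x \<in> carrier W" using assms(3) mhom_closed by metis
  show "finsum W (\<lambda>i. f i v) A \<in> carrier W" if "v \<in> carrier U" for v using c that W by auto
  show "finsum W (\<lambda>i. f i (v \<oplus>\<^bsub>U\<^esub> w)) A = finsum W (\<lambda>i. f i v) A \<oplus>\<^bsub>W\<^esub> finsum W (\<lambda>i. f i w) A"
    if "v \<in> carrier U" "w \<in> carrier U" for v w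
  proof -
    have "finsum W (\<lambda>i. f i (v \<oplus>\<^bsub>U\<^esub> w)) A = finsum W (\<lambda>i. f i v \<oplus>\<^bsub>W\<^esub> f i w) A"
      by (rule vfinsum_cong[OF W refl]) (use that c W in \<open>auto simp: mhom_add[OF assms(3)]\<close>)
    then show ?thesis by (subst vfinsum_add[OF W, symmetric]) (use that c in auto)
  qed
  show "finsum W (\<lambda>i. f i (a \<odot>\<^bsub>U\<^esub> v)) A = a \<odot>\<^bsub>W\<^esub> finsum W (\<lambda>i. f i v) A" if "v \<in> carrier U" for a v
    by (subst vfinsum_smult[OF W], use that c in force, rule vfinsum_cong[OF W refl])
      (use that c W in \<open>auto simp: mhom_smult[OF assms(3)]\<close>)
qed

lemma Cline_simps [simp]: "carrier Cline = UNIV" "\<zero>\<^bsub>Cline\<^esub> = 0" "a \<oplus>\<^bsub>Cline\<^esub> b = a + b" "a \<odot>\<^bsub>Cline\<^esub> b = a * b"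
  by (simp_all add: Cline_def)

lemma vs_Cline [simp]: "vs Cline"
  by (rule vsI) (auto simp: algebra_simps)

lemma finsum_Cline [simp]: "finite A \<Longrightarrow> finsum Cline f A = sum f A"
  by (induction A rule: finite_induct) (simp_all add: vfinsum_insert)

lemma mhom_scale: "vs W \<Longrightarrow> w \<in> carrier W \<Longrightarrow> f \<in> mhom U Cline \<Longrightarrow> (\<lambda>x. f x \<odot>\<^bsub>W\<^esub> w) \<in> mhom U W"
  by (rule mhomI) (auto simp: mhom_add mhom_smult vadd_smult)

section \<open>Dual bases\<close>

text \<open>A finite basis \<open>e\<close> carried along with its dual basis \<open>c\<close>. The
  separate index set lets products and disjoint unions of index sets serve for tensor products and
  direct sums.\<close>

definition frame :: "(complex, 'a, 'x) module_scheme \<Rightarrow> 'i set \<Rightarrow> ('i \<Rightarrow> 'a) \<Rightarrow> ('i \<Rightarrow> 'a \<Rightarrow> complex) \<Rightarrow> bool" where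
  "frame V I e c \<longleftrightarrow> finite I \<and> (\<forall>i\<in>I. e i \<in> carrier V) \<and> (\<forall>i\<in>I. c i \<in> mhom V Cline) \<and>
     (\<forall>i\<in>I. \<forall>j\<in>I. c i (e j) = (if i = j then 1 else 0)) \<and>
     (\<forall>v\<in>carrier V. v = finsum V (\<lambda>i. c i v \<odot>\<^bsub>V\<^esub> e i) I)"

lemma frameD:
  assumes "frame V I e c"
  shows "finite I" "i \<in> I \<Longrightarrow> e i \<in> carrier V" "i \<in> I \<Longrightarrow> c i \<in> mhom V Cline"
    "i \<in> I \<Longrightarrow> j \<in> I \<Longrightarrow> c i (e j) = (if i = j then 1 else 0)"
    "v \<in> carrier V \<Longrightarrow> finsum V (\<lambda>i. c i v \<odot>\<^bsub>V\<^esub> e i) I = v"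
  using assms by (auto simp: frame_def)

lemma frame_eqI:
  assumes "frame V I e c" "v \<in> carrier V" "w \<in> carrier V" "\<And>i. i \<in> I \<Longrightarrow> c i v = c i w" "vs V"
  shows "v = w"
proof -
  have "finsum V (\<lambda>i. c i v \<odot>\<^bsub>V\<^esub> e i) I = finsum V (\<lambda>i. c i w \<odot>\<^bsub>V\<^esub> e i) I"
    by (rule vfinsum_cong) (use assms frameD[OF assms(1)] in auto)
  then show ?thesis using frameD(5)[OF assms(1)] assms by simp
qed

lemma frame_coeff:
  assumes "frame V I e c" "vs V" "i \<in> I"
  shows "c i (finsum V (\<lambda>i. a i \<odot>\<^bsub>V\<^esub> e i) I) = a i"
proof -
  note F = frameD[OF assms(1)]
  have "c i (finsum V (\<lambda>i. a i \<odot>\<^bsub>V\<^esub> e i) I) = (\<Sum>j\<in>I. c i (a j \<odot>\<^bsub>V\<^esub> e j))"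
    by (subst mhom_finsum[OF assms(2) vs_Cline F(3)[OF assms(3)]]) (use F assms in auto)
  also have "\<dots> = (\<Sum>j\<in>I. if i = j then a j else 0)"
    by (rule sum.cong) (use F assms mhom_smult[OF F(3)[OF assms(3)]] in auto)
  finally show ?thesis using F assms by simp
qed

lemma mhom_expand:
  assumes "frame V I e c" "vs V" "vs W" "f \<in> mhom V W" "v \<in> carrier V"
  shows "f v = finsum W (\<lambda>i. c i v \<odot>\<^bsub>W\<^esub> f (e i)) I"
proof -
  note F = frameD[OF assms(1)]
  have "f v = f (finsum V (\<lambda>i. c i v \<odot>\<^bsub>V\<^esub> e i) I)" using F(5) assms by simp
  also have "\<dots> = finsum W (\<lambda>i. f (c i v \<odot>\<^bsub>V\<^esub> e i)) I"
    by (rule mhom_finsum) (use assms F in auto)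
  also have "\<dots> = finsum W (\<lambda>i. c i v \<odot>\<^bsub>W\<^esub> f (e i)) I"
    by (rule vfinsum_cong) (use assms F in \<open>auto simp: mhom_smult[OF assms(4)] mhom_closed[OF assms(4)]\<close>)
  finally show ?thesis .
qed

lemma mhom_eq_frame:
  assumes "frame V I e c" "vs V" "vs W" "f \<in> mhom V W" "g \<in> mhom V W" "\<And>i. i \<in> I \<Longrightarrow> f (e i) = g (e i)" "v \<in> carrier V"
  shows "f v = g v"
  unfolding mhom_expand[OF assms(1-4,7)] mhom_expand[OF assms(1-3,5,7)]
  by (rule vfinsum_cong[OF assms(3)])
     (use assms frameD[OF assms(1)] in \<open>auto intro!: vsmult_closed mhom_closed[OF assms(5)]\<close>)

lemma frame_reindex:
  assumes "frame V I e c" "vs V" "bij_betw h J I"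
  shows "frame V J (\<lambda>j. e (h j)) (\<lambda>j. c (h j))"
proof -
  note F = frameD[OF assms(1)]
  have h: "\<And>j. j \<in> J \<Longrightarrow> h j \<in> I" "inj_on h J" "h ` J = I" using assms(3) by (auto simp: bij_betw_def)
  have "finsum V (\<lambda>i. c (h i) v \<odot>\<^bsub>V\<^esub> e (h i)) J = v" if "v \<in> carrier V" for v
    using vfinsum_reindex[OF assms(2) h(2), of "\<lambda>i. c i v \<odot>\<^bsub>V\<^esub> e i"] F that h assms(2) by auto
  moreover have "finite J" using F(1) assms(3) bij_betw_finite by blast
  ultimately show ?thesis unfolding frame_def using F h by (auto simp: inj_on_eq_iff)
qed

text \<open>\<open>coords\<close> is a definite description. Existence comes from spanning;
  uniqueness among extensional families comes from linear independence, applied to the difference of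
  two families.\<close>

lemma basis_lincomb_coords:
  assumes "vs V" "vectorspace.basis Cf V B" "finite B" "v \<in> carrier V"
  shows "coords V B v \<in> extensional B" "finsum V (\<lambda>b. coords V B v b \<odot>\<^bsub>V\<^esub> b) B = v"
    "a \<in> extensional B \<Longrightarrow> finsum V (\<lambda>b. a b \<odot>\<^bsub>V\<^esub> b) B = v \<Longrightarrow> a = coords V B v"
proof -
  interpret V: vectorspace Cf V by (rule assms)
  have B: "B \<subseteq> carrier V" "V.gen_set B" "V.lin_indpt B" using assms(2) by (auto simp: V.basis_def)
  have ex: "\<exists>a. a \<in> extensional B \<and> V.lincomb a B = v"
  proof -
    obtain a where a: "V.lincomb a B = v" using V.finite_in_span[of B v] B assms by auto
    have "V.lincomb (restrict a B) B = V.lincomb a B"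
      by (rule V.lincomb_cong) (use B in auto)
    then show ?thesis using a by (intro exI[of _ "restrict a B"]) auto
  qed
  have un: "a = a'" if "a \<in> extensional B" "V.lincomb a B = v" "a' \<in> extensional B" "V.lincomb a' B = v" for a a'
  proof (rule extensionalityI[OF that(1,3)])
    fix b assume b: "b \<in> B"
    have cl: "\<And>x. x \<in> B \<Longrightarrow> x \<in> carrier V" using B by auto
    have "V.lincomb (\<lambda>b. a b + (-1) * a' b) B = V.lincomb a B \<oplus>\<^bsub>V\<^esub> (-1) \<odot>\<^bsub>V\<^esub> V.lincomb a' B"
      unfolding V.lincomb_def
      apply (subst vfinsum_smult[OF assms(1)]) using cl apply force
      apply (subst vfinsum_add[OF assms(1), symmetric]) using cl apply (force, force)
      by (rule vfinsum_cong[OF assms(1)]) (use cl assms vadd_smult[OF assms(1), of _ "a _" "- a' _"] in auto)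
    also have "\<dots> = \<zero>\<^bsub>V\<^esub>" using that assms vneg by metis
    finally have 0: "V.lincomb (\<lambda>b. a b + (-1) * a' b) B = \<zero>\<^bsub>V\<^esub>" .
    have "a b + (-1) * a' b = 0"
    proof (rule ccontr)
      assume "a b + (-1) * a' b \<noteq> 0"
      then have "V.lin_dep B" by (intro V.lin_dep_crit[OF assms(3) _ _ b _ 0]) auto
      then show False using B by simp
    qed
    then show "a b = a' b" by simp
  qed
  have "\<exists>!a. a \<in> extensional B \<and> V.lincomb a B = v" using ex un by blast
  from theI'[OF this] show "coords V B v \<in> extensional B" "finsum V (\<lambda>b. coords V B v b \<odot>\<^bsub>V\<^esub> b) B = v"
    unfolding coords_def V.lincomb_def by auto
  then show "a \<in> extensional B \<Longrightarrow> finsum V (\<lambda>b. a b \<odot>\<^bsub>V\<^esub> b) B = v \<Longrightarrow> a = coords V B v"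
    using un unfolding V.lincomb_def by auto
qed

text \<open>Linearity and biorthogonality of \<open>coords\<close> are instances of uniqueness: the
  expected coefficients, restricted to \<open>B\<close>, also represent the vector in
  question.\<close>

lemma frame_basis:
  assumes V: "vs V" and B: "vectorspace.basis Cf V B" and fin: "finite B"
  shows "frame V B (\<lambda>b. b) (\<lambda>b v. coords V B v b)"
proof -
  interpret V: vectorspace Cf V by (rule V)
  have cl: "\<And>x. x \<in> B \<Longrightarrow> x \<in> carrier V" using B by (auto simp: V.basis_def)
  note L = basis_lincomb_coords[OF V B fin]
  have add: "coords V B (v \<oplus>\<^bsub>V\<^esub> w) b = coords V B v b + coords V B w b" if "v \<in> carrier V" "w \<in> carrier V" "b \<in> B" for v w b
  proof -
    have "finsum V (\<lambda>b. restrict (\<lambda>b. coords V B v b + coords V B w b) B b \<odot>\<^bsub>V\<^esub> b) B = 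
       finsum V (\<lambda>b. coords V B v b \<odot>\<^bsub>V\<^esub> b \<oplus>\<^bsub>V\<^esub> coords V B w b \<odot>\<^bsub>V\<^esub> b) B"
      by (rule vfinsum_cong[OF V]) (use cl V in \<open>auto simp: vadd_smult\<close>)
    also have "\<dots> = v \<oplus>\<^bsub>V\<^esub> w"
      by (subst vfinsum_add[OF V]) (use cl V L(2) that in auto)
    finally have "restrict (\<lambda>b. coords V B v b + coords V B w b) B = coords V B (v \<oplus>\<^bsub>V\<^esub> w)"
      by (intro L(3)) (use that in auto)
    from fun_cong[OF this, of b] show ?thesis using that by simp
  qed
  have sm: "coords V B (a \<odot>\<^bsub>V\<^esub> v) b = a * coords V B v b" if "v \<in> carrier V" "b \<in> B" for v a b
  proof -
    have "finsum V (\<lambda>b. restrict (\<lambda>b. a * coords V B v b) B b \<odot>\<^bsub>V\<^esub> b) B = 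
       finsum V (\<lambda>b. a \<odot>\<^bsub>V\<^esub> (coords V B v b \<odot>\<^bsub>V\<^esub> b)) B"
      by (rule vfinsum_cong[OF V]) (use cl V in \<open>auto\<close>)
    also have "\<dots> = a \<odot>\<^bsub>V\<^esub> v"
      by (subst vfinsum_smult[OF V, symmetric]) (use cl V L(2) that in auto)
    finally have "restrict (\<lambda>b. a * coords V B v b) B = coords V B (a \<odot>\<^bsub>V\<^esub> v)"
      by (intro L(3)) (use that V in auto)
    from fun_cong[OF this, of b] show ?thesis using that by simp
  qed
  have de: "coords V B j i = (if i = j then 1 else 0)" if "i \<in> B" "j \<in> B" for i j
  proof -
    have "finsum V (\<lambda>b. restrict (\<lambda>i. if i = j then 1 else 0) B b \<odot>\<^bsub>V\<^esub> b) B = 1 \<odot>\<^bsub>V\<^esub> j"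
      by (subst vfinsum_single[OF V fin that(2)]) (use cl V that in auto)
    then have "restrict (\<lambda>i. if i = j then 1 else 0) B = coords V B j" 
      by (intro L(3)) (use that V cl in auto)
    from fun_cong[OF this, of i] show ?thesis using that by simp
  qed
  show ?thesis unfolding frame_def
    using fin cl de L(2) by (auto intro!: mhomI simp: add sm)
qed

text \<open>Biorthogonality does the work: it separates the vectors \<open>e i\<close>, and applying
  \<open>c i\<close> to a vanishing combination isolates one coefficient. This connects frames with
  the notions of basis and dimension of the vector space locale.\<close>

lemma frame_basis_image:
  assumes V: "vs V" and F: "frame V I e c"
  shows "inj_on e I" "vectorspace.basis Cf V (e ` I)"
proof -
  interpret V: vectorspace Cf V by (rule V)
  note F' = frameD[OF F]
  show inj: "inj_on e I"
  proof (rule inj_onI)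
    fix i j assume "i \<in> I" "j \<in> I" "e i = e j"
    then show "i = j" using F'(4)[of i j] F'(4)[of i i] by (auto split: if_splits)
  qed
  have lc: "V.lincomb a (e ` I) = finsum V (\<lambda>i. a (e i) \<odot>\<^bsub>V\<^esub> e i) I" for a
    unfolding V.lincomb_def by (subst vfinsum_reindex[OF V inj]) (use F' V in auto)
  have sub: "e ` I \<subseteq> carrier V" using F' by auto
  have "\<not> V.lin_dep (e ` I)"
  proof (rule V.finite_lin_indpt2)
    fix a assume "V.lincomb a (e ` I) = \<zero>\<^bsub>V\<^esub>"
    then have z: "finsum V (\<lambda>i. a (e i) \<odot>\<^bsub>V\<^esub> e i) I = \<zero>\<^bsub>V\<^esub>" using lc by simp
    have "a (e i) = 0" if "i \<in> I" for i
      using frame_coeff[OF F V that, of "\<lambda>i. a (e i)"] z mhom_zero[OF V vs_Cline F'(3)[OF that]] by simp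
    then show "\<forall>v\<in>e ` I. a v = \<zero>\<^bsub>Cf\<^esub>" by auto
  qed (use F' sub in auto)
  moreover have "V.span (e ` I) = carrier V"
  proof -
    have "v \<in> V.span (e ` I)" if "v \<in> carrier V" for v
    proof -
      have "v = V.lincomb (\<lambda>b. c (inv_into I e b) v) (e ` I)"
        unfolding lc using F'(5)[OF that] inj
        by (subst vfinsum_cong[OF V refl, of _ _ "\<lambda>i. c i v \<odot>\<^bsub>V\<^esub> e i"]) (use F' V in auto)
      then show ?thesis unfolding V.finite_span[OF finite_imageI[OF F'(1)] sub] by auto
    qed
    then show ?thesis using V.span_is_subset2[OF sub] by auto
  qed
  ultimately show "V.basis (e ` I)" using sub by (simp add: V.basis_def)
qed

lemma fdvs_vs [simp]: "fdvs V \<Longrightarrow> vs V"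
  by (simp add: fdvs_def)

lemma fdvsI: "vs V \<Longrightarrow> frame V I e c \<Longrightarrow> fdvs V"
proof -
  assume V: "vs V" and F: "frame V I e c"
  interpret V: vectorspace Cf V by (rule V)
  show ?thesis unfolding fdvs_def V.fin_dim_def
    using V frame_basis_image[OF V F] frameD(1)[OF F] unfolding V.basis_def
    by (intro conjI exI[of _ "e ` I"]) auto
qed

text \<open>Independent sets are finite in finite dimension. Needed because \<open>vtrace\<close>
  selects a basis of which nothing else is known.\<close>

lemma fdvs_finite_basis:
  assumes "fdvs V" "vectorspace.basis Cf V B" shows "finite B"
proof -
  interpret V: vectorspace Cf V by (rule fdvs_vs[OF assms(1)])
  show ?thesis using assms unfolding fdvs_def 
    by (metis V.basis_def V.fin_dim_li_fin)
qed

text \<open>Numbering the basis gives frames of all spaces the same index type, as matrices and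
  simultaneous choices for families of spaces require.\<close>

lemma fdvs_frame:
  assumes "fdvs V"
  obtains e c and n :: nat where "frame V {..<n} e c"
proof -
  interpret V: vectorspace Cf V by (rule fdvs_vs[OF assms])
  have fd: "V.fin_dim" using assms by (simp add: fdvs_def)
  obtain B where B: "V.basis B" "finite B" using V.finite_basis_exists[OF fd] by auto
  obtain h where h: "bij_betw h {..<card B} B" using bij_betw_from_nat_into_finite[OF B(2)] by blast
  show ?thesis using that frame_reindex[OF frame_basis[OF fdvs_vs[OF assms] B] fdvs_vs[OF assms] h] by blast
qed

lemma vec_eqI:
  assumes "fdvs V" "v \<in> carrier V" "w \<in> carrier V" "\<And>c. c \<in> mhom V Cline \<Longrightarrow> c v = c w"
  shows "v = w"
proof -
  obtain e c and n :: nat where F: "frame V {..<n} e c" using fdvs_frame[OF assms(1)] .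
  show ?thesis by (rule frame_eqI[OF F assms(2,3) assms(4)[OF frameD(3)[OF F]] fdvs_vs[OF assms(1)]])
qed

section \<open>Traces\<close>

text \<open>Expansion in the frame of \<open>W\<close> on the left and in that of \<open>V\<close>
  on the right turns both sides into the double sum of
  \<open>d j (A (e i)) * c i (B (f j))\<close>.\<close>

lemma frame_trace_cyclic:
  assumes "frame V I e c" "frame W J f d" "vs V" "vs W" "A \<in> mhom V W" "B \<in> mhom W V"
  shows "(\<Sum>i\<in>I. c i (B (A (e i)))) = (\<Sum>j\<in>J. d j (A (B (f j))))"
proof -
  note F = frameD[OF assms(1)] and G = frameD[OF assms(2)]
  have "(\<Sum>i\<in>I. c i (B (A (e i)))) = (\<Sum>i\<in>I. \<Sum>j\<in>J. d j (A (e i)) * c i (B (f j)))"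
  proof (rule sum.cong[OF refl])
    fix i assume i: "i \<in> I"
    have "(\<lambda>w. c i (B w)) \<in> mhom W Cline" by (rule mhom_comp[OF assms(6) F(3)[OF i]])
    from mhom_expand[OF assms(2,4) vs_Cline this, of "A (e i)"] 
    show "c i (B (A (e i))) = (\<Sum>j\<in>J. d j (A (e i)) * c i (B (f j)))" 
      using mhom_closed[OF assms(5)] F i G by simp
  qed
  also have "\<dots> = (\<Sum>j\<in>J. \<Sum>i\<in>I. c i (B (f j)) * d j (A (e i)))"
    by (subst sum.swap) (simp add: mult.commute)
  also have "\<dots> = (\<Sum>j\<in>J. d j (A (B (f j))))"
  proof (rule sum.cong[OF refl])
    fix j assume j: "j \<in> J"
    have "(\<lambda>w. d j (A w)) \<in> mhom V Cline" by (rule mhom_comp[OF assms(5) G(3)[OF j]])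
    from mhom_expand[OF assms(1,3) vs_Cline this, of "B (f j)"] 
    show "(\<Sum>i\<in>I. c i (B (f j)) * d j (A (e i))) = d j (A (B (f j)))" 
      using mhom_closed[OF assms(6)] F j G by simp
  qed
  finally show ?thesis .
qed

text \<open>Cyclicity with one of the two maps the identity makes the sum the same for any two
  frames of one space, in particular for the basis selected by \<open>vtrace\<close>.\<close>

lemma vtrace_frame:
  assumes "fdvs V" "frame V I e c" "f \<in> mhom V V"
  shows "vtrace V f = (\<Sum>i\<in>I. c i (f (e i)))"
proof -
  interpret V: vectorspace Cf V by (rule fdvs_vs[OF assms(1)])
  have fd: "V.fin_dim" using assms by (simp add: fdvs_def)
  define B where "B = (SOME B. V.basis B)"
  have B: "V.basis B" unfolding B_def using V.finite_basis_exists[OF fd] by (auto intro: someI)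
  have Bf: "finite B" by (rule fdvs_finite_basis[OF assms(1) B])
  note FB = frame_basis[OF fdvs_vs[OF assms(1)] B Bf]
  have "vtrace V f = (\<Sum>b\<in>B. coords V B (f b) b)" by (simp add: vtrace_def B_def Let_def)
  also have "\<dots> = (\<Sum>i\<in>I. c i (f (e i)))"
    using frame_trace_cyclic[OF FB assms(2) fdvs_vs[OF assms(1)] fdvs_vs[OF assms(1)] assms(3) mhom_id] by simp
  finally show ?thesis .
qed

lemma dim_frame:
  assumes "vs V" "frame V I e c" shows "vectorspace.dim Cf V = card I"
proof -
  interpret V: vectorspace Cf V by (rule assms)
  show ?thesis using V.dim_basis[OF finite_imageI[OF frameD(1)[OF assms(2)]] frame_basis_image(2)[OF assms]]
    card_image[OF frame_basis_image(1)[OF assms]] by simp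
qed

lemma dim_pos:
  assumes "fdvs V" "carrier V \<noteq> {\<zero>\<^bsub>V\<^esub>}" shows "vectorspace.dim Cf V > 0"
proof -
  obtain e c and n :: nat where F: "frame V {..<n} e c" using fdvs_frame[OF assms(1)] .
  have "n \<noteq> 0"
  proof
    assume "n = 0" then have "\<And>v. v \<in> carrier V \<Longrightarrow> v = \<zero>\<^bsub>V\<^esub>" using frameD(5)[OF F] assms(1) by simp
    then show False using assms(2) vzero_closed[OF fdvs_vs[OF assms(1)]] by blast
  qed
  then show ?thesis using dim_frame[OF _ F] assms(1) by simp
qed

text \<open>Dimensions are compared through this formula, both for complete reducibility and in
  \<open>yt_y\<close>.\<close>

lemma vtrace_id: "fdvs V \<Longrightarrow> vtrace V (\<lambda>v. v) = of_nat (vectorspace.dim Cf V)"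
proof -
  assume V: "fdvs V"
  obtain e c and n :: nat where F: "frame V {..<n} e c" using fdvs_frame[OF V] .
  show ?thesis using vtrace_frame[OF V F mhom_id] dim_frame[OF fdvs_vs[OF V] F] frameD(4)[OF F] by simp
qed

lemma vtrace_cyclic:
  assumes "fdvs V" "fdvs W" "A \<in> mhom V W" "B \<in> mhom W V"
  shows "vtrace V (\<lambda>v. B (A v)) = vtrace W (\<lambda>w. A (B w))"
proof -
  obtain e c and n :: nat where F: "frame V {..<n} e c" using fdvs_frame[OF assms(1)] .
  obtain e' c' and n' :: nat where F': "frame W {..<n'} e' c'" using fdvs_frame[OF assms(2)] .
  show ?thesis
    unfolding vtrace_frame[OF assms(1) F mhom_comp[OF assms(3,4)]] vtrace_frame[OF assms(2) F' mhom_comp[OF assms(4,3)]]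
    by (rule frame_trace_cyclic[OF F F' fdvs_vs[OF assms(1)] fdvs_vs[OF assms(2)] assms(3,4)])
qed

lemma vtrace_cong:
  assumes "fdvs V" "f \<in> mhom V V" "\<And>v. v \<in> carrier V \<Longrightarrow> f v = g v"
  shows "vtrace V f = vtrace V g"
proof -
  obtain e c and n :: nat where F: "frame V {..<n} e c" using fdvs_frame[OF assms(1)] .
  have g: "g \<in> mhom V V" by (rule mhom_cong[OF assms(3) fdvs_vs[OF assms(1)] assms(2)])
  show ?thesis
    unfolding vtrace_frame[OF assms(1) F assms(2)] vtrace_frame[OF assms(1) F g]
    using frameD[OF F] assms by simp
qed

lemma vtrace_finsum:
  assumes "fdvs V" "finite A" "\<And>i. i \<in> A \<Longrightarrow> f i \<in> mhom V V"
  shows "vtrace V (\<lambda>v. finsum V (\<lambda>i. f i v) A) = (\<Sum>i\<in>A. vtrace V (f i))"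
proof -
  obtain e c and n :: nat where F: "frame V {..<n} e c" using fdvs_frame[OF assms(1)] .
  note F' = frameD[OF F]
  have V: "vs V" by (rule fdvs_vs[OF assms(1)])
  have s: "(\<lambda>v. finsum V (\<lambda>i. f i v) A) \<in> mhom V V" by (rule mhom_sum[OF V assms(2,3)])
  have "vtrace V (\<lambda>v. finsum V (\<lambda>i. f i v) A) = (\<Sum>k<n. \<Sum>i\<in>A. c k (f i (e k)))"
    unfolding vtrace_frame[OF assms(1) F s]
  proof (rule sum.cong[OF refl])
    fix k assume k: "k \<in> {..<n}"
    show "c k (finsum V (\<lambda>i. f i (e k)) A) = (\<Sum>i\<in>A. c k (f i (e k)))"
      by (subst mhom_finsum[OF V vs_Cline F'(3)[OF k] assms(2)]) (use assms mhom_closed[OF assms(3)] F' k in auto)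
  qed
  also have "\<dots> = (\<Sum>i\<in>A. vtrace V (f i))"
    by (subst sum.swap) (use vtrace_frame[OF assms(1) F assms(3)] in simp)
  finally show ?thesis .
qed

lemma vtrace_add:
  assumes "fdvs V" "f \<in> mhom V V" "g \<in> mhom V V"
  shows "vtrace V (\<lambda>v. f v \<oplus>\<^bsub>V\<^esub> g v) = vtrace V f + vtrace V g"
proof -
  obtain e c and n :: nat where F: "frame V {..<n} e c" using fdvs_frame[OF assms(1)] .
  note F' = frameD[OF F]
  have V: "vs V" by (rule fdvs_vs[OF assms(1)])
  show ?thesis
    unfolding vtrace_frame[OF assms(1) F mhom_plus[OF V assms(2,3)]] vtrace_frame[OF assms(1) F assms(2)] vtrace_frame[OF assms(1) F assms(3)]
    by (subst sum.distrib[symmetric], rule sum.cong)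
      (auto simp: mhom_add[OF F'(3)] mhom_closed[OF assms(2)] mhom_closed[OF assms(3)] F')
qed

lemma vtrace_smult:
  assumes "fdvs V" "f \<in> mhom V V"
  shows "vtrace V (\<lambda>v. a \<odot>\<^bsub>V\<^esub> f v) = a * vtrace V f"
proof -
  obtain e c and n :: nat where F: "frame V {..<n} e c" using fdvs_frame[OF assms(1)] .
  note F' = frameD[OF F]
  have V: "vs V" by (rule fdvs_vs[OF assms(1)])
  show ?thesis unfolding vtrace_frame[OF assms(1) F mhom_const_smult[OF V assms(2)]] vtrace_frame[OF assms(1) F assms(2)]
    by (auto simp: sum_distrib_left mhom_closed[OF assms(2)] F' intro!: sum.cong mhom_smult[OF F'(3), simplified])
qed

lemma frameI:
  assumes "finite I" "\<And>i. i \<in> I \<Longrightarrow> e i \<in> carrier V" "\<And>i. i \<in> I \<Longrightarrow> c i \<in> mhom V Cline"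
    "\<And>i j. i \<in> I \<Longrightarrow> j \<in> I \<Longrightarrow> c i (e j) = (if i = j then 1 else 0)"
    "\<And>v. v \<in> carrier V \<Longrightarrow> finsum V (\<lambda>i. c i v \<odot>\<^bsub>V\<^esub> e i) I = v"
  shows "frame V I e c"
  unfolding frame_def using assms by auto

lemma frame_transfer:
  assumes V: "vs V" "frame V I e c" and W: "vs W" and f: "f \<in> mhom V W" and g: "g \<in> mhom W V"
    and fg: "\<And>w. w \<in> carrier W \<Longrightarrow> f (g w) = w" and gf: "\<And>v. v \<in> carrier V \<Longrightarrow> g (f v) = v"
  shows "frame W I (\<lambda>i. f (e i)) (\<lambda>i w. c i (g w))"
proof (rule frameI)
  note F = frameD[OF V(2)]
  show "finsum W (\<lambda>i. c i (g w) \<odot>\<^bsub>W\<^esub> f (e i)) I = w" if "w \<in> carrier W" for w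
    using mhom_expand[OF V(2,1) W f mhom_closed[OF g that]] fg that by simp
  show "(\<lambda>w. c i (g w)) \<in> mhom W Cline" if "i \<in> I" for i by (rule mhom_comp[OF g F(3)[OF that]])
qed (use frameD[OF V(2)] mhom_closed[OF f] gf in auto)

lemma fdvs_transfer:
  assumes "fdvs V" "vs W" "f \<in> mhom V W" "g \<in> mhom W V"
    "\<And>w. w \<in> carrier W \<Longrightarrow> f (g w) = w" "\<And>v. v \<in> carrier V \<Longrightarrow> g (f v) = v"
  shows "fdvs W"
proof -
  obtain e c and n :: nat where "frame V {..<n} e c" using fdvs_frame[OF assms(1)] .
  from frame_transfer[OF fdvs_vs[OF assms(1)] this assms(2-6)] show ?thesis by (rule fdvsI[OF assms(2)])
qed

lemma frame_Cline: "frame Cline {()} (\<lambda>_. 1) (\<lambda>_ z. z)"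
  by (rule frameI) (auto intro: mhomI simp: vfinsum_insert)

lemma fdvs_Cline [simp]: "fdvs Cline"
  by (rule fdvsI[OF vs_Cline frame_Cline])

section \<open>Spaces of linear maps\<close>

lemma Lin_space_simps [simp]:
  "carrier (Lin_space V W) = Lin V W" "\<zero>\<^bsub>Lin_space V W\<^esub> = (\<lambda>v\<in>carrier V. \<zero>\<^bsub>W\<^esub>)"
  "f \<oplus>\<^bsub>Lin_space V W\<^esub> g = (\<lambda>v\<in>carrier V. f v \<oplus>\<^bsub>W\<^esub> g v)"
  "a \<odot>\<^bsub>Lin_space V W\<^esub> f = (\<lambda>v\<in>carrier V. a \<odot>\<^bsub>W\<^esub> f v)"
  by (simp_all add: Lin_space_def)

lemma Lin_closed: "f \<in> Lin V W \<Longrightarrow> v \<in> carrier V \<Longrightarrow> f v \<in> carrier W"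
  by (rule mhom_closed[OF Lin_mhom])

lemma vs_Lin_space [simp]:
  assumes V: "vs V" and W: "vs W"
  shows "vs (Lin_space V W)"
proof (rule vsI)
  have R: "restrict f (carrier V) \<in> Lin V W" if "f \<in> mhom V W" for f by (rule restrict_Lin[OF V that])
  show "\<zero>\<^bsub>Lin_space V W\<^esub> \<in> carrier (Lin_space V W)"
    using R[OF mhom_const_zero[OF W]] by simp
  show "f \<oplus>\<^bsub>Lin_space V W\<^esub> g \<in> carrier (Lin_space V W)" if "f \<in> carrier (Lin_space V W)" "g \<in> carrier (Lin_space V W)" for f g
    using R[OF mhom_plus[OF W Lin_mhom Lin_mhom]] that by simp
  show "a \<odot>\<^bsub>Lin_space V W\<^esub> g \<in> carrier (Lin_space V W)" if "g \<in> carrier (Lin_space V W)" for a g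
    using R[OF mhom_const_smult[OF W Lin_mhom]] that by simp
  have eq: "restrict h (carrier V) = f" if "f \<in> Lin V W" "\<And>v. v \<in> carrier V \<Longrightarrow> h v = f v" for f h
    using that by (auto simp: Lin_iff extensional_def fun_eq_iff)
  show "f \<oplus>\<^bsub>Lin_space V W\<^esub> g = g \<oplus>\<^bsub>Lin_space V W\<^esub> f" if "f \<in> carrier (Lin_space V W)" "g \<in> carrier (Lin_space V W)" for f g
    using that by (simp, intro restrict_ext vadd_ac(2)[OF W]) (auto intro: Lin_closed)
  show "(f \<oplus>\<^bsub>Lin_space V W\<^esub> g) \<oplus>\<^bsub>Lin_space V W\<^esub> h = f \<oplus>\<^bsub>Lin_space V W\<^esub> (g \<oplus>\<^bsub>Lin_space V W\<^esub> h)"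
    if "f \<in> carrier (Lin_space V W)" "g \<in> carrier (Lin_space V W)" "h \<in> carrier (Lin_space V W)" for f g h
    using that by (auto intro!: restrict_ext simp: vadd_ac(1)[OF W] Lin_closed)
  show "f \<oplus>\<^bsub>Lin_space V W\<^esub> \<zero>\<^bsub>Lin_space V W\<^esub> = f" if "f \<in> carrier (Lin_space V W)" for f
    using that W by (simp, intro eq) (auto simp: Lin_closed)
  show "f \<oplus>\<^bsub>Lin_space V W\<^esub> (-1) \<odot>\<^bsub>Lin_space V W\<^esub> f = \<zero>\<^bsub>Lin_space V W\<^esub>" if "f \<in> carrier (Lin_space V W)" for f
    using that by (auto intro!: restrict_ext simp: vneg[OF W] Lin_closed)
  show "1 \<odot>\<^bsub>Lin_space V W\<^esub> f = f" if "f \<in> carrier (Lin_space V W)" for f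
    using that W by (simp, intro eq) (auto simp: Lin_closed)
  show "(a * b) \<odot>\<^bsub>Lin_space V W\<^esub> f = a \<odot>\<^bsub>Lin_space V W\<^esub> (b \<odot>\<^bsub>Lin_space V W\<^esub> f)" if "f \<in> carrier (Lin_space V W)" for a b f
    using that W by (auto intro!: restrict_ext simp: Lin_closed)
  show "(a + b) \<odot>\<^bsub>Lin_space V W\<^esub> f = a \<odot>\<^bsub>Lin_space V W\<^esub> f \<oplus>\<^bsub>Lin_space V W\<^esub> b \<odot>\<^bsub>Lin_space V W\<^esub> f" if "f \<in> carrier (Lin_space V W)" for a b f
    using that by (auto intro!: restrict_ext simp: Lin_closed vadd_smult[OF W])
  show "a \<odot>\<^bsub>Lin_space V W\<^esub> (f \<oplus>\<^bsub>Lin_space V W\<^esub> g) = a \<odot>\<^bsub>Lin_space V W\<^esub> f \<oplus>\<^bsub>Lin_space V W\<^esub> a \<odot>\<^bsub>Lin_space V W\<^esub> g"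
    if "f \<in> carrier (Lin_space V W)" "g \<in> carrier (Lin_space V W)" for a f g
    using that by (auto intro!: restrict_ext simp: Lin_closed vsmult_add[OF W])
qed

lemma eval_mhom: "v \<in> carrier V \<Longrightarrow> (\<lambda>f. f v) \<in> mhom (Lin_space V W) W"
  by (rule mhomI) (auto simp: Lin_closed)

lemma finsum_Lin_space:
  assumes "vs V" "vs W" "finite A" "F \<in> A \<rightarrow> Lin V W" "v \<in> carrier V"
  shows "finsum (Lin_space V W) F A v = finsum W (\<lambda>i. F i v) A"
  using mhom_finsum[OF vs_Lin_space[OF assms(1,2)] assms(2) eval_mhom[OF assms(5)] assms(3), of F] assms(4) by simp

text \<open>The basis consists of the maps that send \<open>e i\<close> to \<open>f j\<close> and
  the other basis vectors to zero; the coordinates are the matrix entries. That these maps span is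
  checked in the coordinates of \<open>W\<close>.\<close>

lemma frame_Lin_space:
  assumes V: "vs V" "frame V I e c" and W: "vs W" "frame W J f d"
  shows "frame (Lin_space V W) (I \<times> J) (\<lambda>(i, j). \<lambda>v\<in>carrier V. c i v \<odot>\<^bsub>W\<^esub> f j) (\<lambda>(i, j) T. d j (T (e i)))"
proof (rule frameI)
  note F = frameD[OF V(2)] and G = frameD[OF W(2)]
  have L: "(\<lambda>v\<in>carrier V. c i v \<odot>\<^bsub>W\<^esub> f j) \<in> Lin V W" if "i \<in> I" "j \<in> J" for i j
    by (rule restrict_Lin[OF V(1) mhom_scale[OF W(1)]]) (use F G that in auto)
  show "finite (I \<times> J)" using F G by simp
  show "(case p of (i, j) \<Rightarrow> \<lambda>v\<in>carrier V. c i v \<odot>\<^bsub>W\<^esub> f j) \<in> carrier (Lin_space V W)" if "p \<in> I \<times> J" for p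
    using that L by auto
  show "(case p of (i, j) \<Rightarrow> \<lambda>T. d j (T (e i))) \<in> mhom (Lin_space V W) Cline" if "p \<in> I \<times> J" for p
    using that F by (auto intro!: mhom_comp[OF eval_mhom G(3)])
  show "(case p of (i, j) \<Rightarrow> \<lambda>T. d j (T (e i))) (case q of (i, j) \<Rightarrow> \<lambda>v\<in>carrier V. c i v \<odot>\<^bsub>W\<^esub> f j) =
    (if p = q then 1 else 0)" if "p \<in> I \<times> J" "q \<in> I \<times> J" for p q
    using that F G by (auto simp: mhom_smult[OF G(3)] split: if_splits)
  show "finsum (Lin_space V W) (\<lambda>p. (case p of (i, j) \<Rightarrow> \<lambda>T. d j (T (e i))) T \<odot>\<^bsub>Lin_space V W\<^esub>
       (case p of (i, j) \<Rightarrow> \<lambda>v\<in>carrier V. c i v \<odot>\<^bsub>W\<^esub> f j)) (I \<times> J) = T" (is "?S = _") if T: "T \<in> carrier (Lin_space V W)" for T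
  proof (rule Lin_eqI[of _ V W _ W])
    have LV: "vs (Lin_space V W)" using V W by simp
    let ?E = "\<lambda>p. case p of (i, j) \<Rightarrow> \<lambda>v\<in>carrier V. c i v \<odot>\<^bsub>W\<^esub> f j" and ?D = "\<lambda>p. case p of (i, j) \<Rightarrow> \<lambda>T. d j (T (e i))"
    have cl: "(\<lambda>p. ?D p T \<odot>\<^bsub>Lin_space V W\<^esub> ?E p) \<in> I \<times> J \<rightarrow> carrier (Lin_space V W)"
      using L[folded Lin_space_simps(1)] by (auto simp del: Lin_space_simps intro!: vsmult_closed[OF LV])
    show S: "?S \<in> Lin V W" using vfinsum_closed[OF LV cl] by simp
    show "T \<in> Lin V W" using T by simp
    fix v assume v: "v \<in> carrier V"
    have Sv: "?S v = finsum W (\<lambda>p. (?D p T \<odot>\<^bsub>Lin_space V W\<^esub> ?E p) v) (I \<times> J)"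
      by (rule finsum_Lin_space[OF V(1) W(1) _ _ v]) (use cl F G in auto)
    have clW: "(\<lambda>p. (?D p T \<odot>\<^bsub>Lin_space V W\<^esub> ?E p) v) \<in> I \<times> J \<rightarrow> carrier W"
      by (rule Pi_I) (rule Lin_closed[OF Pi_mem[OF cl[unfolded Lin_space_simps(1)]] v])
    show "?S v = T v"
    proof (rule frame_eqI[OF W(2) _ _ _ W(1)])
      show "?S v \<in> carrier W" by (rule Lin_closed[OF S v])
      show "T v \<in> carrier W" using T v by (auto intro: Lin_closed)
      fix k assume k: "k \<in> J"
      have "d k (?S v) = (\<Sum>p\<in>I\<times>J. d k ((?D p T \<odot>\<^bsub>Lin_space V W\<^esub> ?E p) v))"
        unfolding Sv by (subst mhom_finsum[OF W(1) vs_Cline G(3)[OF k] _ clW]) (use F G in auto)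
      also have "\<dots> = (\<Sum>i\<in>I. \<Sum>j\<in>J. d j (T (e i)) * c i v * d k (f j))"
        by (subst sum.cartesian_product) (use F G v k W in \<open>auto intro!: sum.cong simp: mhom_smult[OF G(3)]\<close>)
      also have "\<dots> = (\<Sum>i\<in>I. \<Sum>j\<in>J. if k = j then d j (T (e i)) * c i v else 0)"
        by (intro sum.cong) (use G k in auto)
      also have "\<dots> = (\<Sum>i\<in>I. c i v * d k (T (e i)))" using G k by (simp add: mult.commute)
      also have "\<dots> = d k (T v)"
        using mhom_expand[OF V(2,1) vs_Cline mhom_comp[OF Lin_mhom G(3)[OF k]], of T v] T v F by simp
      finally show "d k (?S v) = d k (T v)" .
    qed
  qed
qed

lemma fdvs_Lin_space [simp]: "fdvs V \<Longrightarrow> fdvs W \<Longrightarrow> fdvs (Lin_space V W)"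
  by (metis fdvsI frame_Lin_space fdvs_frame fdvs_vs vs_Lin_space)

lemma frame_dual:
  assumes V: "vs V" "frame V I e c"
  shows "frame (Lin_space V Cline) I (\<lambda>i. restrict (c i) (carrier V)) (\<lambda>i \<phi>. \<phi> (e i))"
  using frame_reindex[OF frame_Lin_space[OF V vs_Cline frame_Cline], of "\<lambda>i. (i, ())" I] V
  by (force simp: bij_betw_def inj_on_def)

section \<open>Tensor products\<close>

lemma vs_bilin_forms [simp]: "vs V \<Longrightarrow> vs W \<Longrightarrow> vs (bilin_forms V W)"
  and fdvs_bilin_forms [simp]: "fdvs V \<Longrightarrow> fdvs W \<Longrightarrow> fdvs (bilin_forms V W)"
  by (simp_all add: bilin_forms_def)

lemma vs_tensor [simp]: "vs V \<Longrightarrow> vs W \<Longrightarrow> vs (tensor V W)"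
  and fdvs_tensor [simp]: "fdvs V \<Longrightarrow> fdvs W \<Longrightarrow> fdvs (tensor V W)"
  by (simp_all add: tensor_def)

lemma frame_bilin_forms:
  assumes V: "vs V" "frame V I e c" and W: "vs W" "frame W J f d"
  shows "frame (bilin_forms V W) (I \<times> J) (\<lambda>(i, j). \<lambda>v\<in>carrier V. \<lambda>w\<in>carrier W. c i v * d j w) (\<lambda>(i, j) B. B (e i) (f j))"
proof -
  have "c i v \<odot>\<^bsub>Lin_space W Cline\<^esub> restrict (d j) (carrier W) = (\<lambda>w\<in>carrier W. c i v * d j w)" for i j v
    by (auto simp: restrict_def)
  then show ?thesis
    using frame_Lin_space[OF V vs_Lin_space[OF W(1) vs_Cline] frame_dual[OF W]]
    unfolding bilin_forms_def by simp
qed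

text \<open>\<open>tensor\<close> is the dual of the space of bilinear forms, so
  \<open>frame_dual\<close> applies to the frame of product forms \<open>c i v * d j w\<close>:
  evaluation at a pair of basis vectors is their pure tensor, and the coordinates of a tensor are
  its values on product forms.\<close>

lemma frame_tensor:
  assumes V: "vs V" "frame V I e c" and W: "vs W" "frame W J f d"
  shows "frame (tensor V W) (I \<times> J) (\<lambda>(i, j). pure V W (e i) (f j))
     (\<lambda>(i, j) t. t (\<lambda>v\<in>carrier V. \<lambda>w\<in>carrier W. c i v * d j w))"
  using frame_dual[OF vs_bilin_forms[OF V(1) W(1)] frame_bilin_forms[OF assms]]
  by (simp add: tensor_def pure_def case_prod_unfold)

definition bilinear :: "(complex, 'a, 'x) module_scheme \<Rightarrow> (complex, 'b, 'y) module_scheme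
    \<Rightarrow> (complex, 'c, 'z) module_scheme \<Rightarrow> ('a \<Rightarrow> 'b \<Rightarrow> 'c) \<Rightarrow> bool" where
  "bilinear V W Z b \<longleftrightarrow> (\<forall>v\<in>carrier V. b v \<in> mhom W Z) \<and> (\<forall>w\<in>carrier W. (\<lambda>v. b v w) \<in> mhom V Z)"

lemma bilinearD:
  assumes "bilinear V W Z b"
  shows "v \<in> carrier V \<Longrightarrow> b v \<in> mhom W Z" "w \<in> carrier W \<Longrightarrow> (\<lambda>v. b v w) \<in> mhom V Z"
  using assms by (auto simp: bilinear_def)

lemma bilinear_closed: "bilinear V W Z b \<Longrightarrow> v \<in> carrier V \<Longrightarrow> w \<in> carrier W \<Longrightarrow> b v w \<in> carrier Z"
  by (rule mhom_closed[OF bilinearD(1)])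

lemma bilinear_pure: 
  assumes V: "vs V" and W: "vs W"
  shows "bilinear V W (tensor V W) (pure V W)"
proof -
  have cl: "pure V W v w \<in> carrier (tensor V W)" if "v \<in> carrier V" "w \<in> carrier W" for v w
  proof -
    have "(\<lambda>B. B v w) \<in> mhom (bilin_forms V W) Cline"
      unfolding bilin_forms_def by (rule mhom_comp[OF eval_mhom[OF that(1)] eval_mhom[OF that(2)]])
    from restrict_Lin[OF vs_bilin_forms[OF V W] this] show ?thesis by (simp add: pure_def tensor_def)
  qed
  have B: "B \<in> carrier (bilin_forms V W) \<longleftrightarrow> B \<in> Lin V (Lin_space W Cline)" for B by (simp add: bilin_forms_def)
  have B1: "B v \<in> mhom W Cline" if "B \<in> carrier (bilin_forms V W)" "v \<in> carrier V" for B v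
    using Lin_closed[of B V "Lin_space W Cline" v] that by (simp add: B Lin_iff)
  have B2: "(\<lambda>v. B v w) \<in> mhom V Cline" if "B \<in> carrier (bilin_forms V W)" "w \<in> carrier W" for B w
    using mhom_comp[OF Lin_mhom eval_mhom[OF that(2)], of B V Cline] that by (simp add: B)
  show ?thesis unfolding bilinear_def
  proof (intro conjI ballI mhomI cl)
    fix v w w' assume "v \<in> carrier V" "w \<in> carrier W" "w' \<in> carrier W"
    then show "pure V W v (w \<oplus>\<^bsub>W\<^esub> w') = pure V W v w \<oplus>\<^bsub>tensor V W\<^esub> pure V W v w'"
      by (auto simp: pure_def tensor_def mhom_add[OF B1] restrict_def)
  next
    fix v w a assume "v \<in> carrier V" "w \<in> carrier W"
    then show "pure V W v (a \<odot>\<^bsub>W\<^esub> w) = a \<odot>\<^bsub>tensor V W\<^esub> pure V W v w"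
      by (auto simp: pure_def tensor_def mhom_smult[OF B1] restrict_def)
  next
    fix v w v' assume "v \<in> carrier V" "w \<in> carrier W" "v' \<in> carrier V"
    then show "pure V W (v \<oplus>\<^bsub>V\<^esub> v') w = pure V W v w \<oplus>\<^bsub>tensor V W\<^esub> pure V W v' w"
      by (auto simp: pure_def tensor_def mhom_add[OF B2] restrict_def)
  next
    fix v w a assume "v \<in> carrier V" "w \<in> carrier W"
    then show "pure V W (a \<odot>\<^bsub>V\<^esub> v) w = a \<odot>\<^bsub>tensor V W\<^esub> pure V W v w"
      by (auto simp: pure_def tensor_def mhom_smult[OF B2] restrict_def)
  qed
qed

lemmas pure_closed [simp] = bilinear_closed[OF bilinear_pure]
lemmas pure_mhom_right = bilinearD(1)[OF bilinear_pure]
lemmas pure_mhom_left = bilinearD(2)[OF bilinear_pure]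
lemmas pure_add_right = mhom_add[OF pure_mhom_right]
lemmas pure_smult_right = mhom_smult[OF pure_mhom_right]


text \<open>Pure tensors of basis vectors already form a basis. This is the uniqueness half of the
  universal property, and the means by which later identities between maps out of a tensor product
  are reduced to pure tensors.\<close>

lemma tensor_eqI:
  assumes "fdvs V" "fdvs W" "vs Z" "f \<in> mhom (tensor V W) Z" "g \<in> mhom (tensor V W) Z"
    "\<And>v w. v \<in> carrier V \<Longrightarrow> w \<in> carrier W \<Longrightarrow> f (pure V W v w) = g (pure V W v w)" "t \<in> carrier (tensor V W)"
  shows "f t = g t"
proof -
  obtain e c and n :: nat where F: "frame V {..<n} e c" using fdvs_frame[OF assms(1)] .
  obtain e' c' and n' :: nat where F': "frame W {..<n'} e' c'" using fdvs_frame[OF assms(2)] .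
  note V = fdvs_vs[OF assms(1)] and W = fdvs_vs[OF assms(2)]
  show ?thesis
    by (rule mhom_eq_frame[OF frame_tensor[OF V F W F'] vs_tensor[OF V W] assms(3-5) _ assms(7)])
       (use assms(6) frameD[OF F] frameD[OF F'] in auto)
qed

text \<open>A tensor is expanded in the basis of pure tensors and \<open>b\<close> takes the place
  of \<open>pure\<close>. The value at a general pair follows from the values at basis vectors, one
  variable at a time, since both sides are bilinear.\<close>

lemma tlift_ex:
  assumes VV: "fdvs V" and WW: "fdvs W" and Z: "vs Z" and b: "bilinear V W Z b"
  shows "\<exists>f\<in>Lin (tensor V W) Z. \<forall>v\<in>carrier V. \<forall>w\<in>carrier W. f (pure V W v w) = b v w"
proof -
  obtain e c and n :: nat where F: "frame V {..<n} e c" using fdvs_frame[OF VV] .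
  obtain e' c' and n' :: nat where F': "frame W {..<n'} e' c'" using fdvs_frame[OF WW] .
  note V = fdvs_vs[OF VV] and W = fdvs_vs[OF WW]
  note FF = frame_tensor[OF V F W F']
  note D = frameD[OF F] and D' = frameD[OF F'] and DD = frameD[OF FF]
  define d where "d = (\<lambda>(i, j) t. t (\<lambda>v\<in>carrier V. \<lambda>w\<in>carrier W. c i v * c' j w) :: complex)"
  have d: "p \<in> {..<n} \<times> {..<n'} \<Longrightarrow> d p \<in> mhom (tensor V W) Cline" for p using DD(3) by (simp add: d_def)
  define f where "f = (\<lambda>t\<in>carrier (tensor V W). finsum Z (\<lambda>p. d p t \<odot>\<^bsub>Z\<^esub> b (e (fst p)) (e' (snd p))) ({..<n} \<times> {..<n'}))"
  have bc: "p \<in> {..<n} \<times> {..<n'} \<Longrightarrow> b (e (fst p)) (e' (snd p)) \<in> carrier Z" for p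
    using bilinear_closed[OF b] D D' by auto
  have f: "f \<in> Lin (tensor V W) Z" unfolding f_def
    by (intro restrict_Lin vs_tensor V W mhom_sum Z mhom_scale bc d) auto
  have fe: "f (pure V W (e i) (e' j)) = b (e i) (e' j)" if "i \<in> {..<n}" "j \<in> {..<n'}" for i j
  proof -
    have "f (pure V W (e i) (e' j)) = finsum Z (\<lambda>p. d p (pure V W (e i) (e' j)) \<odot>\<^bsub>Z\<^esub> b (e (fst p)) (e' (snd p))) ({..<n} \<times> {..<n'})"
      using that D D' V W unfolding f_def by simp
    also have "\<dots> = d (i, j) (pure V W (e i) (e' j)) \<odot>\<^bsub>Z\<^esub> b (e (fst (i,j))) (e' (snd (i,j)))"
    proof (rule vfinsum_single[OF Z])
      show "d p (pure V W (e i) (e' j)) \<odot>\<^bsub>Z\<^esub> b (e (fst p)) (e' (snd p)) = \<zero>\<^bsub>Z\<^esub>"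
        if "p \<in> {..<n} \<times> {..<n'}" "p \<noteq> (i,j)" for p
        using DD(4)[of p "(i,j)"] bc[OF that(1)] that Z \<open>i \<in> _\<close> \<open>j \<in> _\<close> by (auto simp: d_def)
    qed (use that bc[of "(i,j)"] Z in auto)
    also have "\<dots> = b (e i) (e' j)" using DD(4)[of "(i,j)" "(i,j)"] that bc[of "(i,j)"] Z by (auto simp: d_def)
    finally show ?thesis .
  qed
  have "f (pure V W v w) = b v w" if v: "v \<in> carrier V" and w: "w \<in> carrier W" for v w
  proof (rule mhom_eq_frame[OF F V Z _ _ _ v])
    show "(\<lambda>v. f (pure V W v w)) \<in> mhom V Z" by (rule mhom_comp[OF pure_mhom_left[OF V W w] Lin_mhom[OF f]])
    show "(\<lambda>v. b v w) \<in> mhom V Z" by (rule bilinearD(2)[OF b w])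
    fix i assume i: "i \<in> {..<n}"
    show "f (pure V W (e i) w) = b (e i) w"
      by (rule mhom_eq_frame[OF F' W Z mhom_comp[OF pure_mhom_right[OF V W D(2)[OF i]] Lin_mhom[OF f]]
            bilinearD(1)[OF b D(2)[OF i]] fe[OF i] w])
  qed
  then show ?thesis using f by blast
qed

lemma tlift:
  assumes "fdvs V" "fdvs W" "vs Z" "bilinear V W Z b"
  shows tlift_Lin: "tlift V W Z b \<in> Lin (tensor V W) Z"
    and tlift_pure: "v \<in> carrier V \<Longrightarrow> w \<in> carrier W \<Longrightarrow> tlift V W Z b (pure V W v w) = b v w"
proof -
  let ?P = "\<lambda>f. f \<in> Lin (tensor V W) Z \<and> (\<forall>v\<in>carrier V. \<forall>w\<in>carrier W. f (pure V W v w) = b v w)"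
  have "\<exists>!f. ?P f"
  proof (rule ex_ex1I)
    show "\<exists>f. ?P f" using tlift_ex[OF assms] by blast
    show "f = g" if f: "?P f" and g: "?P g" for f g
    proof (rule Lin_eqI[OF conjunct1[OF f] conjunct1[OF g]])
      show "f t = g t" if "t \<in> carrier (tensor V W)" for t
        by (rule tensor_eqI[OF assms(1-3) Lin_mhom[OF conjunct1[OF f]] Lin_mhom[OF conjunct1[OF g]] _ that])
          (use f g in auto)
    qed
  qed
  from theI'[OF this] show "tlift V W Z b \<in> Lin (tensor V W) Z"
    "v \<in> carrier V \<Longrightarrow> w \<in> carrier W \<Longrightarrow> tlift V W Z b (pure V W v w) = b v w"
    unfolding tlift_def by auto
qed

lemma bilinear_comp:
  assumes "f \<in> mhom V V'" "g \<in> mhom W W'" "bilinear V' W' Z b"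
  shows "bilinear V W Z (\<lambda>v w. b (f v) (g w))"
  unfolding bilinear_def
  by (auto intro: mhom_comp[OF assms(1) bilinearD(2)[OF assms(3)]] mhom_comp[OF assms(2) bilinearD(1)[OF assms(3)]] mhom_closed[OF assms(1)] mhom_closed[OF assms(2)])

lemma
  assumes "fdvs V" "fdvs W" "fdvs V'" "fdvs W'" "f \<in> mhom V V'" "g \<in> mhom W W'"
  shows tmap_Lin: "tmap V W V' W' f g \<in> Lin (tensor V W) (tensor V' W')"
    and tmap_pure: "v \<in> carrier V \<Longrightarrow> w \<in> carrier W \<Longrightarrow> tmap V W V' W' f g (pure V W v w) = pure V' W' (f v) (g w)"
  unfolding tmap_def
  by (rule tlift[OF assms(1,2) _ bilinear_comp[OF assms(5,6) bilinear_pure]]; use assms in simp)+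

lemmas tmap_mhom = Lin_mhom[OF tmap_Lin]

lemma tmap_comp:
  assumes "fdvs V" "fdvs W" "fdvs V'" "fdvs W'" "fdvs V''" "fdvs W''" "f \<in> mhom V V'" "g \<in> mhom W W'" "f' \<in> mhom V' V''" "g' \<in> mhom W' W''"
    "t \<in> carrier (tensor V W)"
  shows "tmap V' W' V'' W'' f' g' (tmap V W V' W' f g t) = tmap V W V'' W'' (\<lambda>v. f' (f v)) (\<lambda>w. g' (g w)) t"
  by (rule tensor_eqI[OF assms(1,2) _ mhom_comp[OF tmap_mhom tmap_mhom] tmap_mhom _ assms(11)])
     (use assms in \<open>auto simp: tmap_pure mhom_comp mhom_closed\<close>)

lemma tmap_id:
  assumes "fdvs V" "fdvs W" "t \<in> carrier (tensor V W)" "\<And>v. v \<in> carrier V \<Longrightarrow> f v = v" "\<And>w. w \<in> carrier W \<Longrightarrow> g w = w"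
  shows "tmap V W V W f g t = t"
proof -
  have f: "f \<in> mhom V V" "g \<in> mhom W W" using assms by (auto intro!: mhomI)
  show ?thesis
    by (rule tensor_eqI[OF assms(1,2) _ tmap_mhom mhom_id _ assms(3)]) (use assms f in \<open>auto simp: tmap_pure\<close>)
qed

lemma tmap_cong:
  assumes "fdvs V" "fdvs W" "fdvs V'" "fdvs W'" "f \<in> mhom V V'" "g \<in> mhom W W'"
    "\<And>v. v \<in> carrier V \<Longrightarrow> f v = f' v" "\<And>w. w \<in> carrier W \<Longrightarrow> g w = g' w" 
  shows "tmap V W V' W' f g = tmap V W V' W' f' g'"
proof -
  have f: "f' \<in> mhom V V'" "g' \<in> mhom W W'"
    using mhom_cong[OF assms(7) fdvs_vs assms(5)] mhom_cong[OF assms(8) fdvs_vs assms(6)] assms by auto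
  show ?thesis
    by (rule Lin_eqI[OF tmap_Lin tmap_Lin], (use assms f in auto)[12],
        rule tensor_eqI[OF assms(1,2) _ tmap_mhom tmap_mhom]) (use assms f in \<open>auto simp: tmap_pure\<close>)
qed

section \<open>Copies in the universe\<close>

text \<open>An infinite set is equipotent with its square, so a pairing \<open>p\<close> on the
  complex numbers absorbs one coordinate after another.\<close>

lemma inj_tuples_complex:
  "\<exists>f :: (nat \<Rightarrow> complex) \<Rightarrow> complex. inj_on f ({..<n} \<rightarrow>\<^sub>E UNIV)"
proof (induction n)
  case 0
  show ?case by (rule exI[of _ "\<lambda>_. 0"]) auto
next
  case (Suc n)
  then obtain f :: "(nat \<Rightarrow> complex) \<Rightarrow> complex" where f: "inj_on f ({..<n} \<rightarrow>\<^sub>E UNIV)" by blast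
  have "(card_of ((UNIV :: complex set) \<times> (UNIV :: complex set)), card_of (UNIV :: complex set)) \<in> ordIso"
    by (rule card_of_Times_same_infinite) (rule infinite_UNIV_char_0)
  then obtain p :: "complex \<times> complex \<Rightarrow> complex" where p: "inj p"
    using card_of_ordIso[of "UNIV \<times> UNIV :: (complex \<times> complex) set" "UNIV :: complex set"] by (auto simp: bij_betw_def)
  have "inj_on (\<lambda>a. p (f (restrict a {..<n}), a n)) ({..<Suc n} \<rightarrow>\<^sub>E UNIV)"
  proof (rule inj_onI)
    fix a b :: "nat \<Rightarrow> complex" assume ab: "a \<in> {..<Suc n} \<rightarrow>\<^sub>E UNIV" "b \<in> {..<Suc n} \<rightarrow>\<^sub>E UNIV"
      and "p (f (restrict a {..<n}), a n) = p (f (restrict b {..<n}), b n)"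
    then have "f (restrict a {..<n}) = f (restrict b {..<n})" and n: "a n = b n" by (auto dest: injD[OF p])
    then have "restrict a {..<n} = restrict b {..<n}" using f by (auto simp: inj_on_def)
    then have "a i = b i" if "i < n" for i using that by (metis lessThan_iff restrict_apply')
    then show "a = b" using ab n by (intro PiE_ext[OF ab]) (auto simp: less_Suc_eq)
  qed
  then show ?case by blast
qed

text \<open>A vector is encoded by its tuple of coordinates. This makes the choice of an injection
  in \<open>enc\<close> meaningful for every finite-dimensional space.\<close>

lemma fdvs_inj:
  assumes "fdvs V" "\<exists>f :: complex \<Rightarrow> 'u. inj f"
  shows "\<exists>f :: 'a \<Rightarrow> 'u. inj_on f (carrier (V :: (complex, 'a, 'x) module_scheme))"
proof -
  obtain e c and n :: nat where F: "frame V {..<n} e c" using fdvs_frame[OF assms(1)] .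
  obtain u :: "complex \<Rightarrow> 'u" where u: "inj u" using assms(2) by blast
  obtain f :: "(nat \<Rightarrow> complex) \<Rightarrow> complex" where f: "inj_on f ({..<n} \<rightarrow>\<^sub>E UNIV)" using inj_tuples_complex by blast
  have "inj_on (\<lambda>v. u (f (\<lambda>i\<in>{..<n}. c i v))) (carrier V)"
  proof (rule inj_onI)
    fix v w assume v: "v \<in> carrier V" "w \<in> carrier V" and "u (f (\<lambda>i\<in>{..<n}. c i v)) = u (f (\<lambda>i\<in>{..<n}. c i w))"
    then have "f (\<lambda>i\<in>{..<n}. c i v) = f (\<lambda>i\<in>{..<n}. c i w)" using u by (auto simp: inj_def)
    then have e: "(\<lambda>i\<in>{..<n}. c i v) = (\<lambda>i\<in>{..<n}. c i w)" by (rule inj_onD[OF f]) auto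
    have "c i v = c i w" if "i \<in> {..<n}" for i using fun_cong[OF e, of i] that by simp
    from frame_eqI[OF F v this] show "v = w" using assms(1) by simp
  qed
  then show ?thesis by blast
qed

definition encodable :: "'u itself \<Rightarrow> (complex, 'a, 'x) module_scheme \<Rightarrow> bool" where
  "encodable _ V \<longleftrightarrow> (\<exists>f :: 'a \<Rightarrow> 'u. inj_on f (carrier V))"

lemma enc_inj: "encodable TYPE('u) V \<Longrightarrow> inj_on (enc V :: 'a \<Rightarrow> 'u) (carrier V)"
  unfolding encodable_def enc_def by (rule someI_ex[of "\<lambda>c. inj_on c (carrier V)"])

lemma dec_enc [simp]: "encodable TYPE('u) V \<Longrightarrow> v \<in> carrier V \<Longrightarrow> dec V (enc V v :: 'u) = v"
  unfolding dec_def by (rule inv_into_f_f[OF enc_inj])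

lemma copy_simps [simp]:
  "carrier (copy V) = enc V ` carrier V" "\<zero>\<^bsub>copy V\<^esub> = enc V \<zero>\<^bsub>V\<^esub>"
  "a \<oplus>\<^bsub>copy V\<^esub> b = enc V (dec V a \<oplus>\<^bsub>V\<^esub> dec V b)" "z \<odot>\<^bsub>copy V\<^esub> a = enc V (z \<odot>\<^bsub>V\<^esub> dec V a)"
  by (simp_all add: copy_def)

lemma enc_dec: "a \<in> carrier (copy V) \<Longrightarrow> enc V (dec V a) = a"
  and dec_closed: "a \<in> carrier (copy V) \<Longrightarrow> dec V a \<in> carrier V"
  unfolding dec_def copy_simps by (auto intro: f_inv_into_f inv_into_into)

lemma enc_mhom:
  "encodable TYPE('u) V \<Longrightarrow> (enc V :: 'a \<Rightarrow> 'u) \<in> mhom V (copy V)"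
  by (rule mhomI) auto

lemma dec_mhom:
  "encodable TYPE('u) V \<Longrightarrow> vs V \<Longrightarrow> (dec V :: 'u \<Rightarrow> 'a) \<in> mhom (copy V) V"
  by (rule mhomI) auto

lemma vs_copy:
  assumes "encodable TYPE('u) V" "vs V"
  shows "vs (copy V :: (complex, 'u) module)"
proof (rule vsI)
  show "v \<oplus>\<^bsub>copy V\<^esub> w = w \<oplus>\<^bsub>copy V\<^esub> v" if "v \<in> carrier (copy V)" "w \<in> carrier (copy V)" for v w :: 'u
    using vadd_ac(2)[OF assms(2), of "dec V v" "dec V w"] that assms by auto
qed (use assms in \<open>auto simp: vadd_smult vsmult_add vneg vadd_ac(1)\<close>)

lemma fdvs_copy:
  assumes "encodable TYPE('u) V" "fdvs V"
  shows "fdvs (copy V :: (complex, 'u) module)"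
  by (rule fdvs_transfer[OF assms(2) vs_copy[OF assms(1) fdvs_vs[OF assms(2)]] enc_mhom dec_mhom])
     (use assms in auto)

section \<open>Subspaces and complements\<close>

text \<open>A subspace in elementary terms; the conversions below connect it with
  \<open>subspace\<close>, in which \<open>irreducible_gmod\<close> is stated.\<close>

definition lin_closed :: "(complex, 'a, 'x) module_scheme \<Rightarrow> 'a set \<Rightarrow> bool" where
  "lin_closed V W \<longleftrightarrow> W \<subseteq> carrier V \<and> \<zero>\<^bsub>V\<^esub> \<in> W \<and> (\<forall>v\<in>W. \<forall>w\<in>W. v \<oplus>\<^bsub>V\<^esub> w \<in> W) \<and> (\<forall>a. \<forall>v\<in>W. a \<odot>\<^bsub>V\<^esub> v \<in> W)"

lemma lin_closed_finsum:
  assumes "vs V" "lin_closed V W" "finite A" "f \<in> A \<rightarrow> W"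
  shows "finsum V f A \<in> W"
  using assms(3,4)
proof (induction A rule: finite_induct)
  case (insert x A)
  then have "finsum V f (insert x A) = f x \<oplus>\<^bsub>V\<^esub> finsum V f A"
    using assms(2) by (intro vfinsum_insert[OF assms(1)]) (auto simp: lin_closed_def)
  then show ?case using insert assms(2) by (auto simp: lin_closed_def)
qed (use assms in \<open>auto simp: lin_closed_def\<close>)

lemma lin_closed_subspace: "vs V \<Longrightarrow> lin_closed V W \<Longrightarrow> VectorSpace.subspace Cf W V"
  unfolding VectorSpace.subspace_def submodule_def lin_closed_def by (simp add: vs_module)

lemma subspace_lin_closed: "VectorSpace.subspace Cf W V \<Longrightarrow> lin_closed V W"
  unfolding VectorSpace.subspace_def submodule_def lin_closed_def by auto

text \<open>Gaussian elimination on the finite separating set \<open>D\<close>. A functional that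
  vanishes on \<open>W\<close> is dropped; any other splits off one vector \<open>u\<close>, and the
  rest of \<open>D\<close> separates the points of its kernel in \<open>W\<close>. The functionals
  obtained are defined on all of \<open>V\<close>, which turns the system into a projection onto
  \<open>W\<close>.\<close>

lemma biorthogonal_system:
  assumes V: "vs V" and "finite D" "lin_closed V W" "\<And>d. d \<in> D \<Longrightarrow> d \<in> mhom V Cline"
    "\<And>w. w \<in> W \<Longrightarrow> (\<forall>d\<in>D. d w = 0) \<Longrightarrow> w = \<zero>\<^bsub>V\<^esub>"
  shows "\<exists>(n::nat) e c. (\<forall>i<n. e i \<in> W) \<and> (\<forall>i<n. c i \<in> mhom V Cline) \<and>
     (\<forall>i<n. \<forall>j<n. c i (e j) = (if i = j then 1 else 0)) \<and>
     (\<forall>w\<in>W. finsum V (\<lambda>i. c i w \<odot>\<^bsub>V\<^esub> e i) {..<n} = w)"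
  using assms(2-5)
proof (induction D arbitrary: W rule: finite_induct)
  case empty
  then have "W = {\<zero>\<^bsub>V\<^esub>}" by (auto simp: lin_closed_def)
  then show ?case using V by (intro exI[of _ 0]) auto
next
  case (insert d D W)
  note W = insert.prems(1)
  have WV: "\<And>w. w \<in> W \<Longrightarrow> w \<in> carrier V" using W by (auto simp: lin_closed_def)
  have d: "d \<in> mhom V Cline" using insert.prems(2) by simp
  show ?case
  proof (cases "\<forall>w\<in>W. d w = 0")
    case True
    show ?thesis by (rule insert.IH[OF W]) (use insert.prems True in auto)
  next
    case False
    then obtain u0 where u0: "u0 \<in> W" "d u0 \<noteq> 0" by auto
    define u where "u = (1 / d u0) \<odot>\<^bsub>V\<^esub> u0"
    have u: "u \<in> W" "d u = 1" "u \<in> carrier V"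
      using u0 W WV d by (auto simp: u_def mhom_smult lin_closed_def)
    define W' where "W' = {w \<in> W. d w = 0}"
    have W': "lin_closed V W'"
      using W d WV mhom_zero[OF V vs_Cline d] unfolding lin_closed_def W'_def
      by (auto simp: mhom_add mhom_smult)
    obtain n :: nat and e c where n: "\<forall>i<n. e i \<in> W'" "\<forall>i<n. c i \<in> mhom V Cline"
       "\<forall>i<n. \<forall>j<n. c i (e j) = (if i = j then 1 else 0)"
       "\<forall>w\<in>W'. finsum V (\<lambda>i. c i w \<odot>\<^bsub>V\<^esub> e i) {..<n} = w"
      using insert.IH[OF W'] insert.prems by (auto simp: W'_def)
    define e' where "e' = (\<lambda>i. if i < n then e i else u)"
    \<comment> \<open>The correction by \<open>c i u\<close> makes the earlier functionals vanish at
      \<open>u\<close>; on \<open>W'\<close>, where \<open>d\<close> is zero, it changes nothing.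
      The new last functional is \<open>d\<close> itself.\<close>
    define c' where "c' = (\<lambda>i v. if i < n then c i v + (- c i u) * d v else d v)"
    have c': "c' i \<in> mhom V Cline" if "i < Suc n" for i
      using n(2) d that unfolding c'_def
      by (auto intro!: mhomI simp: mhom_add[of "c i" V] mhom_smult[of "c i" V] mhom_add[OF d] mhom_smult[OF d] algebra_simps)
    have eV: "i < n \<Longrightarrow> e i \<in> carrier V" "i < n \<Longrightarrow> d (e i) = 0" for i using n(1) WV by (auto simp: W'_def)
    have sum: "finsum V (\<lambda>i. c' i w \<odot>\<^bsub>V\<^esub> e' i) {..<Suc n} = w" if w: "w \<in> W" for w
    proof -
      \<comment> \<open>The component of \<open>w\<close> in the kernel of \<open>d\<close>, to
        which the expansion in the earlier vectors applies.\<close>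
      define w' where "w' = w \<oplus>\<^bsub>V\<^esub> (- d w) \<odot>\<^bsub>V\<^esub> u"
      have wV: "w \<in> carrier V" using WV w by simp
      have "d w' = 0" using u wV d V by (simp add: w'_def mhom_add mhom_smult)
      moreover have "w' \<in> W" using w W u by (auto simp: w'_def lin_closed_def)
      ultimately have w': "w' \<in> W'" by (simp add: W'_def)
      have cw: "c' i w = c i w'" if "i < n" for i
      proof -
        have ci: "c i \<in> mhom V Cline" using that n(2) by simp
        show ?thesis using that u wV V by (simp add: c'_def w'_def mhom_add[OF ci] mhom_smult[OF ci])
      qed
      have "finsum V (\<lambda>i. c' i w \<odot>\<^bsub>V\<^esub> e' i) {..<n} = finsum V (\<lambda>i. c i w' \<odot>\<^bsub>V\<^esub> e i) {..<n}"
        by (rule vfinsum_cong[OF V refl]) (use cw eV V in \<open>auto simp: e'_def\<close>)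
      also have "\<dots> = w'" using n(4) w' by simp
      finally have "finsum V (\<lambda>i. c' i w \<odot>\<^bsub>V\<^esub> e' i) {..<Suc n} = d w \<odot>\<^bsub>V\<^esub> u \<oplus>\<^bsub>V\<^esub> w'"
        using eV u V by (simp add: lessThan_Suc vfinsum_insert e'_def c'_def Pi_iff)
      also have "\<dots> = w \<oplus>\<^bsub>V\<^esub> (d w \<odot>\<^bsub>V\<^esub> u \<oplus>\<^bsub>V\<^esub> (- d w) \<odot>\<^bsub>V\<^esub> u)"
        unfolding w'_def using wV u V by (simp add: vadd_ac(3)[OF V])
      also have "\<dots> = w" using wV V u by (simp add: vadd_smult[OF V u(3), symmetric])
      finally show ?thesis .
    qed
    show ?thesis
    proof (intro exI conjI allI impI)
      fix i j assume "i < Suc n" "j < Suc n"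
      then show "c' i (e' j) = (if i = j then 1 else 0)"
        using n(3) u eV by (auto simp: c'_def e'_def less_Suc_eq)
    qed (use c' sum n(1) u in \<open>auto simp: e'_def W'_def less_Suc_eq\<close>)
  qed
qed

lemma vs_lin_closed:
  assumes V: "vs V" and W: "lin_closed V W"
  shows "vs (V\<lparr>carrier := W\<rparr>)"
  using vectorspace.subspace_is_vs[OF V lin_closed_subspace[OF V W]] .

text \<open>Since the coordinate functionals of \<open>W\<close> extend to \<open>V\<close>, the
  expansion formula defines a linear projection onto \<open>W\<close>. It is the input for the
  averaging in \<open>Maschke\<close>.\<close>

lemma subspace_retraction:
  assumes V: "fdvs V" and W: "lin_closed V W"
  shows "fdvs (V\<lparr>carrier := W\<rparr>)" "\<exists>p \<in> mhom V V. p ` carrier V \<subseteq> W \<and> (\<forall>w\<in>W. p w = w)"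
proof -
  obtain b d and m :: nat where F: "frame V {..<m} b d" using fdvs_frame[OF V] .
  note D = frameD[OF F] and V' = fdvs_vs[OF V]
  have WV: "\<And>w. w \<in> W \<Longrightarrow> w \<in> carrier V" using W by (auto simp: lin_closed_def)
  have sep: "w = \<zero>\<^bsub>V\<^esub>" if "w \<in> W" "\<forall>f\<in>d ` {..<m}. f w = 0" for w
    by (rule frame_eqI[OF F]) (use that WV V' mhom_zero[OF V' vs_Cline D(3)] in auto)
  have "\<exists>(n::nat) e c. (\<forall>i<n. e i \<in> W) \<and> (\<forall>i<n. c i \<in> mhom V Cline) \<and>
     (\<forall>i<n. \<forall>j<n. c i (e j) = (if i = j then 1 else 0)) \<and>
     (\<forall>w\<in>W. finsum V (\<lambda>i. c i w \<odot>\<^bsub>V\<^esub> e i) {..<n} = w)"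
    by (rule biorthogonal_system[OF V' _ W, of "d ` {..<m}"]) (use sep D in auto)
  then obtain n :: nat and e c where n: "\<forall>i<n. e i \<in> W" "\<forall>i<n. c i \<in> mhom V Cline"
       "\<forall>i<n. \<forall>j<n. c i (e j) = (if i = j then 1 else 0)"
       "\<forall>w\<in>W. finsum V (\<lambda>i. c i w \<odot>\<^bsub>V\<^esub> e i) {..<n} = w" by blast
  let ?W = "V\<lparr>carrier := W\<rparr>"
  have vW: "vs ?W" by (rule vs_lin_closed[OF V' W])
  have inc: "(\<lambda>w. w) \<in> mhom ?W V" by (rule mhomI) (use WV in auto)
  have "frame ?W {..<n} e c"
  proof (rule frameI)
    show "c i \<in> mhom ?W Cline" if "i \<in> {..<n}" for i
      using mhom_comp[OF inc, of "c i" Cline] n(2) that by simp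
    show "finsum ?W (\<lambda>i. c i v \<odot>\<^bsub>?W\<^esub> e i) {..<n} = v" if "v \<in> carrier ?W" for v
      using mhom_finsum[OF vW V' inc, of "{..<n}" "\<lambda>i. c i v \<odot>\<^bsub>V\<^esub> e i"] n that W
      by (auto simp: Pi_iff lin_closed_def)
  qed (use n in auto)
  then show "fdvs ?W" by (rule fdvsI[OF vW])
  show "\<exists>p \<in> mhom V V. p ` carrier V \<subseteq> W \<and> (\<forall>w\<in>W. p w = w)"
  proof (intro bexI conjI)
    let ?p = "\<lambda>v. finsum V (\<lambda>i. c i v \<odot>\<^bsub>V\<^esub> e i) {..<n}"
    show "?p \<in> mhom V V" by (intro mhom_sum mhom_scale V') (use n WV in auto)
    show "?p ` carrier V \<subseteq> W" using n W by (auto intro!: lin_closed_finsum[OF V' W] simp: lin_closed_def)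
    show "\<forall>w\<in>W. ?p w = w" using n by simp
  qed
qed

section \<open>Traces of matrices of finite order\<close>

definition mtrace :: "complex mat \<Rightarrow> complex" where
  "mtrace A = (\<Sum>i<dim_row A. A $$ (i, i))"

lemma mtrace_mult_comm:
  assumes "A \<in> carrier_mat n m" "B \<in> carrier_mat m n"
  shows "mtrace (A * B) = mtrace (B * A)"
proof -
  have "mtrace (A * B) = (\<Sum>i<n. \<Sum>j<m. A $$ (i, j) * B $$ (j, i))"
    using assms by (auto simp: mtrace_def scalar_prod_def atLeast0LessThan intro!: sum.cong)
  also have "\<dots> = (\<Sum>j<m. \<Sum>i<n. B $$ (j, i) * A $$ (i, j))"
    by (subst sum.swap) (simp add: mult.commute)
  also have "\<dots> = mtrace (B * A)"
    using assms by (auto simp: mtrace_def scalar_prod_def atLeast0LessThan intro!: sum.cong)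
  finally show ?thesis .
qed

lemma mtrace_similar:
  assumes "similar_mat A B" "A \<in> carrier_mat n n"
  shows "mtrace A = mtrace B"
proof -
  obtain P Q where "similar_mat_wit A B P Q" using assms(1) by (auto simp: similar_mat_def)
  note w = similar_mat_witD2[OF assms(2) this]
  have "mtrace A = mtrace (P * (B * Q))" using w by (simp add: assoc_mult_mat[of P n n B n Q n])
  also have "\<dots> = mtrace (B * Q * P)" by (rule mtrace_mult_comm[of _ n n]) (use w in auto)
  also have "B * Q * P = B" using w by (simp add: assoc_mult_mat[of B n n Q n P n])
  finally show ?thesis .
qed

lemma upper_triangular_mult:
  fixes A B :: "complex mat"
  assumes "A \<in> carrier_mat n n" "B \<in> carrier_mat n n" "upper_triangular A" "upper_triangular B"
  shows "upper_triangular (A * B)" "i < n \<Longrightarrow> (A * B) $$ (i, i) = A $$ (i, i) * B $$ (i, i)"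
proof -
  have e: "(A * B) $$ (i, j) = (\<Sum>k<n. A $$ (i, k) * B $$ (k, j))" if "i < n" "j < n" for i j
    using assms that by (auto simp: scalar_prod_def atLeast0LessThan intro!: sum.cong)
  have z: "A $$ (i, k) * B $$ (k, j) = 0" if "i < n" "j \<le> i" "k < n" "k \<noteq> i \<or> j < i" for i j k
    using that assms upper_triangularD[OF assms(3), of k i] upper_triangularD[OF assms(4), of j k] by (cases "k < i") auto
  show "upper_triangular (A * B)" 
    by (rule upper_triangularI) (use assms e z in \<open>auto intro!: sum.neutral\<close>)
  show "(A * B) $$ (i, i) = A $$ (i, i) * B $$ (i, i)" if "i < n"
    unfolding e[OF that that] by (subst sum.mono_neutral_right[of "{..<n}" "{i}"]) (use that z in auto)
qed

lemma upper_triangular_pow: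
  fixes A :: "complex mat"
  assumes "A \<in> carrier_mat n n" "upper_triangular A"
  shows "upper_triangular (A ^\<^sub>m k) \<and> (\<forall>i<n. (A ^\<^sub>m k) $$ (i, i) = (A $$ (i, i)) ^ k)"
proof (induction k)
  case (Suc k)
  have c: "A ^\<^sub>m k \<in> carrier_mat n n" using assms by simp
  show ?case using upper_triangular_mult[OF c assms(1) _ assms(2)] Suc assms by (auto simp: mult.commute)
qed (use assms in auto)

lemma root_of_unity_norm: "z ^ Suc k = 1 \<Longrightarrow> cmod z = 1"
proof -
  assume "z ^ Suc k = 1"
  then have "cmod z ^ Suc k = 1" by (metis norm_one norm_power)
  then show ?thesis using power_inject_base[of "cmod z" k 1] by simp
qed

text \<open>The order is written \<open>Suc k\<close>, so that the power \<open>k\<close> is the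
  inverse; for a number of modulus one the inverse is the conjugate.\<close>

lemma root_of_unity_cnj: "z ^ Suc k = 1 \<Longrightarrow> z ^ k = cnj z"
proof -
  assume a: "z ^ Suc k = 1"
  then have "z * cnj z = 1" using root_of_unity_norm[OF a] by (simp add: complex_norm_square[symmetric])
  then show ?thesis using a by (metis mult.left_commute mult.right_neutral power_Suc)
qed

text \<open>Over the complex numbers the matrix is similar to a triangular one. Similarity preserves
  the relation of finite order, and the diagonal of a power of a triangular matrix consists of the
  powers of its diagonal entries.\<close>

lemma finite_order_triangular:
  fixes A :: "complex mat"
  assumes A: "A \<in> carrier_mat n n" and k: "A ^\<^sub>m (Suc k) = 1\<^sub>m n"
  obtains B where "B \<in> carrier_mat n n" "upper_triangular B" "similar_mat A B" "similar_mat (A ^\<^sub>m k) (B ^\<^sub>m k)"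
    "\<And>i. i < n \<Longrightarrow> (B $$ (i, i)) ^ Suc k = 1"
proof -
  obtain as where "char_poly A = (\<Prod> a \<leftarrow> as. [:- a, 1:])" using char_poly_factorized[OF A] by blast
  from schur_decomposition_exists[OF A this] obtain B where B: "B \<in> carrier_mat n n" "upper_triangular B" "similar_mat A B" by blast
  obtain P Q where "similar_mat_wit A B P Q" using B(3) by (auto simp: similar_mat_def)
  note sp = similar_mat_wit_pow[OF this]
  have sk: "similar_mat (A ^\<^sub>m k) (B ^\<^sub>m k)" using sp[of k] by (auto simp: similar_mat_def)
  note w = similar_mat_witD2[OF pow_carrier_mat[OF A] sp[of "Suc k"]]
  define C where "C = B ^\<^sub>m (Suc k)"
  have C: "C \<in> carrier_mat n n" unfolding C_def by (rule pow_carrier_mat[OF B(1)])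
  \<comment> \<open>The power of \<open>A\<close> is \<open>P * C * Q\<close> with \<open>Q\<close>
    inverse to \<open>P\<close>; so \<open>C\<close> is conjugate to the identity matrix and
    therefore equal to it.\<close>
  have "Q * (P * C * Q) = Q * (P * C) * Q" by (rule assoc_mult_mat[symmetric, of _ n n _ n _ n]) (use w C in auto)
  also have "Q * (P * C) = C" using w C by (simp add: assoc_mult_mat[symmetric, of Q n n P n C n])
  finally have "Q * (P * C * Q) * P = C" using w C by (simp add: assoc_mult_mat[of C n n Q n P n])
  moreover have "P * C * Q = 1\<^sub>m n" using w(3) k by (simp add: C_def)
  ultimately have "C = Q * 1\<^sub>m n * P" by simp
  also have "\<dots> = 1\<^sub>m n" using w by simp
  finally have Bk: "B ^\<^sub>m (Suc k) = 1\<^sub>m n" unfolding C_def .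
  have d: "(B $$ (i, i)) ^ Suc k = 1" if "i < n" for i
    using upper_triangular_pow[OF B(1,2), of "Suc k"] that unfolding Bk by simp
  then show ?thesis using that B sk by blast
qed

text \<open>The diagonal entries of the triangular form are roots of unity: passing to inverses
  conjugates them, and the modulus of their sum is at most their number. The first part leads to
  \<open>character_ginv\<close>, the second to the bound on \<open>chi_std\<close>.\<close>

lemma mtrace_finite_order:
  fixes A :: "complex mat"
  assumes A: "A \<in> carrier_mat n n" and k: "A ^\<^sub>m (Suc k) = 1\<^sub>m n"
  shows "mtrace (A ^\<^sub>m k) = cnj (mtrace A)" "cmod (mtrace A) \<le> n"
proof -
  obtain B where B: "B \<in> carrier_mat n n" "upper_triangular B" "similar_mat A B" and sk: "similar_mat (A ^\<^sub>m k) (B ^\<^sub>m k)"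
    and d: "\<And>i. i < n \<Longrightarrow> (B $$ (i, i)) ^ Suc k = 1"
    using finite_order_triangular[OF assms] by metis
  have "mtrace (A ^\<^sub>m k) = mtrace (B ^\<^sub>m k)" by (rule mtrace_similar[OF sk]) (use A in auto)
  also have "\<dots> = (\<Sum>i<n. (B $$ (i, i)) ^ k)"
    using upper_triangular_pow[OF B(1,2), of k] B(1) by (simp add: mtrace_def pow_mat_dim_square)
  also have "\<dots> = (\<Sum>i<n. cnj (B $$ (i, i)))" by (intro sum.cong refl root_of_unity_cnj d) auto
  also have "\<dots> = cnj (mtrace B)" using B(1) by (simp add: mtrace_def)
  finally show "mtrace (A ^\<^sub>m k) = cnj (mtrace A)" using mtrace_similar[OF B(3) A] by simp
  have "cmod (mtrace A) \<le> (\<Sum>i<n. cmod (B $$ (i, i)))"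
    using mtrace_similar[OF B(3) A] B(1) by (simp add: mtrace_def norm_sum)
  also have "\<dots> = (\<Sum>i<n. 1)" using root_of_unity_norm[OF d] by simp
  finally show "cmod (mtrace A) \<le> n" by simp
qed

definition frame_mat :: "nat \<Rightarrow> (nat \<Rightarrow> 'a) \<Rightarrow> (nat \<Rightarrow> 'a \<Rightarrow> complex) \<Rightarrow> ('a \<Rightarrow> 'a) \<Rightarrow> complex mat" where
  "frame_mat n e c f = mat n n (\<lambda>(i, j). c i (f (e j)))"

lemma frame_mat_carrier [simp]: "frame_mat n e c f \<in> carrier_mat n n"
  by (simp add: frame_mat_def)

lemma frame_mat_comp:
  assumes V: "vs V" and F: "frame V {..<n} e c" and f: "f \<in> mhom V V" and g: "g \<in> mhom V V"
  shows "frame_mat n e c (\<lambda>v. f (g v)) = frame_mat n e c f * frame_mat n e c g"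
proof (rule eq_matI)
  note D = frameD[OF F]
  fix i j assume "i < dim_row (frame_mat n e c f * frame_mat n e c g)" "j < dim_col (frame_mat n e c f * frame_mat n e c g)"
  then have ij: "i < n" "j < n" by (auto simp: frame_mat_def)
  have "c i (f (g (e j))) = (\<Sum>k<n. c k (g (e j)) * c i (f (e k)))"
    using mhom_expand[OF F V vs_Cline mhom_comp[OF f D(3)], of i "g (e j)"] ij D mhom_closed[OF g] by simp
  then show "frame_mat n e c (\<lambda>v. f (g v)) $$ (i, j) = (frame_mat n e c f * frame_mat n e c g) $$ (i, j)"
    using ij by (simp add: frame_mat_def scalar_prod_def atLeast0LessThan mult.commute)
qed (auto simp: frame_mat_def)

lemma frame_mat_pow:
  assumes V: "vs V" and F: "frame V {..<n} e c" and f: "f \<in> mhom V V"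
  shows "frame_mat n e c (f ^^ k) = frame_mat n e c f ^\<^sub>m k \<and> f ^^ k \<in> mhom V V"
proof (induction k)
  case 0
  have "frame_mat n e c (\<lambda>x. x) = 1\<^sub>m n" using frameD(4)[OF F] by (intro eq_matI) (auto simp: frame_mat_def)
  then show ?case using mhom_id[of V] by (simp add: id_def frame_mat_def)
next
  case (Suc k)
  then show ?case using frame_mat_comp[OF V F _ f, of "f ^^ k"] mhom_comp[OF f, of "f ^^ k" V]
    by (simp add: funpow_swap1 o_def del: funpow.simps) (simp add: funpow_Suc_right o_def del: funpow.simps)
qed

lemma vtrace_frame_mat:
  assumes "fdvs V" "frame V {..<n} e c" "f \<in> mhom V V"
  shows "vtrace V f = mtrace (frame_mat n e c f)"
  using vtrace_frame[OF assms] by (simp add: mtrace_def frame_mat_def)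

lemma vtrace_finite_order:
  assumes V: "fdvs V" and f: "f \<in> mhom V V" and k: "\<And>v. v \<in> carrier V \<Longrightarrow> (f ^^ Suc k) v = v"
  shows "vtrace V (f ^^ k) = cnj (vtrace V f)"
proof -
  obtain e c and n :: nat where F: "frame V {..<n} e c" using fdvs_frame[OF V] .
  note P = frame_mat_pow[OF fdvs_vs[OF V] F f]
  have "frame_mat n e c f ^\<^sub>m (Suc k) = frame_mat n e c (f ^^ Suc k)" using conjunct1[OF P[of "Suc k"]] by (rule sym)
  also have "\<dots> = 1\<^sub>m n" using frameD[OF F] k by (intro eq_matI) (auto simp: frame_mat_def simp del: funpow.simps)
  finally have "mtrace (frame_mat n e c f ^\<^sub>m k) = cnj (mtrace (frame_mat n e c f))"
    by (intro mtrace_finite_order(1)[of _ n]) auto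
  then show ?thesis using vtrace_frame_mat[OF V F] P f by metis
qed

text \<open>The spectrum of a complex matrix of positive size is nonempty, and the entries of a
  matrix eigenvector are the coordinates of the vector sought. Here algebraic closedness enters
  Schur's lemma.\<close>

lemma eigenvector_exists:
  assumes V: "fdvs V" and ne: "carrier V \<noteq> {\<zero>\<^bsub>V\<^esub>}" and f: "f \<in> mhom V V"
  obtains v a where "v \<in> carrier V" "v \<noteq> \<zero>\<^bsub>V\<^esub>" "f v = a \<odot>\<^bsub>V\<^esub> v"
proof -
  obtain e c and n :: nat where F: "frame V {..<n} e c" using fdvs_frame[OF V] .
  note D = frameD[OF F] and vV = fdvs_vs[OF V]
  have "n > 0"
  proof (rule ccontr)
    assume "\<not> n > 0" then have "\<And>v. v \<in> carrier V \<Longrightarrow> v = \<zero>\<^bsub>V\<^esub>" using D(5) vV by simp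
    then show False using ne vzero_closed[OF vV] by blast
  qed
  from spectrum_non_empty[OF frame_mat_carrier this, of e c f] obtain a x where
    x: "x \<in> carrier_vec n" "x \<noteq> 0\<^sub>v n" "frame_mat n e c f *\<^sub>v x = a \<cdot>\<^sub>v x"
    by (auto simp: spectrum_def eigenvalue_def eigenvector_def frame_mat_def)
  define v where "v = finsum V (\<lambda>i. (x $ i) \<odot>\<^bsub>V\<^esub> e i) {..<n}"
  have v: "v \<in> carrier V" using D vV by (auto simp: v_def)
  have cv: "c i v = x $ i" if "i < n" for i using frame_coeff[OF F vV, of i "\<lambda>i. x $ i"] that by (simp add: v_def)
  have "v \<noteq> \<zero>\<^bsub>V\<^esub>"
  proof
    assume "v = \<zero>\<^bsub>V\<^esub>"
    then have "x $ i = 0" if "i < n" for i using cv[OF that] mhom_zero[OF vV vs_Cline D(3), of i] that by simp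
    then show False using x by (auto intro: eq_vecI)
  qed
  moreover have "f v = a \<odot>\<^bsub>V\<^esub> v"
  proof (rule frame_eqI[OF F _ _ _ vV])
    fix i assume i: "i \<in> {..<n}"
    have "c i (f v) = (\<Sum>k<n. c k v * c i (f (e k)))"
      using mhom_expand[OF F vV vs_Cline mhom_comp[OF f D(3)[OF i]] v] by simp
    also have "\<dots> = (frame_mat n e c f *\<^sub>v x) $ i"
      using i x(1) cv by (auto simp: frame_mat_def scalar_prod_def atLeast0LessThan mult.commute intro!: sum.cong)
    also have "\<dots> = c i (a \<odot>\<^bsub>V\<^esub> v)" using i x cv mhom_smult[OF D(3)[OF i] v] by simp
    finally show "c i (f v) = c i (a \<odot>\<^bsub>V\<^esub> v)" .
  qed (use v vV mhom_closed[OF f] in auto)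
  ultimately show ?thesis using that v by blast
qed

section \<open>Modules over a finite subgroup of the special linear group\<close>

text \<open>The adjugate of a two-by-two matrix. In \<open>SL2\<close> it is the inverse, and its
  trace is visibly that of the matrix, which is why \<open>chi_std\<close> is real.\<close>

definition adj2 :: "complex mat \<Rightarrow> complex mat" where
  "adj2 A = mat 2 2 (\<lambda>(i, j). if i = j then A $$ (1 - i, 1 - i) else - A $$ (i, j))"

lemma det2: "A \<in> carrier_mat 2 2 \<Longrightarrow> det A = A $$ (0, 0) * A $$ (1, 1) - A $$ (0, 1) * A $$ (1, 0)" for A :: "complex mat"
  by (simp add: laplace_expansion_row[of A 2 0] numeral_2_eq_2 cofactor_def det_single mat_delete_def)

lemma adj2_mult:
  assumes "A \<in> carrier_mat 2 2" "det A = 1"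
  shows "adj2 A * A = 1\<^sub>m 2"
proof (rule eq_matI)
  fix i j :: nat assume "i < dim_row (1\<^sub>m 2)" "j < dim_col (1\<^sub>m 2)"
  then have "i = 0 \<or> i = 1" "j = 0 \<or> j = 1" by auto
  then show "(adj2 A * A) $$ (i, j) = 1\<^sub>m 2 $$ (i, j)"
    using assms det2[OF assms(1)] by (auto simp: adj2_def scalar_prod_def numeral_2_eq_2 algebra_simps)
qed (use assms in \<open>auto simp: adj2_def\<close>)

lemma group_SL2: "group SL2"
proof (rule groupI)
  fix A assume A: "A \<in> carrier SL2"
  have c: "adj2 A \<in> carrier_mat 2 2" by (simp add: adj2_def)
  have "det (adj2 A) = 1"
    using A adj2_mult[of A] det_mult[OF c, of A] by (auto simp: SL2_def)
  then show "\<exists>B\<in>carrier SL2. B \<otimes>\<^bsub>SL2\<^esub> A = \<one>\<^bsub>SL2\<^esub>"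
    using A adj2_mult[of A] c by (intro bexI[of _ "adj2 A"]) (auto simp: SL2_def)
qed (auto simp: SL2_def det_mult[of _ 2])

text \<open>\<open>GHom\<close> without extensionality, in the same relation to it as
  \<open>mhom\<close> to \<open>Lin\<close>.\<close>

definition eqv :: "complex mat set \<Rightarrow> 'a gmod \<Rightarrow> 'b gmod \<Rightarrow> ('a \<Rightarrow> 'b) set" where
  "eqv \<Gamma> M N = {f \<in> mhom M N. \<forall>g\<in>\<Gamma>. \<forall>m\<in>carrier M. f (act M g m) = act N g (f m)}"

lemma GHom_iff: "f \<in> GHom \<Gamma> M N \<longleftrightarrow> f \<in> eqv \<Gamma> M N \<and> f \<in> extensional (carrier M)"
  by (auto simp: GHom_def eqv_def Lin_iff)

lemma GHom_eqv: "f \<in> GHom \<Gamma> M N \<Longrightarrow> f \<in> eqv \<Gamma> M N"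
  by (simp add: GHom_iff)

lemma GHom_Lin: "f \<in> GHom \<Gamma> M N \<Longrightarrow> f \<in> Lin M N"
  by (simp add: GHom_def)

lemma eqv_mhom: "f \<in> eqv \<Gamma> M N \<Longrightarrow> f \<in> mhom M N"
  by (simp add: eqv_def)

lemma eqv_act: "f \<in> eqv \<Gamma> M N \<Longrightarrow> g \<in> \<Gamma> \<Longrightarrow> m \<in> carrier M \<Longrightarrow> f (act M g m) = act N g (f m)"
  by (simp add: eqv_def)

lemmas eqv_closed = mhom_closed[OF eqv_mhom]

lemma eqvI: "f \<in> mhom M N \<Longrightarrow> (\<And>g m. g \<in> \<Gamma> \<Longrightarrow> m \<in> carrier M \<Longrightarrow> f (act M g m) = act N g (f m)) \<Longrightarrow> f \<in> eqv \<Gamma> M N"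
  by (simp add: eqv_def)

lemma is_gmodD:
  assumes "is_gmod \<Gamma> M"
  shows "fdvs M" "vs M" "g \<in> \<Gamma> \<Longrightarrow> act M g \<in> mhom M M"
    "g \<in> \<Gamma> \<Longrightarrow> m \<in> carrier M \<Longrightarrow> act M g m \<in> carrier M"
    "m \<in> carrier M \<Longrightarrow> act M (1\<^sub>m 2) m = m"
    "g \<in> \<Gamma> \<Longrightarrow> h \<in> \<Gamma> \<Longrightarrow> m \<in> carrier M \<Longrightarrow> act M (g * h) m = act M g (act M h m)"
  using assms by (auto simp: is_gmod_def intro: mhom_closed)

lemma eqv_id: "(\<lambda>x. x) \<in> eqv \<Gamma> M M"
  by (simp add: eqv_def mhom_id)

lemma eqv_comp: "f \<in> eqv \<Gamma> L M \<Longrightarrow> h \<in> eqv \<Gamma> M N \<Longrightarrow> (\<lambda>x. h (f x)) \<in> eqv \<Gamma> L N"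
  by (auto intro!: eqvI intro: mhom_comp[OF eqv_mhom eqv_mhom] simp: eqv_act eqv_closed)

lemma eqv_cong: "(\<And>v. v \<in> carrier M \<Longrightarrow> f v = h v) \<Longrightarrow> is_gmod \<Gamma> M \<Longrightarrow> f \<in> eqv \<Gamma> M N \<Longrightarrow> h \<in> eqv \<Gamma> M N"
  using mhom_cong[of M f h N] by (auto simp: eqv_def is_gmodD)

lemma restrict_GHom: "is_gmod \<Gamma> M \<Longrightarrow> f \<in> eqv \<Gamma> M N \<Longrightarrow> restrict f (carrier M) \<in> GHom \<Gamma> M N"
  unfolding GHom_iff by (auto intro: eqv_cong[of M f])

lemma eqv_smult: "is_gmod \<Gamma> N \<Longrightarrow> f \<in> eqv \<Gamma> M N \<Longrightarrow> (\<lambda>x. a \<odot>\<^bsub>N\<^esub> f x) \<in> eqv \<Gamma> M N"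
  by (rule eqvI) (auto simp: is_gmodD eqv_act eqv_closed mhom_smult[OF is_gmodD(3)] intro: mhom_const_smult eqv_mhom)

lemma eqv_add: "is_gmod \<Gamma> N \<Longrightarrow> f \<in> eqv \<Gamma> M N \<Longrightarrow> h \<in> eqv \<Gamma> M N \<Longrightarrow> (\<lambda>x. f x \<oplus>\<^bsub>N\<^esub> h x) \<in> eqv \<Gamma> M N"
  by (rule eqvI) (auto simp: is_gmodD eqv_act eqv_closed mhom_add[OF is_gmodD(3)] intro: mhom_plus eqv_mhom)

lemma eqv_zero: "is_gmod \<Gamma> N \<Longrightarrow> (\<lambda>x. \<zero>\<^bsub>N\<^esub>) \<in> eqv \<Gamma> M N"
  by (rule eqvI) (auto simp: is_gmodD mhom_zero[OF _ _ is_gmodD(3)] mhom_const_zero)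

lemma mhom_inverse:
  assumes V: "vs V" and f: "f \<in> mhom V W" and b: "bij_betw f (carrier V) (carrier W)"
  obtains h where "h \<in> mhom W V" "\<And>v. v \<in> carrier V \<Longrightarrow> h (f v) = v" "\<And>w. w \<in> carrier W \<Longrightarrow> f (h w) = w"
proof -
  define h where "h = inv_into (carrier V) f"
  have l: "h (f m) = m" if "m \<in> carrier V" for m using b that by (simp add: h_def bij_betw_def)
  have r: "f (h n) = n" "h n \<in> carrier V" if "n \<in> carrier W" for n
    using b that by (auto simp: h_def bij_betw_def f_inv_into_f inv_into_into)
  have "h \<in> mhom W V"
  proof (rule mhomI)
    fix a b assume ab: "a \<in> carrier W" "b \<in> carrier W"
    have "f (h a \<oplus>\<^bsub>V\<^esub> h b) = a \<oplus>\<^bsub>W\<^esub> b" using ab r by (simp add: mhom_add[OF f])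
    then show "h (a \<oplus>\<^bsub>W\<^esub> b) = h a \<oplus>\<^bsub>V\<^esub> h b" using l[of "h a \<oplus>\<^bsub>V\<^esub> h b"] ab r V by simp
  next
    fix a z assume a: "a \<in> carrier W"
    have "f (z \<odot>\<^bsub>V\<^esub> h a) = z \<odot>\<^bsub>W\<^esub> a" using a r by (simp add: mhom_smult[OF f])
    then show "h (z \<odot>\<^bsub>W\<^esub> a) = z \<odot>\<^bsub>V\<^esub> h a" using l[of "z \<odot>\<^bsub>V\<^esub> h a"] a r V by simp
  qed (use r in auto)
  then show ?thesis using that l r by blast
qed

lemma eqv_inverse:
  assumes "is_gmod \<Gamma> M" "is_gmod \<Gamma> N" "f \<in> eqv \<Gamma> M N" "bij_betw f (carrier M) (carrier N)"
  obtains h where "h \<in> eqv \<Gamma> N M" "\<And>m. m \<in> carrier M \<Longrightarrow> h (f m) = m" "\<And>n. n \<in> carrier N \<Longrightarrow> f (h n) = n"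
proof -
  obtain h where h: "h \<in> mhom N M" and l: "\<And>m. m \<in> carrier M \<Longrightarrow> h (f m) = m" and r: "\<And>n. n \<in> carrier N \<Longrightarrow> f (h n) = n"
    using mhom_inverse[OF is_gmodD(2)[OF assms(1)] eqv_mhom[OF assms(3)] assms(4)] by metis
  have "h (act N g a) = act M g (h a)" if "g \<in> \<Gamma>" "a \<in> carrier N" for g a
    using l[of "act M g (h a)"] eqv_act[OF assms(3) that(1), of "h a"] r mhom_closed[OF h] that is_gmodD(4)[OF assms(1)] by simp
  then show ?thesis using that l r h by (blast intro: eqvI)
qed

definition gsub :: "complex mat set \<Rightarrow> 'a gmod \<Rightarrow> 'a set \<Rightarrow> bool" where
  "gsub \<Gamma> M W \<longleftrightarrow> lin_closed M W \<and> (\<forall>g\<in>\<Gamma>. \<forall>w\<in>W. act M g w \<in> W)"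

lemma gsub_gmod:
  assumes M: "is_gmod \<Gamma> M" and W: "gsub \<Gamma> M W"
  shows "is_gmod \<Gamma> (M\<lparr>carrier := W\<rparr>)" "(\<lambda>w. w) \<in> eqv \<Gamma> (M\<lparr>carrier := W\<rparr>) M"
proof -
  have Wc: "lin_closed M W" and WM: "\<And>w. w \<in> W \<Longrightarrow> w \<in> carrier M" using W by (auto simp: gsub_def lin_closed_def)
  show "is_gmod \<Gamma> (M\<lparr>carrier := W\<rparr>)"
    unfolding is_gmod_def using subspace_retraction(1)[OF is_gmodD(1)[OF M] Wc] W
    by (auto intro!: mhomI simp: gsub_def is_gmodD[OF M] WM mhom_add[OF is_gmodD(3)[OF M]] mhom_smult[OF is_gmodD(3)[OF M]])
  show "(\<lambda>w. w) \<in> eqv \<Gamma> (M\<lparr>carrier := W\<rparr>) M"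
    by (auto intro!: eqvI mhomI simp: WM)
qed

lemma irreducibleD:
  assumes "irreducible_gmod \<Gamma> M"
  shows "is_gmod \<Gamma> M" "carrier M \<noteq> {\<zero>\<^bsub>M\<^esub>}" "gsub \<Gamma> M W \<Longrightarrow> W = {\<zero>\<^bsub>M\<^esub>} \<or> W = carrier M"
  using assms lin_closed_subspace[of M W] unfolding irreducible_gmod_def gsub_def
  by (auto simp: is_gmodD image_subset_iff)

lemma irreducibleI:
  assumes "is_gmod \<Gamma> M" "carrier M \<noteq> {\<zero>\<^bsub>M\<^esub>}" "\<And>W. gsub \<Gamma> M W \<Longrightarrow> W = {\<zero>\<^bsub>M\<^esub>} \<or> W = carrier M"
  shows "irreducible_gmod \<Gamma> M"
  using assms subspace_lin_closed unfolding irreducible_gmod_def gsub_def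
  by (auto simp: image_subset_iff)

lemma irreducible_nonzero:
  assumes "irreducible_gmod \<Gamma> M"
  obtains w where "w \<in> carrier M" "w \<noteq> \<zero>\<^bsub>M\<^esub>"
  using irreducibleD(1,2)[OF assms] vzero_closed[OF is_gmodD(2)] by blast

lemma kernel_gsub:
  assumes "is_gmod \<Gamma> M" "is_gmod \<Gamma> N" "f \<in> eqv \<Gamma> M N"
  shows "gsub \<Gamma> M {m \<in> carrier M. f m = \<zero>\<^bsub>N\<^esub>}"
  unfolding gsub_def lin_closed_def
  using is_gmodD[OF assms(1)] is_gmodD[OF assms(2)]
  by (auto simp: mhom_zero[OF _ _ eqv_mhom[OF assms(3)]] mhom_add[OF eqv_mhom[OF assms(3)]] mhom_smult[OF eqv_mhom[OF assms(3)]]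
     eqv_act[OF assms(3)] mhom_zero[OF _ _ is_gmodD(3)[OF assms(2)]])

lemma image_gsub:
  assumes "is_gmod \<Gamma> M" "is_gmod \<Gamma> N" "f \<in> eqv \<Gamma> M N"
  shows "gsub \<Gamma> N (f ` carrier M)"
  unfolding gsub_def lin_closed_def
proof (intro conjI ballI allI)
  note M = is_gmodD[OF assms(1)] and N = is_gmodD[OF assms(2)] and f = eqv_mhom[OF assms(3)]
  show "f ` carrier M \<subseteq> carrier N" using eqv_closed[OF assms(3)] by auto
  show "\<zero>\<^bsub>N\<^esub> \<in> f ` carrier M" using mhom_zero[OF M(2) N(2) f] vzero_closed[OF M(2)] by (metis imageI)
  show "v \<oplus>\<^bsub>N\<^esub> w \<in> f ` carrier M" if "v \<in> f ` carrier M" "w \<in> f ` carrier M" for v w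
    using that M(2) by (auto simp: mhom_add[OF f, symmetric] intro!: imageI)
  show "a \<odot>\<^bsub>N\<^esub> v \<in> f ` carrier M" if "v \<in> f ` carrier M" for a v
    using that M(2) by (auto simp: mhom_smult[OF f, symmetric] intro!: imageI)
  show "act N g w \<in> f ` carrier M" if "g \<in> \<Gamma>" "w \<in> f ` carrier M" for g w
    using that M(4) by (auto simp: eqv_act[OF assms(3), symmetric] intro!: imageI)
qed

section \<open>Schur's lemma\<close>

text \<open>The vector \<open>m\<close> shows that the kernel is not everything and that the image
  is not zero, so irreducibility leaves only the zero kernel and the full image.\<close>

lemma Schur_bij:
  assumes M: "irreducible_gmod \<Gamma> M" and N: "irreducible_gmod \<Gamma> N" and f: "f \<in> eqv \<Gamma> M N"
    and "m \<in> carrier M" "f m \<noteq> \<zero>\<^bsub>N\<^esub>"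
  shows "bij_betw f (carrier M) (carrier N)"
proof -
  note m = irreducibleD[OF M] and n = irreducibleD[OF N]
  have z: "f \<zero>\<^bsub>M\<^esub> = \<zero>\<^bsub>N\<^esub>" by (rule mhom_zero[OF is_gmodD(2)[OF m(1)] is_gmodD(2)[OF n(1)] eqv_mhom[OF f]])
  have ker: "{x \<in> carrier M. f x = \<zero>\<^bsub>N\<^esub>} = {\<zero>\<^bsub>M\<^esub>}" using m(3)[OF kernel_gsub[OF m(1) n(1) f]] assms(4,5) by blast
  have im: "f ` carrier M = carrier N" using n(3)[OF image_gsub[OF m(1) n(1) f]] assms(4,5) by blast
  have "inj_on f (carrier M)"
  proof (rule inj_onI)
    fix x y assume xy: "x \<in> carrier M" "y \<in> carrier M" "f x = f y"
    note v = is_gmodD(2)[OF m(1)]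
    have "f (x \<oplus>\<^bsub>M\<^esub> (-1) \<odot>\<^bsub>M\<^esub> y) = f y \<oplus>\<^bsub>N\<^esub> (-1) \<odot>\<^bsub>N\<^esub> f y"
      using xy v by (simp add: mhom_add[OF eqv_mhom[OF f]] mhom_smult[OF eqv_mhom[OF f]])
    also have "\<dots> = \<zero>\<^bsub>N\<^esub>" by (rule vneg[OF is_gmodD(2)[OF n(1)] eqv_closed[OF f xy(2)]])
    finally have "x \<oplus>\<^bsub>M\<^esub> (-1) \<odot>\<^bsub>M\<^esub> y \<in> {x \<in> carrier M. f x = \<zero>\<^bsub>N\<^esub>}" using xy v by simp
    then show "x = y" unfolding ker using vsub_eq_zero[OF v xy(1,2)] by simp
  qed
  then show ?thesis using im by (simp add: bij_betw_def)
qed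

text \<open>The difference of \<open>f\<close> and an eigenvalue kills an eigenvector, so it is not
  injective and must vanish by \<open>Schur_bij\<close>.\<close>

lemma Schur_scalar:
  assumes M: "irreducible_gmod \<Gamma> M" and f: "f \<in> eqv \<Gamma> M M"
  shows "\<exists>a. \<forall>v\<in>carrier M. f v = a \<odot>\<^bsub>M\<^esub> v"
proof -
  note m = irreducibleD[OF M] note g = is_gmodD[OF m(1)]
  obtain v a where v: "v \<in> carrier M" "v \<noteq> \<zero>\<^bsub>M\<^esub>" "f v = a \<odot>\<^bsub>M\<^esub> v"
    using eigenvector_exists[OF g(1) m(2) eqv_mhom[OF f]] by blast
  define h where "h = (\<lambda>x. f x \<oplus>\<^bsub>M\<^esub> (-1) \<odot>\<^bsub>M\<^esub> (a \<odot>\<^bsub>M\<^esub> x))"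
  have h: "h \<in> eqv \<Gamma> M M" unfolding h_def by (intro eqv_add eqv_smult eqv_id f m)
  have hv: "h v = \<zero>\<^bsub>M\<^esub>" unfolding h_def v(3) by (rule vneg) (use g v in auto)
  have "h x = \<zero>\<^bsub>M\<^esub>" if "x \<in> carrier M" for x
  proof (rule ccontr)
    assume "h x \<noteq> \<zero>\<^bsub>M\<^esub>"
    from Schur_bij[OF M M h that this] have "inj_on h (carrier M)" by (simp add: bij_betw_def)
    moreover have "h \<zero>\<^bsub>M\<^esub> = \<zero>\<^bsub>M\<^esub>" by (rule mhom_zero[OF g(2) g(2) eqv_mhom[OF h]])
    ultimately show False using hv v g(2) by (metis inj_onD vzero_closed)
  qed
  then show ?thesis
    using vsub_eq_zero[OF g(2) eqv_closed[OF f]] g(2) unfolding h_def by (intro exI[of _ a]) (auto simp del: vsmult_smult)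
qed

locale finite_SL2 =
  fixes \<Gamma> :: "complex mat set"
  assumes subgroup: "subgroup \<Gamma> SL2" and fin [simp]: "finite \<Gamma>"
begin

definition ginv :: "complex mat \<Rightarrow> complex mat" where
  "ginv g = inv\<^bsub>SL2\<^esub> g"

lemma mat_closed: "g \<in> \<Gamma> \<Longrightarrow> g \<in> carrier_mat 2 2" "g \<in> \<Gamma> \<Longrightarrow> det g = 1"
  using subgroup.subset[OF subgroup] by (auto simp: SL2_def)

lemma SL2_simps: "\<one>\<^bsub>SL2\<^esub> = 1\<^sub>m 2" "g \<otimes>\<^bsub>SL2\<^esub> h = g * h"
  by (simp_all add: SL2_def)

lemma one_mem [simp]: "1\<^sub>m 2 \<in> \<Gamma>"
  using subgroup.one_closed[OF subgroup] by (simp add: SL2_simps)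

lemma mult_mem [simp]: "g \<in> \<Gamma> \<Longrightarrow> h \<in> \<Gamma> \<Longrightarrow> g * h \<in> \<Gamma>"
  using subgroup.m_closed[OF subgroup] by (simp add: SL2_simps)

lemma ginv_mem [simp]: "g \<in> \<Gamma> \<Longrightarrow> ginv g \<in> \<Gamma>"
  unfolding ginv_def by (rule subgroup.m_inv_closed[OF subgroup])

lemma ginv_mult [simp]: "g \<in> \<Gamma> \<Longrightarrow> ginv g * g = 1\<^sub>m 2" "g \<in> \<Gamma> \<Longrightarrow> g * ginv g = 1\<^sub>m 2"
  using group.l_inv[OF group_SL2 subgroup.mem_carrier[OF subgroup]] group.r_inv[OF group_SL2 subgroup.mem_carrier[OF subgroup]]
  by (simp_all add: ginv_def SL2_simps)

lemma mult_assoc: "g \<in> \<Gamma> \<Longrightarrow> h \<in> \<Gamma> \<Longrightarrow> k \<in> \<Gamma> \<Longrightarrow> g * h * k = g * (h * k)"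
  using assoc_mult_mat[of g 2 2 h 2 k 2] mat_closed by blast

lemma one_mult [simp]: "g \<in> \<Gamma> \<Longrightarrow> 1\<^sub>m 2 * g = g" "g \<in> \<Gamma> \<Longrightarrow> g * 1\<^sub>m 2 = g"
  using mat_closed(1)[of g] by simp_all

lemma ginv_cancel [simp]: "g \<in> \<Gamma> \<Longrightarrow> h \<in> \<Gamma> \<Longrightarrow> ginv h * (h * g) = g" "g \<in> \<Gamma> \<Longrightarrow> h \<in> \<Gamma> \<Longrightarrow> h * (ginv h * g) = g"
  by (simp_all flip: mult_assoc)

lemma ginv_unique: "g \<in> \<Gamma> \<Longrightarrow> h \<in> \<Gamma> \<Longrightarrow> g * h = 1\<^sub>m 2 \<Longrightarrow> ginv g = h"
  using ginv_cancel(1)[of h g] by simp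

lemma bij_mult: "h \<in> \<Gamma> \<Longrightarrow> bij_betw (\<lambda>g. h * g) \<Gamma> \<Gamma>"
  by (rule bij_betw_byWitness[where f' = "\<lambda>g. ginv h * g"]) auto

lemma ginv_mult_distrib: "g \<in> \<Gamma> \<Longrightarrow> h \<in> \<Gamma> \<Longrightarrow> ginv (h * g) = ginv g * ginv h"
  by (rule ginv_unique) (auto simp: mult_assoc)

lemma nonempty [simp]: "\<Gamma> \<noteq> {}"
  using one_mem by blast

lemma card_pos [simp]: "card \<Gamma> > 0"
  by (simp add: card_gt_0_iff)

text \<open>By finiteness two powers of \<open>g\<close> coincide. An inverse that is a power is
  what \<open>vtrace_finite_order\<close> can handle.\<close>

lemma ginv_power: "g \<in> \<Gamma> \<Longrightarrow> \<exists>k. g ^\<^sub>m (Suc k) = 1\<^sub>m 2 \<and> ginv g = g ^\<^sub>m k"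
proof -
  assume g: "g \<in> \<Gamma>"
  have p: "g ^\<^sub>m k \<in> \<Gamma>" for k using g mat_closed(1)[OF g] by (induction k) auto
  have add: "g ^\<^sub>m (k + l) = g ^\<^sub>m k * g ^\<^sub>m l" for k l
    by (induction l) (use p g mat_closed(1)[OF g] in \<open>auto simp: mult_assoc\<close>)
  have "\<not> inj_on (\<lambda>k. g ^\<^sub>m k) UNIV"
  proof
    assume "inj_on (\<lambda>k. g ^\<^sub>m k) UNIV"
    then have "finite (UNIV :: nat set)" by (rule inj_on_finite[OF _ _ fin]) (use p in auto)
    then show False by simp
  qed
  then obtain k l where "g ^\<^sub>m k = g ^\<^sub>m l" "k < l" unfolding inj_on_def by (metis linorder_neqE_nat)
  then have "g ^\<^sub>m k = g ^\<^sub>m k * g ^\<^sub>m (l - k)" using add[of k "l - k"] by simp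
  then have "ginv (g ^\<^sub>m k) * (g ^\<^sub>m k * 1\<^sub>m 2) = ginv (g ^\<^sub>m k) * (g ^\<^sub>m k * g ^\<^sub>m (l - k))" using p by simp
  then have 1: "g ^\<^sub>m (l - k) = 1\<^sub>m 2" using p by simp
  obtain j where j: "l - k = Suc j" using \<open>k < l\<close> by (metis Suc_diff_Suc)
  have "g * g ^\<^sub>m j = g ^\<^sub>m (1 + j)" using add[of 1 j] g mat_closed(1)[OF g] by simp
  then have "ginv g = g ^\<^sub>m j" by (intro ginv_unique g p) (use 1 j in simp)
  then show ?thesis using 1 j by auto
qed

section \<open>Averaging, complete reducibility and orthogonality of characters\<close>

lemma act_ginv:
  assumes "is_gmod \<Gamma> M" "g \<in> \<Gamma>" "m \<in> carrier M"
  shows "act M (ginv g) (act M g m) = m" "act M g (act M (ginv g) m) = m"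
  using is_gmodD(6)[OF assms(1) ginv_mem[OF assms(2)] assms(2,3)] is_gmodD(6)[OF assms(1) assms(2) ginv_mem[OF assms(2)] assms(3)]
    is_gmodD(5)[OF assms(1,3)] assms(2) by simp_all

text \<open>The mean of the conjugates of \<open>T\<close> under the group, which is the projection
  of the space of linear maps onto the equivariant ones.\<close>

definition avg :: "'b gmod \<Rightarrow> 'a gmod \<Rightarrow> ('b \<Rightarrow> 'a) \<Rightarrow> 'b \<Rightarrow> 'a" where
  "avg N M T v = (1 / of_nat (card \<Gamma>)) \<odot>\<^bsub>M\<^esub> finsum M (\<lambda>g. act M g (T (act N (ginv g) v))) \<Gamma>"

lemma conj_mhom:
  assumes "is_gmod \<Gamma> N" "is_gmod \<Gamma> M" "T \<in> mhom N M" "g \<in> \<Gamma>"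
  shows "(\<lambda>v. act M g (T (act N (ginv g) v))) \<in> mhom N M"
  by (intro mhom_comp[OF mhom_comp[OF is_gmodD(3)[OF assms(1)] assms(3)] is_gmodD(3)[OF assms(2)]] assms ginv_mem)

text \<open>Acting by \<open>h\<close> only permutes the summands, through the substitution of
  \<open>h * g\<close> for \<open>g\<close>.\<close>

lemma avg_eqv:
  assumes N: "is_gmod \<Gamma> N" and M: "is_gmod \<Gamma> M" and T: "T \<in> mhom N M"
  shows "avg N M T \<in> eqv \<Gamma> N M"
proof (rule eqvI)
  note n = is_gmodD[OF N] and m = is_gmodD[OF M]
  show "avg N M T \<in> mhom N M"
    unfolding avg_def by (intro mhom_const_smult mhom_sum m fin conj_mhom N M T)
  fix h v assume h: "h \<in> \<Gamma>" and v: "v \<in> carrier N"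
  let ?F = "\<lambda>v g. act M g (T (act N (ginv g) v))"
  have c: "?F v g \<in> carrier M" if "g \<in> \<Gamma>" "v \<in> carrier N" for g v using that mhom_closed[OF conj_mhom[OF N M T]] by blast
  have "finsum M (?F (act N h v)) \<Gamma> = finsum M (?F (act N h v)) ((\<lambda>g. h * g) ` \<Gamma>)"
    using bij_mult[OF h] by (simp add: bij_betw_def)
  also have "\<dots> = finsum M (\<lambda>g. ?F (act N h v) (h * g)) \<Gamma>"
    by (rule vfinsum_reindex[OF m(2)]) (use bij_mult[OF h] c n h v in \<open>auto simp: bij_betw_def\<close>)
  also have "\<dots> = finsum M (\<lambda>g. act M h (?F v g)) \<Gamma>"
  proof (rule vfinsum_cong[OF m(2) refl])
    fix g assume g: "g \<in> \<Gamma>"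
    have "act N (ginv (h * g)) (act N h v) = act N (ginv g) (act N (ginv h) (act N h v))"
      using g h v n by (simp add: ginv_mult_distrib)
    also have "\<dots> = act N (ginv g) v" using act_ginv(1)[OF N h v] by simp
    finally show "?F (act N h v) (h * g) = act M h (?F v g)" 
      using g h v n m mhom_closed[OF T] by simp
    show "act M h (?F v g) \<in> carrier M" using g h v c m by simp
  qed
  also have "\<dots> = act M h (finsum M (?F v) \<Gamma>)"
    by (rule mhom_finsum[OF m(2) m(2) m(3)[OF h] fin, symmetric]) (use c v in auto)
  finally show "avg N M T (act N h v) = act M h (avg N M T v)"
    unfolding avg_def using c v m h by (simp add: mhom_smult[OF m(3)[OF h]] Pi_iff)
qed

text \<open>By cyclicity every conjugate of \<open>T\<close> has the trace of \<open>T\<close>. The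
  scalar in \<open>char_inner_self\<close> is read off from this.\<close>

lemma vtrace_avg:
  assumes M: "is_gmod \<Gamma> M" and T: "T \<in> mhom M M"
  shows "vtrace M (avg M M T) = vtrace M T"
proof -
  note m = is_gmodD[OF M]
  let ?F = "\<lambda>g v. act M g (T (act M (ginv g) v))"
  have F: "?F g \<in> mhom M M" if "g \<in> \<Gamma>" for g by (rule conj_mhom[OF M M T that])
  have tr: "vtrace M (?F g) = vtrace M T" if g: "g \<in> \<Gamma>" for g
  proof -
    have "vtrace M (?F g) = vtrace M (\<lambda>v. T (act M (ginv g) (act M g v)))"
      using vtrace_cyclic[OF m(1) m(1) mhom_comp[OF m(3)[OF ginv_mem[OF g]] T] m(3)[OF g]] by simp
    also have "\<dots> = vtrace M T"
      by (rule vtrace_cong[OF m(1) mhom_comp[OF m(3)[OF g] mhom_comp[OF m(3)[OF ginv_mem[OF g]] T]]]) (use act_ginv(1)[OF M g] in simp)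
    finally show ?thesis .
  qed
  have "vtrace M (avg M M T) = (1 / of_nat (card \<Gamma>)) * vtrace M (\<lambda>v. finsum M (\<lambda>g. ?F g v) \<Gamma>)"
    unfolding avg_def by (rule vtrace_smult[OF m(1) mhom_sum[OF m(2) fin F]])
  also have "vtrace M (\<lambda>v. finsum M (\<lambda>g. ?F g v) \<Gamma>) = (\<Sum>g\<in>\<Gamma>. vtrace M T)"
    using vtrace_finsum[OF m(1) fin F] tr by simp
  finally show ?thesis by simp
qed

text \<open>The average of a linear projection onto \<open>W\<close> has its values in
  \<open>W\<close>, because \<open>W\<close> is stable, and still fixes \<open>W\<close>, because
  every conjugate does.\<close>

lemma Maschke:
  assumes M: "is_gmod \<Gamma> M" and W: "gsub \<Gamma> M W"
  obtains P where "P \<in> eqv \<Gamma> M M" "\<And>v. v \<in> carrier M \<Longrightarrow> P v \<in> W" "\<And>w. w \<in> W \<Longrightarrow> P w = w"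
proof -
  note m = is_gmodD[OF M]
  have Wc: "lin_closed M W" and Wi: "\<And>g w. g \<in> \<Gamma> \<Longrightarrow> w \<in> W \<Longrightarrow> act M g w \<in> W"
    and WM: "\<And>w. w \<in> W \<Longrightarrow> w \<in> carrier M" using W by (auto simp: gsub_def lin_closed_def)
  obtain p where p: "p \<in> mhom M M" "p ` carrier M \<subseteq> W" "\<forall>w\<in>W. p w = w"
    using subspace_retraction(2)[OF m(1) Wc] by blast
  let ?P = "avg M M p"
  have "?P v \<in> W" if v: "v \<in> carrier M" for v
  proof -
    have "finsum M (\<lambda>g. act M g (p (act M (ginv g) v))) \<Gamma> \<in> W"
      by (rule lin_closed_finsum[OF m(2) Wc fin]) (use p(2) Wi m v in \<open>auto simp: image_subset_iff\<close>)
    then show ?thesis unfolding avg_def using Wc by (simp add: lin_closed_def)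
  qed
  moreover have "?P w = w" if w: "w \<in> W" for w
  proof -
    have "finsum M (\<lambda>g. act M g (p (act M (ginv g) w))) \<Gamma> = finsum M (\<lambda>g. 1 \<odot>\<^bsub>M\<^esub> w) \<Gamma>"
      by (rule vfinsum_cong[OF m(2) refl]) (use w p(3) Wi WM m act_ginv(2)[OF M] in auto)
    also have "\<dots> = of_nat (card \<Gamma>) \<odot>\<^bsub>M\<^esub> w" using vfinsum_smult_left[OF m(2) fin WM[OF w], of "\<lambda>_. 1"] by simp
    finally show ?thesis unfolding avg_def using WM[OF w] m by simp
  qed
  ultimately show ?thesis using that avg_eqv[OF M M p(1)] by blast
qed

text \<open>The inverse of \<open>g\<close> is a power of \<open>g\<close> and acts by the
  corresponding power of the action, so \<open>vtrace_finite_order\<close> applies. The conjugate in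
  \<open>char_inner\<close> can then be replaced by an inverse.\<close>

lemma character_ginv:
  assumes M: "is_gmod \<Gamma> M" and g: "g \<in> \<Gamma>"
  shows "character \<Gamma> M (ginv g) = cnj (character \<Gamma> M g)"
proof -
  note m = is_gmodD[OF M]
  obtain k where k: "g ^\<^sub>m (Suc k) = 1\<^sub>m 2" "ginv g = g ^\<^sub>m k" using ginv_power[OF g] by blast
  have p: "g ^\<^sub>m k \<in> \<Gamma>" for k using g mat_closed(1)[OF g] by (induction k) auto
  have pow: "(act M g ^^ j) v = act M (g ^\<^sub>m j) v" if "v \<in> carrier M" for j v
    using that
  proof (induction j arbitrary: v)
    case (Suc j)
    then show ?case using g p m by (simp add: funpow_Suc_right del: funpow.simps)
  qed (use m mat_closed(1)[OF g] in auto)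
  have pm: "act M g ^^ j \<in> mhom M M" for j 
    by (rule mhom_cong[OF pow[symmetric] m(2) m(3)[OF p]])
  have "vtrace M (act M (ginv g)) = vtrace M (act M g ^^ k)"
    by (rule vtrace_cong[OF m(1) pm, symmetric]) (use pow k in simp)
  also have "\<dots> = cnj (vtrace M (act M g))"
    by (rule vtrace_finite_order[OF m(1) m(3)[OF g]]) (use pow k m(5) in \<open>simp del: funpow.simps pow_mat.simps\<close>)
  finally show ?thesis using g by (simp add: character_def)
qed

lemma character_iso:
  assumes M: "is_gmod \<Gamma> M" and N: "is_gmod \<Gamma> N" and f: "f \<in> eqv \<Gamma> M N" and h: "h \<in> mhom N M"
    and hf: "\<And>m. m \<in> carrier M \<Longrightarrow> h (f m) = m" and fh: "\<And>n. n \<in> carrier N \<Longrightarrow> f (h n) = n"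
  shows "character \<Gamma> M = character \<Gamma> N"
proof -
  note m = is_gmodD[OF M] and n = is_gmodD[OF N]
  have "vtrace M (act M g) = vtrace N (act N g)" if g: "g \<in> \<Gamma>" for g
  proof -
    have "vtrace M (act M g) = vtrace M (\<lambda>v. h (f (act M g v)))"
      by (rule vtrace_cong[OF m(1) m(3)[OF g]]) (use hf m g in simp)
    also have "\<dots> = vtrace N (\<lambda>v. f (act M g (h v)))"
      by (rule vtrace_cyclic[OF m(1) n(1) mhom_comp[OF m(3)[OF g] eqv_mhom[OF f]] h])
    also have "\<dots> = vtrace N (act N g)"
      by (rule vtrace_cong[OF n(1) mhom_comp[OF h mhom_comp[OF m(3)[OF g] eqv_mhom[OF f]]]])
         (use g fh mhom_closed[OF h] in \<open>simp add: eqv_act[OF f]\<close>)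
    finally show ?thesis .
  qed
  then show ?thesis unfolding character_def by (auto simp: restrict_def)
qed

text \<open>With an inverse in place of the conjugate, the inner product is a sum of products of
  matrix coefficients. Summing over the group before the indices turns each product into a
  coefficient of the average of a rank-one map from \<open>N\<close> to \<open>M\<close>, so
  orthogonality is reduced to knowledge of the equivariant maps.\<close>

lemma char_inner_avg:
  assumes M: "is_gmod \<Gamma> M" and N: "is_gmod \<Gamma> N" and FM: "frame M I e c" and FN: "frame N J e' d"
  shows "char_inner \<Gamma> (character \<Gamma> M) (character \<Gamma> N) = (\<Sum>i\<in>I. \<Sum>k\<in>J. c i (avg N M (\<lambda>v. d k v \<odot>\<^bsub>M\<^esub> e i) (e' k)))"
proof -
  note m = is_gmodD[OF M] and n = is_gmodD[OF N] and DM = frameD[OF FM] and DN = frameD[OF FN]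
  have 1: "c i (avg N M (\<lambda>v. d k v \<odot>\<^bsub>M\<^esub> e i) (e' k)) = (\<Sum>g\<in>\<Gamma>. c i (act M g (e i)) * d k (act N (ginv g) (e' k))) / of_nat (card \<Gamma>)"
    if i: "i \<in> I" and k: "k \<in> J" for i k
  proof -
    have cl: "(\<lambda>g. act M g (d k (act N (ginv g) (e' k)) \<odot>\<^bsub>M\<^esub> e i)) \<in> \<Gamma> \<rightarrow> carrier M" using m DM i by auto
    have "c i (avg N M (\<lambda>v. d k v \<odot>\<^bsub>M\<^esub> e i) (e' k)) =
       (1 / of_nat (card \<Gamma>)) * (\<Sum>g\<in>\<Gamma>. c i (act M g (d k (act N (ginv g) (e' k)) \<odot>\<^bsub>M\<^esub> e i)))"
      unfolding avg_def using cl mhom_smult[OF DM(3)[OF i] vfinsum_closed[OF m(2) cl]]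
        mhom_finsum[OF m(2) vs_Cline DM(3)[OF i] fin cl] by simp
    also have "(\<Sum>g\<in>\<Gamma>. c i (act M g (d k (act N (ginv g) (e' k)) \<odot>\<^bsub>M\<^esub> e i))) = 
        (\<Sum>g\<in>\<Gamma>. c i (act M g (e i)) * d k (act N (ginv g) (e' k)))"
      using i DM m by (intro sum.cong refl) (simp add: mhom_smult[OF m(3)] mhom_smult[OF DM(3)[OF i]])
    finally show ?thesis by simp
  qed
  have "char_inner \<Gamma> (character \<Gamma> M) (character \<Gamma> N) = (\<Sum>g\<in>\<Gamma>. character \<Gamma> M g * character \<Gamma> N (ginv g)) / of_nat (card \<Gamma>)"
    unfolding char_inner_def using character_ginv[OF N] by simp
  also have "(\<Sum>g\<in>\<Gamma>. character \<Gamma> M g * character \<Gamma> N (ginv g)) = 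
      (\<Sum>g\<in>\<Gamma>. \<Sum>i\<in>I. \<Sum>k\<in>J. c i (act M g (e i)) * d k (act N (ginv g) (e' k)))"
    by (intro sum.cong refl) (simp add: character_def vtrace_frame[OF m(1) FM m(3)] vtrace_frame[OF n(1) FN n(3)] sum_product)
  also have "\<dots> = (\<Sum>i\<in>I. \<Sum>k\<in>J. \<Sum>g\<in>\<Gamma>. c i (act M g (e i)) * d k (act N (ginv g) (e' k)))"
    by (subst sum.swap) (intro sum.cong refl sum.swap)
  finally show ?thesis using 1 by (simp add: sum_divide_distrib)
qed

text \<open>All averages in \<open>char_inner_avg\<close> are equivariant and hence zero.\<close>

lemma char_inner_zero:
  assumes M: "is_gmod \<Gamma> M" and N: "is_gmod \<Gamma> N"
    and z: "\<And>f v. f \<in> eqv \<Gamma> N M \<Longrightarrow> v \<in> carrier N \<Longrightarrow> f v = \<zero>\<^bsub>M\<^esub>"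
  shows "char_inner \<Gamma> (character \<Gamma> M) (character \<Gamma> N) = 0"
proof -
  note m = is_gmodD[OF M] and n = is_gmodD[OF N]
  obtain e c and k :: nat where F: "frame M {..<k} e c" using fdvs_frame[OF m(1)] .
  obtain e' c' and k' :: nat where F': "frame N {..<k'} e' c'" using fdvs_frame[OF n(1)] .
  note D = frameD[OF F] and D' = frameD[OF F']
  show ?thesis unfolding char_inner_avg[OF M N F F']
  proof (intro sum.neutral ballI)
    fix i j assume ij: "i \<in> {..<k}" "j \<in> {..<k'}"
    have "avg N M (\<lambda>v. c' j v \<odot>\<^bsub>M\<^esub> e i) (e' j) = \<zero>\<^bsub>M\<^esub>"
      by (intro z avg_eqv N M mhom_scale m) (use ij D D' in auto)
    then show "c i (avg N M (\<lambda>v. c' j v \<odot>\<^bsub>M\<^esub> e i) (e' j)) = 0" using mhom_zero[OF m(2) vs_Cline D(3)[OF ij(1)]] by simp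
  qed
qed

lemma irreducible_dim_pos: "irreducible_gmod \<Gamma> M \<Longrightarrow> vectorspace.dim Cf M > 0"
  by (rule dim_pos[OF is_gmodD(1)[OF irreducibleD(1)] irreducibleD(2)])

text \<open>By Schur's lemma the average of the rank-one map with indices \<open>i\<close> and
  \<open>k\<close> is a scalar. Averaging preserves the trace, so the scalar is \<open>1 / n\<close>
  for \<open>i = k\<close> and 0 otherwise, and the \<open>n\<close> diagonal terms add up to
  1.\<close>

lemma char_inner_self:
  assumes I: "irreducible_gmod \<Gamma> M"
  shows "char_inner \<Gamma> (character \<Gamma> M) (character \<Gamma> M) = 1"
proof -
  note M = irreducibleD(1)[OF I] note m = is_gmodD[OF M]
  obtain e c and n :: nat where F: "frame M {..<n} e c" using fdvs_frame[OF m(1)] .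
  note D = frameD[OF F]
  have n: "n > 0" using irreducible_dim_pos[OF I] dim_frame[OF m(2) F] by simp
  have 1: "c i (avg M M (\<lambda>v. c k v \<odot>\<^bsub>M\<^esub> e i) (e k)) = (if i = k then 1 / of_nat n else 0)"
    if i: "i \<in> {..<n}" and k: "k \<in> {..<n}" for i k
  proof -
    let ?T = "\<lambda>v. c k v \<odot>\<^bsub>M\<^esub> e i"
    have T: "?T \<in> mhom M M" by (intro mhom_scale m D i k)
    obtain a where a: "\<forall>v\<in>carrier M. avg M M ?T v = a \<odot>\<^bsub>M\<^esub> v" using Schur_scalar[OF I avg_eqv[OF M M T]] by blast
    have "vtrace M (avg M M ?T) = vtrace M (\<lambda>v. a \<odot>\<^bsub>M\<^esub> v)"
      by (rule vtrace_cong[OF m(1) eqv_mhom[OF avg_eqv[OF M M T]]]) (use a in auto)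
    also have "\<dots> = a * of_nat n" using vtrace_smult[OF m(1) mhom_id] vtrace_id[OF m(1)] dim_frame[OF m(2) F] by simp
    finally have "a * of_nat n = vtrace M ?T" using vtrace_avg[OF M T] by simp
    also have "\<dots> = (\<Sum>j<n. if k = j then (if i = k then 1 else 0) else 0)"
      unfolding vtrace_frame[OF m(1) F T] using D i k by (intro sum.cong refl) (auto simp: mhom_smult[OF D(3)])
    also have "\<dots> = (if i = k then 1 else 0)" using k by simp
    finally have "a = (if i = k then 1 / of_nat n else 0)" using n by (auto simp: field_simps)
    then show ?thesis using a D i k by (simp add: mhom_smult[OF D(3)])
  qed
  show ?thesis unfolding char_inner_avg[OF M M F F] using 1 n by simp
qed

text \<open>If every equivariant map were zero, \<open>char_inner_zero\<close> would give 0 where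
  \<open>char_inner_self\<close> gives 1. Characters may therefore serve as names of isomorphism
  classes.\<close>

lemma irreducible_same_character:
  assumes M: "irreducible_gmod \<Gamma> M" and N: "irreducible_gmod \<Gamma> N" and e: "character \<Gamma> M = character \<Gamma> N"
  obtains f h where "f \<in> eqv \<Gamma> M N" "h \<in> eqv \<Gamma> N M" "\<And>m. m \<in> carrier M \<Longrightarrow> h (f m) = m" "\<And>n. n \<in> carrier N \<Longrightarrow> f (h n) = n"
proof -
  note m = irreducibleD(1)[OF M] and n = irreducibleD(1)[OF N]
  have "char_inner \<Gamma> (character \<Gamma> N) (character \<Gamma> M) = 1" using char_inner_self[OF M] e by simp
  then obtain f v where f: "f \<in> eqv \<Gamma> M N" "v \<in> carrier M" "f v \<noteq> \<zero>\<^bsub>N\<^esub>"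
    using char_inner_zero[OF n m] by fastforce
  from eqv_inverse[OF m n f(1) Schur_bij[OF M N f]] that f(1) show ?thesis by metis
qed

text \<open>A nonzero map would be an isomorphism, and isomorphic modules have the same
  character.\<close>

lemma Schur_zero:
  assumes M: "irreducible_gmod \<Gamma> M" and N: "irreducible_gmod \<Gamma> N" and ne: "character \<Gamma> M \<noteq> character \<Gamma> N"
    and f: "f \<in> eqv \<Gamma> M N" and v: "v \<in> carrier M"
  shows "f v = \<zero>\<^bsub>N\<^esub>"
proof (rule ccontr)
  note m = irreducibleD(1)[OF M] and n = irreducibleD(1)[OF N]
  assume "f v \<noteq> \<zero>\<^bsub>N\<^esub>"
  from eqv_inverse[OF m n f Schur_bij[OF M N f v this]] 
  obtain h where "h \<in> eqv \<Gamma> N M" "\<And>m. m \<in> carrier M \<Longrightarrow> h (f m) = m" "\<And>n. n \<in> carrier N \<Longrightarrow> f (h n) = n" by metis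
  from character_iso[OF m n f eqv_mhom[OF this(1)] this(2,3)] ne show False by simp
qed

lemma char_inner_distinct:
  assumes "irreducible_gmod \<Gamma> M" "irreducible_gmod \<Gamma> N" "character \<Gamma> M \<noteq> character \<Gamma> N"
  shows "char_inner \<Gamma> (character \<Gamma> M) (character \<Gamma> N) = 0"
  by (rule char_inner_zero) (use assms Schur_zero[OF assms(2,1)] irreducibleD(1) in metis)+

end

section \<open>Constructions of modules\<close>

lemma with_act_simps [simp]:
  "carrier (with_act V a) = carrier V" "\<zero>\<^bsub>with_act V a\<^esub> = \<zero>\<^bsub>V\<^esub>" "x \<oplus>\<^bsub>with_act V a\<^esub> y = x \<oplus>\<^bsub>V\<^esub> y"
  "z \<odot>\<^bsub>with_act V a\<^esub> x = z \<odot>\<^bsub>V\<^esub> x" "act (with_act V a) = a"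
  by (simp_all add: with_act_def module.defs gmod.defs)

text \<open>Records with different extension fields have different types, so a module and its
  underlying space cannot be equated; their properties are carried over through the agreement of the
  operations.\<close>

lemma vs_cong:
  fixes V :: "(complex, 'a, 'x) module_scheme" and W :: "(complex, 'a, 'y) module_scheme"
  assumes V: "vs V" and "carrier W = carrier V" "\<zero>\<^bsub>W\<^esub> = \<zero>\<^bsub>V\<^esub>" "add W = add V" "module.smult W = module.smult V"
  shows "vs W"
  by (rule vsI) (use assms in \<open>auto simp: vadd_smult vsmult_add vneg vadd_ac(1) intro: vadd_ac(2)[OF V]\<close>)

lemma fdvs_cong:
  fixes V :: "(complex, 'a, 'x) module_scheme" and W :: "(complex, 'a, 'y) module_scheme"
  assumes "fdvs V" "carrier W = carrier V" "\<zero>\<^bsub>W\<^esub> = \<zero>\<^bsub>V\<^esub>" "add W = add V" "module.smult W = module.smult V"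
  shows "fdvs W"
proof -
  have V: "vs V" using assms(1) by simp
  have "vs W" by (rule vs_cong[OF V assms(2-5)])
  then show ?thesis by (rule fdvs_transfer[OF assms(1), of _ "\<lambda>x. x" "\<lambda>x. x"]) (auto intro!: mhomI simp: assms)
qed

lemma Lin_space_cong:
  assumes "carrier W = carrier V" "add W = add V" "module.smult W = module.smult V"
  shows "Lin_space W U = Lin_space V U"
  unfolding Lin_space_def Lin_def LinearCombinations.module_hom_def assms by simp

lemma mhom_with_act [simp]: "mhom (with_act V a) U = mhom V U" "mhom U (with_act V a) = mhom U V"
  by (simp_all add: LinearCombinations.module_hom_def)

lemma Lin_with_act [simp]: "Lin (with_act V a) U = Lin V U" "Lin U (with_act V a) = Lin U V"
  by (simp_all add: Lin_def)

lemma fdvs_with_act [simp]: "fdvs (with_act V a) \<longleftrightarrow> fdvs V"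
  by (auto intro: fdvs_cong simp: fun_eq_iff)

lemma vs_with_act [simp]: "vs V \<Longrightarrow> vs (with_act V a)"
  by (erule vs_cong) (simp_all add: fun_eq_iff)

lemma frame_with_act: "vs V \<Longrightarrow> frame V I e c \<Longrightarrow> frame (with_act V a) I e c"
  by (rule frame_transfer[of V I e c "with_act V a" "\<lambda>x. x" "\<lambda>x. x"]) (auto intro!: mhomI)

lemma vtrace_with_act [simp]: "fdvs V \<Longrightarrow> f \<in> mhom V V \<Longrightarrow> vtrace (with_act V a) f = vtrace V f"
proof -
  assume V: "fdvs V" and f: "f \<in> mhom V V"
  obtain e c and n :: nat where F: "frame V {..<n} e c" using fdvs_frame[OF V] .
  have f': "f \<in> mhom (with_act V a) (with_act V a)" using f by simp
  show ?thesis
    using vtrace_frame[OF V F f] vtrace_frame[OF _ frame_with_act[OF fdvs_vs[OF V] F] f'] V by simp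
qed

text \<open>The summands of \<open>total\<close> are built from \<open>triv (V \<chi>)\<close>, the
  maps between them from \<open>V \<chi>\<close>; both give the same tensor product.\<close>

lemma tensor_triv [simp]: "tensor (triv V) W = tensor V W" "pure (triv V) W = pure V W"
  by (simp_all add: tensor_def bilin_forms_def pure_def triv_def Lin_space_cong[of "with_act V _" V] fun_eq_iff)

lemma tlift_triv [simp]: "tlift (triv V) W Z = tlift V W Z"
  by (simp add: tlift_def triv_def fun_eq_iff flip: tensor_triv)

lemma gtensor_simps [simp]:
  "carrier (gtensor M N) = carrier (tensor M N)" "\<zero>\<^bsub>gtensor M N\<^esub> = \<zero>\<^bsub>tensor M N\<^esub>"
  "x \<oplus>\<^bsub>gtensor M N\<^esub> y = x \<oplus>\<^bsub>tensor M N\<^esub> y" "z \<odot>\<^bsub>gtensor M N\<^esub> x = z \<odot>\<^bsub>tensor M N\<^esub> x"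
  "act (gtensor M N) g = tmap M N M N (act M g) (act N g)"
  by (simp_all add: gtensor_def)

lemma mhom_gtensor [simp]: "mhom (gtensor M N) U = mhom (tensor M N) U" "mhom U (gtensor M N) = mhom U (tensor M N)"
  by (simp_all add: gtensor_def)

lemma Lin_gtensor [simp]: "Lin (gtensor M N) U = Lin (tensor M N) U" "Lin U (gtensor M N) = Lin U (tensor M N)"
  by (simp_all add: gtensor_def)

lemma is_gmodI:
  assumes "fdvs M" "\<And>g. g \<in> \<Gamma> \<Longrightarrow> act M g \<in> mhom M M" "\<And>m. m \<in> carrier M \<Longrightarrow> act M (1\<^sub>m 2) m = m"
    "\<And>g h m. g \<in> \<Gamma> \<Longrightarrow> h \<in> \<Gamma> \<Longrightarrow> m \<in> carrier M \<Longrightarrow> act M (g * h) m = act M g (act M h m)"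
  shows "is_gmod \<Gamma> M"
  using assms by (simp add: is_gmod_def)

context finite_SL2
begin

lemma gmod_gtensor [simp]:
  assumes M: "is_gmod \<Gamma> M" and N: "is_gmod \<Gamma> N"
  shows "is_gmod \<Gamma> (gtensor M N)"
proof (rule is_gmodI)
  note m = is_gmodD[OF M] and n = is_gmodD[OF N]
  show "fdvs (gtensor M N)" unfolding gtensor_def using m n by simp
  show "act (gtensor M N) g \<in> mhom (gtensor M N) (gtensor M N)" if "g \<in> \<Gamma>" for g
    by (simp add: tmap_mhom m n that)
  show "act (gtensor M N) (1\<^sub>m 2) t = t" if "t \<in> carrier (gtensor M N)" for t
    using that by (simp add: tmap_id m n)
  show "act (gtensor M N) (g * h) t = act (gtensor M N) g (act (gtensor M N) h t)" if "g \<in> \<Gamma>" "h \<in> \<Gamma>" "t \<in> carrier (gtensor M N)" for g h t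
    using that by (simp add: tmap_comp m n, subst tmap_cong[of M N M N "act M (g * h)" "act N (g * h)" "\<lambda>v. act M g (act M h v)" "\<lambda>v. act N g (act N h v)"])
       (auto simp: m n)
qed

text \<open>In the basis of pure tensors the diagonal coefficients of the action are products of
  diagonal coefficients, so the trace factors.\<close>

lemma character_gtensor:
  assumes M: "is_gmod \<Gamma> M" and N: "is_gmod \<Gamma> N" and g: "g \<in> \<Gamma>"
  shows "character \<Gamma> (gtensor M N) g = character \<Gamma> M g * character \<Gamma> N g"
proof -
  note m = is_gmodD[OF M] and n = is_gmodD[OF N]
  obtain e c and k :: nat where F: "frame M {..<k} e c" using fdvs_frame[OF m(1)] .
  obtain e' c' and k' :: nat where F': "frame N {..<k'} e' c'" using fdvs_frame[OF n(1)] .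
  note D = frameD[OF F] and D' = frameD[OF F']
  let ?A = "tmap M N M N (act M g) (act N g)"
  have A: "?A \<in> mhom (tensor M N) (tensor M N)" by (simp add: tmap_mhom m n g)
  have ev: "pure M N (act M g (e i)) (act N g (e' j)) (\<lambda>v\<in>carrier M. \<lambda>w\<in>carrier N. c i v * c' j w) = c i (act M g (e i)) * c' j (act N g (e' j))"
    if "i < k" "j < k'" for i j
    using frameD(2)[OF frame_bilin_forms[OF m(2) F n(2) F'], of "(i,j)"] that D D' m n g by (simp add: pure_def)
  have "vtrace (gtensor M N) (act (gtensor M N) g) = vtrace (tensor M N) ?A"
    unfolding gtensor_def using A m n by simp
  also have "\<dots> = (\<Sum>i<k. \<Sum>j<k'. c i (act M g (e i)) * c' j (act N g (e' j)))"
    unfolding vtrace_frame[OF fdvs_tensor[OF m(1) n(1)] frame_tensor[OF m(2) F n(2) F'] A]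
    by (subst sum.cartesian_product) (auto intro!: sum.cong simp: ev tmap_pure m n g D D')
  also have "\<dots> = vtrace M (act M g) * vtrace N (act N g)"
    by (simp add: vtrace_frame[OF m(1) F m(3)[OF g]] vtrace_frame[OF n(1) F' n(3)[OF g]] sum_product)
  finally show ?thesis using g by (simp add: character_def)
qed

lemma gmod_triv [simp]: "fdvs V \<Longrightarrow> is_gmod \<Gamma> (triv V)"
  unfolding triv_def by (rule is_gmodI) (auto simp: mhom_id)

end

lemma gsum_simps [simp]:
  "carrier (gsum I M) = (\<Pi>\<^sub>E i\<in>I. carrier (M i))" "\<zero>\<^bsub>gsum I M\<^esub> = (\<lambda>i\<in>I. \<zero>\<^bsub>M i\<^esub>)"
  "m \<oplus>\<^bsub>gsum I M\<^esub> n = (\<lambda>i\<in>I. m i \<oplus>\<^bsub>M i\<^esub> n i)" "c \<odot>\<^bsub>gsum I M\<^esub> m = (\<lambda>i\<in>I. c \<odot>\<^bsub>M i\<^esub> m i)"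
  "act (gsum I M) g m = (\<lambda>i\<in>I. act (M i) g (m i))"
  by (simp_all add: gsum_def)

text \<open>The inclusion of the summand with index \<open>i\<close> into the direct sum.\<close>

definition single :: "'i set \<Rightarrow> ('i \<Rightarrow> (complex, 'a, 'x) module_scheme) \<Rightarrow> 'i \<Rightarrow> 'a \<Rightarrow> 'i \<Rightarrow> 'a" where
  "single I M i v = (\<lambda>k\<in>I. if k = i then v else \<zero>\<^bsub>M k\<^esub>)"

lemma proj_mhom: "i \<in> I \<Longrightarrow> (\<lambda>m. m i) \<in> mhom (gsum I M) (M i)"
  by (rule mhomI) auto

lemma vs_gsum: "(\<And>i. i \<in> I \<Longrightarrow> vs (M i)) \<Longrightarrow> vs (gsum I M)"
proof (rule vsI)
  assume M: "\<And>i. i \<in> I \<Longrightarrow> vs (M i)"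
  show "v \<oplus>\<^bsub>gsum I M\<^esub> w = w \<oplus>\<^bsub>gsum I M\<^esub> v" if "v \<in> carrier (gsum I M)" "w \<in> carrier (gsum I M)" for v w
    using that M by (simp, intro restrict_ext vadd_ac(2)) (auto simp: PiE_iff)
  show "v \<oplus>\<^bsub>gsum I M\<^esub> \<zero>\<^bsub>gsum I M\<^esub> = v" "1 \<odot>\<^bsub>gsum I M\<^esub> v = v" if "v \<in> carrier (gsum I M)" for v
    using that M by (auto simp: fun_eq_iff PiE_iff extensional_def)
qed (auto intro!: restrict_ext simp: vadd_smult vsmult_add vneg vadd_ac(1) PiE_iff)

lemma single_mhom: "(\<And>i. i \<in> I \<Longrightarrow> vs (M i)) \<Longrightarrow> i \<in> I \<Longrightarrow> single I M i \<in> mhom (M i) (gsum I M)"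
  by (rule mhomI) (auto simp: single_def intro!: restrict_ext)

lemma single_closed: "(\<And>i. i \<in> I \<Longrightarrow> vs (M i)) \<Longrightarrow> i \<in> I \<Longrightarrow> v \<in> carrier (M i) \<Longrightarrow> single I M i v \<in> carrier (gsum I M)"
  by (auto simp: single_def)

lemma gsum_decomp:
  assumes "\<And>i. i \<in> I \<Longrightarrow> vs (M i)" "finite I" "m \<in> carrier (gsum I M)"
  shows "finsum (gsum I M) (\<lambda>i. single I M i (m i)) I = m"
proof -
  have V: "vs (gsum I M)" by (rule vs_gsum[OF assms(1)])
  have c: "(\<lambda>i. single I M i (m i)) \<in> I \<rightarrow> carrier (gsum I M)"
    using assms(3) by (auto simp del: gsum_simps intro!: single_closed assms(1)) auto
  have "finsum (gsum I M) (\<lambda>i. single I M i (m i)) I k = m k" if k: "k \<in> I" for k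
  proof -
    have "finsum (gsum I M) (\<lambda>i. single I M i (m i)) I k = finsum (M k) (\<lambda>i. single I M i (m i) k) I"
      by (rule mhom_finsum[OF V assms(1)[OF k] proj_mhom[OF k] assms(2) c])
    also have "\<dots> = single I M k (m k) k"
      by (rule vfinsum_single[OF assms(1)[OF k] assms(2) k]) (use k assms in \<open>auto simp: single_def\<close>)
    finally show ?thesis using k by (simp add: single_def)
  qed
  moreover have "finsum (gsum I M) (\<lambda>i. single I M i (m i)) I \<in> (\<Pi>\<^sub>E i\<in>I. carrier (M i))"
    using vfinsum_closed[OF V c] by simp
  ultimately show ?thesis using assms(3) by (intro PiE_ext) auto
qed

lemma frame_gsum:
  assumes V: "\<And>i. i \<in> I \<Longrightarrow> vs (M i)" and fin: "finite I" and F: "\<And>i. i \<in> I \<Longrightarrow> frame (M i) (J i) (e i) (c i)"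
  shows "frame (gsum I M) (Sigma I J) (\<lambda>(i, j). single I M i (e i j)) (\<lambda>(i, j) m. c i j (m i))"
proof (rule frameI)
  have VG: "vs (gsum I M)" by (rule vs_gsum[OF V])
  note D = frameD[OF F]
  show "finite (Sigma I J)" using fin D(1) by blast
  show "(case p of (i, j) \<Rightarrow> single I M i (e i j)) \<in> carrier (gsum I M)" if "p \<in> Sigma I J" for p
    using that D by (auto simp del: gsum_simps intro!: single_closed V)
  show "(case p of (i, j) \<Rightarrow> \<lambda>m. c i j (m i)) \<in> mhom (gsum I M) Cline" if "p \<in> Sigma I J" for p
  proof -
    obtain i j where p: "p = (i, j)" "i \<in> I" "j \<in> J i" using \<open>p \<in> Sigma I J\<close> by auto
    show ?thesis using mhom_comp[OF proj_mhom[OF p(2), of M] D(3)[OF p(2,3)]] by (simp add: p(1))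
  qed
  show "(case p of (i, j) \<Rightarrow> \<lambda>m. c i j (m i)) (case q of (i, j) \<Rightarrow> single I M i (e i j)) = (if p = q then 1 else 0)"
    if "p \<in> Sigma I J" "q \<in> Sigma I J" for p q
    using that D(4) by (auto simp: single_def mhom_zero[OF V vs_Cline D(3)] split: if_splits)
  show "finsum (gsum I M) (\<lambda>p. (case p of (i, j) \<Rightarrow> \<lambda>m. c i j (m i)) m \<odot>\<^bsub>gsum I M\<^esub> (case p of (i, j) \<Rightarrow> single I M i (e i j))) (Sigma I J) = m" (is "?S = m")
    if m: "m \<in> carrier (gsum I M)" for m
  proof -
    let ?E = "\<lambda>p. (case p of (i, j) \<Rightarrow> \<lambda>m. c i j (m i)) m \<odot>\<^bsub>gsum I M\<^esub> (case p of (i, j) \<Rightarrow> single I M i (e i j))"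
    have c: "?E \<in> Sigma I J \<rightarrow> carrier (gsum I M)"
      using D VG by (auto simp del: gsum_simps intro!: vsmult_closed single_closed V)
    have fS: "finite (Sigma I J)" using fin D(1) by blast
    have "?S k = m k" if k: "k \<in> I" for k
    proof -
      note Dk = frameD[OF F[OF k]]
      have "?S k = finsum (M k) (\<lambda>p. ?E p k) (Sigma I J)"
        by (rule mhom_finsum[OF VG V[OF k] proj_mhom[OF k] fS c])
      \<comment> \<open>In component \<open>k\<close> only the basis vectors that come from the
        summand \<open>k\<close> survive.\<close>
      also have "\<dots> = finsum (M k) (\<lambda>p. ?E p k) (Pair k ` J k)"
      proof -
        have S: "Sigma I J = Pair k ` J k \<union> (Sigma I J - Pair k ` J k)" using k by auto
        have ck: "?E p k \<in> carrier (M k)" if "p \<in> Sigma I J" for p using Pi_mem[OF c that] k by auto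
        have "finsum (M k) (\<lambda>p. ?E p k) (Sigma I J) = finsum (M k) (\<lambda>p. ?E p k) (Pair k ` J k) \<oplus>\<^bsub>M k\<^esub>
            finsum (M k) (\<lambda>p. ?E p k) (Sigma I J - Pair k ` J k)"
          by (subst S, rule vfinsum_Un[OF V[OF k]]) (use fS Dk ck k in auto)
        also have "finsum (M k) (\<lambda>p. ?E p k) (Sigma I J - Pair k ` J k) = \<zero>\<^bsub>M k\<^esub>"
          by (rule vfinsum_zero[OF V[OF k]]) (use k V D in \<open>auto simp: single_def\<close>)
        also have "finsum (M k) (\<lambda>p. ?E p k) (Pair k ` J k) \<oplus>\<^bsub>M k\<^esub> \<zero>\<^bsub>M k\<^esub> = finsum (M k) (\<lambda>p. ?E p k) (Pair k ` J k)"
          by (rule vzero_add(2)[OF V[OF k] vfinsum_closed[OF V[OF k]]], intro Pi_I ck) (use k in auto)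
        finally show ?thesis .
      qed
      also have "\<dots> = finsum (M k) (\<lambda>j. ?E (k, j) k) (J k)"
        by (rule vfinsum_reindex[OF V[OF k]]) (use k Dk V[OF k] in \<open>auto simp: single_def inj_on_def\<close>)
      also have "\<dots> = finsum (M k) (\<lambda>j. c k j (m k) \<odot>\<^bsub>M k\<^esub> e k j) (J k)"
        by (rule vfinsum_cong[OF V[OF k] refl]) (use k Dk V[OF k] in \<open>auto simp: single_def\<close>)
      also have "\<dots> = m k" using Dk(5)[of "m k"] m k by auto
      finally show ?thesis .
    qed
    moreover have "?S \<in> (\<Pi>\<^sub>E i\<in>I. carrier (M i))"
      using vfinsum_closed[OF VG c] by simp
    ultimately show ?thesis using m by (intro PiE_ext) auto
  qed
qed

lemma fdvs_gsum:
  assumes "\<And>i. i \<in> I \<Longrightarrow> fdvs (M i)" "finite I" shows "fdvs (gsum I M)"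
proof -
  have "\<exists>e c n. frame (M i) {..<n::nat} e c" if "i \<in> I" for i using fdvs_frame[OF assms(1)[OF that]] by metis
  then obtain e c n where F: "\<And>i. i \<in> I \<Longrightarrow> frame (M i) {..<n i :: nat} (e i) (c i)" by metis
  show ?thesis by (rule fdvsI[OF vs_gsum frame_gsum[OF _ assms(2) F]]) (use assms in auto)
qed

lemma gmod_gsum:
  assumes "\<And>i. i \<in> I \<Longrightarrow> is_gmod \<Gamma> (M i)" "finite I"
  shows "is_gmod \<Gamma> (gsum I M)"
proof (rule is_gmodI)
  note m = is_gmodD[OF assms(1)]
  show "fdvs (gsum I M)" by (rule fdvs_gsum) (use m assms in auto)
  show "act (gsum I M) g \<in> mhom (gsum I M) (gsum I M)" if "g \<in> \<Gamma>" for g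
    by (rule mhomI) (use that m in \<open>auto intro!: restrict_ext simp: mhom_add[OF m(3)] mhom_smult[OF m(3)] PiE_iff\<close>)
  show "act (gsum I M) (1\<^sub>m 2) x = x" if "x \<in> carrier (gsum I M)" for x
    using that m by (auto simp: fun_eq_iff PiE_iff extensional_def)
qed (use is_gmodD[OF assms(1)] in \<open>auto intro!: restrict_ext simp: PiE_iff\<close>)

section \<open>Copies of modules\<close>

lemma gcopy_simps [simp]:
  "carrier (gcopy M) = carrier (copy M)" "\<zero>\<^bsub>gcopy M\<^esub> = \<zero>\<^bsub>copy M\<^esub>"
  "x \<oplus>\<^bsub>gcopy M\<^esub> y = x \<oplus>\<^bsub>copy M\<^esub> y" "z \<odot>\<^bsub>gcopy M\<^esub> x = z \<odot>\<^bsub>copy M\<^esub> x"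
  "act (gcopy M) g x = enc M (act M g (dec M x))"
  by (simp_all add: gcopy_def del: copy_simps)

lemma gcopy_gmod:
  assumes E: "encodable TYPE('u) M" and M: "is_gmod \<Gamma> M"
  shows "is_gmod \<Gamma> (gcopy M :: 'u gmod)" "(enc M :: 'a \<Rightarrow> 'u) \<in> eqv \<Gamma> M (gcopy M)" "(dec M :: 'u \<Rightarrow> 'a) \<in> eqv \<Gamma> (gcopy M) M"
proof -
  note m = is_gmodD[OF M]
  show "is_gmod \<Gamma> (gcopy M :: 'u gmod)"
  proof (rule is_gmodI)
    show "fdvs (gcopy M :: 'u gmod)" unfolding gcopy_def using fdvs_copy[OF E m(1)] by simp
  qed (use E m in \<open>auto intro!: mhomI simp: mhom_add[OF m(3)] mhom_smult[OF m(3)]\<close>)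
  show "(enc M :: 'a \<Rightarrow> 'u) \<in> eqv \<Gamma> M (gcopy M)" "(dec M :: 'u \<Rightarrow> 'a) \<in> eqv \<Gamma> (gcopy M) M"
    using E m by (auto intro!: eqvI mhomI)
qed

text \<open>A submodule of \<open>N\<close> is carried by \<open>h\<close> to a submodule of
  \<open>M\<close> and recovered from it by \<open>f\<close>.\<close>

lemma irreducible_iso:
  assumes M: "irreducible_gmod \<Gamma> M" and N: "is_gmod \<Gamma> N" and f: "f \<in> eqv \<Gamma> M N" and h: "h \<in> eqv \<Gamma> N M"
    and hf: "\<And>m. m \<in> carrier M \<Longrightarrow> h (f m) = m" and fh: "\<And>n. n \<in> carrier N \<Longrightarrow> f (h n) = n"
  shows "irreducible_gmod \<Gamma> N"
proof (rule irreducibleI[OF N])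
  note m = irreducibleD[OF M]
  have f0: "f \<zero>\<^bsub>M\<^esub> = \<zero>\<^bsub>N\<^esub>" by (rule mhom_zero[OF is_gmodD(2)[OF m(1)] is_gmodD(2)[OF N] eqv_mhom[OF f]])
  obtain w where w: "w \<in> carrier M" "w \<noteq> \<zero>\<^bsub>M\<^esub>" using irreducible_nonzero[OF M] .
  show "carrier N \<noteq> {\<zero>\<^bsub>N\<^esub>}"
    using w hf[of w] hf[of "\<zero>\<^bsub>M\<^esub>"] f0 eqv_closed[OF f w(1)] vzero_closed[OF is_gmodD(2)[OF m(1)]] by (metis singletonD)
  fix W assume W: "gsub \<Gamma> N W"
  have WN: "W \<subseteq> carrier N" using W by (auto simp: gsub_def lin_closed_def)
  have "gsub \<Gamma> M (h ` carrier (N\<lparr>carrier := W\<rparr>))"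
    using image_gsub[OF gsub_gmod(1)[OF N W] m(1) eqv_comp[OF gsub_gmod(2)[OF N W] h]] by simp
  then have "h ` W = {\<zero>\<^bsub>M\<^esub>} \<or> h ` W = carrier M" using m(3) by simp
  moreover have "f ` h ` W = W" using fh WN by force
  moreover have "f ` carrier M = carrier N" using fh eqv_closed[OF h] eqv_closed[OF f] by force
  ultimately show "W = {\<zero>\<^bsub>N\<^esub>} \<or> W = carrier N" using f0 by (metis image_empty image_insert)
qed

section \<open>Isotypic decompositions\<close>

locale irreducibles = finite_SL2 \<Gamma> for \<Gamma> :: "complex mat set" +
  fixes X :: "cfun \<Rightarrow> 'u gmod"
  assumes universe: "\<exists>f :: complex \<Rightarrow> 'u. inj f"
    and choice: "irr_choice \<Gamma> X"
begin

lemma encodable [simp]: "fdvs V \<Longrightarrow> encodable TYPE('u) V"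
  unfolding encodable_def by (rule fdvs_inj[OF _ universe])

lemma irrD:
  assumes "\<chi> \<in> Irr TYPE('u) \<Gamma>"
  shows "irreducible_gmod \<Gamma> (X \<chi>)" "character \<Gamma> (X \<chi>) = \<chi>" "is_gmod \<Gamma> (X \<chi>)" "fdvs (X \<chi>)" "vs (X \<chi>)"
  using choice assms irreducibleD(1) is_gmodD(1,2) unfolding irr_choice_def by blast+

text \<open>\<open>Irr\<close> speaks only of modules with carrier in \<open>'u\<close>. A module
  over another type is copied there, which is possible by the assumption
  \<open>universe\<close>.\<close>

lemma irreducible_in_irr:
  assumes "irreducible_gmod \<Gamma> M" shows "character \<Gamma> M \<in> Irr TYPE('u) \<Gamma>"
proof -
  note m = irreducibleD(1)[OF assms]
  have E: "encodable TYPE('u) M" using is_gmodD(1)[OF m] by simp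
  let ?N = "gcopy M :: 'u gmod"
  note c = gcopy_gmod[OF E m]
  have 1: "\<And>v. v \<in> carrier M \<Longrightarrow> dec M (enc M v :: 'u) = v" using E by simp
  have 2: "\<And>v. v \<in> carrier ?N \<Longrightarrow> enc M (dec M v) = v" using E by auto
  have "irreducible_gmod \<Gamma> ?N" by (rule irreducible_iso[OF assms c 1 2])
  moreover have "character \<Gamma> M = character \<Gamma> ?N"
    by (rule character_iso[OF m c(1,2) eqv_mhom[OF c(3)] 1 2])
  ultimately show ?thesis unfolding Irr_def by blast
qed

text \<open>A decomposition of \<open>M\<close> as a direct sum of chosen irreducible modules, with
  inclusions \<open>f\<close> and projections \<open>g\<close>; the summand with number
  \<open>i\<close> is a copy of \<open>X (k i)\<close>.\<close>

definition isodecomp :: "'a gmod \<Rightarrow> nat \<Rightarrow> (nat \<Rightarrow> cfun) \<Rightarrow> (nat \<Rightarrow> 'u \<Rightarrow> 'a) \<Rightarrow> (nat \<Rightarrow> 'a \<Rightarrow> 'u) \<Rightarrow> bool" where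
  "isodecomp M n k f g \<longleftrightarrow>
    (\<forall>i<n. k i \<in> Irr TYPE('u) \<Gamma> \<and> f i \<in> eqv \<Gamma> (X (k i)) M \<and> g i \<in> eqv \<Gamma> M (X (k i))) \<and>
    (\<forall>i<n. \<forall>j<n. \<forall>w\<in>carrier (X (k j)). g i (f j w) = (if i = j then w else \<zero>\<^bsub>X (k i)\<^esub>)) \<and>
    (\<forall>m\<in>carrier M. finsum M (\<lambda>i. f i (g i m)) {..<n} = m)"

lemma isodecompD:
  assumes "isodecomp M n k f g"
  shows "i < n \<Longrightarrow> k i \<in> Irr TYPE('u) \<Gamma>" "i < n \<Longrightarrow> f i \<in> eqv \<Gamma> (X (k i)) M" "i < n \<Longrightarrow> g i \<in> eqv \<Gamma> M (X (k i))"
    "i < n \<Longrightarrow> w \<in> carrier (X (k i)) \<Longrightarrow> g i (f i w) = w"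
    "i < n \<Longrightarrow> j < n \<Longrightarrow> i \<noteq> j \<Longrightarrow> w \<in> carrier (X (k j)) \<Longrightarrow> g i (f j w) = \<zero>\<^bsub>X (k i)\<^esub>"
    "m \<in> carrier M \<Longrightarrow> finsum M (\<lambda>i. f i (g i m)) {..<n} = m"
  using assms by (auto simp: isodecomp_def)

text \<open>\<open>P\<close> and \<open>Q\<close> are complementary equivariant projections onto
  \<open>W\<close> and \<open>K\<close>. The summands of \<open>W\<close> keep their numbers, those
  of \<open>K\<close> are shifted by \<open>n1\<close>, and the projections to the summands are
  preceded by \<open>P\<close> or \<open>Q\<close>.\<close>

lemma isodecomp_combine:
  assumes M: "is_gmod \<Gamma> M" and P: "P \<in> eqv \<Gamma> M M" and Q: "Q \<in> eqv \<Gamma> M M"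
    and W: "gsub \<Gamma> M W" "\<And>v. v \<in> carrier M \<Longrightarrow> P v \<in> W" "\<And>w. w \<in> W \<Longrightarrow> P w = w" "\<And>w. w \<in> W \<Longrightarrow> Q w = \<zero>\<^bsub>M\<^esub>"
    and K: "gsub \<Gamma> M K" "\<And>v. v \<in> carrier M \<Longrightarrow> Q v \<in> K" "\<And>w. w \<in> K \<Longrightarrow> Q w = w" "\<And>w. w \<in> K \<Longrightarrow> P w = \<zero>\<^bsub>M\<^esub>"
    and PQ: "\<And>v. v \<in> carrier M \<Longrightarrow> P v \<oplus>\<^bsub>M\<^esub> Q v = v"
    and d1: "isodecomp (M\<lparr>carrier := W\<rparr>) n1 k1 f1 g1" and d2: "isodecomp (M\<lparr>carrier := K\<rparr>) n2 k2 f2 g2"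
  shows "\<exists>n k f g. isodecomp M n k f g"
proof -
  let ?W = "M\<lparr>carrier := W\<rparr>" and ?K = "M\<lparr>carrier := K\<rparr>"
  note D1 = isodecompD[OF d1] and D2 = isodecompD[OF d2]
  note sW = gsub_gmod[OF M W(1)] and sK = gsub_gmod[OF M K(1)]
  note vM = is_gmodD(2)[OF M]
  have WM: "\<And>w. w \<in> W \<Longrightarrow> w \<in> carrier M" and KM: "\<And>w. w \<in> K \<Longrightarrow> w \<in> carrier M"
    using W(1) K(1) by (auto simp: gsub_def lin_closed_def)
  have PW: "P \<in> eqv \<Gamma> M ?W" using P W(2) by (auto simp: eqv_def LinearCombinations.module_hom_def)
  have QK: "Q \<in> eqv \<Gamma> M ?K" using Q K(2) by (auto simp: eqv_def LinearCombinations.module_hom_def)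
  define k where "k = (\<lambda>i. if i < n1 then k1 i else k2 (i - n1))"
  define f where "f = (\<lambda>i. if i < n1 then f1 i else f2 (i - n1))"
  define g where "g = (\<lambda>i v. if i < n1 then g1 i (P v) else g2 (i - n1) (Q v))"
  have fW: "i < n1 \<Longrightarrow> w \<in> carrier (X (k1 i)) \<Longrightarrow> f1 i w \<in> W" for i w using eqv_closed[OF D1(2)] by auto
  have fK: "i < n2 \<Longrightarrow> w \<in> carrier (X (k2 i)) \<Longrightarrow> f2 i w \<in> K" for i w using eqv_closed[OF D2(2)] by auto
  have z1: "i < n1 \<Longrightarrow> g1 i \<zero>\<^bsub>M\<^esub> = \<zero>\<^bsub>X (k1 i)\<^esub>" for i
    using mhom_zero[OF is_gmodD(2)[OF sW(1)] _ eqv_mhom[OF D1(3)]] irrD[OF D1(1)] by simp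
  have z2: "i < n2 \<Longrightarrow> g2 i \<zero>\<^bsub>M\<^esub> = \<zero>\<^bsub>X (k2 i)\<^esub>" for i
    using mhom_zero[OF is_gmodD(2)[OF sK(1)] _ eqv_mhom[OF D2(3)]] irrD[OF D2(1)] by simp
  have ki: "k i \<in> Irr TYPE('u) \<Gamma>" if "i < n1 + n2" for i using that D1(1)[of i] D2(1)[of "i - n1"] by (auto simp: k_def)
  have fi: "f i \<in> eqv \<Gamma> (X (k i)) M" if "i < n1 + n2" for i
    using that eqv_comp[OF D1(2) sW(2), of i] eqv_comp[OF D2(2) sK(2), of "i - n1"] by (auto simp: k_def f_def)
  have gi: "g i \<in> eqv \<Gamma> M (X (k i))" if "i < n1 + n2" for i
    using that eqv_comp[OF PW D1(3), of i] eqv_comp[OF QK D2(3), of "i - n1"] by (auto simp: k_def g_def)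
  have gf: "g i (f j w) = (if i = j then w else \<zero>\<^bsub>X (k i)\<^esub>)" if "i < n1 + n2" "j < n1 + n2" "w \<in> carrier (X (k j))" for i j w
    using that D1(4,5) D2(4,5) z1 z2 W(3,4) K(3,4) fW fK
    by (cases "i < n1"; cases "j < n1") (auto simp: k_def f_def g_def)
  have sum: "finsum M (\<lambda>i. f i (g i m)) {..<n1 + n2} = m" if m: "m \<in> carrier M" for m
  proof -
    have c: "f i (g i m) \<in> carrier M" if "i < n1 + n2" for i using eqv_closed[OF fi[OF that]] eqv_closed[OF gi[OF that] m] by simp
    have "{..<n1 + n2} = {..<n1} \<union> (\<lambda>i. i + n1) ` {..<n2}"
    proof (intro equalityI subsetI)
      show "x \<in> {..<n1} \<union> (\<lambda>i. i + n1) ` {..<n2}" if "x \<in> {..<n1 + n2}" for x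
        using that by (cases "x < n1") (auto intro!: image_eqI[of _ _ "x - n1"])
    qed auto
    then have "finsum M (\<lambda>i. f i (g i m)) {..<n1 + n2} = 
       finsum M (\<lambda>i. f i (g i m)) {..<n1} \<oplus>\<^bsub>M\<^esub> finsum M (\<lambda>i. f i (g i m)) ((\<lambda>i. i + n1) ` {..<n2})"
      using c by (auto intro!: vfinsum_Un[OF vM])
    also have "finsum M (\<lambda>i. f i (g i m)) {..<n1} = finsum M (\<lambda>i. f1 i (g1 i (P m))) {..<n1}"
      by (intro vfinsum_cong[OF vM refl]) (use eqv_closed[OF D1(3), of _ "P m"] W(2)[OF m] fW WM in \<open>auto simp: f_def g_def\<close>)
    also have "\<dots> = finsum ?W (\<lambda>i. f1 i (g1 i (P m))) {..<n1}"
      using mhom_finsum[OF is_gmodD(2)[OF sW(1)] vM eqv_mhom[OF sW(2)], of "{..<n1}" "\<lambda>i. f1 i (g1 i (P m))"]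
        eqv_closed[OF D1(2)] eqv_closed[OF D1(3)] W(2)[OF m] by (simp add: Pi_iff)
    also have "\<dots> = P m" using D1(6)[of "P m"] W(2)[OF m] by simp
    also have "finsum M (\<lambda>i. f i (g i m)) ((\<lambda>i. i + n1) ` {..<n2}) = finsum M (\<lambda>i. f (i + n1) (g (i + n1) m)) {..<n2}"
      by (rule vfinsum_reindex[OF vM]) (use c in auto)
    also have "\<dots> = finsum M (\<lambda>i. f2 i (g2 i (Q m))) {..<n2}"
      by (intro vfinsum_cong[OF vM refl]) (use eqv_closed[OF D2(3), of _ "Q m"] K(2)[OF m] fK KM in \<open>auto simp: f_def g_def\<close>)
    also have "\<dots> = finsum ?K (\<lambda>i. f2 i (g2 i (Q m))) {..<n2}"
      using mhom_finsum[OF is_gmodD(2)[OF sK(1)] vM eqv_mhom[OF sK(2)], of "{..<n2}" "\<lambda>i. f2 i (g2 i (Q m))"]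
        eqv_closed[OF D2(2)] eqv_closed[OF D2(3)] K(2)[OF m] by (simp add: Pi_iff)
    also have "\<dots> = Q m" using D2(6)[of "Q m"] K(2)[OF m] by simp
    finally show ?thesis using PQ[OF m] by simp
  qed
  have "isodecomp M (n1 + n2) k f g"
    unfolding isodecomp_def using ki fi gi gf sum by simp
  then show ?thesis by blast
qed

text \<open>Induction on the dimension: if \<open>M\<close> is neither zero nor irreducible, a
  proper nonzero submodule \<open>W\<close> is complemented by the kernel \<open>K\<close> of an
  equivariant projection, and both are smaller.\<close>

lemma isodecomp_exists:
  assumes "is_gmod \<Gamma> M"
  shows "\<exists>n k f g. isodecomp M n k f g"
  using assms
proof (induction "vectorspace.dim Cf M" arbitrary: M rule: less_induct)
  case less
  note M = less.prems note m = is_gmodD[OF M]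
  consider "carrier M = {\<zero>\<^bsub>M\<^esub>}" | "irreducible_gmod \<Gamma> M"
    | W where "carrier M \<noteq> {\<zero>\<^bsub>M\<^esub>}" "gsub \<Gamma> M W" "W \<noteq> {\<zero>\<^bsub>M\<^esub>}" "W \<noteq> carrier M"
    using irreducibleI[OF M] by blast
  then show ?case
  proof cases
    case 1
    then have "isodecomp M 0 k f g" for k f g using m(2) by (simp add: isodecomp_def)
    then show ?thesis by blast
  next
    case 2
    let ?\<chi> = "character \<Gamma> M"
    have \<chi>: "?\<chi> \<in> Irr TYPE('u) \<Gamma>" by (rule irreducible_in_irr[OF 2])
    obtain f h where fh: "f \<in> eqv \<Gamma> (X ?\<chi>) M" "h \<in> eqv \<Gamma> M (X ?\<chi>)"
      "\<And>x. x \<in> carrier (X ?\<chi>) \<Longrightarrow> h (f x) = x" "\<And>n. n \<in> carrier M \<Longrightarrow> f (h n) = n"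
      using irreducible_same_character[OF irrD(1)[OF \<chi>] 2 irrD(2)[OF \<chi>]] by metis
    have "isodecomp M 1 (\<lambda>_. ?\<chi>) (\<lambda>_. f) (\<lambda>_. h)"
      unfolding isodecomp_def using \<chi> fh m(2) by (simp add: vfinsum_insert Pi_iff lessThan_Suc)
    then show ?thesis by blast
  next
    case (3 W)
    obtain P where P: "P \<in> eqv \<Gamma> M M" "\<And>v. v \<in> carrier M \<Longrightarrow> P v \<in> W" "\<And>w. w \<in> W \<Longrightarrow> P w = w"
      using Maschke[OF M 3(2)] by metis
    define Q where "Q = (\<lambda>v. v \<oplus>\<^bsub>M\<^esub> (-1) \<odot>\<^bsub>M\<^esub> P v)"
    have Q: "Q \<in> eqv \<Gamma> M M" unfolding Q_def by (intro eqv_add eqv_id eqv_smult P M)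
    define K where "K = {v \<in> carrier M. P v = \<zero>\<^bsub>M\<^esub>}"
    have K: "gsub \<Gamma> M K" unfolding K_def by (rule kernel_gsub[OF M M P(1)])
    have WM: "\<And>w. w \<in> W \<Longrightarrow> w \<in> carrier M" using 3(2) by (auto simp: gsub_def lin_closed_def)
    have Pc: "\<And>v. v \<in> carrier M \<Longrightarrow> P v \<in> carrier M" using P(2) WM by simp
    have QK: "Q v \<in> K" if "v \<in> carrier M" for v
    proof -
      have "P (Q v) = P v \<oplus>\<^bsub>M\<^esub> (-1) \<odot>\<^bsub>M\<^esub> P v"
        using that Pc m(2) P by (simp add: Q_def mhom_add[OF eqv_mhom[OF P(1)]] mhom_smult[OF eqv_mhom[OF P(1)]])
      also have "\<dots> = \<zero>\<^bsub>M\<^esub>" by (rule vneg[OF m(2) Pc[OF that]])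
      finally show ?thesis unfolding K_def using eqv_closed[OF Q that] by simp
    qed
    have Kid: "Q w = w" "P w = \<zero>\<^bsub>M\<^esub>" if "w \<in> K" for w using that m(2) by (auto simp: K_def Q_def)
    have Wz: "Q w = \<zero>\<^bsub>M\<^esub>" if "w \<in> W" for w using P(3)[OF that] vneg[OF m(2) WM[OF that]] by (simp add: Q_def)
    have PQ: "P v \<oplus>\<^bsub>M\<^esub> Q v = v" if "v \<in> carrier M" for v
    proof -
      have "P v \<oplus>\<^bsub>M\<^esub> Q v = v \<oplus>\<^bsub>M\<^esub> (P v \<oplus>\<^bsub>M\<^esub> (-1) \<odot>\<^bsub>M\<^esub> P v)"
        unfolding Q_def using that Pc m(2) by (simp add: vadd_ac(3)[OF m(2)])
      then show ?thesis using vneg[OF m(2) Pc[OF that]] that m(2) by simp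
    qed
    let ?W = "M\<lparr>carrier := W\<rparr>" and ?K = "M\<lparr>carrier := K\<rparr>"
    note sW = gsub_gmod[OF M 3(2)] and sK = gsub_gmod[OF M K]
    have PW: "P \<in> mhom M ?W" using eqv_mhom[OF P(1)] P(2) by (auto simp: LinearCombinations.module_hom_def)
    have QK': "Q \<in> mhom M ?K" using eqv_mhom[OF Q] QK by (auto simp: LinearCombinations.module_hom_def)
    \<comment> \<open>Dimensions are traces of identities. The identity of \<open>M\<close> is the
      sum of \<open>P\<close> and \<open>Q\<close>, whose traces are by cyclicity those of the
      identities of \<open>W\<close> and \<open>K\<close>.\<close>
    have "vtrace M (\<lambda>v. P v \<oplus>\<^bsub>M\<^esub> Q v) = vtrace M P + vtrace M Q"
      by (rule vtrace_add[OF m(1) eqv_mhom[OF P(1)] eqv_mhom[OF Q]])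
    moreover have "vtrace M (\<lambda>v. P v \<oplus>\<^bsub>M\<^esub> Q v) = vtrace M (\<lambda>v. v)"
      by (rule vtrace_cong[OF m(1) mhom_id, symmetric]) (use PQ in simp)
    moreover have "vtrace M P = vtrace ?W (\<lambda>v. v)"
      using vtrace_cyclic[OF m(1) is_gmodD(1)[OF sW(1)] PW eqv_mhom[OF sW(2)]]
        vtrace_cong[OF is_gmodD(1)[OF sW(1)] mhom_id, of P] P(3) by simp
    moreover have "vtrace M Q = vtrace ?K (\<lambda>v. v)"
      using vtrace_cyclic[OF m(1) is_gmodD(1)[OF sK(1)] QK' eqv_mhom[OF sK(2)]]
        vtrace_cong[OF is_gmodD(1)[OF sK(1)] mhom_id, of Q] Kid by simp
    ultimately have "of_nat (vectorspace.dim Cf M) = (of_nat (vectorspace.dim Cf ?W + vectorspace.dim Cf ?K) :: complex)"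
      using vtrace_id[OF m(1)] vtrace_id[OF is_gmodD(1)[OF sW(1)]] vtrace_id[OF is_gmodD(1)[OF sK(1)]] by simp
    then have dim: "vectorspace.dim Cf M = vectorspace.dim Cf ?W + vectorspace.dim Cf ?K" by (simp only: of_nat_eq_iff)
    \<comment> \<open>Each part is smaller than \<open>M\<close> only because the other is nonzero;
      a vector \<open>v\<close> outside \<open>W\<close> has a nonzero component \<open>Q v\<close>
      in \<open>K\<close>.\<close>
    have "\<exists>v\<in>carrier M. v \<notin> W" using 3(4) WM by blast
    then obtain v where v: "v \<in> carrier M" "v \<notin> W" by blast
    have "Q v \<noteq> \<zero>\<^bsub>M\<^esub>" using PQ[OF v(1)] v P(2)[OF v(1)] Pc[OF v(1)] m(2) by auto
    then have "carrier ?K \<noteq> {\<zero>\<^bsub>?K\<^esub>}" using QK[OF v(1)] by auto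
    then have dK: "vectorspace.dim Cf ?K > 0" by (rule dim_pos[OF is_gmodD(1)[OF sK(1)]])
    have dW: "vectorspace.dim Cf ?W > 0" by (rule dim_pos[OF is_gmodD(1)[OF sW(1)]]) (use 3(3) in simp)
    obtain n1 k1 f1 g1 where d1: "isodecomp ?W n1 k1 f1 g1" using less.hyps[OF _ sW(1)] dim dK by auto
    obtain n2 k2 f2 g2 where d2: "isodecomp ?K n2 k2 f2 g2" using less.hyps[OF _ sK(1)] dim dW by auto
    show ?thesis
      by (rule isodecomp_combine[OF M P(1) Q 3(2) P(2,3) Wz K QK Kid PQ d1 d2])
  qed
qed

section \<open>Characters and multiplicities\<close>

text \<open>The identity of \<open>M\<close> is the sum of the composites of \<open>g i\<close> and
  \<open>f i\<close>. Cyclicity moves each trace to \<open>X (k i)\<close>, where the two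
  equivariant maps cancel.\<close>

lemma isodecomp_character:
  assumes M: "is_gmod \<Gamma> M" and d: "isodecomp M n k f g" and x: "x \<in> \<Gamma>"
  shows "character \<Gamma> M x = (\<Sum>i<n. k i x)"
proof -
  note D = isodecompD[OF d] and m = is_gmodD[OF M]
  have fg: "(\<lambda>v. f i (g i (act M x v))) \<in> mhom M M" if "i < n" for i
    by (rule mhom_comp[OF m(3)[OF x] mhom_comp[OF eqv_mhom[OF D(3)[OF that]] eqv_mhom[OF D(2)[OF that]]]])
  have "vtrace M (act M x) = vtrace M (\<lambda>v. finsum M (\<lambda>i. f i (g i (act M x v))) {..<n})"
    by (rule vtrace_cong[OF m(1) m(3)[OF x]]) (use D(6) m x in simp)
  also have "\<dots> = (\<Sum>i<n. vtrace M (\<lambda>v. f i (g i (act M x v))))"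
    by (rule vtrace_finsum[OF m(1)]) (use fg in auto)
  also have "\<dots> = (\<Sum>i<n. k i x)"
  proof (rule sum.cong[OF refl])
    fix i assume "i \<in> {..<n}"
    then have i: "i < n" by simp
    note I = irrD[OF D(1)[OF i]] note ii = is_gmodD[OF I(3)]
    have "vtrace M (\<lambda>v. f i (g i (act M x v))) = vtrace (X (k i)) (\<lambda>w. g i (act M x (f i w)))"
      by (rule vtrace_cyclic[OF m(1) I(4) mhom_comp[OF m(3)[OF x] eqv_mhom[OF D(3)[OF i]]] eqv_mhom[OF D(2)[OF i]]])
    also have "\<dots> = vtrace (X (k i)) (act (X (k i)) x)"
      by (rule vtrace_cong[OF I(4) ii(3)[OF x], symmetric])
        (use x i D(4)[OF i] ii eqv_closed[OF D(2)[OF i]] in \<open>simp add: eqv_act[OF D(3)[OF i], symmetric] eqv_act[OF D(2)[OF i], symmetric]\<close>)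
    also have "\<dots> = k i x" using I(2) x unfolding character_def by (metis restrict_apply')
    finally show "vtrace M (\<lambda>v. f i (g i (act M x v))) = k i x" .
  qed
  finally show ?thesis using x by (simp add: character_def)
qed

lemma char_inner_irr:
  assumes "\<chi> \<in> Irr TYPE('u) \<Gamma>" "\<psi> \<in> Irr TYPE('u) \<Gamma>"
  shows "char_inner \<Gamma> \<chi> \<psi> = (if \<chi> = \<psi> then 1 else 0)"
  using char_inner_self[OF irrD(1)[OF assms(1)]] char_inner_distinct[OF irrD(1)[OF assms(1)] irrD(1)[OF assms(2)]]
    irrD(2)[OF assms(1)] irrD(2)[OF assms(2)] by auto

lemma char_inner_cong: "(\<And>g. g \<in> \<Gamma> \<Longrightarrow> \<chi> g = \<chi>' g) \<Longrightarrow> (\<And>g. g \<in> \<Gamma> \<Longrightarrow> \<psi> g = \<psi>' g) \<Longrightarrow> char_inner \<Gamma> \<chi> \<psi> = char_inner \<Gamma> \<chi>' \<psi>'"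
  by (simp add: char_inner_def)

lemma char_inner_sum_left: "char_inner \<Gamma> (\<lambda>g. \<Sum>i\<in>A. a i * \<phi> i g) \<psi> = (\<Sum>i\<in>A. a i * char_inner \<Gamma> (\<phi> i) \<psi>)"
proof -
  have "(\<Sum>g\<in>\<Gamma>. (\<Sum>i\<in>A. a i * \<phi> i g) * cnj (\<psi> g)) = (\<Sum>i\<in>A. a i * (\<Sum>g\<in>\<Gamma>. \<phi> i g * cnj (\<psi> g)))"
    by (simp add: sum_distrib_left sum_distrib_right mult.assoc) (rule sum.swap)
  then show ?thesis by (simp add: char_inner_def flip: sum_divide_distrib)
qed

lemma char_inner_cnj: "char_inner \<Gamma> \<psi> \<chi> = cnj (char_inner \<Gamma> \<chi> \<psi>)"
  by (simp add: char_inner_def mult.commute)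

lemma char_inner_sum_right: "char_inner \<Gamma> \<psi> (\<lambda>g. \<Sum>i\<in>A. a i * \<phi> i g) = (\<Sum>i\<in>A. cnj (a i) * char_inner \<Gamma> \<psi> (\<phi> i))"
  by (subst char_inner_cnj, subst char_inner_sum_left) (simp add: char_inner_cnj[of _ \<psi>])

lemma char_inner_diff: "char_inner \<Gamma> (\<lambda>g. a g - b g) \<psi> = char_inner \<Gamma> a \<psi> - char_inner \<Gamma> b \<psi>"
  "char_inner \<Gamma> \<psi> (\<lambda>g. a g - b g) = char_inner \<Gamma> \<psi> a - char_inner \<Gamma> \<psi> b"
  by (simp_all add: char_inner_def algebra_simps sum_subtractf diff_divide_distrib)

lemma char_inner_ge_0: "Re (char_inner \<Gamma> \<psi> \<psi>) \<ge> 0"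
  unfolding char_inner_def
  by (simp add: complex_norm_square[symmetric] flip: of_real_sum of_real_power) (simp add: sum_nonneg)

text \<open>By orthogonality the inner product counts summands. In particular it is a natural
  number, as the definition of \<open>mckay_mult\<close> presupposes.\<close>

lemma char_inner_isodecomp:
  assumes M: "is_gmod \<Gamma> M" and d: "isodecomp M n k f g" and \<chi>: "\<chi> \<in> Irr TYPE('u) \<Gamma>"
  shows "char_inner \<Gamma> (character \<Gamma> M) \<chi> = of_nat (card {i. i < n \<and> k i = \<chi>})"
proof -
  have "char_inner \<Gamma> (character \<Gamma> M) \<chi> = char_inner \<Gamma> (\<lambda>g. \<Sum>i<n. 1 * k i g) \<chi>"
    by (rule char_inner_cong) (simp_all add: isodecomp_character[OF M d])
  also have "\<dots> = (\<Sum>i<n. char_inner \<Gamma> (k i) \<chi>)" by (subst char_inner_sum_left) simp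
  also have "\<dots> = (\<Sum>i<n. if k i = \<chi> then 1 else 0)"
    by (rule sum.cong) (auto simp: char_inner_irr \<chi> isodecompD(1)[OF d])
  also have "\<dots> = of_nat (card {i. i < n \<and> k i = \<chi>})"
    by (simp flip: sum.inter_filter add: lessThan_def Collect_conj_eq)
  finally show ?thesis .
qed

lemma character_one:
  assumes "\<chi> \<in> Irr TYPE('u) \<Gamma>" shows "\<chi> (1\<^sub>m 2) = of_nat (vectorspace.dim Cf (X \<chi>))"
proof -
  note I = irrD[OF assms]
  have "character \<Gamma> (X \<chi>) (1\<^sub>m 2) = vtrace (X \<chi>) (act (X \<chi>) (1\<^sub>m 2))" by (simp add: character_def)
  also have "\<dots> = vtrace (X \<chi>) (\<lambda>v. v)"
    by (rule vtrace_cong[OF I(4) is_gmodD(3)[OF I(3) one_mem]]) (use is_gmodD[OF I(3)] in simp)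
  finally show ?thesis using vtrace_id[OF I(4)] I(2) by simp
qed

lemma irr_dim_pos: "\<chi> \<in> Irr TYPE('u) \<Gamma> \<Longrightarrow> vectorspace.dim Cf (X \<chi>) > 0"
  by (rule irreducible_dim_pos[OF irrD(1)])

text \<open>Bessel's inequality for the indicator function of the neutral element.\<close>

lemma finite_irr [simp]: "finite (Irr TYPE('u) \<Gamma>)"
proof -
  have "card S \<le> card \<Gamma>" if S: "S \<subseteq> Irr TYPE('u) \<Gamma>" "finite S" for S
  proof -
    define \<delta> :: cfun where "\<delta> = (\<lambda>g. if g = 1\<^sub>m 2 then 1 else 0)"
    define N :: real where "N = real (card \<Gamma>)"
    have N: "N > 0" by (simp add: N_def)
    \<comment> \<open>These are the coefficients of the indicator function: its inner product with
      \<open>\<chi>\<close> picks out the value at the identity, a dimension, and divides by the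
      order of the group.\<close>
    define a where "a = (\<lambda>\<chi>. real (vectorspace.dim Cf (X \<chi>)) / N)"
    have d\<chi>: "char_inner \<Gamma> \<delta> \<chi> = of_real (a \<chi>)" if "\<chi> \<in> Irr TYPE('u) \<Gamma>" for \<chi>
    proof -
      have "(\<Sum>g\<in>\<Gamma>. \<delta> g * cnj (\<chi> g)) = (\<Sum>g\<in>\<Gamma>. if g = 1\<^sub>m 2 then cnj (\<chi> g) else 0)"
        by (rule sum.cong) (auto simp: \<delta>_def)
      then show ?thesis unfolding char_inner_def using character_one[OF that] by (simp add: a_def N_def)
    qed
    have \<chi>d: "char_inner \<Gamma> \<chi> \<delta> = of_real (a \<chi>)" if "\<chi> \<in> Irr TYPE('u) \<Gamma>" for \<chi>
      using d\<chi>[OF that] char_inner_cnj[of \<chi> \<delta>] by simp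
    define s :: cfun where "s = (\<lambda>g. \<Sum>\<chi>\<in>S. of_real (a \<chi>) * \<chi> g)"
    have dd: "char_inner \<Gamma> \<delta> \<delta> = of_real (1 / N)"
    proof -
      have "(\<Sum>g\<in>\<Gamma>. \<delta> g * cnj (\<delta> g)) = (\<Sum>g\<in>\<Gamma>. if g = 1\<^sub>m 2 then 1 else 0)"
        by (rule sum.cong) (auto simp: \<delta>_def)
      then show ?thesis by (simp add: char_inner_def N_def)
    qed
    have ds: "char_inner \<Gamma> \<delta> s = of_real (\<Sum>\<chi>\<in>S. (a \<chi>)\<^sup>2)"
      unfolding s_def char_inner_sum_right using d\<chi> S by (simp add: power2_eq_square subset_iff)
    have sd: "char_inner \<Gamma> s \<delta> = of_real (\<Sum>\<chi>\<in>S. (a \<chi>)\<^sup>2)"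
      unfolding s_def char_inner_sum_left using \<chi>d S by (simp add: power2_eq_square subset_iff)
    have "char_inner \<Gamma> \<chi> s = of_real (a \<chi>)" if "\<chi> \<in> S" for \<chi>
    proof -
      have "char_inner \<Gamma> \<chi> s = (\<Sum>\<psi>\<in>S. if \<chi> = \<psi> then of_real (a \<psi>) else 0)"
        unfolding s_def char_inner_sum_right using that S by (intro sum.cong refl) (auto simp: char_inner_irr subset_iff)
      then show ?thesis using that S by simp
    qed
    then have ss: "char_inner \<Gamma> s s = of_real (\<Sum>\<chi>\<in>S. (a \<chi>)\<^sup>2)"
      by (subst (1) s_def, subst char_inner_sum_left) (simp add: power2_eq_square)
    have "Re (char_inner \<Gamma> (\<lambda>g. \<delta> g - s g) (\<lambda>g. \<delta> g - s g)) = 1 / N - (\<Sum>\<chi>\<in>S. (a \<chi>)\<^sup>2)"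
      unfolding char_inner_diff dd ds sd ss by simp
    then have le: "(\<Sum>\<chi>\<in>S. (a \<chi>)\<^sup>2) \<le> 1 / N" using char_inner_ge_0[of "\<lambda>g. \<delta> g - s g"] by simp
    \<comment> \<open>Every dimension is at least 1, so each character in \<open>S\<close>
      contributes at least \<open>1 / N\<^sup>2\<close> to a sum bounded by \<open>1 / N\<close>.
      Hence \<open>S\<close> has at most \<open>N\<close> elements.\<close>
    have "1 / N\<^sup>2 \<le> (a \<chi>)\<^sup>2" if "\<chi> \<in> S" for \<chi>
    proof -
      have "1 \<le> real (vectorspace.dim Cf (X \<chi>))" using irr_dim_pos[of \<chi>] that S by auto
      then have "1 / N \<le> a \<chi>" using N by (simp add: a_def divide_right_mono)
      then show ?thesis using power_mono[of "1 / N" "a \<chi>" 2] N by (simp add: power_divide)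
    qed
    then have "real (card S) * (1 / N\<^sup>2) \<le> (\<Sum>\<chi>\<in>S. (a \<chi>)\<^sup>2)" using sum_mono[of S "\<lambda>_. 1 / N\<^sup>2" "\<lambda>\<chi>. (a \<chi>)\<^sup>2"] by simp
    with le have "real (card S) * (1 / N\<^sup>2) \<le> 1 / N" by linarith
    then show ?thesis using N by (simp add: field_simps power2_eq_square N_def)
  qed
  then show ?thesis
    using infinite_arbitrarily_large[of "Irr TYPE('u) \<Gamma>" "Suc (card \<Gamma>)"] by (metis Suc_n_not_le_n)
qed

end

section \<open>The standard module\<close>

lemma module_vec_simps' [simp]:
  "carrier (module_vec TYPE(complex) n) = carrier_vec n" "\<zero>\<^bsub>module_vec TYPE(complex) n\<^esub> = 0\<^sub>v n"
  "v \<oplus>\<^bsub>module_vec TYPE(complex) n\<^esub> w = v + w" "a \<odot>\<^bsub>module_vec TYPE(complex) n\<^esub> v = a \<cdot>\<^sub>v v"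
  by (simp_all add: module_vec_def)

lemma vs_vec: "vs (module_vec TYPE(complex) n)"
  by (rule vsI) (auto simp: smult_smult_assoc add_smult_distrib_vec smult_add_distrib_vec intro!: eq_vecI)

lemma frame_vec: "frame (module_vec TYPE(complex) n) {..<n} (unit_vec n) (\<lambda>i v. v $ i)"
proof (rule frameI)
  show "finsum (module_vec TYPE(complex) n) (\<lambda>i. (v $ i) \<odot>\<^bsub>module_vec TYPE(complex) n\<^esub> unit_vec n i) {..<n} = v" (is "?S = _")
    if "v \<in> carrier (module_vec TYPE(complex) n)" for v
  proof (rule eq_vecI)
    have c: "?S \<in> carrier_vec n" using vfinsum_closed[OF vs_vec, of "\<lambda>i. (v $ i) \<cdot>\<^sub>v unit_vec n i" "{..<n}" n] by simp
    show "dim_vec ?S = dim_vec v" using c that by simp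
    fix j assume j: "j < dim_vec v"
    have e: "(\<lambda>v. v $ j) \<in> mhom (module_vec TYPE(complex) n) Cline" using j that by (intro mhomI) auto
    have "?S $ j = (\<Sum>i<n. ((v $ i) \<cdot>\<^sub>v unit_vec n i) $ j)"
      using mhom_finsum[OF vs_vec vs_Cline e, of "{..<n}" "\<lambda>i. (v $ i) \<cdot>\<^sub>v unit_vec n i"] by simp
    also have "\<dots> = (\<Sum>i<n. if i = j then v $ i else 0)" using j that by (intro sum.cong) auto
    finally show "?S $ j = v $ j" using j that by simp
  qed
qed (auto intro!: mhomI)

lemma Xstd_simps [simp]:
  "carrier Xstd = carrier_vec 2" "\<zero>\<^bsub>Xstd\<^esub> = 0\<^sub>v 2" "v \<oplus>\<^bsub>Xstd\<^esub> w = v + w" "a \<odot>\<^bsub>Xstd\<^esub> v = a \<cdot>\<^sub>v v" "act Xstd g v = g *\<^sub>v v"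
  by (simp_all add: Xstd_def)

lemma fdvs_Xstd [simp]: "fdvs Xstd"
  unfolding Xstd_def using fdvsI[OF vs_vec frame_vec] by simp

lemma frame_Xstd: "frame Xstd {..<2} (unit_vec 2) (\<lambda>i v. v $ i)"
  unfolding Xstd_def by (rule frame_with_act[OF vs_vec frame_vec])

lemma SL2_Cayley_Hamilton:
  fixes A :: "complex mat"
  assumes "A \<in> carrier_mat 2 2" "det A = 1"
  shows "A * A = mtrace A \<cdot>\<^sub>m A - 1\<^sub>m 2"
proof (rule eq_matI)
  fix i j :: nat assume "i < dim_row (mtrace A \<cdot>\<^sub>m A - 1\<^sub>m 2)" "j < dim_col (mtrace A \<cdot>\<^sub>m A - 1\<^sub>m 2)"
  then have "i = 0 \<or> i = 1" "j = 0 \<or> j = 1" using assms by auto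
  then show "(A * A) $$ (i, j) = (mtrace A \<cdot>\<^sub>m A - 1\<^sub>m 2) $$ (i, j)"
    using assms det2[OF assms(1)] by (auto simp: mtrace_def scalar_prod_def numeral_2_eq_2 algebra_simps)
qed (use assms in auto)

text \<open>By the theorem of Cayley and Hamilton the difference of \<open>A\<close> and the
  identity has square zero, so the powers depend linearly on the exponent.\<close>

lemma SL2_unipotent_pow:
  fixes A :: "complex mat"
  assumes A: "A \<in> carrier_mat 2 2" "det A = 1" "mtrace A = 2"
  shows "A ^\<^sub>m k = of_nat k \<cdot>\<^sub>m A - (of_nat k - 1) \<cdot>\<^sub>m 1\<^sub>m 2"
proof (induction k)
  case 0
  show ?case by (rule eq_matI) (use A in auto)
next
  case (Suc k)
  have AA: "A * A = 2 \<cdot>\<^sub>m A - 1\<^sub>m 2" using SL2_Cayley_Hamilton[OF A(1,2)] A(3) by simp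
  have "A ^\<^sub>m Suc k = of_nat k \<cdot>\<^sub>m (A * A) - (of_nat k - 1) \<cdot>\<^sub>m A"
    using A by (simp add: Suc minus_mult_distrib_mat[of _ 2 2 _ _ 2] mult_smult_assoc_mat[of _ 2 2 _ 2])
  then show ?case unfolding AA by (intro eq_matI) (use A in \<open>auto simp: algebra_simps\<close>)
qed

text \<open>A unipotent matrix of finite order is the identity: the linear formula for the power
  \<open>Suc k\<close> can only give the identity if \<open>A\<close> is the identity.\<close>

lemma SL2_trace_2:
  fixes A :: "complex mat"
  assumes A: "A \<in> carrier_mat 2 2" "det A = 1" "mtrace A = 2" and k: "A ^\<^sub>m Suc k = 1\<^sub>m 2"
  shows "A = 1\<^sub>m 2"
proof (rule eq_matI)
  have e: "of_nat (Suc k) \<cdot>\<^sub>m A - of_nat k \<cdot>\<^sub>m 1\<^sub>m 2 = 1\<^sub>m 2" using SL2_unipotent_pow[OF A, of "Suc k"] k by simp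
  fix i j :: nat assume ij: "i < dim_row (1\<^sub>m 2)" "j < dim_col (1\<^sub>m 2)"
  have "(of_nat (Suc k) \<cdot>\<^sub>m A - of_nat k \<cdot>\<^sub>m 1\<^sub>m 2) $$ (i, j) = of_nat (Suc k) * A $$ (i, j) - of_nat k * 1\<^sub>m 2 $$ (i, j)"
    using ij A by simp
  then have "of_nat (Suc k) * A $$ (i, j) = of_nat (Suc k) * (1\<^sub>m 2 $$ (i, j) :: complex)" unfolding e by (simp add: algebra_simps)
  then show "A $$ (i, j) = 1\<^sub>m 2 $$ (i, j)" by (simp only: mult_cancel_left of_nat_eq_0_iff) simp
qed (use A in auto)

context finite_SL2
begin

lemma gmod_Xstd [simp]: "is_gmod \<Gamma> Xstd"
proof (rule is_gmodI)
  show "act Xstd g \<in> mhom Xstd Xstd" if "g \<in> \<Gamma>" for g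
    using mat_closed(1)[OF that] by (intro mhomI) (auto simp: mult_add_distrib_mat_vec mult_mat_vec)
  show "act Xstd (g * h) m = act Xstd g (act Xstd h m)" if "g \<in> \<Gamma>" "h \<in> \<Gamma>" "m \<in> carrier Xstd" for g h m
    using assoc_mult_mat_vec[of g 2 2 h 2 m] mat_closed(1)[OF that(1)] mat_closed(1)[OF that(2)] that by simp
qed auto

definition chi_std :: cfun where "chi_std = character \<Gamma> Xstd"

lemma chi_std_mtrace: "g \<in> \<Gamma> \<Longrightarrow> chi_std g = mtrace g"
proof -
  assume g: "g \<in> \<Gamma>"
  have "vtrace Xstd (act Xstd g) = (\<Sum>i<2. (g *\<^sub>v unit_vec 2 i) $ i)"
    using vtrace_frame[OF fdvs_Xstd frame_Xstd is_gmodD(3)[OF gmod_Xstd g]] by simp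
  also have "\<dots> = mtrace g"
    using mat_closed(1)[OF g] by (auto simp: mtrace_def intro!: sum.cong)
  finally show ?thesis using g by (simp add: chi_std_def character_def)
qed

lemma ginv_adj2: "g \<in> \<Gamma> \<Longrightarrow> ginv g = adj2 g"
proof -
  assume g: "g \<in> \<Gamma>"
  have a: "adj2 g * g = 1\<^sub>m 2" by (rule adj2_mult[OF mat_closed[OF g]])
  have c: "adj2 g \<in> carrier_mat 2 2" by (simp add: adj2_def)
  have "adj2 g = adj2 g * (g * ginv g)" using g c by simp
  also have "\<dots> = adj2 g * g * ginv g"
    using assoc_mult_mat[OF c mat_closed(1)[OF g] mat_closed(1)[OF ginv_mem[OF g]]] by simp
  finally show ?thesis using a g by simp
qed

text \<open>The value at the inverse is the conjugate value, while the inverse in \<open>SL2\<close>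
  is the adjugate and has the same trace.\<close>

lemma chi_std_real: "g \<in> \<Gamma> \<Longrightarrow> cnj (chi_std g) = chi_std g"
proof -
  assume g: "g \<in> \<Gamma>"
  have "cnj (chi_std g) = mtrace (adj2 g)"
    using character_ginv[OF gmod_Xstd g] chi_std_mtrace[OF ginv_mem[OF g]] g by (simp add: chi_std_def ginv_adj2)
  also have "\<dots> = mtrace g" using mat_closed(1)[OF g] by (simp add: adj2_def mtrace_def numeral_2_eq_2)
  finally show ?thesis using chi_std_mtrace[OF g] by simp
qed

lemma chi_std_le: "g \<in> \<Gamma> \<Longrightarrow> cmod (chi_std g) \<le> 2"
proof -
  assume g: "g \<in> \<Gamma>"
  obtain k where "g ^\<^sub>m Suc k = 1\<^sub>m 2" using ginv_power[OF g] by blast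
  from mtrace_finite_order(2)[OF mat_closed(1)[OF g] this] show ?thesis using chi_std_mtrace[OF g] by simp
qed

text \<open>A real value of modulus 2 is 2 or -2. The case 2 is \<open>SL2_trace_2\<close>, the case
  -2 is the same statement for \<open>- g\<close>.\<close>

lemma chi_std_extreme:
  assumes g: "g \<in> \<Gamma>" and c: "cmod (chi_std g) = 2"
  shows "g = 1\<^sub>m 2 \<or> g = - 1\<^sub>m 2"
proof -
  note G = mat_closed[OF g]
  obtain k where k: "g ^\<^sub>m Suc k = 1\<^sub>m 2" using ginv_power[OF g] by blast
  have Re: "chi_std g = of_real (Re (chi_std g))" using chi_std_real[OF g] by (simp add: Reals_cnj_iff of_real_Re)
  then have "\<bar>Re (chi_std g)\<bar> = 2" using c by (metis norm_of_real)
  then have "chi_std g = 2 \<or> chi_std g = -2" using Re by (auto simp: abs_if split: if_splits) (metis add.inverse_inverse of_real_minus of_real_numeral)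
  then show ?thesis
  proof
    assume "chi_std g = 2"
    then show ?thesis using SL2_trace_2[OF G _ k] chi_std_mtrace[OF g] by simp
  next
    assume t: "chi_std g = -2"
    have c: "- g \<in> carrier_mat 2 2" using G by simp
    have "mtrace (- g) = - mtrace g" using G by (simp add: mtrace_def sum_negf)
    then have "mtrace (- g) = 2" using t chi_std_mtrace[OF g] by simp
    moreover have "det (- g) = 1" using det2[OF c] det2[OF G(1)] G by simp
    \<comment> \<open>An even exponent removes the sign, so \<open>- g\<close> has finite order
      whether or not it lies in \<open>\<Gamma>\<close>.\<close>
    moreover have "(- g) ^\<^sub>m (2 * Suc k) = 1\<^sub>m 2"
    proof -
      have m: "- g = (-1) \<cdot>\<^sub>m g" by (rule eq_matI) auto
      have pw: "(- g) ^\<^sub>m j = ((-1) ^ j) \<cdot>\<^sub>m (g ^\<^sub>m j)" for j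
      proof (induction j)
        case (Suc j)
        have gj: "g ^\<^sub>m j \<in> carrier_mat 2 2" by (rule pow_carrier_mat[OF G(1)])
        show ?case
          by (rule eq_matI) (use gj G in \<open>auto simp: Suc mult_smult_assoc_mat[OF gj c] scalar_prod_def sum_negf sum_distrib_left\<close>)
      qed (use G in auto)
      have "(-1 :: complex) ^ (2 * Suc k) = 1" by (simp only: power_mult) simp
      moreover have "1 \<cdot>\<^sub>m (g ^\<^sub>m (2 * Suc k)) = g ^\<^sub>m (2 * Suc k)" by (rule eq_matI) auto
      ultimately have "(- g) ^\<^sub>m (2 * Suc k) = g ^\<^sub>m (Suc k + Suc k)" by (simp only: pw mult_2)
      also have "\<dots> = g ^\<^sub>m Suc k * g ^\<^sub>m Suc k"
      proof -
        have "g ^\<^sub>m (i + j) = g ^\<^sub>m i * g ^\<^sub>m j" for i j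
          by (induction j) (use G in \<open>auto simp: assoc_mult_mat[of _ 2 2 _ 2 _ 2]\<close>)
        then show ?thesis .
      qed
      finally show ?thesis using k by simp
    qed
    moreover have "2 * Suc k = Suc (2 * k + 1)" by simp
    ultimately have "- g = 1\<^sub>m 2" using SL2_trace_2[OF c] by metis
    then have "g = - 1\<^sub>m 2" using G by (metis uminus_uminus_mat)
    then show ?thesis ..
  qed
qed

lemma gmod_trivial: "is_gmod \<Gamma> (triv Cline)"
  by simp

lemma character_trivial: "character \<Gamma> (triv Cline) = (\<lambda>g\<in>\<Gamma>. 1)"
proof -
  have "vtrace (triv Cline) (\<lambda>v. v) = 1"
    using vtrace_frame[OF fdvs_Cline frame_Cline mhom_id] by (simp add: triv_def mhom_id)
  then show ?thesis by (simp add: character_def triv_def restrict_def fun_eq_iff)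
qed

lemma irreducible_trivial: "irreducible_gmod \<Gamma> (triv Cline)"
proof (rule irreducibleI[OF gmod_trivial])
  show "carrier (triv Cline) \<noteq> {\<zero>\<^bsub>triv Cline\<^esub>}" by (simp add: triv_def) (metis UNIV_I one_neq_zero singletonD)
  fix W assume W: "gsub \<Gamma> (triv Cline) W"
  show "W = {\<zero>\<^bsub>triv Cline\<^esub>} \<or> W = carrier (triv Cline)"
  proof (cases "\<exists>w\<in>W. w \<noteq> 0")
    case True
    then obtain w where w: "w \<in> W" "w \<noteq> 0" by blast
    have "z \<in> W" for z using W w unfolding gsub_def lin_closed_def triv_def
      by simp (metis nonzero_divide_eq_eq)
    then show ?thesis by (auto simp: triv_def)
  next
    case False
    then show ?thesis using W unfolding gsub_def lin_closed_def triv_def by auto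
  qed
qed

end

context irreducibles
begin

lemma trivial_irr: "(\<lambda>g\<in>\<Gamma>. 1) \<in> Irr TYPE('u) \<Gamma>"
  using irreducible_in_irr[OF irreducible_trivial] by (simp add: character_trivial)

lemma character_Xstd_tensor:
  assumes "\<chi> \<in> Irr TYPE('u) \<Gamma>" "g \<in> \<Gamma>"
  shows "character \<Gamma> (gtensor Xstd (X \<chi>)) g = \<chi> g * chi_std g"
  using character_gtensor[OF gmod_Xstd irrD(3)[OF assms(1)] assms(2)] irrD(2)[OF assms(1)]
  by (simp add: chi_std_def mult.commute)

text \<open>\<open>mckay_mult\<close> is a definite description of a natural number. It is justified
  by a decomposition of the tensor product, in which the inner product counts the summands with
  character \<open>\<chi>'\<close>.\<close>

lemma mckay_mult_isodecomp:
  assumes \<chi>: "\<chi> \<in> Irr TYPE('u) \<Gamma>" and \<chi>': "\<chi>' \<in> Irr TYPE('u) \<Gamma>" and d: "isodecomp (gtensor Xstd (X \<chi>)) n k f g"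
  shows "char_inner \<Gamma> (\<lambda>g. \<chi> g * chi_std g) \<chi>' = of_nat (mckay_mult \<Gamma> \<chi> \<chi>')"
    "mckay_mult \<Gamma> \<chi> \<chi>' = card {i. i < n \<and> k i = \<chi>'}"
proof -
  have "char_inner \<Gamma> (\<lambda>g. \<chi> g * chi_std g) \<chi>' = char_inner \<Gamma> (character \<Gamma> (gtensor Xstd (X \<chi>))) \<chi>'"
    by (rule char_inner_cong) (simp_all add: character_Xstd_tensor[OF \<chi>])
  also have "\<dots> = of_nat (card {i. i < n \<and> k i = \<chi>'})"
    by (rule char_inner_isodecomp[OF gmod_gtensor[OF gmod_Xstd irrD(3)[OF \<chi>]] d \<chi>'])
  finally have e: "char_inner \<Gamma> (\<lambda>g. \<chi> g * chi_std g) \<chi>' = of_nat (card {i. i < n \<and> k i = \<chi>'})" .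
  then show "mckay_mult \<Gamma> \<chi> \<chi>' = card {i. i < n \<and> k i = \<chi>'}"
    unfolding mckay_mult_def chi_std_def by (intro the_equality) auto
  then show "char_inner \<Gamma> (\<lambda>g. \<chi> g * chi_std g) \<chi>' = of_nat (mckay_mult \<Gamma> \<chi> \<chi>')" using e by simp
qed

lemma mckay_mult_eq:
  assumes "\<chi> \<in> Irr TYPE('u) \<Gamma>" "\<chi>' \<in> Irr TYPE('u) \<Gamma>"
  shows "char_inner \<Gamma> (\<lambda>g. \<chi> g * chi_std g) \<chi>' = of_nat (mckay_mult \<Gamma> \<chi> \<chi>')"
  using mckay_mult_isodecomp(1)[OF assms] isodecomp_exists[OF gmod_gtensor[OF gmod_Xstd irrD(3)[OF assms(1)]]] by blast

text \<open>As \<open>chi_std\<close> is real, it moves from one side of the inner product to the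
  other. Edges are unordered while \<open>mckay_mult\<close> takes an ordered pair; this makes the
  two agree.\<close>

lemma mckay_mult_sym:
  assumes "\<chi> \<in> Irr TYPE('u) \<Gamma>" "\<chi>' \<in> Irr TYPE('u) \<Gamma>"
  shows "mckay_mult \<Gamma> \<chi> \<chi>' = mckay_mult \<Gamma> \<chi>' \<chi>"
proof -
  have "char_inner \<Gamma> (\<lambda>g. \<chi>' g * chi_std g) \<chi> = cnj (char_inner \<Gamma> \<chi> (\<lambda>g. \<chi>' g * chi_std g))" by (rule char_inner_cnj)
  also have "char_inner \<Gamma> \<chi> (\<lambda>g. \<chi>' g * chi_std g) = char_inner \<Gamma> (\<lambda>g. \<chi> g * chi_std g) \<chi>'"
    by (simp add: char_inner_def chi_std_real mult.assoc mult.commute mult.left_commute)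
  finally have "(of_nat (mckay_mult \<Gamma> \<chi>' \<chi>) :: complex) = of_nat (mckay_mult \<Gamma> \<chi> \<chi>')"
    using mckay_mult_eq[OF assms] mckay_mult_eq[OF assms(2,1)] by simp
  then show ?thesis by simp
qed

lemma irr_norm: 
  assumes "\<chi> \<in> Irr TYPE('u) \<Gamma>" shows "(\<Sum>g\<in>\<Gamma>. (cmod (\<chi> g))\<^sup>2) = card \<Gamma>"
proof -
  have "(\<Sum>g\<in>\<Gamma>. \<chi> g * cnj (\<chi> g)) = of_nat (card \<Gamma>)"
    using char_inner_irr[OF assms assms] by (simp add: char_inner_def)
  moreover have "complex_of_real (\<Sum>g\<in>\<Gamma>. (cmod (\<chi> g))\<^sup>2) = (\<Sum>g\<in>\<Gamma>. \<chi> g * cnj (\<chi> g))"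
    by (simp only: of_real_sum complex_norm_square)
  ultimately have "complex_of_real (\<Sum>g\<in>\<Gamma>. (cmod (\<chi> g))\<^sup>2) = of_real (real (card \<Gamma>))" by simp
  then show ?thesis by (simp only: of_real_eq_iff)
qed

text \<open>If the multiplicity is at least two, then \<open>\<chi> \<chi>\<^sub>s\<^sub>t\<^sub>d - 2 \<chi>'\<close> has norm zero, and \<open>\<bar>\<chi>\<^sub>s\<^sub>t\<^sub>d\<bar>\<close> attains
  its maximum on the support of \<open>\<chi>\<close>.\<close>

lemma mckay_mult_ge_2:
  assumes \<chi>: "\<chi> \<in> Irr TYPE('u) \<Gamma>" and \<chi>': "\<chi>' \<in> Irr TYPE('u) \<Gamma>" and m: "mckay_mult \<Gamma> \<chi> \<chi>' \<ge> 2" and g: "g \<in> \<Gamma>"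
  shows "\<chi> g * chi_std g = 2 * \<chi>' g" "\<chi> g \<noteq> 0 \<Longrightarrow> g = 1\<^sub>m 2 \<or> g = - 1\<^sub>m 2"
proof -
  define F where "F = (\<lambda>g. (cmod (\<chi> g * chi_std g - 2 * \<chi>' g))\<^sup>2)"
  \<comment> \<open>\<open>E\<close> measures how far \<open>chi_std\<close> stays below its bound 2
    on the support of \<open>\<chi>\<close>; \<open>F\<close> is the integrand of the norm that is
    to vanish.\<close>
  define E where "E = (\<lambda>g. (cmod (\<chi> g))\<^sup>2 * (4 - (cmod (chi_std g))\<^sup>2))"
  have F0: "F g \<ge> 0" for g by (simp add: F_def)
  have E0: "E g \<ge> 0" if "g \<in> \<Gamma>" for g
  proof -
    have "(cmod (chi_std g))\<^sup>2 \<le> 2\<^sup>2" by (rule power_mono[OF chi_std_le[OF that]]) simp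
    then show ?thesis unfolding E_def by (intro mult_nonneg_nonneg) auto
  qed
  define R where "R = (\<lambda>g. Re (\<chi> g * chi_std g * cnj (\<chi>' g)))"
  \<comment> \<open>The terms with the square of \<open>chi_std\<close> cancel. What remains sums to
    \<open>4 + 4\<close> minus four times the multiplicity, all times the order of the group, and
    this is not positive for multiplicity at least 2.\<close>
  have FE: "F g + E g = 4 * (cmod (\<chi> g))\<^sup>2 + 4 * (cmod (\<chi>' g))\<^sup>2 - 4 * R g" for g
    by (simp add: R_def F_def E_def cmod_power2 power_mult_distrib norm_mult) (simp add: power2_eq_square algebra_simps)
  have re: "(\<Sum>g\<in>\<Gamma>. R g) = real (mckay_mult \<Gamma> \<chi> \<chi>') * card \<Gamma>"
  proof -
    have "(\<Sum>g\<in>\<Gamma>. \<chi> g * chi_std g * cnj (\<chi>' g)) = of_nat (mckay_mult \<Gamma> \<chi> \<chi>') * of_nat (card \<Gamma>)"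
      using mckay_mult_eq[OF \<chi> \<chi>'] by (simp add: char_inner_def field_simps)
    then have "Re (\<Sum>g\<in>\<Gamma>. \<chi> g * chi_std g * cnj (\<chi>' g)) = Re (of_nat (mckay_mult \<Gamma> \<chi> \<chi>' * card \<Gamma>))" by simp
    then show ?thesis by (simp add: R_def)
  qed
  have "(\<Sum>g\<in>\<Gamma>. F g + E g) = 4 * card \<Gamma> + 4 * card \<Gamma> - 4 * (real (mckay_mult \<Gamma> \<chi> \<chi>') * card \<Gamma>)"
    by (simp add: FE sum.distrib sum_subtractf re flip: sum_distrib_left) (simp add: irr_norm[OF \<chi>] irr_norm[OF \<chi>'])
  also have "\<dots> \<le> 0"
  proof -
    have "2 * real (card \<Gamma>) \<le> real (mckay_mult \<Gamma> \<chi> \<chi>') * card \<Gamma>" using m by (intro mult_right_mono) auto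
    then show ?thesis by simp
  qed
  finally have s0: "(\<Sum>g\<in>\<Gamma>. F g + E g) = 0" using sum_nonneg[of \<Gamma> "\<lambda>g. F g + E g"] F0 E0 by (simp add: add_nonneg_nonneg order_antisym)
  have "F g + E g = 0" by (rule sum_nonneg_0[OF fin _ s0 g]) (use F0 E0 in \<open>auto intro: add_nonneg_nonneg\<close>)
  then have z: "F g = 0" "E g = 0" using F0[of g] E0[OF g] by linarith+
  then show "\<chi> g * chi_std g = 2 * \<chi>' g" by (simp add: F_def)
  show "g = 1\<^sub>m 2 \<or> g = - 1\<^sub>m 2" if "\<chi> g \<noteq> 0"
  proof (rule chi_std_extreme[OF g])
    have "(cmod (chi_std g))\<^sup>2 = 2\<^sup>2" using z(2) that by (simp add: E_def)
    then show "cmod (chi_std g) = 2" by (rule power2_eq_imp_eq) auto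
  qed
qed

text \<open>By \<open>mckay_mult_ge_2\<close> both characters vanish outside the identity and its
  negative. The sum of an irreducible character over the group is the order of the group or 0,
  according to whether it is trivial; with the norm this bounds the order by 2.\<close>

lemma mckay_mult_le_1:
  assumes \<chi>: "\<chi> \<in> Irr TYPE('u) \<Gamma>" and \<chi>': "\<chi>' \<in> Irr TYPE('u) \<Gamma>"
    and nt: "\<Gamma> \<noteq> {1\<^sub>m 2}" and n2: "\<Gamma> \<noteq> {1\<^sub>m 2, - (1\<^sub>m 2)}"
  shows "mckay_mult \<Gamma> \<chi> \<chi>' \<le> 1"
proof (rule ccontr)
  assume "\<not> ?thesis"
  then have m: "mckay_mult \<Gamma> \<chi> \<chi>' \<ge> 2" by simp
  note M = mckay_mult_ge_2[OF \<chi> \<chi>' m]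
  let ?I = "1\<^sub>m 2 :: complex mat"
  define N where "N = real (card \<Gamma>)"
  have N: "N > 0" by (simp add: N_def)
  have ne: "- ?I \<noteq> ?I"
  proof
    assume "- ?I = ?I"
    then have "(- ?I) $$ (0, 0) = ?I $$ (0, 0)" by simp
    then show False by simp
  qed
  have c1: "chi_std ?I = 2" using chi_std_mtrace[OF one_mem] by (simp add: mtrace_def)
  define d where "d = real (vectorspace.dim Cf (X \<chi>))"
  have d: "\<chi> ?I = of_real d" "d > 0" using character_one[OF \<chi>] irr_dim_pos[OF \<chi>] by (simp_all add: d_def)
  have d': "\<chi>' ?I = of_real d" using M(1)[OF one_mem] c1 d by simp
  have tr: "(\<Sum>g\<in>\<Gamma>. \<psi> g) = (if \<psi> = (\<lambda>g\<in>\<Gamma>. 1) then of_real N else 0)" if "\<psi> \<in> Irr TYPE('u) \<Gamma>" for \<psi>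
    using char_inner_irr[OF that trivial_irr] by (auto simp: char_inner_def N_def split: if_splits)
  have supp: "\<chi> g = 0" "\<chi>' g = 0" if "g \<in> \<Gamma>" "g \<noteq> ?I" "g \<noteq> - ?I" for g
  proof -
    show "\<chi> g = 0" using M(2)[OF that(1)] that by blast
    then show "\<chi>' g = 0" using M(1)[OF that(1)] by simp
  qed
  show False
  proof (cases "- ?I \<in> \<Gamma>")
    case False
    \<comment> \<open>Only the identity contributes. So the order of the group is \<open>d\<close>
      by the sum and the square of \<open>d\<close> by the norm, which makes the group
      trivial.\<close>
    have "(\<Sum>g\<in>\<Gamma>. \<chi> g) = (\<Sum>g\<in>{?I}. \<chi> g)" by (rule sum.mono_neutral_right) (use supp False in auto)
    then have 1: "of_real d = (if \<chi> = (\<lambda>g\<in>\<Gamma>. 1) then complex_of_real N else 0)" using tr[OF \<chi>] d by simp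
    have "(\<Sum>g\<in>\<Gamma>. (cmod (\<chi> g))\<^sup>2) = (\<Sum>g\<in>{?I}. (cmod (\<chi> g))\<^sup>2)" by (rule sum.mono_neutral_right) (use supp False in auto)
    then have 2: "d\<^sup>2 = N" using irr_norm[OF \<chi>] d by (simp add: N_def)
    have "d = N" using 1 d(2) by (auto split: if_splits)
    then have "N = 1" using 2 N by (simp add: power2_eq_square)
    then have "card \<Gamma> = 1" by (simp add: N_def)
    then have "\<Gamma> = {?I}" using one_mem by (metis card_1_singletonE singletonD)
    then show False using nt by simp
  next
    case True
    have cm: "chi_std (- ?I) = -2" using chi_std_mtrace[OF True] by (simp add: mtrace_def)
    define x where "x = \<chi> (- ?I)"
    have x': "\<chi>' (- ?I) = - x" using M(1)[OF True] cm by (simp add: x_def)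
    have red: "(\<Sum>g\<in>\<Gamma>. \<phi> g) = \<phi> ?I + \<phi> (- ?I)" if "\<And>g. g \<in> \<Gamma> \<Longrightarrow> g \<noteq> ?I \<Longrightarrow> g \<noteq> - ?I \<Longrightarrow> \<phi> g = 0" for \<phi> :: "complex mat \<Rightarrow> 'c :: comm_monoid_add"
    proof -
      have "(\<Sum>g\<in>\<Gamma>. \<phi> g) = (\<Sum>g\<in>{?I, - ?I}. \<phi> g)" by (rule sum.mono_neutral_right) (use that True in auto)
      then show ?thesis using ne by (simp add: ne[symmetric])
    qed
    \<comment> \<open>\<open>a\<close> and \<open>b\<close> are the sums of \<open>\<chi>\<close>
      and \<open>\<chi>'\<close> over the group, each 0 or \<open>N\<close>. As
      \<open>\<chi>'\<close> arises from \<open>\<chi>\<close> by a change of sign at the negative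
      of the identity, they are \<open>d + r\<close> and \<open>d - r\<close>; their squares add up
      to \<open>2 * N\<close>, so that \<open>a + b = 2\<close>.\<close>
    define a where "a = (if \<chi> = (\<lambda>g\<in>\<Gamma>. 1) then N else 0)"
    define b where "b = (if \<chi>' = (\<lambda>g\<in>\<Gamma>. 1) then N else 0)"
    have 1: "of_real d + x = of_real a" using tr[OF \<chi>] red[of \<chi>] supp d by (simp add: x_def a_def)
    have 2: "of_real d - x = of_real b" using tr[OF \<chi>'] red[of \<chi>'] supp d' x' by (simp add: b_def)
    have "x = of_real (a - d)" using 1 by (simp add: algebra_simps)
    then obtain r where r: "x = of_real r" by blast
    have 3: "d + r = a" using 1 unfolding r by (simp only: of_real_add[symmetric] of_real_eq_iff)
    have 4: "d - r = b" using 2 unfolding r by (simp only: of_real_diff[symmetric] of_real_eq_iff)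
    have 5: "d\<^sup>2 + r\<^sup>2 = N"
      using irr_norm[OF \<chi>] red[of "\<lambda>g. (cmod (\<chi> g))\<^sup>2"] supp d r by (simp add: N_def x_def[symmetric])
    have "a\<^sup>2 + b\<^sup>2 = 2 * N" unfolding 3[symmetric] 4[symmetric] 5[symmetric] by (simp add: power2_eq_square algebra_simps)
    moreover have "a\<^sup>2 = N * a" "b\<^sup>2 = N * b" by (auto simp: a_def b_def power2_eq_square)
    ultimately have "N * (a + b) = N * 2" by (simp add: algebra_simps)
    then have "a + b = 2" using N by simp
    then have "N \<le> 2" using N by (auto simp: a_def b_def split: if_splits)
    then have "card \<Gamma> \<le> card {?I, - ?I}" using ne by (simp add: N_def ne[symmetric])
    then have "{?I, - ?I} = \<Gamma>" by (intro card_seteq[OF fin]) (use True in auto)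
    then show False using n2 by simp
  qed
qed

section \<open>Arrows\<close>

lemma quiver_simps [simp]: "tail (mckay_quiver TYPE('u) \<Gamma>) (a, b, i) = a" "head (mckay_quiver TYPE('u) \<Gamma>) (a, b, i) = b"
  by (simp_all add: mckay_quiver_def)

text \<open>An edge forgets the order of its ends. The symmetry of the multiplicity makes the bound
  on \<open>i\<close> the same in either order.\<close>

lemma arcs_iff: "(a, b, i) \<in> arcs (mckay_quiver TYPE('u) \<Gamma>) \<longleftrightarrow> a \<in> Irr TYPE('u) \<Gamma> \<and> b \<in> Irr TYPE('u) \<Gamma> \<and> i < mckay_mult \<Gamma> a b"
  unfolding mckay_quiver_def mckay_edges_def by (auto simp: doubleton_eq_iff mckay_mult_sym)

lemma arcs_tail_head:
  "h \<in> arcs (mckay_quiver TYPE('u) \<Gamma>) \<Longrightarrow> tail (mckay_quiver TYPE('u) \<Gamma>) h \<in> Irr TYPE('u) \<Gamma>"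
  "h \<in> arcs (mckay_quiver TYPE('u) \<Gamma>) \<Longrightarrow> head (mckay_quiver TYPE('u) \<Gamma>) h \<in> Irr TYPE('u) \<Gamma>"
  by (cases h; simp add: arcs_iff)+

lemma arcs_Sigma:
  "{h \<in> arcs (mckay_quiver TYPE('u) \<Gamma>). tail (mckay_quiver TYPE('u) \<Gamma>) h = \<chi>} =
     (\<lambda>(b, i). (\<chi>, b, i)) ` (SIGMA b:(if \<chi> \<in> Irr TYPE('u) \<Gamma> then Irr TYPE('u) \<Gamma> else {}). {..<mckay_mult \<Gamma> \<chi> b})"
  by (auto simp: arcs_iff image_iff split: if_splits)

lemma finite_arcs [simp]: "finite (arcs (mckay_quiver TYPE('u) \<Gamma>))"
proof -
  have "arcs (mckay_quiver TYPE('u) \<Gamma>) \<subseteq> (\<Union>\<chi>\<in>Irr TYPE('u) \<Gamma>. {h \<in> arcs (mckay_quiver TYPE('u) \<Gamma>). tail (mckay_quiver TYPE('u) \<Gamma>) h = \<chi>})"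
    using arcs_tail_head by auto
  moreover have "finite \<dots>" by (intro finite_UN_I) (auto simp: arcs_Sigma)
  ultimately show ?thesis by (rule finite_subset)
qed

end

text \<open>\<open>Q\<close> factors through its image, on which it is the identity, and cyclicity
  moves the trace there. An idempotent of trace 0 is therefore zero.\<close>

lemma vtrace_idempotent:
  assumes V: "fdvs V" and Q: "Q \<in> mhom V V" and QQ: "\<And>v. v \<in> carrier V \<Longrightarrow> Q (Q v) = Q v"
  shows "vtrace V Q = of_nat (vectorspace.dim Cf (V\<lparr>carrier := Q ` carrier V\<rparr>))" "fdvs (V\<lparr>carrier := Q ` carrier V\<rparr>)"
proof -
  let ?W = "V\<lparr>carrier := Q ` carrier V\<rparr>"
  note vV = fdvs_vs[OF V]
  have W: "lin_closed V (Q ` carrier V)"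
    unfolding lin_closed_def
  proof (intro conjI ballI allI)
    show "\<zero>\<^bsub>V\<^esub> \<in> Q ` carrier V" using mhom_zero[OF vV vV Q] vzero_closed[OF vV] by (metis imageI)
  qed (use Q vV in \<open>auto simp: mhom_closed mhom_add[OF Q, symmetric] mhom_smult[OF Q, symmetric] intro!: imageI\<close>)
  show fW: "fdvs ?W" by (rule subspace_retraction(1)[OF V W])
  have inc: "(\<lambda>w. w) \<in> mhom ?W V" by (rule mhomI) (use mhom_closed[OF Q] in auto)
  have QW: "Q \<in> mhom V ?W" by (rule mhomI) (auto simp: mhom_add[OF Q] mhom_smult[OF Q])
  have "vtrace V Q = vtrace ?W Q" using vtrace_cyclic[OF V fW QW inc] by simp
  also have "\<dots> = vtrace ?W (\<lambda>w. w)" by (rule vtrace_cong[OF fW mhom_id, symmetric]) (use QQ in auto)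
  finally show "vtrace V Q = of_nat (vectorspace.dim Cf ?W)" using vtrace_id[OF fW] by simp
qed

locale mckay_choice = irreducibles \<Gamma> X for \<Gamma> :: "complex mat set" and X :: "cfun \<Rightarrow> 'u gmod" +
  fixes y :: "arrow \<Rightarrow> (complex vec, 'u) tens \<Rightarrow> 'u"
    and yt :: "arrow \<Rightarrow> 'u \<Rightarrow> (complex vec, 'u) tens"
  assumes nontrivial: "\<Gamma> \<noteq> {1\<^sub>m 2}" and arrows: "arrow_choice \<Gamma> X y yt"
begin

lemma arrow_maps:
  assumes "h \<in> arcs (mckay_quiver TYPE('u) \<Gamma>)"
  shows "y h \<in> eqv \<Gamma> (gtensor Xstd (X (tail (mckay_quiver TYPE('u) \<Gamma>) h))) (X (head (mckay_quiver TYPE('u) \<Gamma>) h))"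
    "yt h \<in> eqv \<Gamma> (X (head (mckay_quiver TYPE('u) \<Gamma>) h)) (gtensor Xstd (X (tail (mckay_quiver TYPE('u) \<Gamma>) h)))"
proof -
  let ?Q = "mckay_quiver TYPE('u) \<Gamma>"
  have "\<forall>h\<in>arcs ?Q. y h \<in> GHom \<Gamma> (gtensor Xstd (X (tail ?Q h))) (X (head ?Q h)) \<and>
     yt h \<in> GHom \<Gamma> (X (head ?Q h)) (gtensor Xstd (X (tail ?Q h)))"
  proof (cases "\<Gamma> = {1\<^sub>m 2, - (1\<^sub>m 2)}")
    case True
    then have "mu2_choice \<Gamma> X y yt" using arrows by (simp add: arrow_choice_def)
    then show ?thesis unfolding mu2_choice_def Let_def by (elim exE conjE) assumption
  next
    case False
    then have "generic_choice \<Gamma> X y yt" using arrows by (simp add: arrow_choice_def)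
    then show ?thesis unfolding generic_choice_def Let_def by blast
  qed
  then show "y h \<in> eqv \<Gamma> (gtensor Xstd (X (tail ?Q h))) (X (head ?Q h))" "yt h \<in> eqv \<Gamma> (X (head ?Q h)) (gtensor Xstd (X (tail ?Q h)))"
    using assms GHom_eqv by blast+
qed

lemma Xstd_unit [simp]: "unit_vec 2 i \<in> carrier_vec 2" by simp

text \<open>The scalar of Schur's lemma can be read off at a single nonzero vector.
  \<open>mu2_choice\<close> gives the sections only at \<open>e0\<close> and
  \<open>e1\<close>.\<close>

lemma eqv_scalar_at:
  assumes \<chi>: "\<chi> \<in> Irr TYPE('u) \<Gamma>" and f: "f \<in> eqv \<Gamma> (X \<chi>) (X \<chi>)" and e: "e \<in> carrier (X \<chi>)" "e \<noteq> \<zero>\<^bsub>X \<chi>\<^esub>"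
    and a: "f e = a \<odot>\<^bsub>X \<chi>\<^esub> e" and w: "w \<in> carrier (X \<chi>)"
  shows "f w = a \<odot>\<^bsub>X \<chi>\<^esub> w"
proof -
  note V = irrD(5)[OF \<chi>]
  obtain b where b: "\<forall>v\<in>carrier (X \<chi>). f v = b \<odot>\<^bsub>X \<chi>\<^esub> v" using Schur_scalar[OF irrD(1)[OF \<chi>] f] by blast
  have "(b + - a) \<odot>\<^bsub>X \<chi>\<^esub> e = b \<odot>\<^bsub>X \<chi>\<^esub> e \<oplus>\<^bsub>X \<chi>\<^esub> (-1) \<odot>\<^bsub>X \<chi>\<^esub> (a \<odot>\<^bsub>X \<chi>\<^esub> e)"
    using vadd_smult[OF V e(1), of b "- a"] V e by simp
  also have "\<dots> = \<zero>\<^bsub>X \<chi>\<^esub>" using a b e vneg[OF V vsmult_closed[OF V e(1), of a]] by simp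
  finally have "b = a" using vsmult_eq_zero[OF V e(1)] e(2) by fastforce
  then show ?thesis using b w by simp
qed

text \<open>Arrows with different heads are separated by Schur's lemma. For equal heads
  \<open>mckay_mult_le_1\<close> leaves only \<open>g = h\<close>, the section property; in order
  two the parallel arrows \<open>h1\<close>, \<open>h2\<close> and \<open>h3\<close>,
  \<open>h4\<close> read off the two coordinates of the standard module, and their sections insert
  the corresponding unit vectors.\<close>

lemma y_yt:
  assumes g: "g \<in> arcs (mckay_quiver TYPE('u) \<Gamma>)" and h: "h \<in> arcs (mckay_quiver TYPE('u) \<Gamma>)"
    and t: "tail (mckay_quiver TYPE('u) \<Gamma>) g = tail (mckay_quiver TYPE('u) \<Gamma>) h"
    and w: "w \<in> carrier (X (head (mckay_quiver TYPE('u) \<Gamma>) h))"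
  shows "y g (yt h w) = (if g = h then w else \<zero>\<^bsub>X (head (mckay_quiver TYPE('u) \<Gamma>) g)\<^esub>)"
proof -
  let ?Q = "mckay_quiver TYPE('u) \<Gamma>"
  note hg = arcs_tail_head[OF g] and hh = arcs_tail_head[OF h]
  have c: "(\<lambda>w. y g (yt h w)) \<in> eqv \<Gamma> (X (head ?Q h)) (X (head ?Q g))"
    by (rule eqv_comp[OF arrow_maps(2)[OF h, folded t] arrow_maps(1)[OF g]])
  show ?thesis
  proof (cases "head ?Q g = head ?Q h")
    case False
    then have "character \<Gamma> (X (head ?Q h)) \<noteq> character \<Gamma> (X (head ?Q g))" using irrD(2)[OF hg(2)] irrD(2)[OF hh(2)] by simp
    from Schur_zero[OF irrD(1)[OF hh(2)] irrD(1)[OF hg(2)] this c w] show ?thesis using False by auto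
  next
    case True
    note c' = c[unfolded True]
    show ?thesis
    proof (cases "\<Gamma> = {1\<^sub>m 2, - (1\<^sub>m 2)}")
      case F: False
      have gc: "generic_choice \<Gamma> X y yt" using arrows F by (simp add: arrow_choice_def)
      obtain a b i where gg: "g = (a, b, i)" by (metis prod_cases3)
      obtain j where hh': "h = (a, b, j)" using t True gg by (metis prod_cases3 quiver_simps)
      have "i < mckay_mult \<Gamma> a b" "j < mckay_mult \<Gamma> a b" using g h unfolding gg hh' arcs_iff by auto
      moreover have "mckay_mult \<Gamma> a b \<le> 1" using mckay_mult_le_1[OF _ _ nontrivial F, of a b] g unfolding gg arcs_iff by simp
      ultimately have "g = h" using gg hh' by simp
      then show ?thesis using gc g w by (auto simp: generic_choice_def Let_def)
    next
      case T: True
      have "mu2_choice \<Gamma> X y yt" using arrows T by (simp add: arrow_choice_def)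
      then obtain \<chi>0 \<chi>1 h1 h2 h3 h4 e0 e1 where
        A: "arcs ?Q = {h1, h2, h3, h4}" "distinct [h1, h2, h3, h4]" "\<chi>1 \<noteq> \<chi>0"
        and th: "tail ?Q h1 = \<chi>0" "head ?Q h1 = \<chi>1" "tail ?Q h2 = \<chi>0" "head ?Q h2 = \<chi>1"
         "tail ?Q h3 = \<chi>1" "head ?Q h3 = \<chi>0" "tail ?Q h4 = \<chi>1" "head ?Q h4 = \<chi>0"
        and e: "e0 \<in> carrier (X \<chi>0)" "e0 \<noteq> \<zero>\<^bsub>X \<chi>0\<^esub>" "e1 \<in> carrier (X \<chi>1)" "e1 \<noteq> \<zero>\<^bsub>X \<chi>1\<^esub>"
        and y: "\<And>s. s \<in> carrier Xstd \<Longrightarrow> y h1 (pure Xstd (X \<chi>0) s e0) = (s $ 0) \<odot>\<^bsub>X \<chi>1\<^esub> e1"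
         "\<And>s. s \<in> carrier Xstd \<Longrightarrow> y h2 (pure Xstd (X \<chi>0) s e0) = (s $ 1) \<odot>\<^bsub>X \<chi>1\<^esub> e1"
         "\<And>s c. s \<in> carrier Xstd \<Longrightarrow> y h3 (pure Xstd (X \<chi>1) s (c \<odot>\<^bsub>X \<chi>1\<^esub> e1)) = (s $ 0 * c) \<odot>\<^bsub>X \<chi>0\<^esub> e0"
         "\<And>s c. s \<in> carrier Xstd \<Longrightarrow> y h4 (pure Xstd (X \<chi>1) s (c \<odot>\<^bsub>X \<chi>1\<^esub> e1)) = (s $ 1 * c) \<odot>\<^bsub>X \<chi>0\<^esub> e0"
        and yt: "yt h1 e1 = pure Xstd (X \<chi>0) (unit_vec 2 0) e0" "yt h3 e0 = pure Xstd (X \<chi>1) (unit_vec 2 0) e1"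
         "yt h2 e1 = pure Xstd (X \<chi>0) (unit_vec 2 1) e0" "yt h4 e0 = pure Xstd (X \<chi>1) (unit_vec 2 1) e1"
        unfolding mu2_choice_def Let_def by metis
      have irr: "\<chi>0 \<in> Irr TYPE('u) \<Gamma>" "\<chi>1 \<in> Irr TYPE('u) \<Gamma>"
        using arcs_tail_head[of h1] A(1) th by auto
      note V = irrD(5)[OF irr(1)] irrD(5)[OF irr(2)]
      \<comment> \<open>The given formulas at \<open>c = 1\<close>, because the sections take values
        in tensors with \<open>e1\<close> itself.\<close>
      have y1: "y h3 (pure Xstd (X \<chi>1) s e1) = (s $ 0) \<odot>\<^bsub>X \<chi>0\<^esub> e0" "y h4 (pure Xstd (X \<chi>1) s e1) = (s $ 1) \<odot>\<^bsub>X \<chi>0\<^esub> e0"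
        if "s \<in> carrier Xstd" for s
        using y(3,4)[OF that, of 1] V e by simp_all
      \<comment> \<open>The two possible answers are written as one scalar, in the form that
        \<open>eqv_scalar_at\<close> extends from \<open>e0\<close> or \<open>e1\<close> to the
        whole module.\<close>
      define d :: complex where "d = (if g = h then 1 else 0)"
      have "y g (yt h w) = d \<odot>\<^bsub>X (head ?Q h)\<^esub> w"
      proof (cases "head ?Q h = \<chi>1")
        case h1: True
        then have "h \<in> {h1, h2}" "g \<in> {h1, h2}" using g h A th True by auto
        then have "y g (yt h e1) = d \<odot>\<^bsub>X \<chi>1\<^esub> e1" using A(2) y yt by (auto simp: d_def)
        then show ?thesis using eqv_scalar_at[OF irr(2) c'[unfolded h1] e(3,4) _ w[unfolded h1]] h1 by simp
      next
        case h1: False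
        then have m: "h \<in> {h3, h4}" "g \<in> {h3, h4}" using g h A th True by auto
        then have h0: "head ?Q h = \<chi>0" using th by auto
        have "y g (yt h e0) = d \<odot>\<^bsub>X \<chi>0\<^esub> e0" using m A(2) y1 yt by (auto simp: d_def)
        then show ?thesis using eqv_scalar_at[OF irr(1) c'[unfolded h0] e(1,2) _ w[unfolded h0]] h0 by simp
      qed
      then show ?thesis using w True irrD(5)[OF hh(2)] by (auto simp: d_def)
    qed
  qed
qed

text \<open>Both sides are the dimension of the tensor product: the summands of a decomposition,
  grouped by character, are as many as the arrows with source \<open>\<chi>\<close> and that
  character as head.\<close>

lemma dim_Xstd_tensor:
  assumes "\<chi> \<in> Irr TYPE('u) \<Gamma>"
  shows "vtrace (gtensor Xstd (X \<chi>)) (\<lambda>v. v) =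
    (\<Sum>h | h \<in> arcs (mckay_quiver TYPE('u) \<Gamma>) \<and> tail (mckay_quiver TYPE('u) \<Gamma>) h = \<chi>.
       of_nat (vectorspace.dim Cf (X (head (mckay_quiver TYPE('u) \<Gamma>) h))))"
proof -
  let ?M = "gtensor Xstd (X \<chi>)"
  have M: "is_gmod \<Gamma> ?M" by (rule gmod_gtensor[OF gmod_Xstd irrD(3)[OF assms]])
  obtain n k f g where d: "isodecomp ?M n k f g" using isodecomp_exists[OF M] by blast
  have "vtrace ?M (\<lambda>v. v) = vtrace ?M (act ?M (1\<^sub>m 2))"
    by (rule vtrace_cong[OF is_gmodD(1)[OF M] mhom_id]) (use is_gmodD(5)[OF M] in \<open>simp del: gtensor_simps\<close>)
  also have "\<dots> = (\<Sum>i<n. k i (1\<^sub>m 2))" using isodecomp_character[OF M d one_mem] by (simp add: character_def)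
  also have "\<dots> = (\<Sum>b\<in>Irr TYPE('u) \<Gamma>. \<Sum>i\<in>{i. i < n \<and> k i = b}. k i (1\<^sub>m 2))"
    using isodecompD(1)[OF d] by (subst sum.group[symmetric, of "{..<n}" "Irr TYPE('u) \<Gamma>" k]) (auto simp: image_subset_iff)
  also have "\<dots> = (\<Sum>b\<in>Irr TYPE('u) \<Gamma>. of_nat (mckay_mult \<Gamma> \<chi> b) * of_nat (vectorspace.dim Cf (X b)))"
    by (intro sum.cong refl) (simp add: mckay_mult_isodecomp(2)[OF assms _ d] character_one)
  also have "\<dots> = (\<Sum>b\<in>Irr TYPE('u) \<Gamma>. \<Sum>i<mckay_mult \<Gamma> \<chi> b. of_nat (vectorspace.dim Cf (X b)))" by simp
  also have "\<dots> = (\<Sum>p\<in>(SIGMA b:Irr TYPE('u) \<Gamma>. {..<mckay_mult \<Gamma> \<chi> b}). of_nat (vectorspace.dim Cf (X (fst p))))"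
    by (subst sum.Sigma) (auto simp: case_prod_unfold)
  also have "\<dots> = (\<Sum>h | h \<in> arcs (mckay_quiver TYPE('u) \<Gamma>) \<and> tail (mckay_quiver TYPE('u) \<Gamma>) h = \<chi>.
       of_nat (vectorspace.dim Cf (X (head (mckay_quiver TYPE('u) \<Gamma>) h))))"
    unfolding arcs_Sigma using assms by (subst sum.reindex) (auto simp: inj_on_def case_prod_unfold intro!: sum.cong)
  finally show ?thesis .
qed

lemma yt_y:
  assumes \<chi>: "\<chi> \<in> Irr TYPE('u) \<Gamma>" and t: "t \<in> carrier (tensor Xstd (X \<chi>))"
  shows "finsum (tensor Xstd (X \<chi>)) (\<lambda>h. yt h (y h t)) {h \<in> arcs (mckay_quiver TYPE('u) \<Gamma>). tail (mckay_quiver TYPE('u) \<Gamma>) h = \<chi>} = t"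
proof -
  let ?Q = "mckay_quiver TYPE('u) \<Gamma>"
  let ?A = "{h \<in> arcs ?Q. tail ?Q h = \<chi>}"
  let ?T = "tensor Xstd (X \<chi>)"
  note I = irrD[OF \<chi>]
  have T: "fdvs ?T" "vs ?T" using I by simp_all
  have fA: "finite ?A" by simp
  have y: "y h \<in> mhom ?T (X (head ?Q h))" and yt: "yt h \<in> mhom (X (head ?Q h)) ?T" if "h \<in> ?A" for h
    using eqv_mhom[OF arrow_maps(1)[of h]] eqv_mhom[OF arrow_maps(2)[of h]] that by auto
  have hI: "head ?Q h \<in> Irr TYPE('u) \<Gamma>" if "h \<in> ?A" for h using arcs_tail_head[of h] that by auto
  have m: "(\<lambda>t. yt h (y h t)) \<in> mhom ?T ?T" if "h \<in> ?A" for h by (rule mhom_comp[OF y[OF that] yt[OF that]])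
  define P where "P = (\<lambda>t. finsum ?T (\<lambda>h. yt h (y h t)) ?A)"
  have P: "P \<in> mhom ?T ?T" unfolding P_def by (rule mhom_sum[OF T(2) fA m])
  \<comment> \<open>The complementary idempotent. Once its trace is seen to be 0,
    \<open>vtrace_idempotent\<close> shows that its image is zero, so that \<open>P\<close> is the
    identity.\<close>
  define R where "R = (\<lambda>t. t \<oplus>\<^bsub>?T\<^esub> (-1) \<odot>\<^bsub>?T\<^esub> P t)"
  have R: "R \<in> mhom ?T ?T" unfolding R_def by (intro mhom_plus mhom_id mhom_const_smult P T)
  \<comment> \<open>By \<open>y_yt\<close> only the summand of \<open>g\<close> survives, so
    \<open>P\<close> is invisible to every \<open>y g\<close>. Idempotence follows, since
    \<open>P\<close> is built from the maps \<open>y g\<close>.\<close>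
  have yP: "y g (P t) = y g t" if g: "g \<in> ?A" and t: "t \<in> carrier ?T" for g t
  proof -
    have c: "h \<in> ?A \<Longrightarrow> yt h (y h t) \<in> carrier ?T" for h using mhom_closed[OF m] t by simp
    note vg = irrD(5)[OF hI[OF g]]
    have "y g (P t) = finsum (X (head ?Q g)) (\<lambda>h. y g (yt h (y h t))) ?A"
      unfolding P_def by (rule mhom_finsum[OF T(2) vg y[OF g] fA]) (use c in auto)
    also have "\<dots> = y g (yt g (y g t))"
    proof (rule vfinsum_single[OF vg fA g])
      show "y g (yt g (y g t)) \<in> carrier (X (head ?Q g))" using mhom_closed[OF y[OF g] c[OF g]] .
      show "y g (yt h (y h t)) = \<zero>\<^bsub>X (head ?Q g)\<^esub>" if "h \<in> ?A" "h \<noteq> g" for h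
        using y_yt[of g h "y h t"] g that mhom_closed[OF y[OF that(1)] t] by auto
    qed
    also have "\<dots> = y g t" using y_yt[of g g "y g t"] g mhom_closed[OF y[OF g] t] by simp
    finally show ?thesis .
  qed
  have PP: "P (P t) = P t" if "t \<in> carrier ?T" for t
  proof -
    have "finsum ?T (\<lambda>h. yt h (y h (P t))) ?A = finsum ?T (\<lambda>h. yt h (y h t)) ?A"
      by (rule vfinsum_cong[OF T(2) refl]) (use yP[OF _ that] mhom_closed[OF m] that in auto)
    then show ?thesis using fun_cong[OF P_def, of "P t"] fun_cong[OF P_def, of t] by simp
  qed
  have PR: "P (R t) = \<zero>\<^bsub>?T\<^esub>" if t: "t \<in> carrier ?T" for t
  proof -
    have "P (R t) = P t \<oplus>\<^bsub>?T\<^esub> (-1) \<odot>\<^bsub>?T\<^esub> P t"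
      using t T PP mhom_closed[OF P] by (simp add: R_def mhom_add[OF P] mhom_smult[OF P])
    then show ?thesis using vneg[OF T(2) mhom_closed[OF P t]] by simp
  qed
  have RR: "R (R t) = R t" if t: "t \<in> carrier ?T" for t
    using PR[OF t] mhom_closed[OF R t] T fun_cong[OF R_def, of "R t"] by simp
  have trP: "vtrace ?T P = vtrace ?T (\<lambda>v. v)"
  proof -
    have "vtrace ?T P = (\<Sum>h\<in>?A. vtrace ?T (\<lambda>t. yt h (y h t)))"
      unfolding P_def by (rule vtrace_finsum[OF T(1) fA m])
    also have "\<dots> = (\<Sum>h\<in>?A. of_nat (vectorspace.dim Cf (X (head ?Q h))))"
    proof (rule sum.cong[OF refl])
      fix h assume h: "h \<in> ?A"
      note Ih = irrD[OF hI[OF h]]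
      have "vtrace ?T (\<lambda>t. yt h (y h t)) = vtrace (X (head ?Q h)) (\<lambda>w. y h (yt h w))"
        by (rule vtrace_cyclic[OF T(1) Ih(4) y[OF h] yt[OF h]])
      also have "\<dots> = vtrace (X (head ?Q h)) (\<lambda>w. w)"
        by (rule vtrace_cong[OF Ih(4) mhom_id, symmetric]) (use y_yt[of h h] h in auto)
      finally show "vtrace ?T (\<lambda>t. yt h (y h t)) = of_nat (vectorspace.dim Cf (X (head ?Q h)))"
        using vtrace_id[OF Ih(4)] by simp
    qed
    also have "\<dots> = vtrace (gtensor Xstd (X \<chi>)) (\<lambda>v. v)" using dim_Xstd_tensor[OF \<chi>] by simp
    also have "\<dots> = vtrace ?T (\<lambda>v. v)" unfolding gtensor_def by (rule vtrace_with_act[OF T(1) mhom_id])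
    finally show ?thesis .
  qed
  have "vtrace ?T R = vtrace ?T (\<lambda>v. v) + (-1) * vtrace ?T P"
    unfolding R_def vtrace_add[OF T(1) mhom_id mhom_const_smult[OF T(2) P]] vtrace_smult[OF T(1) P] ..
  then have "vectorspace.dim Cf (?T\<lparr>carrier := R ` carrier ?T\<rparr>) = 0"
    using vtrace_idempotent(1)[OF T(1) R RR] trP by simp
  then have "R ` carrier ?T = {\<zero>\<^bsub>?T\<^esub>}"
    using dim_pos[OF vtrace_idempotent(2)[OF T(1) R RR]] by auto
  then have "R t = \<zero>\<^bsub>?T\<^esub>" using t by blast
  then show ?thesis using vsub_eq_zero[OF T(2) t mhom_closed[OF P t]] by (simp add: R_def P_def)
qed

end

lemma Lin_compose: "vs V \<Longrightarrow> f \<in> Lin V W \<Longrightarrow> g \<in> Lin W Z \<Longrightarrow> compose (carrier V) g f \<in> Lin V Z"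
  unfolding compose_def by (rule restrict_Lin[OF _ mhom_comp[OF Lin_mhom Lin_mhom]])

lemma Lin_id: "vs V \<Longrightarrow> (\<lambda>v\<in>carrier V. v) \<in> Lin V V"
  by (intro restrict_Lin mhom_id)

lemma GHom_compose: "is_gmod \<Gamma> M \<Longrightarrow> f \<in> GHom \<Gamma> M N \<Longrightarrow> g \<in> GHom \<Gamma> N L \<Longrightarrow> compose (carrier M) g f \<in> GHom \<Gamma> M L"
  unfolding compose_def by (rule restrict_GHom[OF _ eqv_comp[OF GHom_eqv GHom_eqv]])

lemma GHom_id: "is_gmod \<Gamma> M \<Longrightarrow> (\<lambda>v\<in>carrier M. v) \<in> GHom \<Gamma> M M"
  by (intro restrict_GHom eqv_id)

lemma Lin_compose_id:
  "f \<in> Lin V W \<Longrightarrow> compose (carrier V) f (\<lambda>v\<in>carrier V. v) = f"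
  "f \<in> Lin V W \<Longrightarrow> compose (carrier V) (\<lambda>v\<in>carrier W. v) f = f"
  by (auto simp: compose_def Lin_iff extensional_def fun_eq_iff mhom_closed)

lemma Lin_compose_assoc:
  "f \<in> Lin U V \<Longrightarrow> compose (carrier U) h (compose (carrier U) g f) = compose (carrier U) (compose (carrier V) h g) f"
  by (auto simp: compose_def fun_eq_iff Lin_closed)

section \<open>The category of module data\<close>

lemma McK_simps [simp]:
  "Ob (McK \<Gamma>) = {N. is_mck \<Gamma> N}" "Mor (McK \<Gamma>) = mck_mor \<Gamma>"
  "Idt (McK \<Gamma>) N = (\<lambda>m\<in>carrier (MM N). m, \<lambda>m\<in>carrier (MMf N). m)"
  "Cmp (McK \<Gamma>) N N' N'' (\<Phi>', \<Psi>') (\<Phi>, \<Psi>) = (compose (carrier (MM N)) \<Phi>' \<Phi>, compose (carrier (MMf N)) \<Psi>' \<Psi>)"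
  by (simp_all add: McK_def)

lemma is_mckD:
  assumes "is_mck \<Gamma> N"
  shows "is_gmod \<Gamma> (MM N)" "is_gmod \<Gamma> (MMf N)" "MD N \<in> GHom \<Gamma> (gtensor Xstd (MM N)) (MM N)"
    "MZ1 N \<in> GHom \<Gamma> (MMf N) (MM N)" "MZ2 N \<in> GHom \<Gamma> (MM N) (MMf N)"
    "fdvs (MM N)" "fdvs (MMf N)" "MD N \<in> mhom (tensor Xstd (MM N)) (MM N)"
    "MZ1 N \<in> mhom (MMf N) (MM N)" "MZ2 N \<in> mhom (MM N) (MMf N)"
proof -
  show 1: "is_gmod \<Gamma> (MM N)" "is_gmod \<Gamma> (MMf N)" "MD N \<in> GHom \<Gamma> (gtensor Xstd (MM N)) (MM N)"
    "MZ1 N \<in> GHom \<Gamma> (MMf N) (MM N)" "MZ2 N \<in> GHom \<Gamma> (MM N) (MMf N)"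
    using assms unfolding is_mck_def by blast+
  show "fdvs (MM N)" "fdvs (MMf N)" using 1(1,2) by (auto dest: is_gmodD(1))
  show "MD N \<in> mhom (tensor Xstd (MM N)) (MM N)" using Lin_mhom[OF GHom_Lin[OF 1(3)]] by simp
  show "MZ1 N \<in> mhom (MMf N) (MM N)" "MZ2 N \<in> mhom (MM N) (MMf N)"
    using Lin_mhom[OF GHom_Lin[OF 1(4)]] Lin_mhom[OF GHom_Lin[OF 1(5)]] by simp_all
qed

lemma mck_morI:
  assumes "\<Phi> \<in> GHom \<Gamma> (MM N) (MM N')" "\<Psi> \<in> GHom \<Gamma> (MMf N) (MMf N')"
    "\<And>t. t \<in> carrier (tensor Xstd (MM N)) \<Longrightarrow> \<Phi> (MD N t) = MD N' (tmap Xstd (MM N) Xstd (MM N') (\<lambda>s. s) \<Phi> t)"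
    "\<And>m. m \<in> carrier (MM N) \<Longrightarrow> \<Psi> (MZ2 N m) = MZ2 N' (\<Phi> m)"
    "\<And>m. m \<in> carrier (MMf N) \<Longrightarrow> \<Phi> (MZ1 N m) = MZ1 N' (\<Psi> m)"
  shows "(\<Phi>, \<Psi>) \<in> mck_mor \<Gamma> N N'"
  using assms by (simp add: mck_mor_def)

lemma mck_morD:
  assumes "(\<Phi>, \<Psi>) \<in> mck_mor \<Gamma> N N'"
  shows "\<Phi> \<in> GHom \<Gamma> (MM N) (MM N')" "\<Psi> \<in> GHom \<Gamma> (MMf N) (MMf N')"
    "t \<in> carrier (tensor Xstd (MM N)) \<Longrightarrow> \<Phi> (MD N t) = MD N' (tmap Xstd (MM N) Xstd (MM N') (\<lambda>s. s) \<Phi> t)"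
    "m \<in> carrier (MM N) \<Longrightarrow> \<Psi> (MZ2 N m) = MZ2 N' (\<Phi> m)"
    "m \<in> carrier (MMf N) \<Longrightarrow> \<Phi> (MZ1 N m) = MZ1 N' (\<Psi> m)"
    "\<Phi> \<in> mhom (MM N) (MM N')" "\<Psi> \<in> mhom (MMf N) (MMf N')" "\<Phi> \<in> Lin (MM N) (MM N')" "\<Psi> \<in> Lin (MMf N) (MMf N')"
  using assms by (auto simp: mck_mor_def intro: GHom_Lin dest: GHom_Lin Lin_mhom)

text \<open>Both sides of the condition on \<open>MD\<close> are linear in the tensor, so pure
  tensors suffice and \<open>tmap\<close> disappears from the condition.\<close>

lemma mck_mor_pureI:
  assumes N: "is_mck \<Gamma> N" and N': "is_mck \<Gamma> N'" and "\<Phi> \<in> GHom \<Gamma> (MM N) (MM N')" "\<Psi> \<in> GHom \<Gamma> (MMf N) (MMf N')"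
    "\<And>s m. s \<in> carrier Xstd \<Longrightarrow> m \<in> carrier (MM N) \<Longrightarrow> \<Phi> (MD N (pure Xstd (MM N) s m)) = MD N' (pure Xstd (MM N') s (\<Phi> m))"
    "\<And>m. m \<in> carrier (MM N) \<Longrightarrow> \<Psi> (MZ2 N m) = MZ2 N' (\<Phi> m)"
    "\<And>m. m \<in> carrier (MMf N) \<Longrightarrow> \<Phi> (MZ1 N m) = MZ1 N' (\<Psi> m)"
  shows "(\<Phi>, \<Psi>) \<in> mck_mor \<Gamma> N N'"
proof (rule mck_morI[OF assms(3,4) _ assms(6,7)])
  note n = is_mckD[OF N] and n' = is_mckD[OF N'] and \<Phi> = Lin_mhom[OF GHom_Lin[OF assms(3)]]
  have T: "tmap Xstd (MM N) Xstd (MM N') (\<lambda>s. s) \<Phi> \<in> mhom (tensor Xstd (MM N)) (tensor Xstd (MM N'))"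
    by (rule tmap_mhom) (use n n' \<Phi> mhom_id in auto)
  fix t assume t: "t \<in> carrier (tensor Xstd (MM N))"
  show "\<Phi> (MD N t) = MD N' (tmap Xstd (MM N) Xstd (MM N') (\<lambda>s. s) \<Phi> t)"
    by (rule tensor_eqI[OF fdvs_Xstd n(6) fdvs_vs[OF n'(6)] mhom_comp[OF n(8) \<Phi>] mhom_comp[OF T n'(8)] _ t])
       (use assms(5) in \<open>simp add: tmap_pure[OF fdvs_Xstd n(6) fdvs_Xstd n'(6) mhom_id \<Phi>]\<close>)
qed

lemma category_McK: "category (McK \<Gamma>)"
  unfolding category_def
proof (intro conjI ballI)
  fix N assume "N \<in> Ob (McK \<Gamma>)"
  then have N: "is_mck \<Gamma> N" by simp
  note n = is_mckD[OF N]
  show "Idt (McK \<Gamma>) N \<in> Mor (McK \<Gamma>) N N"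
    using n Lin_closed[OF GHom_Lin[OF n(3)]]
    by (auto intro!: mck_mor_pureI[OF N N] GHom_id simp: mhom_closed[OF n(9)] mhom_closed[OF n(10)] mhom_closed[OF n(8)])
next
  fix N N' N'' f g assume "N \<in> Ob (McK \<Gamma>)" "N' \<in> Ob (McK \<Gamma>)" "N'' \<in> Ob (McK \<Gamma>)"
    and f: "f \<in> Mor (McK \<Gamma>) N N'" and g: "g \<in> Mor (McK \<Gamma>) N' N''"
  then have N: "is_mck \<Gamma> N" and N': "is_mck \<Gamma> N'" and N'': "is_mck \<Gamma> N''" by simp_all
  note n = is_mckD[OF N] and n' = is_mckD[OF N'] and n'' = is_mckD[OF N'']
  obtain \<Phi> \<Psi> \<Phi>' \<Psi>' where e: "f = (\<Phi>, \<Psi>)" "g = (\<Phi>', \<Psi>')" by (metis surj_pair)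
  note F = mck_morD[OF f[unfolded e McK_simps]] and G = mck_morD[OF g[unfolded e McK_simps]]
  show "Cmp (McK \<Gamma>) N N' N'' g f \<in> Mor (McK \<Gamma>) N N''"
    unfolding e McK_simps
  proof (rule mck_mor_pureI[OF N N'' GHom_compose[OF n(1) F(1) G(1)] GHom_compose[OF n(2) F(2) G(2)]])
    fix s m assume s: "s \<in> carrier Xstd" and m: "m \<in> carrier (MM N)"
    have 1: "pure Xstd (MM N) s m \<in> carrier (tensor Xstd (MM N))" using s m n by (simp del: Xstd_simps)
    have 2: "pure Xstd (MM N') s (\<Phi> m) \<in> carrier (tensor Xstd (MM N'))" using s mhom_closed[OF F(6) m] n' by (simp del: Xstd_simps)
    show "compose (carrier (MM N)) \<Phi>' \<Phi> (MD N (pure Xstd (MM N) s m)) = MD N'' (pure Xstd (MM N'') s (compose (carrier (MM N)) \<Phi>' \<Phi> m))"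
      using F(3)[OF 1] G(3)[OF 2] s m mhom_closed[OF n(8) 1] mhom_closed[OF F(6) m]
      by (simp del: Xstd_simps add: compose_eq tmap_pure[OF fdvs_Xstd n(6) fdvs_Xstd n'(6) mhom_id F(6)] tmap_pure[OF fdvs_Xstd n'(6) fdvs_Xstd n''(6) mhom_id G(6)])
  qed (use F(4,5) G(4,5) mhom_closed[OF F(6)] mhom_closed[OF F(7)] mhom_closed[OF n(9)] mhom_closed[OF n(10)] in \<open>simp_all add: compose_eq\<close>)
next
  fix N N' f assume f: "f \<in> Mor (McK \<Gamma>) N N'"
  obtain \<Phi> \<Psi> where e: "f = (\<Phi>, \<Psi>)" by (metis surj_pair)
  note F = mck_morD(8,9)[OF f[unfolded e McK_simps]]
  show "Cmp (McK \<Gamma>) N N N' f (Idt (McK \<Gamma>) N) = f" "Cmp (McK \<Gamma>) N N' N' (Idt (McK \<Gamma>) N') f = f"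
    unfolding e by (simp_all add: Lin_compose_id[OF F(1)] Lin_compose_id[OF F(2)])
next
  fix N1 N2 N3 N4 f g h assume f: "f \<in> Mor (McK \<Gamma>) N1 N2" and "g \<in> Mor (McK \<Gamma>) N2 N3" and "h \<in> Mor (McK \<Gamma>) N3 N4"
  obtain \<Phi> \<Psi> \<Phi>' \<Psi>' \<Phi>'' \<Psi>'' where e: "f = (\<Phi>, \<Psi>)" "g = (\<Phi>', \<Psi>')" "h = (\<Phi>'', \<Psi>'')" by (metis surj_pair)
  note F = mck_morD(8,9)[OF f[unfolded e McK_simps]]
  show "Cmp (McK \<Gamma>) N1 N3 N4 h (Cmp (McK \<Gamma>) N1 N2 N3 g f) = Cmp (McK \<Gamma>) N1 N2 N4 (Cmp (McK \<Gamma>) N2 N3 N4 h g) f"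
    unfolding e by (simp add: Lin_compose_assoc[OF F(1)] Lin_compose_assoc[OF F(2)])
qed

text \<open>The compatibility relations for the inverse are those for the morphism at the inverse
  images. Invertibility is thereby reduced to bijectivity.\<close>

lemma mck_isoI:
  assumes N: "is_mck \<Gamma> N" and N': "is_mck \<Gamma> N'" and f: "(\<Phi>, \<Psi>) \<in> mck_mor \<Gamma> N N'"
    and b: "bij_betw \<Phi> (carrier (MM N)) (carrier (MM N'))" "bij_betw \<Psi> (carrier (MMf N)) (carrier (MMf N'))"
  shows "is_iso (McK \<Gamma>) N N' (\<Phi>, \<Psi>)"
proof -
  note n = is_mckD[OF N] and n' = is_mckD[OF N'] and F = mck_morD[OF f]
  obtain \<Phi>' where \<Phi>': "\<Phi>' \<in> eqv \<Gamma> (MM N') (MM N)" "\<And>m. m \<in> carrier (MM N) \<Longrightarrow> \<Phi>' (\<Phi> m) = m" "\<And>m. m \<in> carrier (MM N') \<Longrightarrow> \<Phi> (\<Phi>' m) = m"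
    using eqv_inverse[OF n(1) n'(1) GHom_eqv[OF F(1)] b(1)] by metis
  obtain \<Psi>' where \<Psi>': "\<Psi>' \<in> eqv \<Gamma> (MMf N') (MMf N)" "\<And>m. m \<in> carrier (MMf N) \<Longrightarrow> \<Psi>' (\<Psi> m) = m" "\<And>m. m \<in> carrier (MMf N') \<Longrightarrow> \<Psi> (\<Psi>' m) = m"
    using eqv_inverse[OF n(2) n'(2) GHom_eqv[OF F(2)] b(2)] by metis
  let ?\<Phi> = "restrict \<Phi>' (carrier (MM N'))" and ?\<Psi> = "restrict \<Psi>' (carrier (MMf N'))"
  have c: "\<And>m. m \<in> carrier (MM N') \<Longrightarrow> \<Phi>' m \<in> carrier (MM N)" "\<And>m. m \<in> carrier (MMf N') \<Longrightarrow> \<Psi>' m \<in> carrier (MMf N)"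
    using eqv_closed[OF \<Phi>'(1)] eqv_closed[OF \<Psi>'(1)] by auto
  have cF: "\<And>m. m \<in> carrier (MM N) \<Longrightarrow> \<Phi> m \<in> carrier (MM N')" "\<And>m. m \<in> carrier (MMf N) \<Longrightarrow> \<Psi> m \<in> carrier (MMf N')"
    using mhom_closed[OF F(6)] mhom_closed[OF F(7)] by auto
  have "(?\<Phi>, ?\<Psi>) \<in> mck_mor \<Gamma> N' N"
  proof (rule mck_mor_pureI[OF N' N restrict_GHom[OF n'(1) \<Phi>'(1)] restrict_GHom[OF n'(2) \<Psi>'(1)]])
    fix s m assume s: "s \<in> carrier Xstd" and m: "m \<in> carrier (MM N')"
    have 1: "pure Xstd (MM N) s (\<Phi>' m) \<in> carrier (tensor Xstd (MM N))" using s c(1)[OF m] n by (simp del: Xstd_simps)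
    have 2: "pure Xstd (MM N') s m \<in> carrier (tensor Xstd (MM N'))" using s m n' by (simp del: Xstd_simps)
    have "\<Phi> (MD N (pure Xstd (MM N) s (\<Phi>' m))) = MD N' (pure Xstd (MM N') s m)"
      using F(3)[OF 1] s m c \<Phi>'(3) by (simp del: Xstd_simps add: tmap_pure[OF fdvs_Xstd n(6) fdvs_Xstd n'(6) mhom_id F(6)])
    then show "?\<Phi> (MD N' (pure Xstd (MM N') s m)) = MD N (pure Xstd (MM N) s (?\<Phi> m))"
      using \<Phi>'(2)[OF mhom_closed[OF n(8) 1]] m mhom_closed[OF n'(8) 2] by simp
  next
    fix m assume m: "m \<in> carrier (MM N')"
    have "\<Psi> (MZ2 N (\<Phi>' m)) = MZ2 N' m" using F(4)[OF c(1)[OF m]] \<Phi>'(3)[OF m] by simp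
    then show "?\<Psi> (MZ2 N' m) = MZ2 N (?\<Phi> m)"
      using \<Psi>'(2)[OF mhom_closed[OF n(10) c(1)[OF m]]] mhom_closed[OF n'(10) m] m by simp
  next
    fix m assume m: "m \<in> carrier (MMf N')"
    have "\<Phi> (MZ1 N (\<Psi>' m)) = MZ1 N' m" using F(5)[OF c(2)[OF m]] \<Psi>'(3)[OF m] by simp
    then show "?\<Phi> (MZ1 N' m) = MZ1 N (?\<Psi> m)"
      using \<Phi>'(2)[OF mhom_closed[OF n(9) c(2)[OF m]]] mhom_closed[OF n'(9) m] m by simp
  qed
  moreover have "compose (carrier (MM N)) ?\<Phi> \<Phi> = (\<lambda>m\<in>carrier (MM N). m)" "compose (carrier (MMf N)) ?\<Psi> \<Psi> = (\<lambda>m\<in>carrier (MMf N). m)"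
    "compose (carrier (MM N')) \<Phi> ?\<Phi> = (\<lambda>m\<in>carrier (MM N'). m)" "compose (carrier (MMf N')) \<Psi> ?\<Psi> = (\<lambda>m\<in>carrier (MMf N'). m)"
    using \<Phi>' \<Psi>' cF by (auto simp: compose_def intro!: restrict_ext)
  ultimately show ?thesis unfolding is_iso_def using f by (auto intro!: bexI[of _ "(?\<Phi>, ?\<Psi>)"])
qed

section \<open>The category of quiver representations\<close>

context irreducibles
begin

lemma Rep_simps [simp]:
  "Ob (Rep \<Gamma> :: ('u qrep, 'u qmor) cat) = {R. is_qrep \<Gamma> R}" "Mor (Rep \<Gamma> :: ('u qrep, 'u qmor) cat) = qrep_mor \<Gamma>"
  "Idt (Rep \<Gamma>) (R :: 'u qrep) = (\<lambda>\<chi>\<in>Irr TYPE('u) \<Gamma>. \<lambda>v\<in>carrier (RV R \<chi>). v, \<lambda>\<chi>\<in>Irr TYPE('u) \<Gamma>. \<lambda>v\<in>carrier (RVf R \<chi>). v)"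
  "Cmp (Rep \<Gamma>) R R' R'' (\<phi>', \<psi>') (\<phi>, \<psi>) =
     (\<lambda>\<chi>\<in>Irr TYPE('u) \<Gamma>. compose (carrier (RV R \<chi>)) (\<phi>' \<chi>) (\<phi> \<chi>),
      \<lambda>\<chi>\<in>Irr TYPE('u) \<Gamma>. compose (carrier (RVf R \<chi>)) (\<psi>' \<chi>) (\<psi> \<chi>))"
  by (simp_all add: Rep_def Let_def)

lemma is_qrepD:
  assumes "is_qrep \<Gamma> (R :: 'u qrep)"
  shows "\<chi> \<in> Irr TYPE('u) \<Gamma> \<Longrightarrow> fdvs (RV R \<chi>)" "\<chi> \<in> Irr TYPE('u) \<Gamma> \<Longrightarrow> fdvs (RVf R \<chi>)"
    "h \<in> arcs (mckay_quiver TYPE('u) \<Gamma>) \<Longrightarrow> Rx R h \<in> mhom (RV R (tail (mckay_quiver TYPE('u) \<Gamma>) h)) (RV R (head (mckay_quiver TYPE('u) \<Gamma>) h))"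
    "\<chi> \<in> Irr TYPE('u) \<Gamma> \<Longrightarrow> Rv1 R \<chi> \<in> mhom (RVf R \<chi>) (RV R \<chi>)"
    "\<chi> \<in> Irr TYPE('u) \<Gamma> \<Longrightarrow> Rv2 R \<chi> \<in> mhom (RV R \<chi>) (RVf R \<chi>)"
  using assms unfolding is_qrep_def Let_def by (auto dest: PiE_mem intro: Lin_mhom)

lemma qrep_morI:
  assumes "\<phi> \<in> (\<Pi>\<^sub>E \<chi>\<in>Irr TYPE('u) \<Gamma>. Lin (RV R \<chi>) (RV R' \<chi>))" "\<psi> \<in> (\<Pi>\<^sub>E \<chi>\<in>Irr TYPE('u) \<Gamma>. Lin (RVf R \<chi>) (RVf R' \<chi>))"
    "\<And>h v. h \<in> arcs (mckay_quiver TYPE('u) \<Gamma>) \<Longrightarrow> v \<in> carrier (RV R (tail (mckay_quiver TYPE('u) \<Gamma>) h)) \<Longrightarrow>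
       \<phi> (head (mckay_quiver TYPE('u) \<Gamma>) h) (Rx R h v) = Rx R' h (\<phi> (tail (mckay_quiver TYPE('u) \<Gamma>) h) v)"
    "\<And>\<chi> v. \<chi> \<in> Irr TYPE('u) \<Gamma> \<Longrightarrow> v \<in> carrier (RVf R \<chi>) \<Longrightarrow> \<phi> \<chi> (Rv1 R \<chi> v) = Rv1 R' \<chi> (\<psi> \<chi> v)"
    "\<And>\<chi> v. \<chi> \<in> Irr TYPE('u) \<Gamma> \<Longrightarrow> v \<in> carrier (RV R \<chi>) \<Longrightarrow> \<psi> \<chi> (Rv2 R \<chi> v) = Rv2 R' \<chi> (\<phi> \<chi> v)"
  shows "(\<phi>, \<psi>) \<in> qrep_mor \<Gamma> (R :: 'u qrep) R'"
  using assms by (simp add: qrep_mor_def Let_def)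

lemma qrep_morD:
  assumes "(\<phi>, \<psi>) \<in> qrep_mor \<Gamma> (R :: 'u qrep) R'"
  shows "\<phi> \<in> (\<Pi>\<^sub>E \<chi>\<in>Irr TYPE('u) \<Gamma>. Lin (RV R \<chi>) (RV R' \<chi>))" "\<psi> \<in> (\<Pi>\<^sub>E \<chi>\<in>Irr TYPE('u) \<Gamma>. Lin (RVf R \<chi>) (RVf R' \<chi>))"
    "h \<in> arcs (mckay_quiver TYPE('u) \<Gamma>) \<Longrightarrow> v \<in> carrier (RV R (tail (mckay_quiver TYPE('u) \<Gamma>) h)) \<Longrightarrow>
       \<phi> (head (mckay_quiver TYPE('u) \<Gamma>) h) (Rx R h v) = Rx R' h (\<phi> (tail (mckay_quiver TYPE('u) \<Gamma>) h) v)"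
    "\<chi> \<in> Irr TYPE('u) \<Gamma> \<Longrightarrow> v \<in> carrier (RVf R \<chi>) \<Longrightarrow> \<phi> \<chi> (Rv1 R \<chi> v) = Rv1 R' \<chi> (\<psi> \<chi> v)"
    "\<chi> \<in> Irr TYPE('u) \<Gamma> \<Longrightarrow> v \<in> carrier (RV R \<chi>) \<Longrightarrow> \<psi> \<chi> (Rv2 R \<chi> v) = Rv2 R' \<chi> (\<phi> \<chi> v)"
    "\<chi> \<in> Irr TYPE('u) \<Gamma> \<Longrightarrow> \<phi> \<chi> \<in> Lin (RV R \<chi>) (RV R' \<chi>)" "\<chi> \<in> Irr TYPE('u) \<Gamma> \<Longrightarrow> \<psi> \<chi> \<in> Lin (RVf R \<chi>) (RVf R' \<chi>)"
    "\<chi> \<in> Irr TYPE('u) \<Gamma> \<Longrightarrow> \<phi> \<chi> \<in> mhom (RV R \<chi>) (RV R' \<chi>)" "\<chi> \<in> Irr TYPE('u) \<Gamma> \<Longrightarrow> \<psi> \<chi> \<in> mhom (RVf R \<chi>) (RVf R' \<chi>)"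
  using assms by (auto simp: qrep_mor_def Let_def dest: PiE_mem intro!: Lin_mhom)

lemma category_Rep: "category (Rep \<Gamma> :: ('u qrep, 'u qmor) cat)"
  unfolding category_def
proof (intro conjI ballI)
  fix R :: "'u qrep" assume "R \<in> Ob (Rep \<Gamma>)"
  then have R: "is_qrep \<Gamma> R" by simp
  note r = is_qrepD[OF R]
  show "Idt (Rep \<Gamma>) R \<in> Mor (Rep \<Gamma>) R R"
    unfolding Rep_simps
    by (rule qrep_morI) (use r arcs_tail_head in \<open>auto intro!: Lin_id simp: mhom_closed[OF r(3)] mhom_closed[OF r(4)] mhom_closed[OF r(5)]\<close>)
next
  fix R R' R'' :: "'u qrep" and f g assume "R \<in> Ob (Rep \<Gamma>)" "R' \<in> Ob (Rep \<Gamma>)" "R'' \<in> Ob (Rep \<Gamma>)"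
    and f: "f \<in> Mor (Rep \<Gamma>) R R'" and g: "g \<in> Mor (Rep \<Gamma>) R' R''"
  then have R: "is_qrep \<Gamma> R" "is_qrep \<Gamma> R'" "is_qrep \<Gamma> R''" by simp_all
  note r = is_qrepD[OF R(1)]
  obtain \<phi> \<psi> \<phi>' \<psi>' where e: "f = (\<phi>, \<psi>)" "g = (\<phi>', \<psi>')" by (metis surj_pair)
  note F = qrep_morD[OF f[unfolded e Rep_simps]] and G = qrep_morD[OF g[unfolded e Rep_simps]]
  show "Cmp (Rep \<Gamma>) R R' R'' g f \<in> Mor (Rep \<Gamma>) R R''"
    unfolding e Rep_simps
    by (rule qrep_morI)
       (use r arcs_tail_head in \<open>auto intro!: Lin_compose F(6,7) G(6,7) simp: compose_eq mhom_closed[OF r(3)] mhom_closed[OF r(4)] mhom_closed[OF r(5)]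
         mhom_closed[OF F(8)] mhom_closed[OF F(9)] F(3-5) G(3-5)\<close>)
next
  fix R R' :: "'u qrep" and f assume f: "f \<in> Mor (Rep \<Gamma>) R R'"
  obtain \<phi> \<psi> where e: "f = (\<phi>, \<psi>)" by (metis surj_pair)
  note F = qrep_morD[OF f[unfolded e Rep_simps]]
  show "Cmp (Rep \<Gamma>) R R R' f (Idt (Rep \<Gamma>) R) = f" "Cmp (Rep \<Gamma>) R R' R' (Idt (Rep \<Gamma>) R') f = f"
    unfolding e using F(1,2)
    by (auto simp: Lin_compose_id[OF F(6)] Lin_compose_id[OF F(7)] fun_eq_iff PiE_iff extensional_def)
next
  fix R1 R2 R3 R4 :: "'u qrep" and f g h assume f: "f \<in> Mor (Rep \<Gamma>) R1 R2"
  obtain \<phi> \<psi> where e: "f = (\<phi>, \<psi>)" by (metis surj_pair)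
  note F = qrep_morD[OF f[unfolded e Rep_simps]]
  show "Cmp (Rep \<Gamma>) R1 R3 R4 h (Cmp (Rep \<Gamma>) R1 R2 R3 g f) = Cmp (Rep \<Gamma>) R1 R2 R4 (Cmp (Rep \<Gamma>) R2 R3 R4 h g) f"
    unfolding e by (cases g, cases h) (auto intro!: restrict_ext simp: Lin_compose_assoc[OF F(6)] Lin_compose_assoc[OF F(7)])
qed

text \<open>As for \<open>mck_isoI\<close>, vertex by vertex; the inverses have to be made
  extensional both in the character and in the vector.\<close>

lemma rep_isoI:
  assumes R: "is_qrep \<Gamma> (R :: 'u qrep)" and R': "is_qrep \<Gamma> R'" and f: "(\<phi>, \<psi>) \<in> qrep_mor \<Gamma> R R'"
    and b: "\<And>\<chi>. \<chi> \<in> Irr TYPE('u) \<Gamma> \<Longrightarrow> bij_betw (\<phi> \<chi>) (carrier (RV R \<chi>)) (carrier (RV R' \<chi>))"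
      "\<And>\<chi>. \<chi> \<in> Irr TYPE('u) \<Gamma> \<Longrightarrow> bij_betw (\<psi> \<chi>) (carrier (RVf R \<chi>)) (carrier (RVf R' \<chi>))"
  shows "is_iso (Rep \<Gamma>) R R' (\<phi>, \<psi>)"
proof -
  note r = is_qrepD[OF R] and r' = is_qrepD[OF R'] and F = qrep_morD[OF f]
  have "\<exists>h. h \<in> mhom (RV R' \<chi>) (RV R \<chi>) \<and> (\<forall>v\<in>carrier (RV R \<chi>). h (\<phi> \<chi> v) = v) \<and> (\<forall>w\<in>carrier (RV R' \<chi>). \<phi> \<chi> (h w) = w)"
    if "\<chi> \<in> Irr TYPE('u) \<Gamma>" for \<chi> using mhom_inverse[OF fdvs_vs[OF r(1)[OF that]] F(8)[OF that] b(1)[OF that]] by metis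
  then obtain \<phi>' where p: "\<And>\<chi>. \<chi> \<in> Irr TYPE('u) \<Gamma> \<Longrightarrow> \<phi>' \<chi> \<in> mhom (RV R' \<chi>) (RV R \<chi>)"
     "\<And>\<chi> v. \<chi> \<in> Irr TYPE('u) \<Gamma> \<Longrightarrow> v \<in> carrier (RV R \<chi>) \<Longrightarrow> \<phi>' \<chi> (\<phi> \<chi> v) = v"
     "\<And>\<chi> v. \<chi> \<in> Irr TYPE('u) \<Gamma> \<Longrightarrow> v \<in> carrier (RV R' \<chi>) \<Longrightarrow> \<phi> \<chi> (\<phi>' \<chi> v) = v" by metis
  have "\<exists>h. h \<in> mhom (RVf R' \<chi>) (RVf R \<chi>) \<and> (\<forall>v\<in>carrier (RVf R \<chi>). h (\<psi> \<chi> v) = v) \<and> (\<forall>w\<in>carrier (RVf R' \<chi>). \<psi> \<chi> (h w) = w)"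
    if "\<chi> \<in> Irr TYPE('u) \<Gamma>" for \<chi> using mhom_inverse[OF fdvs_vs[OF r(2)[OF that]] F(9)[OF that] b(2)[OF that]] by metis
  then obtain \<psi>' where q: "\<And>\<chi>. \<chi> \<in> Irr TYPE('u) \<Gamma> \<Longrightarrow> \<psi>' \<chi> \<in> mhom (RVf R' \<chi>) (RVf R \<chi>)"
     "\<And>\<chi> v. \<chi> \<in> Irr TYPE('u) \<Gamma> \<Longrightarrow> v \<in> carrier (RVf R \<chi>) \<Longrightarrow> \<psi>' \<chi> (\<psi> \<chi> v) = v"
     "\<And>\<chi> v. \<chi> \<in> Irr TYPE('u) \<Gamma> \<Longrightarrow> v \<in> carrier (RVf R' \<chi>) \<Longrightarrow> \<psi> \<chi> (\<psi>' \<chi> v) = v" by metis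
  define \<phi>'' where "\<phi>'' = (\<lambda>\<chi>\<in>Irr TYPE('u) \<Gamma>. restrict (\<phi>' \<chi>) (carrier (RV R' \<chi>)))"
  define \<psi>'' where "\<psi>'' = (\<lambda>\<chi>\<in>Irr TYPE('u) \<Gamma>. restrict (\<psi>' \<chi>) (carrier (RVf R' \<chi>)))"
  note c = mhom_closed[OF p(1)] mhom_closed[OF q(1)] mhom_closed[OF F(8)] mhom_closed[OF F(9)]
  let ?Q = "mckay_quiver TYPE('u) \<Gamma>"
  have "(\<phi>'', \<psi>'') \<in> qrep_mor \<Gamma> R' R"
  proof (rule qrep_morI)
    show "\<phi>'' \<in> (\<Pi>\<^sub>E \<chi>\<in>Irr TYPE('u) \<Gamma>. Lin (RV R' \<chi>) (RV R \<chi>))" unfolding \<phi>''_def using r' p by (auto intro!: restrict_Lin)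
    show "\<psi>'' \<in> (\<Pi>\<^sub>E \<chi>\<in>Irr TYPE('u) \<Gamma>. Lin (RVf R' \<chi>) (RVf R \<chi>))" unfolding \<psi>''_def using r' q by (auto intro!: restrict_Lin)
  next
    fix h v assume h: "h \<in> arcs ?Q" and v: "v \<in> carrier (RV R' (tail ?Q h))"
    note th = arcs_tail_head[OF h]
    have "\<phi> (head ?Q h) (Rx R h (\<phi>' (tail ?Q h) v)) = Rx R' h v"
      using F(3)[OF h c(1)[OF th(1) v]] p(3)[OF th(1) v] by simp
    then show "\<phi>'' (head ?Q h) (Rx R' h v) = Rx R h (\<phi>'' (tail ?Q h) v)"
      using p(2)[OF th(2) mhom_closed[OF r(3)[OF h] c(1)[OF th(1) v]]] th v mhom_closed[OF r'(3)[OF h] v]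
      by (simp add: \<phi>''_def)
  next
    fix \<chi> v assume \<chi>: "\<chi> \<in> Irr TYPE('u) \<Gamma>" and v: "v \<in> carrier (RVf R' \<chi>)"
    have "\<phi> \<chi> (Rv1 R \<chi> (\<psi>' \<chi> v)) = Rv1 R' \<chi> v" using F(4)[OF \<chi> c(2)[OF \<chi> v]] q(3)[OF \<chi> v] by simp
    then show "\<phi>'' \<chi> (Rv1 R' \<chi> v) = Rv1 R \<chi> (\<psi>'' \<chi> v)"
      using p(2)[OF \<chi> mhom_closed[OF r(4)[OF \<chi>] c(2)[OF \<chi> v]]] \<chi> v mhom_closed[OF r'(4)[OF \<chi>] v] by (simp add: \<phi>''_def \<psi>''_def)
  next
    fix \<chi> v assume \<chi>: "\<chi> \<in> Irr TYPE('u) \<Gamma>" and v: "v \<in> carrier (RV R' \<chi>)"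
    have "\<psi> \<chi> (Rv2 R \<chi> (\<phi>' \<chi> v)) = Rv2 R' \<chi> v" using F(5)[OF \<chi> c(1)[OF \<chi> v]] p(3)[OF \<chi> v] by simp
    then show "\<psi>'' \<chi> (Rv2 R' \<chi> v) = Rv2 R \<chi> (\<phi>'' \<chi> v)"
      using q(2)[OF \<chi> mhom_closed[OF r(5)[OF \<chi>] c(1)[OF \<chi> v]]] \<chi> v mhom_closed[OF r'(5)[OF \<chi>] v] by (simp add: \<phi>''_def \<psi>''_def)
  qed
  moreover have "Cmp (Rep \<Gamma>) R R' R (\<phi>'', \<psi>'') (\<phi>, \<psi>) = Idt (Rep \<Gamma>) R" "Cmp (Rep \<Gamma>) R' R R' (\<phi>, \<psi>) (\<phi>'', \<psi>'') = Idt (Rep \<Gamma>) R'"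
    using p q c by (auto simp: compose_def \<phi>''_def \<psi>''_def intro!: restrict_ext)
  ultimately show ?thesis unfolding is_iso_def using f by (auto intro!: bexI[of _ "(\<phi>'', \<psi>'')"] simp del: Rep_simps(3,4))
qed

end

section \<open>The functor from quiver representations to module data\<close>

lemma vfinsum_mono_neutral:
  assumes V: "vs V" and "finite B" "A \<subseteq> B" "\<And>i. i \<in> B - A \<Longrightarrow> f i = \<zero>\<^bsub>V\<^esub>" "f \<in> A \<rightarrow> carrier V"
  shows "finsum V f B = finsum V f A"
proof -
  have B: "B = A \<union> (B - A)" using assms(3) by blast
  have "finsum V f B = finsum V f A \<oplus>\<^bsub>V\<^esub> finsum V f (B - A)"
    by (subst B, rule vfinsum_Un[OF V]) (use assms in \<open>auto intro: finite_subset\<close>)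
  then show ?thesis using vfinsum_zero[OF V, of "B - A" f] assms(4) vfinsum_closed[OF V assms(5)] V by simp
qed

lemma gsum_mhom:
  assumes f: "\<And>i. i \<in> I \<Longrightarrow> f i \<in> mhom U (M i)"
  shows "(\<lambda>t. \<lambda>i\<in>I. f i t) \<in> mhom U (gsum I M)"
  by (rule mhomI) (auto intro!: restrict_ext simp: mhom_closed[OF f] mhom_add[OF f] mhom_smult[OF f])

lemma triv_simps [simp]:
  "carrier (triv V) = carrier V" "\<zero>\<^bsub>triv V\<^esub> = \<zero>\<^bsub>V\<^esub>" "act (triv V) g = (\<lambda>v. v)" "fdvs (triv V) \<longleftrightarrow> fdvs V"
  "mhom (triv V) U = mhom V U" "mhom U (triv V) = mhom U V"
  by (simp_all add: triv_def)

lemma tmap_triv [simp]: "tmap (triv V) W (triv V') W' f g = tmap V W V' W' f g"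
  by (simp add: tmap_def)

context irreducibles
begin

text \<open>The pure tensor of \<open>v\<close> and \<open>w\<close> in the summand
  \<open>\<chi>\<close> of the direct sum, seen in the copy with carrier in \<open>'u\<close>. These
  elements span the copy, and maps on it are computed on them.\<close>

definition inn :: "(cfun \<Rightarrow> (complex, 'u) module) \<Rightarrow> cfun \<Rightarrow> 'u \<Rightarrow> 'u \<Rightarrow> 'u" where
  "inn V \<chi> v w = enc (total \<Gamma> X V) (single (Irr TYPE('u) \<Gamma>) (\<lambda>\<chi>. gtensor (triv (V \<chi>)) (X \<chi>)) \<chi> (pure (V \<chi>) (X \<chi>) v w))"

definition fdfam :: "(cfun \<Rightarrow> (complex, 'u) module) \<Rightarrow> bool" where
  "fdfam V \<longleftrightarrow> (\<forall>\<chi>\<in>Irr TYPE('u) \<Gamma>. fdvs (V \<chi>))"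

lemma fdfamD: "fdfam V \<Longrightarrow> \<chi> \<in> Irr TYPE('u) \<Gamma> \<Longrightarrow> fdvs (V \<chi>)"
  by (simp add: fdfam_def)

lemma total_gmod:
  assumes "fdfam V" shows "is_gmod \<Gamma> (total \<Gamma> X V)"
  unfolding total_def by (rule gmod_gsum) (use fdfamD[OF assms] irrD in auto)

lemma
  assumes "fdfam V"
  shows encodable_total: "encodable TYPE('u) (total \<Gamma> X V)"
    and FM_gmod: "is_gmod \<Gamma> (gcopy (total \<Gamma> X V) :: 'u gmod)"
    and FM_enc: "enc (total \<Gamma> X V) \<in> eqv \<Gamma> (total \<Gamma> X V) (gcopy (total \<Gamma> X V) :: 'u gmod)"
    and FM_dec: "dec (total \<Gamma> X V) \<in> eqv \<Gamma> (gcopy (total \<Gamma> X V) :: 'u gmod) (total \<Gamma> X V)"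
proof -
  show E: "encodable TYPE('u) (total \<Gamma> X V)" by (rule encodable[OF is_gmodD(1)[OF total_gmod[OF assms]]])
  show "is_gmod \<Gamma> (gcopy (total \<Gamma> X V) :: 'u gmod)" "enc (total \<Gamma> X V) \<in> eqv \<Gamma> (total \<Gamma> X V) (gcopy (total \<Gamma> X V) :: 'u gmod)"
    "dec (total \<Gamma> X V) \<in> eqv \<Gamma> (gcopy (total \<Gamma> X V) :: 'u gmod) (total \<Gamma> X V)"
    by (rule gcopy_gmod[OF E total_gmod[OF assms]])+
qed

lemma summand_vs: "fdfam V \<Longrightarrow> \<chi> \<in> Irr TYPE('u) \<Gamma> \<Longrightarrow> vs (gtensor (triv (V \<chi>)) (X \<chi>))"
  using fdfamD irrD by (auto simp: gtensor_def)

lemma single_total_mhom: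
  assumes "fdfam V" "\<chi> \<in> Irr TYPE('u) \<Gamma>"
  shows "single (Irr TYPE('u) \<Gamma>) (\<lambda>\<chi>. gtensor (triv (V \<chi>)) (X \<chi>)) \<chi> \<in> mhom (tensor (V \<chi>) (X \<chi>)) (total \<Gamma> X V)"
  using single_mhom[of "Irr TYPE('u) \<Gamma>" "\<lambda>\<chi>. gtensor (triv (V \<chi>)) (X \<chi>)" \<chi>, OF summand_vs[OF assms(1)] assms(2)]
  unfolding total_def by simp

lemma bilinear_mhom: "bilinear V W Z b \<Longrightarrow> f \<in> mhom Z Z' \<Longrightarrow> bilinear V W Z' (\<lambda>v w. f (b v w))"
  unfolding bilinear_def by (auto intro: mhom_comp)

lemma inn_bilinear:
  assumes "fdfam V" "\<chi> \<in> Irr TYPE('u) \<Gamma>"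
  shows "bilinear (V \<chi>) (X \<chi>) (gcopy (total \<Gamma> X V)) (inn V \<chi>)"
  unfolding inn_def[abs_def]
  by (rule bilinear_mhom[OF bilinear_mhom[OF bilinear_pure single_total_mhom[OF assms]] eqv_mhom[OF FM_enc[OF assms(1)]]])
     (use fdfamD[OF assms] irrD(5)[OF assms(2)] in auto)

lemmas inn_closed = bilinear_closed[OF inn_bilinear]

lemma single_total_closed:
  assumes "fdfam V" "\<chi> \<in> Irr TYPE('u) \<Gamma>" "t \<in> carrier (tensor (V \<chi>) (X \<chi>))"
  shows "single (Irr TYPE('u) \<Gamma>) (\<lambda>\<chi>. gtensor (triv (V \<chi>)) (X \<chi>)) \<chi> t \<in> carrier (total \<Gamma> X V)"
  by (rule mhom_closed[OF single_total_mhom[OF assms(1,2)] assms(3)])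

lemma dec_inn:
  assumes "fdfam V" "\<chi> \<in> Irr TYPE('u) \<Gamma>" "v \<in> carrier (V \<chi>)" "w \<in> carrier (X \<chi>)"
  shows "dec (total \<Gamma> X V) (inn V \<chi> v w) = single (Irr TYPE('u) \<Gamma>) (\<lambda>\<chi>. gtensor (triv (V \<chi>)) (X \<chi>)) \<chi> (pure (V \<chi>) (X \<chi>) v w)"
  unfolding inn_def by (rule dec_enc[OF encodable_total[OF assms(1)] single_total_closed[OF assms(1,2)]])
    (use assms fdfamD irrD(5) in auto)

lemma single_apply: "k \<in> I \<Longrightarrow> single I M i v k = (if k = i then v else \<zero>\<^bsub>M k\<^esub>)"
  by (simp add: single_def)

lemma inn_act:
  assumes V: "fdfam V" and \<chi>: "\<chi> \<in> Irr TYPE('u) \<Gamma>" and v: "v \<in> carrier (V \<chi>)" and w: "w \<in> carrier (X \<chi>)" and g: "g \<in> \<Gamma>"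
  shows "act (gcopy (total \<Gamma> X V) :: 'u gmod) g (inn V \<chi> v w) = inn V \<chi> v (act (X \<chi>) g w)"
proof -
  have "act (total \<Gamma> X V) g (single (Irr TYPE('u) \<Gamma>) (\<lambda>\<chi>. gtensor (triv (V \<chi>)) (X \<chi>)) \<chi> (pure (V \<chi>) (X \<chi>) v w)) =
     single (Irr TYPE('u) \<Gamma>) (\<lambda>\<chi>. gtensor (triv (V \<chi>)) (X \<chi>)) \<chi> (pure (V \<chi>) (X \<chi>) v (act (X \<chi>) g w))" (is "?l = ?r")
  proof
    fix k
    show "?l k = ?r k"
    proof (cases "k \<in> Irr TYPE('u) \<Gamma>")
      case k: True
      note xk = irrD(4)[OF k] and vk = fdfamD[OF V k] and ak = is_gmodD(3)[OF irrD(3)[OF k] g]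
      have T: "tmap (V k) (X k) (V k) (X k) (\<lambda>v. v) (act (X k) g) \<in> mhom (tensor (V k) (X k)) (tensor (V k) (X k))"
        by (rule tmap_mhom[OF vk xk vk xk mhom_id ak])
      have e: "tmap (triv (V k)) (X k) (triv (V k)) (X k) (act (triv (V k)) g) (act (X k) g) = tmap (V k) (X k) (V k) (X k) (\<lambda>v. v) (act (X k) g)"
        by simp
      show ?thesis
        using k v w mhom_zero[OF _ _ T] vk xk tmap_pure[OF vk xk vk xk mhom_id ak]
        by (auto simp: total_def e single_apply)
    qed (simp add: total_def single_def)
  qed
  then show ?thesis by (simp add: dec_inn[OF V \<chi> v w]) (simp add: inn_def)
qed

text \<open>The existence half of the universal property of a direct sum of tensor products: lift on
  each summand with \<open>tlift\<close> and add up.\<close>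

lemma FM_lift:
  assumes V: "fdfam V" and Z: "vs Z" and b': "\<forall>\<chi>\<in>Irr TYPE('u) \<Gamma>. bilinear (V \<chi>) (X \<chi>) Z (b \<chi>)"
  obtains L where "L \<in> mhom (gcopy (total \<Gamma> X V) :: 'u gmod) Z"
    "\<And>\<chi> v w. \<chi> \<in> Irr TYPE('u) \<Gamma> \<Longrightarrow> v \<in> carrier (V \<chi>) \<Longrightarrow> w \<in> carrier (X \<chi>) \<Longrightarrow> L (inn V \<chi> v w) = b \<chi> v w"
proof -
  let ?I = "Irr TYPE('u) \<Gamma>"
  note b = bspec[OF b']
  define L where "L = (\<lambda>a :: 'u. finsum Z (\<lambda>\<chi>. tlift (V \<chi>) (X \<chi>) Z (b \<chi>) (dec (total \<Gamma> X V) a \<chi>)) ?I)"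
  have tl: "tlift (V \<chi>) (X \<chi>) Z (b \<chi>) \<in> mhom (tensor (V \<chi>) (X \<chi>)) Z" if "\<chi> \<in> ?I" for \<chi>
    by (rule Lin_mhom[OF tlift_Lin[OF fdfamD[OF V that] irrD(4)[OF that] Z b[OF that]]])
  have p: "(\<lambda>m. m \<chi>) \<in> mhom (total \<Gamma> X V) (tensor (V \<chi>) (X \<chi>))" if "\<chi> \<in> ?I" for \<chi>
    using proj_mhom[OF that, of "\<lambda>\<chi>. gtensor (triv (V \<chi>)) (X \<chi>)"] by (simp add: total_def)
  have c: "(\<lambda>a. tlift (V \<chi>) (X \<chi>) Z (b \<chi>) (dec (total \<Gamma> X V) a \<chi>)) \<in> mhom (gcopy (total \<Gamma> X V) :: 'u gmod) Z" if "\<chi> \<in> ?I" for \<chi>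
    by (rule mhom_comp[OF eqv_mhom[OF FM_dec[OF V]] mhom_comp[OF p[OF that] tl[OF that]]])
  have "L \<in> mhom (gcopy (total \<Gamma> X V) :: 'u gmod) Z" unfolding L_def by (rule mhom_sum[OF Z finite_irr c])
  moreover have "L (inn V \<chi> v w) = b \<chi> v w" if "\<chi> \<in> ?I" "v \<in> carrier (V \<chi>)" "w \<in> carrier (X \<chi>)" for \<chi> v w
  proof -
    have z: "tlift (V k) (X k) Z (b k) \<zero>\<^bsub>tensor (V k) (X k)\<^esub> = \<zero>\<^bsub>Z\<^esub>" if "k \<in> ?I" for k
      by (rule mhom_zero[OF vs_tensor Z tl[OF that]]) (use fdfamD[OF V that] irrD(5)[OF that] in auto)
    have bp: "tlift (V \<chi>) (X \<chi>) Z (b \<chi>) (pure (V \<chi>) (X \<chi>) v w) = b \<chi> v w"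
      by (rule tlift_pure[OF fdfamD[OF V that(1)] irrD(4)[OF that(1)] Z b[OF that(1)] that(2,3)])
    have "L (inn V \<chi> v w) = tlift (V \<chi>) (X \<chi>) Z (b \<chi>) (dec (total \<Gamma> X V) (inn V \<chi> v w) \<chi>)"
      unfolding L_def
      by (rule vfinsum_single[OF Z finite_irr that(1)])
        (use that bp z bilinear_closed[OF b[OF that(1)] that(2,3)] in \<open>auto simp: dec_inn[OF V that] single_apply\<close>)
    also have "\<dots> = b \<chi> v w" using bp that by (simp add: dec_inn[OF V that] single_apply)
    finally show ?thesis .
  qed
  ultimately show ?thesis using that by blast
qed

text \<open>The uniqueness half: \<open>gsum_decomp\<close> splits an element into its summands, and
  \<open>tensor_eqI\<close> treats each of them.\<close>

lemma FM_eqI: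
  assumes V: "fdfam V" and Z: "vs Z" and f: "f \<in> mhom (gcopy (total \<Gamma> X V) :: 'u gmod) Z" and g: "g \<in> mhom (gcopy (total \<Gamma> X V) :: 'u gmod) Z"
    and eq: "\<And>\<chi> v w. \<chi> \<in> Irr TYPE('u) \<Gamma> \<Longrightarrow> v \<in> carrier (V \<chi>) \<Longrightarrow> w \<in> carrier (X \<chi>) \<Longrightarrow> f (inn V \<chi> v w) = g (inn V \<chi> v w)"
    and a: "a \<in> carrier (gcopy (total \<Gamma> X V) :: 'u gmod)"
  shows "f a = g a"
proof -
  let ?I = "Irr TYPE('u) \<Gamma>" and ?T = "total \<Gamma> X V" and ?M = "\<lambda>\<chi>. gtensor (triv (V \<chi>)) (X \<chi>)"
  note vT = is_gmodD(2)[OF total_gmod[OF V]] and vF = is_gmodD(2)[OF FM_gmod[OF V]]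
  define m where "m = dec ?T a"
  have m: "m \<in> carrier ?T" unfolding m_def by (rule eqv_closed[OF FM_dec[OF V] a])
  have mk: "m k \<in> carrier (tensor (V k) (X k))" if "k \<in> ?I" for k using m that by (auto simp: total_def)
  have a': "a = enc ?T m" using a unfolding m_def by (simp add: enc_dec del: copy_simps)
  have "m = finsum ?T (\<lambda>k. single ?I ?M k (m k)) ?I"
    using gsum_decomp[of ?I ?M m] summand_vs[OF V] m unfolding total_def by simp
  then have dec: "a = finsum (gcopy ?T :: 'u gmod) (\<lambda>k. enc ?T (single ?I ?M k (m k))) ?I"
    using mhom_finsum[OF vT vF eqv_mhom[OF FM_enc[OF V]] finite_irr, of "\<lambda>k. single ?I ?M k (m k)"]
      single_total_closed[OF V _ mk] a' by (auto simp: Pi_iff)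
  have eqk: "f (enc ?T (single ?I ?M k (m k))) = g (enc ?T (single ?I ?M k (m k)))" if k: "k \<in> ?I" for k
  proof -
    have c: "(\<lambda>t. enc ?T (single ?I ?M k t)) \<in> mhom (tensor (V k) (X k)) (gcopy ?T :: 'u gmod)"
      by (rule mhom_comp[OF single_total_mhom[OF V k] eqv_mhom[OF FM_enc[OF V]]])
    show ?thesis
      by (rule tensor_eqI[OF fdfamD[OF V k] irrD(4)[OF k] Z mhom_comp[OF c f] mhom_comp[OF c g] _ mk[OF k]])
         (use eq[OF k] in \<open>simp add: inn_def\<close>)
  qed
  have cl: "enc ?T (single ?I ?M k (m k)) \<in> carrier (gcopy ?T :: 'u gmod)" if "k \<in> ?I" for k
    by (rule eqv_closed[OF FM_enc[OF V] single_total_closed[OF V that mk[OF that]]])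
  have "f a = finsum Z (\<lambda>k. f (enc ?T (single ?I ?M k (m k)))) ?I"
    by (subst dec, rule mhom_finsum[OF vF Z f finite_irr]) (use cl in auto)
  also have "\<dots> = finsum Z (\<lambda>k. g (enc ?T (single ?I ?M k (m k)))) ?I"
    by (rule vfinsum_cong[OF Z refl]) (use eqk mhom_closed[OF g cl] in auto)
  also have "\<dots> = g a"
    by (subst dec, rule mhom_finsum[OF vF Z g finite_irr, symmetric]) (use cl in auto)
  finally show ?thesis .
qed

text \<open>Once the values on generators are known, equivariance follows from
  \<open>FM_eqI\<close>, and the definition of \<open>total_map\<close> is not unfolded again. In
  the functor the maps \<open>g\<close> are the identity or the multiplication by
  \<open>1 / delta X \<chi>\<close>.\<close>

lemma
  assumes V: "fdfam V" and W: "fdfam W"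
    and f': "\<forall>\<chi>\<in>Irr TYPE('u) \<Gamma>. f \<chi> \<in> mhom (V \<chi>) (W \<chi>)" and g': "\<forall>\<chi>\<in>Irr TYPE('u) \<Gamma>. g \<chi> \<in> eqv \<Gamma> (X \<chi>) (X \<chi>)"
  shows total_map_inn: "\<chi> \<in> Irr TYPE('u) \<Gamma> \<Longrightarrow> v \<in> carrier (V \<chi>) \<Longrightarrow> w \<in> carrier (X \<chi>) \<Longrightarrow>
      total_map \<Gamma> X V W f g (inn V \<chi> v w) = inn W \<chi> (f \<chi> v) (g \<chi> w)"
    and total_map_GHom: "total_map \<Gamma> X V W f g \<in> GHom \<Gamma> (gcopy (total \<Gamma> X V)) (gcopy (total \<Gamma> X W))"
proof -
  note f = bspec[OF f'] and g = bspec[OF g']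
  let ?I = "Irr TYPE('u) \<Gamma>" and ?FV = "gcopy (total \<Gamma> X V) :: 'u gmod" and ?FW = "gcopy (total \<Gamma> X W) :: 'u gmod"
  have T: "tmap (V \<chi>) (X \<chi>) (W \<chi>) (X \<chi>) (f \<chi>) (g \<chi>) \<in> mhom (tensor (V \<chi>) (X \<chi>)) (tensor (W \<chi>) (X \<chi>))" if "\<chi> \<in> ?I" for \<chi>
    by (rule tmap_mhom) (use fdfamD[OF V that] fdfamD[OF W that] irrD(4)[OF that] f[OF that] eqv_mhom[OF g[OF that]] in auto)
  have inn: "total_map \<Gamma> X V W f g (inn V \<chi> v w) = inn W \<chi> (f \<chi> v) (g \<chi> w)"
    if \<chi>: "\<chi> \<in> ?I" and v: "v \<in> carrier (V \<chi>)" and w: "w \<in> carrier (X \<chi>)" for \<chi> v w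
  proof -
    have "(\<lambda>k\<in>?I. tmap (V k) (X k) (W k) (X k) (f k) (g k) (dec (total \<Gamma> X V) (inn V \<chi> v w) k)) =
       single ?I (\<lambda>\<chi>. gtensor (triv (W \<chi>)) (X \<chi>)) \<chi> (pure (W \<chi>) (X \<chi>) (f \<chi> v) (g \<chi> w))" (is "?l = ?r")
    proof
      fix k show "?l k = ?r k"
      proof (cases "k \<in> ?I")
        case k: True
        show ?thesis
        proof (cases "k = \<chi>")
          case True
          then show ?thesis using k v w tmap_pure[OF fdfamD[OF V \<chi>] irrD(4)[OF \<chi>] fdfamD[OF W \<chi>] irrD(4)[OF \<chi>] f[OF \<chi>] eqv_mhom[OF g[OF \<chi>]]]
            by (simp add: dec_inn[OF V \<chi> v w] single_apply)
        next
          case False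
          then show ?thesis using k mhom_zero[OF _ _ T[OF k]] fdfamD[OF V k] fdfamD[OF W k] irrD(5)[OF k]
            by (simp add: dec_inn[OF V \<chi> v w] single_apply)
        qed
      qed (simp add: single_def)
    qed
    then show ?thesis unfolding total_map_def using inn_closed[OF V \<chi> v w] by (simp add: inn_def del: copy_simps gcopy_simps(2-))
  qed
  then show "\<chi> \<in> ?I \<Longrightarrow> v \<in> carrier (V \<chi>) \<Longrightarrow> w \<in> carrier (X \<chi>) \<Longrightarrow> total_map \<Gamma> X V W f g (inn V \<chi> v w) = inn W \<chi> (f \<chi> v) (g \<chi> w)" .
  have p: "(\<lambda>m. m \<chi>) \<in> mhom (total \<Gamma> X V) (tensor (V \<chi>) (X \<chi>))" if "\<chi> \<in> ?I" for \<chi>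
    using proj_mhom[OF that, of "\<lambda>\<chi>. gtensor (triv (V \<chi>)) (X \<chi>)"] by (simp add: total_def)
  have "(\<lambda>m. \<lambda>k\<in>?I. tmap (V k) (X k) (W k) (X k) (f k) (g k) (m k)) \<in> mhom (total \<Gamma> X V) (total \<Gamma> X W)"
    unfolding total_def[of _ _ W] by (rule gsum_mhom) (use mhom_comp[OF p T] in simp)
  from mhom_comp[OF mhom_comp[OF eqv_mhom[OF FM_dec[OF V]] this] eqv_mhom[OF FM_enc[OF W]]]
  have L: "total_map \<Gamma> X V W f g \<in> Lin ?FV ?FW"
    unfolding total_map_def by (rule restrict_Lin[OF is_gmodD(2)[OF FM_gmod[OF V]]])
  note FV = is_gmodD[OF FM_gmod[OF V]] and FW = is_gmodD[OF FM_gmod[OF W]] and Lm = Lin_mhom[OF L]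
  have "total_map \<Gamma> X V W f g (act ?FV x a) = act ?FW x (total_map \<Gamma> X V W f g a)" if x: "x \<in> \<Gamma>" and a: "a \<in> carrier ?FV" for x a
  proof (rule FM_eqI[OF V FW(2) mhom_comp[OF FV(3)[OF x] Lm] mhom_comp[OF Lm FW(3)[OF x]] _ a])
    fix \<chi> v w assume c: "\<chi> \<in> ?I" "v \<in> carrier (V \<chi>)" "w \<in> carrier (X \<chi>)"
    have gw: "g \<chi> w \<in> carrier (X \<chi>)" by (rule eqv_closed[OF g[OF c(1)] c(3)])
    have xw: "act (X \<chi>) x w \<in> carrier (X \<chi>)" by (rule is_gmodD(4)[OF irrD(3)[OF c(1)] x c(3)])
    show "total_map \<Gamma> X V W f g (act ?FV x (inn V \<chi> v w)) = act ?FW x (total_map \<Gamma> X V W f g (inn V \<chi> v w))"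
      unfolding inn_act[OF V c x] inn[OF c] inn[OF c(1,2) xw] inn_act[OF W c(1) mhom_closed[OF f[OF c(1)] c(2)] gw x]
        eqv_act[OF g[OF c(1)] x c(3)] ..
  qed
  then show "total_map \<Gamma> X V W f g \<in> GHom \<Gamma> ?FV ?FW" unfolding GHom_def using L by simp
qed

end

lemma flip_bilinear: "vs X \<Longrightarrow> vs V \<Longrightarrow> bilinear X V (tensor V X) (\<lambda>w v. pure V X v w)"
  using bilinear_pure[of V X] by (auto simp: bilinear_def)

lemma
  assumes "fdvs X" "fdvs V"
  shows flip_mhom: "flip X V \<in> mhom (tensor X V) (tensor V X)"
    and flip_pure: "w \<in> carrier X \<Longrightarrow> v \<in> carrier V \<Longrightarrow> flip X V (pure X V w v) = pure V X v w"
  unfolding flip_def using tlift[OF assms vs_tensor flip_bilinear] assms by (auto intro: Lin_mhom)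

text \<open>The map is trilinear in \<open>s\<close>, \<open>v\<close>, \<open>w\<close> and is
  lifted in two stages. Because the inner lift is determined by pure tensors, its linear dependence
  on \<open>s\<close> may be checked on them.\<close>

lemma
  assumes S: "fdvs S" and V: "fdvs V" and X: "fdvs X"
  shows rearrange_mhom: "rearrange S V X \<in> mhom (tensor S (tensor V X)) (tensor (tensor S X) V)"
    and rearrange_pure: "s \<in> carrier S \<Longrightarrow> v \<in> carrier V \<Longrightarrow> w \<in> carrier X \<Longrightarrow>
      rearrange S V X (pure S (tensor V X) s (pure V X v w)) = pure (tensor S X) V (pure S X s w) v"
proof -
  let ?Z = "tensor (tensor S X) V"
  have Z: "vs ?Z" using S V X by simp
  note vS = fdvs_vs[OF S] and vV = fdvs_vs[OF V] and vX = fdvs_vs[OF X]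
  have vSX: "vs (tensor S X)" by (rule vs_tensor[OF vS vX])
  define b where "b = (\<lambda>s v w. pure (tensor S X) V (pure S X s w) v)"
  have bl: "bilinear V X ?Z (b s)" if s: "s \<in> carrier S" for s
    unfolding bilinear_def b_def
  proof (intro conjI ballI)
    show "(\<lambda>w. pure (tensor S X) V (pure S X s w) v) \<in> mhom X ?Z" if "v \<in> carrier V" for v
      by (rule mhom_comp[OF pure_mhom_right[OF vS vX s] pure_mhom_left[OF vSX vV that]])
    show "(\<lambda>v. pure (tensor S X) V (pure S X s w) v) \<in> mhom V ?Z" if "w \<in> carrier X" for w
      by (rule pure_mhom_right[OF vSX vV pure_closed[OF vS vX s that]])
  qed
  have bs: "(\<lambda>s. b s v w) \<in> mhom S ?Z" if "v \<in> carrier V" "w \<in> carrier X" for v w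
    unfolding b_def by (rule mhom_comp[OF pure_mhom_left[OF vS vX that(2)] pure_mhom_left[OF vSX vV that(1)]])
  note tl = tlift[OF V X Z bl]
  have "bilinear S (tensor V X) ?Z (\<lambda>s. tlift V X ?Z (b s))"
    unfolding bilinear_def
  proof (intro conjI ballI)
    show "tlift V X ?Z (b s) \<in> mhom (tensor V X) ?Z" if "s \<in> carrier S" for s by (rule Lin_mhom[OF tl(1)[OF that]])
    fix t assume t: "t \<in> carrier (tensor V X)"
    show "(\<lambda>s. tlift V X ?Z (b s) t) \<in> mhom S ?Z"
    proof (rule mhomI)
      show "tlift V X ?Z (b s) t \<in> carrier ?Z" if "s \<in> carrier S" for s by (rule mhom_closed[OF Lin_mhom[OF tl(1)[OF that]] t])
    next
      fix s s' assume s: "s \<in> carrier S" "s' \<in> carrier S"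
      have ss: "s \<oplus>\<^bsub>S\<^esub> s' \<in> carrier S" using s vS by simp
      show "tlift V X ?Z (b (s \<oplus>\<^bsub>S\<^esub> s')) t = tlift V X ?Z (b s) t \<oplus>\<^bsub>?Z\<^esub> tlift V X ?Z (b s') t"
        by (rule tensor_eqI[OF V X Z Lin_mhom[OF tl(1)[OF ss]] mhom_plus[OF Z Lin_mhom[OF tl(1)[OF s(1)]] Lin_mhom[OF tl(1)[OF s(2)]]] _ t])
           (simp add: tl(2)[OF ss] tl(2)[OF s(1)] tl(2)[OF s(2)] mhom_add[OF bs s])
    next
      fix s a assume s: "s \<in> carrier S"
      have ss: "a \<odot>\<^bsub>S\<^esub> s \<in> carrier S" using s vS by simp
      show "tlift V X ?Z (b (a \<odot>\<^bsub>S\<^esub> s)) t = a \<odot>\<^bsub>?Z\<^esub> tlift V X ?Z (b s) t"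
        by (rule tensor_eqI[OF V X Z Lin_mhom[OF tl(1)[OF ss]] mhom_const_smult[OF Z Lin_mhom[OF tl(1)[OF s]]] _ t])
           (simp add: tl(2)[OF ss] tl(2)[OF s] mhom_smult[OF bs s])
    qed
  qed
  note r = tlift[OF S fdvs_tensor[OF V X] Z this]
  have e: "rearrange S V X = tlift S (tensor V X) ?Z (\<lambda>s. tlift V X ?Z (b s))" by (simp add: rearrange_def b_def)
  show "rearrange S V X \<in> mhom (tensor S (tensor V X)) ?Z" unfolding e by (rule Lin_mhom[OF r(1)])
  show "rearrange S V X (pure S (tensor V X) s (pure V X v w)) = pure (tensor S X) V (pure S X s w) v"
    if "s \<in> carrier S" "v \<in> carrier V" "w \<in> carrier X"
    unfolding e using r(2)[OF that(1) pure_closed[OF vV vX that(2,3)]] tl(2)[OF that] by (simp add: b_def)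
qed

context mckay_choice
begin

lemma y_mhom:
  assumes "h \<in> arcs (mckay_quiver TYPE('u) \<Gamma>)"
  shows "y h \<in> mhom (tensor Xstd (X (tail (mckay_quiver TYPE('u) \<Gamma>) h))) (X (head (mckay_quiver TYPE('u) \<Gamma>) h))"
    "yt h \<in> mhom (X (head (mckay_quiver TYPE('u) \<Gamma>) h)) (tensor Xstd (X (tail (mckay_quiver TYPE('u) \<Gamma>) h)))"
  using eqv_mhom[OF arrow_maps(1)[OF assms]] eqv_mhom[OF arrow_maps(2)[OF assms]] by simp_all

text \<open>The rearrangements only bring \<open>s\<close> next to \<open>w\<close> and back; on
  pure tensors they leave \<open>Rx R h\<close> acting on \<open>v\<close> and \<open>y h\<close> on
  the other two factors.\<close>

lemma
  assumes R: "is_qrep \<Gamma> (R :: 'u qrep)" and h: "h \<in> arcs (mckay_quiver TYPE('u) \<Gamma>)"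
  defines "i \<equiv> tail (mckay_quiver TYPE('u) \<Gamma>) h" and "j \<equiv> head (mckay_quiver TYPE('u) \<Gamma>) h"
  shows arrow_map_mhom: "arrow_map \<Gamma> X y R h \<in> mhom (tensor Xstd (tensor (RV R i) (X i))) (tensor (RV R j) (X j))"
    and arrow_map_pure: "s \<in> carrier Xstd \<Longrightarrow> v \<in> carrier (RV R i) \<Longrightarrow> w \<in> carrier (X i) \<Longrightarrow>
      arrow_map \<Gamma> X y R h (pure Xstd (tensor (RV R i) (X i)) s (pure (RV R i) (X i) v w)) =
      pure (RV R j) (X j) (Rx R h v) (y h (pure Xstd (X i) s w))"
proof -
  note r = is_qrepD[OF R]
  have I: "i \<in> Irr TYPE('u) \<Gamma>" "j \<in> Irr TYPE('u) \<Gamma>" using arcs_tail_head[OF h] by (auto simp: i_def j_def)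
  have fd: "fdvs (RV R i)" "fdvs (RV R j)" "fdvs (X i)" "fdvs (X j)" using r(1) I irrD(4) by auto
  have yh: "y h \<in> mhom (tensor Xstd (X i)) (X j)" using y_mhom(1)[OF h] by (simp add: i_def j_def)
  have xh: "Rx R h \<in> mhom (RV R i) (RV R j)" using r(3)[OF h] by (simp add: i_def j_def)
  have e: "arrow_map \<Gamma> X y R h = (\<lambda>t. flip (X j) (RV R j) (tmap (tensor Xstd (X i)) (RV R i) (X j) (RV R j) (y h) (Rx R h) (rearrange Xstd (RV R i) (X i) t)))"
    by (simp add: arrow_map_def Let_def i_def j_def fun_eq_iff)
  have T: "tmap (tensor Xstd (X i)) (RV R i) (X j) (RV R j) (y h) (Rx R h) \<in> mhom (tensor (tensor Xstd (X i)) (RV R i)) (tensor (X j) (RV R j))"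
    by (rule tmap_mhom) (use fd yh xh in auto)
  show "arrow_map \<Gamma> X y R h \<in> mhom (tensor Xstd (tensor (RV R i) (X i))) (tensor (RV R j) (X j))"
    unfolding e by (rule mhom_comp[OF mhom_comp[OF rearrange_mhom T] flip_mhom]) (use fd in auto)
  assume s: "s \<in> carrier Xstd" and v: "v \<in> carrier (RV R i)" and w: "w \<in> carrier (X i)"
  have c: "pure Xstd (X i) s w \<in> carrier (tensor Xstd (X i))" using s w fd by (simp del: Xstd_simps)
  show "arrow_map \<Gamma> X y R h (pure Xstd (tensor (RV R i) (X i)) s (pure (RV R i) (X i) v w)) =
      pure (RV R j) (X j) (Rx R h v) (y h (pure Xstd (X i) s w))"
    unfolding e rearrange_pure[OF fdvs_Xstd fd(1,3) s v w]
    using tmap_pure[OF fdvs_tensor[OF fdvs_Xstd fd(3)] fd(1) fd(4) fd(2) yh xh c v] flip_pure[OF fd(4,2) mhom_closed[OF yh c] mhom_closed[OF xh v]] by simp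
qed

lemma fdfam_RV:
  assumes "is_qrep \<Gamma> (R :: 'u qrep)" shows "fdfam (RV R)" "fdfam (RVf R)"
  using is_qrepD(1,2)[OF assms] by (auto simp: fdfam_def)

lemma total_Delta_mhom:
  assumes R: "is_qrep \<Gamma> (R :: 'u qrep)"
  shows "total_Delta \<Gamma> X y R \<in> mhom (tensor Xstd (total \<Gamma> X (RV R))) (total \<Gamma> X (RV R))"
proof -
  let ?Q = "mckay_quiver TYPE('u) \<Gamma>" and ?B = "total \<Gamma> X (RV R)" and ?I = "Irr TYPE('u) \<Gamma>"
  note r = is_qrepD[OF R] and B = is_gmodD[OF total_gmod[OF fdfam_RV(1)[OF R]]]
  have p: "(\<lambda>m. m \<chi>) \<in> mhom ?B (tensor (RV R \<chi>) (X \<chi>))" if "\<chi> \<in> ?I" for \<chi>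
    using proj_mhom[OF that, of "\<lambda>\<chi>. gtensor (triv (RV R \<chi>)) (X \<chi>)"] by (simp add: total_def)
  have a: "(\<lambda>t. arrow_map \<Gamma> X y R h (tmap Xstd ?B Xstd (tensor (RV R (tail ?Q h)) (X (tail ?Q h))) (\<lambda>s. s) (\<lambda>m. m (tail ?Q h)) t))
      \<in> mhom (tensor Xstd ?B) (tensor (RV R (head ?Q h)) (X (head ?Q h)))" if h: "h \<in> arcs ?Q" for h
    by (rule mhom_comp[OF tmap_mhom[OF fdvs_Xstd B(1) fdvs_Xstd _ mhom_id p] arrow_map_mhom[OF R h]])
       (use arcs_tail_head[OF h] r(1) irrD(4) in auto)
  have e: "total_Delta \<Gamma> X y R = (\<lambda>t. \<lambda>\<chi>\<in>?I. finsum (tensor (RV R \<chi>) (X \<chi>)) (\<lambda>h. arrow_map \<Gamma> X y R h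
       (tmap Xstd ?B Xstd (tensor (RV R (tail ?Q h)) (X (tail ?Q h))) (\<lambda>s. s) (\<lambda>m. m (tail ?Q h)) t)) {h \<in> arcs ?Q. head ?Q h = \<chi>})"
    by (simp add: total_Delta_def Let_def fun_eq_iff)
  have "(\<lambda>t. finsum (tensor (RV R \<chi>) (X \<chi>)) (\<lambda>h. arrow_map \<Gamma> X y R h
       (tmap Xstd ?B Xstd (tensor (RV R (tail ?Q h)) (X (tail ?Q h))) (\<lambda>s. s) (\<lambda>m. m (tail ?Q h)) t)) {h \<in> arcs ?Q. head ?Q h = \<chi>})
     \<in> mhom (tensor Xstd ?B) (gtensor (triv (RV R \<chi>)) (X \<chi>))" if \<chi>: "\<chi> \<in> ?I" for \<chi>
  proof -
    have "(\<lambda>t. finsum (tensor (RV R \<chi>) (X \<chi>)) (\<lambda>h. arrow_map \<Gamma> X y R h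
       (tmap Xstd ?B Xstd (tensor (RV R (tail ?Q h)) (X (tail ?Q h))) (\<lambda>s. s) (\<lambda>m. m (tail ?Q h)) t)) {h \<in> arcs ?Q. head ?Q h = \<chi>})
     \<in> mhom (tensor Xstd ?B) (tensor (RV R \<chi>) (X \<chi>))"
    proof (rule mhom_sum)
      show "vs (tensor (RV R \<chi>) (X \<chi>))" using r(1)[OF \<chi>] irrD(5)[OF \<chi>] by simp
      show "finite {h \<in> arcs ?Q. head ?Q h = \<chi>}" by simp
      fix h assume "h \<in> {h \<in> arcs ?Q. head ?Q h = \<chi>}"
      then have h: "h \<in> arcs ?Q" "head ?Q h = \<chi>" by auto
      show "(\<lambda>t. arrow_map \<Gamma> X y R h (tmap Xstd ?B Xstd (tensor (RV R (tail ?Q h)) (X (tail ?Q h))) (\<lambda>s. s) (\<lambda>m. m (tail ?Q h)) t))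
        \<in> mhom (tensor Xstd ?B) (tensor (RV R \<chi>) (X \<chi>))" using a[OF h(1)] unfolding h(2) .
    qed
    then show ?thesis by simp
  qed
  from gsum_mhom[OF this] show ?thesis unfolding e total_def[of _ _ "RV R"] .
qed

text \<open>The definition groups arrows by head, since the component at a vertex collects what
  arrives there. On a generator from the summand \<open>\<chi>\<close> only the arrows leaving
  \<open>\<chi>\<close> contribute, so here the sum is regrouped by tail.\<close>

lemma total_Delta_pure:
  assumes R: "is_qrep \<Gamma> (R :: 'u qrep)" and \<chi>: "\<chi> \<in> Irr TYPE('u) \<Gamma>" and s: "s \<in> carrier Xstd" and v: "v \<in> carrier (RV R \<chi>)" and w: "w \<in> carrier (X \<chi>)"
  shows "total_Delta \<Gamma> X y R (pure Xstd (total \<Gamma> X (RV R)) s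
       (single (Irr TYPE('u) \<Gamma>) (\<lambda>\<chi>. gtensor (triv (RV R \<chi>)) (X \<chi>)) \<chi> (pure (RV R \<chi>) (X \<chi>) v w))) =
    finsum (total \<Gamma> X (RV R)) (\<lambda>h. single (Irr TYPE('u) \<Gamma>) (\<lambda>\<chi>. gtensor (triv (RV R \<chi>)) (X \<chi>)) (head (mckay_quiver TYPE('u) \<Gamma>) h)
        (pure (RV R (head (mckay_quiver TYPE('u) \<Gamma>) h)) (X (head (mckay_quiver TYPE('u) \<Gamma>) h)) (Rx R h v) (y h (pure Xstd (X \<chi>) s w))))
      {h \<in> arcs (mckay_quiver TYPE('u) \<Gamma>). tail (mckay_quiver TYPE('u) \<Gamma>) h = \<chi>}"
    (is "total_Delta _ _ _ _ (pure _ _ _ ?m) = finsum _ ?F ?A")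
proof -
  let ?Q = "mckay_quiver TYPE('u) \<Gamma>" and ?B = "total \<Gamma> X (RV R)" and ?I = "Irr TYPE('u) \<Gamma>"
  let ?p = "\<lambda>h. pure (RV R (head ?Q h)) (X (head ?Q h)) (Rx R h v) (y h (pure Xstd (X \<chi>) s w))"
  note r = is_qrepD[OF R] and V = fdfam_RV(1)[OF R] note B = is_gmodD[OF total_gmod[OF V]]
  have fd: "fdvs (RV R k)" "fdvs (X k)" if "k \<in> ?I" for k using that r(1) irrD(4) by auto
  have m: "?m \<in> carrier ?B" by (rule single_total_closed[OF V \<chi>]) (use fd[OF \<chi>] v w in simp)
  have c: "pure Xstd (X \<chi>) s w \<in> carrier (tensor Xstd (X \<chi>))" using s w fd[OF \<chi>] by (simp del: Xstd_simps)
  have pc: "?p h \<in> carrier (tensor (RV R (head ?Q h)) (X (head ?Q h)))" if "h \<in> ?A" for h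
  proof -
    have h: "h \<in> arcs ?Q" "tail ?Q h = \<chi>" using that by auto
    show ?thesis
      using mhom_closed[OF r(3)[OF h(1)], unfolded h(2), OF v] mhom_closed[OF y_mhom(1)[OF h(1)], unfolded h(2), OF c]
       fd[OF arcs_tail_head(2)[OF h(1)]] by simp
  qed
  have Fc: "?F h \<in> carrier ?B" if "h \<in> ?A" for h
    by (rule single_total_closed[OF V _ pc[OF that]]) (use arcs_tail_head(2) that in auto)
  have p: "(\<lambda>m. m k) \<in> mhom ?B (tensor (RV R k) (X k))" if "k \<in> ?I" for k
    using proj_mhom[OF that, of "\<lambda>\<chi>. gtensor (triv (RV R \<chi>)) (X \<chi>)"] by (simp add: total_def)
  have a: "arrow_map \<Gamma> X y R h (tmap Xstd ?B Xstd (tensor (RV R (tail ?Q h)) (X (tail ?Q h))) (\<lambda>s. s) (\<lambda>m. m (tail ?Q h)) (pure Xstd ?B s ?m)) =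
     (if tail ?Q h = \<chi> then ?p h else \<zero>\<^bsub>tensor (RV R (head ?Q h)) (X (head ?Q h))\<^esub>)" if h: "h \<in> arcs ?Q" for h
  proof -
    note th = arcs_tail_head[OF h]
    let ?T = "tensor (RV R (tail ?Q h)) (X (tail ?Q h))"
    have T: "fdvs ?T" using fd[OF th(1)] by simp
    have "tmap Xstd ?B Xstd ?T (\<lambda>s. s) (\<lambda>m. m (tail ?Q h)) (pure Xstd ?B s ?m) = pure Xstd ?T s (?m (tail ?Q h))"
      by (rule tmap_pure[OF fdvs_Xstd B(1) fdvs_Xstd T mhom_id p[OF th(1)] s m])
    moreover have "?m (tail ?Q h) = (if tail ?Q h = \<chi> then pure (RV R \<chi>) (X \<chi>) v w else \<zero>\<^bsub>?T\<^esub>)"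
      using th by (simp add: single_apply)
    moreover have "pure Xstd ?T s \<zero>\<^bsub>?T\<^esub> = \<zero>\<^bsub>tensor Xstd ?T\<^esub>"
      by (rule mhom_zero[OF _ _ pure_mhom_right[OF _ _ s]]) (use T in auto)
    moreover have "arrow_map \<Gamma> X y R h \<zero>\<^bsub>tensor Xstd ?T\<^esub> = \<zero>\<^bsub>tensor (RV R (head ?Q h)) (X (head ?Q h))\<^esub>"
      by (rule mhom_zero[OF _ _ arrow_map_mhom[OF R h]]) (use T fd[OF th(2)] in auto)
    ultimately show ?thesis using arrow_map_pure[OF R h s] v w by auto
  qed
  have "total_Delta \<Gamma> X y R (pure Xstd ?B s ?m) k = finsum ?B ?F ?A k" if k: "k \<in> ?I" for k
  proof -
    let ?T = "tensor (RV R k) (X k)"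
    have vT: "vs ?T" using fd[OF k] by simp
    have "total_Delta \<Gamma> X y R (pure Xstd ?B s ?m) k = finsum ?T (\<lambda>h. if tail ?Q h = \<chi> then ?p h else \<zero>\<^bsub>?T\<^esub>) {h \<in> arcs ?Q. head ?Q h = k}"
      using k unfolding total_Delta_def Let_def restrict_apply'[OF k]
      by (intro vfinsum_cong[OF vT refl]) (use a pc vT in auto)
    \<comment> \<open>Arrows with another tail see a zero component of the generator and drop
      out.\<close>
    also have "\<dots> = finsum ?T (\<lambda>h. if tail ?Q h = \<chi> then ?p h else \<zero>\<^bsub>?T\<^esub>) {h \<in> arcs ?Q. head ?Q h = k \<and> tail ?Q h = \<chi>}"
      by (rule vfinsum_mono_neutral[OF vT]) (use pc in auto)
    also have "\<dots> = finsum ?T (\<lambda>h. ?F h k) {h \<in> arcs ?Q. head ?Q h = k \<and> tail ?Q h = \<chi>}"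
      by (rule vfinsum_cong[OF vT refl]) (use pc k in \<open>auto simp: single_apply\<close>)
    \<comment> \<open>Arrows with another head may be added, as their terms have component zero at
      \<open>k\<close>.\<close>
    also have "\<dots> = finsum ?T (\<lambda>h. ?F h k) ?A"
      by (rule vfinsum_mono_neutral[OF vT, symmetric]) (use pc k in \<open>auto simp: single_apply\<close>)
    also have "\<dots> = finsum ?B ?F ?A k"
      by (rule mhom_finsum[OF B(2) vT p[OF k], symmetric]) (use Fc in auto)
    finally show ?thesis .
  qed
  moreover have "total_Delta \<Gamma> X y R (pure Xstd ?B s ?m) \<in> carrier ?B"
    by (rule mhom_closed[OF total_Delta_mhom[OF R] pure_closed[OF fdvs_vs[OF fdvs_Xstd] B(2) s m]])
  moreover have "finsum ?B ?F ?A \<in> carrier ?B" by (rule vfinsum_closed[OF B(2)]) (use Fc in auto)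
  ultimately show ?thesis by (intro PiE_ext[of _ ?I "\<lambda>\<chi>. carrier (gtensor (triv (RV R \<chi>)) (X \<chi>))"]) (simp_all add: total_def[of _ _ "RV R"])
qed

lemma F_ob_simps [simp]:
  "MM (F_ob \<Gamma> X y R) = gcopy (total \<Gamma> X (RV R))" "MMf (F_ob \<Gamma> X y R) = gcopy (total \<Gamma> X (RVf R))"
  "MZ1 (F_ob \<Gamma> X y R) = total_map \<Gamma> X (RVf R) (RV R) (Rv1 R) (\<lambda>\<chi> w. (1 / delta X \<chi>) \<odot>\<^bsub>X \<chi>\<^esub> w)"
  "MZ2 (F_ob \<Gamma> X y R) = total_map \<Gamma> X (RV R) (RVf R) (Rv2 R) (\<lambda>\<chi> w. w)"
  by (simp_all add: F_ob_def Let_def)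

lemma FM_fdvs: "fdfam V \<Longrightarrow> fdvs (gcopy (total \<Gamma> X V) :: 'u gmod)"
  by (rule is_gmodD(1)[OF FM_gmod])

lemma tensor_FM_eqI:
  assumes V: "fdfam V" and Z: "vs Z" and f: "f \<in> mhom (tensor Xstd (gcopy (total \<Gamma> X V) :: 'u gmod)) Z"
    and g: "g \<in> mhom (tensor Xstd (gcopy (total \<Gamma> X V) :: 'u gmod)) Z"
    and eq: "\<And>s \<chi> v w. s \<in> carrier Xstd \<Longrightarrow> \<chi> \<in> Irr TYPE('u) \<Gamma> \<Longrightarrow> v \<in> carrier (V \<chi>) \<Longrightarrow> w \<in> carrier (X \<chi>) \<Longrightarrow>
      f (pure Xstd (gcopy (total \<Gamma> X V)) s (inn V \<chi> v w)) = g (pure Xstd (gcopy (total \<Gamma> X V)) s (inn V \<chi> v w))"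
    and t: "t \<in> carrier (tensor Xstd (gcopy (total \<Gamma> X V) :: 'u gmod))"
  shows "f t = g t"
proof (rule tensor_eqI[OF fdvs_Xstd FM_fdvs[OF V] Z f g _ t])
  fix s m assume s: "s \<in> carrier Xstd" and m: "m \<in> carrier (gcopy (total \<Gamma> X V) :: 'u gmod)"
  note p = pure_mhom_right[OF fdvs_vs[OF fdvs_Xstd] fdvs_vs[OF FM_fdvs[OF V]] s]
  show "f (pure Xstd (gcopy (total \<Gamma> X V)) s m) = g (pure Xstd (gcopy (total \<Gamma> X V)) s m)"
    by (rule FM_eqI[OF V Z mhom_comp[OF p f] mhom_comp[OF p g] eq[OF s] m])
qed

text \<open>\<Delta> sends \<open>s \<otimes> (v \<otimes> w)\<close> to the sum over the arrows
  \<open>h\<close> from \<open>\<chi>\<close> of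
  \<open>Rx R h v \<otimes> y h (s \<otimes> w)\<close>. Apart from linearity this is all that is
  used of \<Delta> from here on.\<close>

lemma
  assumes R: "is_qrep \<Gamma> (R :: 'u qrep)"
  shows MD_F_Lin: "MD (F_ob \<Gamma> X y R) \<in> Lin (tensor Xstd (gcopy (total \<Gamma> X (RV R)) :: 'u gmod)) (gcopy (total \<Gamma> X (RV R)))"
    and MD_F_pure: "s \<in> carrier Xstd \<Longrightarrow> \<chi> \<in> Irr TYPE('u) \<Gamma> \<Longrightarrow> v \<in> carrier (RV R \<chi>) \<Longrightarrow> w \<in> carrier (X \<chi>) \<Longrightarrow>
      MD (F_ob \<Gamma> X y R) (pure Xstd (gcopy (total \<Gamma> X (RV R))) s (inn (RV R) \<chi> v w)) =
      finsum (gcopy (total \<Gamma> X (RV R))) (\<lambda>h. inn (RV R) (head (mckay_quiver TYPE('u) \<Gamma>) h) (Rx R h v) (y h (pure Xstd (X \<chi>) s w)))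
        {h \<in> arcs (mckay_quiver TYPE('u) \<Gamma>). tail (mckay_quiver TYPE('u) \<Gamma>) h = \<chi>}"
proof -
  let ?Q = "mckay_quiver TYPE('u) \<Gamma>" and ?B = "total \<Gamma> X (RV R)" and ?I = "Irr TYPE('u) \<Gamma>"
  let ?M = "gcopy ?B :: 'u gmod"
  note V = fdfam_RV(1)[OF R] note B = is_gmodD[OF total_gmod[OF V]] and M = is_gmodD[OF FM_gmod[OF V]]
  note en = eqv_mhom[OF FM_enc[OF V]] and de = eqv_mhom[OF FM_dec[OF V]]
  have e: "MD (F_ob \<Gamma> X y R) = restrict (\<lambda>t. enc ?B (total_Delta \<Gamma> X y R (tmap Xstd ?M Xstd ?B (\<lambda>s. s) (dec ?B) t))) (carrier (tensor Xstd ?M))"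
    by (simp add: F_ob_def Let_def)
  show L: "MD (F_ob \<Gamma> X y R) \<in> Lin (tensor Xstd ?M) ?M"
    unfolding e by (rule restrict_Lin[OF vs_tensor mhom_comp[OF mhom_comp[OF tmap_mhom[OF fdvs_Xstd M(1) fdvs_Xstd B(1) mhom_id de] total_Delta_mhom[OF R]] en]])
      (use M in auto)
  assume s: "s \<in> carrier Xstd" and \<chi>: "\<chi> \<in> ?I" and v: "v \<in> carrier (RV R \<chi>)" and w: "w \<in> carrier (X \<chi>)"
  let ?A = "{h \<in> arcs ?Q. tail ?Q h = \<chi>}"
  have c: "pure Xstd ?M s (inn (RV R) \<chi> v w) \<in> carrier (tensor Xstd ?M)"
    by (rule pure_closed[OF fdvs_vs[OF fdvs_Xstd] M(2) s inn_closed[OF V \<chi> v w]])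
  have cw: "pure Xstd (X \<chi>) s w \<in> carrier (tensor Xstd (X \<chi>))"
    by (rule pure_closed[OF fdvs_vs[OF fdvs_Xstd] irrD(5)[OF \<chi>] s w])
  let ?F = "\<lambda>h. single ?I (\<lambda>\<chi>. gtensor (triv (RV R \<chi>)) (X \<chi>)) (head ?Q h)
        (pure (RV R (head ?Q h)) (X (head ?Q h)) (Rx R h v) (y h (pure Xstd (X \<chi>) s w)))"
  have Fc: "?F h \<in> carrier ?B" if "h \<in> ?A" for h
  proof -
    have h: "h \<in> arcs ?Q" "tail ?Q h = \<chi>" using that by auto
    note th = arcs_tail_head(2)[OF h(1)]
    show ?thesis
      by (rule single_total_closed[OF V th pure_closed[OF fdvs_vs[OF fdfamD[OF V th]] irrD(5)[OF th]
         mhom_closed[OF is_qrepD(3)[OF R h(1), unfolded h(2)] v] mhom_closed[OF y_mhom(1)[OF h(1), unfolded h(2)] cw]]])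
  qed
  have "MD (F_ob \<Gamma> X y R) (pure Xstd ?M s (inn (RV R) \<chi> v w)) = enc ?B (total_Delta \<Gamma> X y R (pure Xstd ?B s (dec ?B (inn (RV R) \<chi> v w))))"
    unfolding e restrict_apply'[OF c] tmap_pure[OF fdvs_Xstd M(1) fdvs_Xstd B(1) mhom_id de s inn_closed[OF V \<chi> v w]] ..
  also have "\<dots> = enc ?B (finsum ?B ?F ?A)"
    unfolding dec_inn[OF V \<chi> v w] total_Delta_pure[OF R \<chi> s v w] ..
  also have "\<dots> = finsum ?M (\<lambda>h. enc ?B (?F h)) ?A"
    by (rule mhom_finsum[OF B(2) M(2) en]) (use Fc in auto)
  finally show "MD (F_ob \<Gamma> X y R) (pure Xstd ?M s (inn (RV R) \<chi> v w)) =
      finsum ?M (\<lambda>h. inn (RV R) (head ?Q h) (Rx R h v) (y h (pure Xstd (X \<chi>) s w))) ?A" by (simp add: inn_def)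
qed

lemma inn_term_closed:
  assumes V: "fdfam V" and h: "h \<in> arcs (mckay_quiver TYPE('u) \<Gamma>)" "tail (mckay_quiver TYPE('u) \<Gamma>) h = \<chi>"
    and v: "v \<in> carrier (V (head (mckay_quiver TYPE('u) \<Gamma>) h))" and s: "s \<in> carrier Xstd" and w: "w \<in> carrier (X \<chi>)"
  shows "y h (pure Xstd (X \<chi>) s w) \<in> carrier (X (head (mckay_quiver TYPE('u) \<Gamma>) h))"
    "inn V (head (mckay_quiver TYPE('u) \<Gamma>) h) v (y h (pure Xstd (X \<chi>) s w)) \<in> carrier (gcopy (total \<Gamma> X V) :: 'u gmod)"
proof -
  have \<chi>: "\<chi> \<in> Irr TYPE('u) \<Gamma>" using arcs_tail_head(1)[OF h(1)] h(2) by simp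
  show 1: "y h (pure Xstd (X \<chi>) s w) \<in> carrier (X (head (mckay_quiver TYPE('u) \<Gamma>) h))"
    by (rule mhom_closed[OF y_mhom(1)[OF h(1), unfolded h(2)] pure_closed[OF fdvs_vs[OF fdvs_Xstd] irrD(5)[OF \<chi>] s w]])
  show "inn V (head (mckay_quiver TYPE('u) \<Gamma>) h) v (y h (pure Xstd (X \<chi>) s w)) \<in> carrier (gcopy (total \<Gamma> X V) :: 'u gmod)"
    by (rule inn_closed[OF V arcs_tail_head(2)[OF h(1)] v 1])
qed

lemma scale_eqv: "\<forall>\<chi>\<in>Irr TYPE('u) \<Gamma>. (\<lambda>w. a \<chi> \<odot>\<^bsub>X \<chi>\<^esub> w) \<in> eqv \<Gamma> (X \<chi>) (X \<chi>)"
  by (intro ballI eqv_smult irrD(3) eqv_id)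

lemma id_eqv: "\<forall>\<chi>\<in>Irr TYPE('u) \<Gamma>. (\<lambda>w. w) \<in> eqv \<Gamma> (X \<chi>) (X \<chi>)"
  by (intro ballI eqv_id)

lemma is_qrep_all:
  assumes "is_qrep \<Gamma> (R :: 'u qrep)"
  shows "\<forall>\<chi>\<in>Irr TYPE('u) \<Gamma>. Rv1 R \<chi> \<in> mhom (RVf R \<chi>) (RV R \<chi>)" "\<forall>\<chi>\<in>Irr TYPE('u) \<Gamma>. Rv2 R \<chi> \<in> mhom (RV R \<chi>) (RVf R \<chi>)"
  using is_qrepD(4,5)[OF assms] by blast+

lemma qrep_mor_all:
  assumes "(\<phi>, \<psi>) \<in> qrep_mor \<Gamma> (R :: 'u qrep) R'"
  shows "\<forall>\<chi>\<in>Irr TYPE('u) \<Gamma>. \<phi> \<chi> \<in> mhom (RV R \<chi>) (RV R' \<chi>)" "\<forall>\<chi>\<in>Irr TYPE('u) \<Gamma>. \<psi> \<chi> \<in> mhom (RVf R \<chi>) (RVf R' \<chi>)"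
  using qrep_morD(8,9)[OF assms] by blast+

text \<open>The group acts on \<open>s\<close> and \<open>w\<close> and leaves \<open>v\<close>
  alone, so on generators the equivariance of \<Delta> is that of the maps
  \<open>y h\<close>.\<close>

lemma F_ob_mck:
  assumes R: "is_qrep \<Gamma> (R :: 'u qrep)"
  shows "is_mck \<Gamma> (F_ob \<Gamma> X y R)"
  unfolding is_mck_def F_ob_simps
proof (intro conjI)
  note V = fdfam_RV[OF R] note r = is_qrepD[OF R]
  let ?M = "gcopy (total \<Gamma> X (RV R)) :: 'u gmod" and ?Q = "mckay_quiver TYPE('u) \<Gamma>" and ?D = "MD (F_ob \<Gamma> X y R)"
  show "is_gmod \<Gamma> ?M" "is_gmod \<Gamma> (gcopy (total \<Gamma> X (RVf R)) :: 'u gmod)" by (rule FM_gmod[OF V(1)] FM_gmod[OF V(2)])+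
  show "total_map \<Gamma> X (RVf R) (RV R) (Rv1 R) (\<lambda>\<chi> w. (1 / delta X \<chi>) \<odot>\<^bsub>X \<chi>\<^esub> w) \<in> GHom \<Gamma> (gcopy (total \<Gamma> X (RVf R))) ?M"
    by (rule total_map_GHom[OF V(2,1) is_qrep_all(1)[OF R] scale_eqv[of "\<lambda>\<chi>. 1 / delta X \<chi>"]])
  show "total_map \<Gamma> X (RV R) (RVf R) (Rv2 R) (\<lambda>\<chi> w. w) \<in> GHom \<Gamma> ?M (gcopy (total \<Gamma> X (RVf R)))"
    by (rule total_map_GHom[OF V is_qrep_all(2)[OF R] id_eqv])
  note M = is_gmodD[OF FM_gmod[OF V(1)]] and st = is_gmodD[OF gmod_Xstd]
  have D: "?D \<in> mhom (tensor Xstd ?M) ?M" by (rule Lin_mhom[OF MD_F_Lin[OF R]])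
  have "?D (tmap Xstd ?M Xstd ?M (act Xstd g) (act ?M g) t) = act ?M g (?D t)" if g: "g \<in> \<Gamma>" and t: "t \<in> carrier (tensor Xstd ?M)" for g t
  proof (rule tensor_FM_eqI[OF V(1) M(2) mhom_comp[OF tmap_mhom[OF fdvs_Xstd M(1) fdvs_Xstd M(1) st(3)[OF g] M(3)[OF g]] D] mhom_comp[OF D M(3)[OF g]] _ t])
    fix s \<chi> v w assume s: "s \<in> carrier Xstd" and c: "\<chi> \<in> Irr TYPE('u) \<Gamma>" "v \<in> carrier (RV R \<chi>)" "w \<in> carrier (X \<chi>)"
    have gs: "act Xstd g s \<in> carrier Xstd" by (rule st(4)[OF g s])
    have gw: "act (X \<chi>) g w \<in> carrier (X \<chi>)" by (rule is_gmodD(4)[OF irrD(3)[OF c(1)] g c(3)])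
    let ?A = "{h \<in> arcs ?Q. tail ?Q h = \<chi>}"
    have "?D (tmap Xstd ?M Xstd ?M (act Xstd g) (act ?M g) (pure Xstd ?M s (inn (RV R) \<chi> v w))) = ?D (pure Xstd ?M (act Xstd g s) (inn (RV R) \<chi> v (act (X \<chi>) g w)))"
      unfolding tmap_pure[OF fdvs_Xstd M(1) fdvs_Xstd M(1) st(3)[OF g] M(3)[OF g] s inn_closed[OF V(1) c]] inn_act[OF V(1) c g] ..
    also have "\<dots> = finsum ?M (\<lambda>h. inn (RV R) (head ?Q h) (Rx R h v) (y h (pure Xstd (X \<chi>) (act Xstd g s) (act (X \<chi>) g w)))) ?A"
      by (rule MD_F_pure[OF R gs c(1,2) gw])
    also have "\<dots> = finsum ?M (\<lambda>h. act ?M g (inn (RV R) (head ?Q h) (Rx R h v) (y h (pure Xstd (X \<chi>) s w)))) ?A"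
    proof (rule vfinsum_cong[OF M(2) refl])
      fix h assume "h \<in> ?A"
      then have h: "h \<in> arcs ?Q" "tail ?Q h = \<chi>" by auto
      note th = arcs_tail_head(2)[OF h(1)]
      have xv: "Rx R h v \<in> carrier (RV R (head ?Q h))" by (rule mhom_closed[OF r(3)[OF h(1), unfolded h(2)] c(2)])
      note tc = inn_term_closed[OF V(1) h xv s c(3)]
      have "y h (act (gtensor Xstd (X \<chi>)) g (pure Xstd (X \<chi>) s w)) = act (X (head ?Q h)) g (y h (pure Xstd (X \<chi>) s w))"
        by (rule eqv_act[OF arrow_maps(1)[OF h(1), unfolded h(2)] g])
          (use pure_closed[OF fdvs_vs[OF fdvs_Xstd] irrD(5)[OF c(1)] s c(3)] in simp)
      then have "y h (pure Xstd (X \<chi>) (act Xstd g s) (act (X \<chi>) g w)) = act (X (head ?Q h)) g (y h (pure Xstd (X \<chi>) s w))"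
        unfolding gtensor_simps tmap_pure[OF fdvs_Xstd irrD(4)[OF c(1)] fdvs_Xstd irrD(4)[OF c(1)] st(3)[OF g] is_gmodD(3)[OF irrD(3)[OF c(1)] g] s c(3)] .
      then show "inn (RV R) (head ?Q h) (Rx R h v) (y h (pure Xstd (X \<chi>) (act Xstd g s) (act (X \<chi>) g w))) =
          act ?M g (inn (RV R) (head ?Q h) (Rx R h v) (y h (pure Xstd (X \<chi>) s w)))"
        using inn_act[OF V(1) th xv tc(1) g] by (simp del: gcopy_simps)
      show "act ?M g (inn (RV R) (head ?Q h) (Rx R h v) (y h (pure Xstd (X \<chi>) s w))) \<in> carrier ?M"
        by (rule M(4)[OF g tc(2)])
    qed
    also have "\<dots> = act ?M g (finsum ?M (\<lambda>h. inn (RV R) (head ?Q h) (Rx R h v) (y h (pure Xstd (X \<chi>) s w))) ?A)"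
    proof (rule mhom_finsum[OF M(2) M(2) M(3)[OF g], symmetric])
      show "(\<lambda>h. inn (RV R) (head ?Q h) (Rx R h v) (y h (pure Xstd (X \<chi>) s w))) \<in> ?A \<rightarrow> carrier ?M"
      proof (rule Pi_I)
        fix h assume "h \<in> ?A"
        then have h: "h \<in> arcs ?Q" "tail ?Q h = \<chi>" by auto
        show "inn (RV R) (head ?Q h) (Rx R h v) (y h (pure Xstd (X \<chi>) s w)) \<in> carrier ?M"
          by (rule inn_term_closed(2)[OF V(1) h mhom_closed[OF r(3)[OF h(1), unfolded h(2)] c(2)] s c(3)])
      qed
    qed simp
    also have "\<dots> = act ?M g (?D (pure Xstd ?M s (inn (RV R) \<chi> v w)))" unfolding MD_F_pure[OF R s c] ..
    finally show "?D (tmap Xstd ?M Xstd ?M (act Xstd g) (act ?M g) (pure Xstd ?M s (inn (RV R) \<chi> v w))) = act ?M g (?D (pure Xstd ?M s (inn (RV R) \<chi> v w)))" .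
  qed
  then show "?D \<in> GHom \<Gamma> (gtensor Xstd ?M) ?M" using MD_F_Lin[OF R] by (simp add: GHom_def del: gcopy_simps)
qed

text \<open>On generators the conditions become the commutation of \<open>\<phi>\<close> and
  \<open>\<psi>\<close> with \<open>Rx\<close>, \<open>Rv1\<close> and \<open>Rv2\<close>; the
  factors in the irreducible modules are the same on both sides.\<close>

lemma F_mor_mck:
  assumes R: "is_qrep \<Gamma> (R :: 'u qrep)" and R': "is_qrep \<Gamma> R'" and f: "(\<phi>, \<psi>) \<in> qrep_mor \<Gamma> R R'"
  shows "(total_map \<Gamma> X (RV R) (RV R') \<phi> (\<lambda>\<chi> w. w), total_map \<Gamma> X (RVf R) (RVf R') \<psi> (\<lambda>\<chi> w. w)) \<in> mck_mor \<Gamma> (F_ob \<Gamma> X y R) (F_ob \<Gamma> X y R')"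
    (is "(?\<Phi>, ?\<Psi>) \<in> _")
proof -
  note V = fdfam_RV[OF R] and V' = fdfam_RV[OF R'] note r = is_qrepD[OF R] and r' = is_qrepD[OF R'] and F = qrep_morD[OF f]
  let ?M = "gcopy (total \<Gamma> X (RV R)) :: 'u gmod" and ?M' = "gcopy (total \<Gamma> X (RV R')) :: 'u gmod" and ?Q = "mckay_quiver TYPE('u) \<Gamma>"
  let ?N = "F_ob \<Gamma> X y R" and ?N' = "F_ob \<Gamma> X y R'"
  note n = is_mckD[OF F_ob_mck[OF R], unfolded F_ob_simps(1,2)] and n' = is_mckD[OF F_ob_mck[OF R'], unfolded F_ob_simps(1,2)]
  note \<Phi> = total_map_GHom[OF V(1) V'(1) qrep_mor_all(1)[OF f] id_eqv] and \<Psi> = total_map_GHom[OF V(2) V'(2) qrep_mor_all(2)[OF f] id_eqv]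
  note \<Phi>i = total_map_inn[OF V(1) V'(1) qrep_mor_all(1)[OF f] id_eqv] and \<Psi>i = total_map_inn[OF V(2) V'(2) qrep_mor_all(2)[OF f] id_eqv]
  note \<Phi>m = Lin_mhom[OF GHom_Lin[OF \<Phi>]] and \<Psi>m = Lin_mhom[OF GHom_Lin[OF \<Psi>]]
  note v' = is_gmodD(2)[OF n'(1)] is_gmodD(2)[OF n'(2)] and v = is_gmodD(2)[OF n(1)]
  note Z1 = total_map_inn[OF V(2,1) is_qrep_all(1)[OF R] scale_eqv[of "\<lambda>\<chi>. 1 / delta X \<chi>"]] and Z1' = total_map_inn[OF V'(2,1) is_qrep_all(1)[OF R'] scale_eqv[of "\<lambda>\<chi>. 1 / delta X \<chi>"]]
  note Z2 = total_map_inn[OF V is_qrep_all(2)[OF R] id_eqv] and Z2' = total_map_inn[OF V' is_qrep_all(2)[OF R'] id_eqv]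
  show ?thesis
  proof (rule mck_mor_pureI[OF F_ob_mck[OF R] F_ob_mck[OF R']], unfold F_ob_simps(1,2))
    show "?\<Phi> \<in> GHom \<Gamma> ?M ?M'" by (rule \<Phi>)
    show "?\<Psi> \<in> GHom \<Gamma> (gcopy (total \<Gamma> X (RVf R))) (gcopy (total \<Gamma> X (RVf R')))" by (rule \<Psi>)
  next
    fix s m assume s: "s \<in> carrier Xstd" and m: "m \<in> carrier ?M"
    note p = pure_mhom_right[OF fdvs_vs[OF fdvs_Xstd] v s] and p' = pure_mhom_right[OF fdvs_vs[OF fdvs_Xstd] v'(1) s]
    show "?\<Phi> (MD ?N (pure Xstd ?M s m)) = MD ?N' (pure Xstd ?M' s (?\<Phi> m))"
    proof (rule FM_eqI[OF V(1) v'(1) mhom_comp[OF mhom_comp[OF p n(8)] \<Phi>m] mhom_comp[OF mhom_comp[OF \<Phi>m p'] n'(8)] _ m])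
      fix \<chi> v w assume c: "\<chi> \<in> Irr TYPE('u) \<Gamma>" "v \<in> carrier (RV R \<chi>)" "w \<in> carrier (X \<chi>)"
      let ?A = "{h \<in> arcs ?Q. tail ?Q h = \<chi>}"
      note \<phi>v = mhom_closed[OF F(8)[OF c(1)] c(2)]
      have tc: "inn (RV R) (head ?Q h) (Rx R h v) (y h (pure Xstd (X \<chi>) s w)) \<in> carrier ?M" if "h \<in> ?A" for h
      proof -
        have h: "h \<in> arcs ?Q" "tail ?Q h = \<chi>" using that by auto
        show ?thesis by (rule inn_term_closed(2)[OF V(1) h mhom_closed[OF r(3)[OF h(1), unfolded h(2)] c(2)] s c(3)])
      qed
      have "?\<Phi> (MD ?N (pure Xstd ?M s (inn (RV R) \<chi> v w))) = finsum ?M' (\<lambda>h. ?\<Phi> (inn (RV R) (head ?Q h) (Rx R h v) (y h (pure Xstd (X \<chi>) s w)))) ?A"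
        unfolding MD_F_pure[OF R s c] by (rule mhom_finsum[OF is_gmodD(2)[OF n(1)] v'(1) \<Phi>m]) (use tc in auto)
      also have "\<dots> = finsum ?M' (\<lambda>h. inn (RV R') (head ?Q h) (Rx R' h (\<phi> \<chi> v)) (y h (pure Xstd (X \<chi>) s w))) ?A"
      proof (rule vfinsum_cong[OF v'(1) refl])
        fix h assume "h \<in> ?A"
        then have h: "h \<in> arcs ?Q" "tail ?Q h = \<chi>" by auto
        have xv: "Rx R h v \<in> carrier (RV R (head ?Q h))" by (rule mhom_closed[OF r(3)[OF h(1), unfolded h(2)] c(2)])
        have xv': "Rx R' h (\<phi> \<chi> v) \<in> carrier (RV R' (head ?Q h))" by (rule mhom_closed[OF r'(3)[OF h(1), unfolded h(2)] \<phi>v])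
        show "?\<Phi> (inn (RV R) (head ?Q h) (Rx R h v) (y h (pure Xstd (X \<chi>) s w))) = inn (RV R') (head ?Q h) (Rx R' h (\<phi> \<chi> v)) (y h (pure Xstd (X \<chi>) s w))"
          unfolding \<Phi>i[OF arcs_tail_head(2)[OF h(1)] xv inn_term_closed(1)[OF V(1) h xv s c(3)]] F(3)[OF h(1), unfolded h(2), OF c(2)] ..
        show "inn (RV R') (head ?Q h) (Rx R' h (\<phi> \<chi> v)) (y h (pure Xstd (X \<chi>) s w)) \<in> carrier ?M'"
          by (rule inn_term_closed(2)[OF V'(1) h xv' s c(3)])
      qed
      also have "\<dots> = MD ?N' (pure Xstd ?M' s (?\<Phi> (inn (RV R) \<chi> v w)))"
        unfolding \<Phi>i[OF c] MD_F_pure[OF R' s c(1) \<phi>v c(3)] ..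
      finally show "?\<Phi> (MD ?N (pure Xstd ?M s (inn (RV R) \<chi> v w))) = MD ?N' (pure Xstd ?M' s (?\<Phi> (inn (RV R) \<chi> v w)))" .
    qed
  next
    fix m assume m: "m \<in> carrier ?M"
    show "?\<Psi> (MZ2 ?N m) = MZ2 ?N' (?\<Phi> m)"
    proof (rule FM_eqI[OF V(1) v'(2) mhom_comp[OF n(10) \<Psi>m] mhom_comp[OF \<Phi>m n'(10)] _ m])
      fix \<chi> v w assume c: "\<chi> \<in> Irr TYPE('u) \<Gamma>" "v \<in> carrier (RV R \<chi>)" "w \<in> carrier (X \<chi>)"
      show "?\<Psi> (MZ2 ?N (inn (RV R) \<chi> v w)) = MZ2 ?N' (?\<Phi> (inn (RV R) \<chi> v w))"
        unfolding F_ob_simps Z2[OF c] \<Phi>i[OF c] Z2'[OF c(1) mhom_closed[OF F(8)[OF c(1)] c(2)] c(3)]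
          \<Psi>i[OF c(1) mhom_closed[OF r(5)[OF c(1)] c(2)] c(3)] F(5)[OF c(1,2)] ..
    qed
  next
    fix m assume m: "m \<in> carrier (gcopy (total \<Gamma> X (RVf R)) :: 'u gmod)"
    show "?\<Phi> (MZ1 ?N m) = MZ1 ?N' (?\<Psi> m)"
    proof (rule FM_eqI[OF V(2) v'(1) mhom_comp[OF n(9) \<Phi>m] mhom_comp[OF \<Psi>m n'(9)] _ m])
      fix \<chi> v w assume c: "\<chi> \<in> Irr TYPE('u) \<Gamma>" "v \<in> carrier (RVf R \<chi>)" "w \<in> carrier (X \<chi>)"
      have w': "(1 / delta X \<chi>) \<odot>\<^bsub>X \<chi>\<^esub> w \<in> carrier (X \<chi>)" using c irrD(5) by simp
      show "?\<Phi> (MZ1 ?N (inn (RVf R) \<chi> v w)) = MZ1 ?N' (?\<Psi> (inn (RVf R) \<chi> v w))"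
        unfolding F_ob_simps Z1[OF c] \<Psi>i[OF c] Z1'[OF c(1) mhom_closed[OF F(9)[OF c(1)] c(2)] c(3)]
          \<Phi>i[OF c(1) mhom_closed[OF r(4)[OF c(1)] c(2)] w'] F(4)[OF c(1,2)] ..
    qed
  qed
qed

lemma F_functor_simps [simp]:
  "onOb (F_functor \<Gamma> X y) = F_ob \<Gamma> X y"
  "onMor (F_functor \<Gamma> X y) R R' (\<phi>, \<psi>) = (total_map \<Gamma> X (RV R) (RV R') \<phi> (\<lambda>\<chi> w. w), total_map \<Gamma> X (RVf R) (RVf R') \<psi> (\<lambda>\<chi> w. w))"
  by (simp_all add: F_functor_def)

lemma total_map_id:
  assumes V: "fdfam V"
  shows "total_map \<Gamma> X V V (\<lambda>\<chi>\<in>Irr TYPE('u) \<Gamma>. \<lambda>v\<in>carrier (V \<chi>). v) (\<lambda>\<chi> w. w) = (\<lambda>m\<in>carrier (gcopy (total \<Gamma> X V) :: 'u gmod). m)"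
proof -
  let ?M = "gcopy (total \<Gamma> X V) :: 'u gmod"
  define J where "J = (\<lambda>\<chi>\<in>Irr TYPE('u) \<Gamma>. \<lambda>v\<in>carrier (V \<chi>). v)"
  note M = is_gmodD[OF FM_gmod[OF V]]
  have i: "\<forall>\<chi>\<in>Irr TYPE('u) \<Gamma>. J \<chi> \<in> mhom (V \<chi>) (V \<chi>)"
    using Lin_mhom[OF Lin_id[OF fdvs_vs[OF fdfamD[OF V]]]] by (simp add: J_def)
  note L = GHom_Lin[OF total_map_GHom[OF V V i id_eqv]]
  have "total_map \<Gamma> X V V J (\<lambda>\<chi> w. w) = (\<lambda>m\<in>carrier ?M. m)" (is "?T = _")
  proof (rule Lin_eqI[OF L Lin_id[OF M(2)]])
    fix m assume m: "m \<in> carrier ?M"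
    have "?T m = m"
    proof (rule FM_eqI[OF V M(2) Lin_mhom[OF L] mhom_id _ m])
      fix \<chi> v w assume c: "\<chi> \<in> Irr TYPE('u) \<Gamma>" "v \<in> carrier (V \<chi>)" "w \<in> carrier (X \<chi>)"
      show "?T (inn V \<chi> v w) = inn V \<chi> v w" unfolding total_map_inn[OF V V i id_eqv c] using c by (simp add: J_def)
    qed
    then show "?T m = (\<lambda>m\<in>carrier ?M. m) m" using m by simp
  qed
  then show ?thesis unfolding J_def .
qed

lemma total_map_comp:
  assumes U: "fdfam U" and V: "fdfam V" and W: "fdfam W"
    and f: "\<forall>\<chi>\<in>Irr TYPE('u) \<Gamma>. f \<chi> \<in> mhom (U \<chi>) (V \<chi>)" and g: "\<forall>\<chi>\<in>Irr TYPE('u) \<Gamma>. g \<chi> \<in> mhom (V \<chi>) (W \<chi>)"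
  shows "total_map \<Gamma> X U W (\<lambda>\<chi>\<in>Irr TYPE('u) \<Gamma>. compose (carrier (U \<chi>)) (g \<chi>) (f \<chi>)) (\<lambda>\<chi> w. w) =
    compose (carrier (gcopy (total \<Gamma> X U) :: 'u gmod)) (total_map \<Gamma> X V W g (\<lambda>\<chi> w. w)) (total_map \<Gamma> X U V f (\<lambda>\<chi> w. w))"
    (is "_ = compose ?C ?G ?F")
proof -
  note M = is_gmodD[OF FM_gmod[OF U]] and MW = is_gmodD[OF FM_gmod[OF W]]
  define J where "J = (\<lambda>\<chi>\<in>Irr TYPE('u) \<Gamma>. compose (carrier (U \<chi>)) (g \<chi>) (f \<chi>))"
  have i: "\<forall>\<chi>\<in>Irr TYPE('u) \<Gamma>. J \<chi> \<in> mhom (U \<chi>) (W \<chi>)"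
    using Lin_mhom[OF restrict_Lin[OF fdvs_vs[OF fdfamD[OF U]] mhom_comp[OF bspec[OF f] bspec[OF g]]]] by (simp add: compose_def J_def)
  note L = GHom_Lin[OF total_map_GHom[OF U W i id_eqv]] and LF = GHom_Lin[OF total_map_GHom[OF U V f id_eqv]] and LG = GHom_Lin[OF total_map_GHom[OF V W g id_eqv]]
  have "total_map \<Gamma> X U W J (\<lambda>\<chi> w. w) = compose ?C ?G ?F" (is "?T = _")
  proof (rule Lin_eqI[OF L Lin_compose[OF M(2) LF LG]])
    fix m assume m: "m \<in> ?C"
    have "?T m = ?G (?F m)"
    proof (rule FM_eqI[OF U MW(2) Lin_mhom[OF L] mhom_comp[OF Lin_mhom[OF LF] Lin_mhom[OF LG]] _ m])
      fix \<chi> v w assume c: "\<chi> \<in> Irr TYPE('u) \<Gamma>" "v \<in> carrier (U \<chi>)" "w \<in> carrier (X \<chi>)"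
      show "?T (inn U \<chi> v w) = ?G (?F (inn U \<chi> v w))"
        unfolding total_map_inn[OF U V f id_eqv c] total_map_inn[OF V W g id_eqv c(1) mhom_closed[OF bspec[OF f c(1)] c(2)] c(3)]
          total_map_inn[OF U W i id_eqv c] using c by (simp add: compose_eq J_def)
    qed
    then show "?T m = compose ?C ?G ?F m" using m by (simp add: compose_eq)
  qed
  then show ?thesis unfolding J_def .
qed

lemma functor_F: "is_functor (Rep \<Gamma>) (McK \<Gamma>) (F_functor \<Gamma> X y)"
  unfolding is_functor_def
proof (intro conjI ballI)
  fix R :: "'u qrep" assume "R \<in> Ob (Rep \<Gamma>)"
  then have R: "is_qrep \<Gamma> R" by simp
  show "onOb (F_functor \<Gamma> X y) R \<in> Ob (McK \<Gamma>)" using F_ob_mck[OF R] by simp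
  show "onMor (F_functor \<Gamma> X y) R R (Idt (Rep \<Gamma>) R) = Idt (McK \<Gamma>) (onOb (F_functor \<Gamma> X y) R)"
    unfolding Rep_simps F_functor_simps McK_simps F_ob_simps total_map_id[OF fdfam_RV(1)[OF R]] total_map_id[OF fdfam_RV(2)[OF R]] ..
next
  fix R R' :: "'u qrep" and f assume "R \<in> Ob (Rep \<Gamma>)" "R' \<in> Ob (Rep \<Gamma>)" and f: "f \<in> Mor (Rep \<Gamma>) R R'"
  then have R: "is_qrep \<Gamma> R" "is_qrep \<Gamma> R'" by simp_all
  obtain \<phi> \<psi> where e: "f = (\<phi>, \<psi>)" by (metis surj_pair)
  show "onMor (F_functor \<Gamma> X y) R R' f \<in> Mor (McK \<Gamma>) (onOb (F_functor \<Gamma> X y) R) (onOb (F_functor \<Gamma> X y) R')"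
    using F_mor_mck[OF R f[unfolded e Rep_simps]] by (simp add: e)
next
  fix R R' R'' :: "'u qrep" and f g assume "R \<in> Ob (Rep \<Gamma>)" "R' \<in> Ob (Rep \<Gamma>)" "R'' \<in> Ob (Rep \<Gamma>)"
    and f: "f \<in> Mor (Rep \<Gamma>) R R'" and g: "g \<in> Mor (Rep \<Gamma>) R' R''"
  then have R: "is_qrep \<Gamma> R" "is_qrep \<Gamma> R'" "is_qrep \<Gamma> R''" by simp_all
  obtain \<phi> \<psi> \<phi>' \<psi>' where e: "f = (\<phi>, \<psi>)" "g = (\<phi>', \<psi>')" by (metis surj_pair)
  note F = qrep_morD[OF f[unfolded e Rep_simps]] and G = qrep_morD[OF g[unfolded e Rep_simps]]
  show "onMor (F_functor \<Gamma> X y) R R'' (Cmp (Rep \<Gamma>) R R' R'' g f) =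
     Cmp (McK \<Gamma>) (onOb (F_functor \<Gamma> X y) R) (onOb (F_functor \<Gamma> X y) R') (onOb (F_functor \<Gamma> X y) R'') (onMor (F_functor \<Gamma> X y) R' R'' g) (onMor (F_functor \<Gamma> X y) R R' f)"
    using total_map_comp[OF fdfam_RV(1)[OF R(1)] fdfam_RV(1)[OF R(2)] fdfam_RV(1)[OF R(3)] qrep_mor_all(1)[OF f[unfolded e Rep_simps]] qrep_mor_all(1)[OF g[unfolded e Rep_simps]]]
      total_map_comp[OF fdfam_RV(2)[OF R(1)] fdfam_RV(2)[OF R(2)] fdfam_RV(2)[OF R(3)] qrep_mor_all(2)[OF f[unfolded e Rep_simps]] qrep_mor_all(2)[OF g[unfolded e Rep_simps]]]
    unfolding e Rep_simps F_functor_simps McK_simps F_ob_simps by (intro arg_cong2[of _ _ _ _ Pair])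
qed

end

section \<open>The functor from module data to quiver representations\<close>

lemma GHom_space_simps [simp]:
  "carrier (GHom_space \<Gamma> M N) = GHom \<Gamma> M N" "\<zero>\<^bsub>GHom_space \<Gamma> M N\<^esub> = (\<lambda>v\<in>carrier M. \<zero>\<^bsub>N\<^esub>)"
  "f \<oplus>\<^bsub>GHom_space \<Gamma> M N\<^esub> g = (\<lambda>v\<in>carrier M. f v \<oplus>\<^bsub>N\<^esub> g v)"
  "a \<odot>\<^bsub>GHom_space \<Gamma> M N\<^esub> f = (\<lambda>v\<in>carrier M. a \<odot>\<^bsub>N\<^esub> f v)"
  by (simp_all add: GHom_space_def Lin_space_def)

lemma GHom_lin_closed:
  assumes M: "is_gmod \<Gamma> M" and N: "is_gmod \<Gamma> N"
  shows "lin_closed (Lin_space M N) (GHom \<Gamma> M N)"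
  using restrict_GHom[OF M eqv_zero[OF N]] restrict_GHom[OF M eqv_add[OF N GHom_eqv GHom_eqv]] restrict_GHom[OF M eqv_smult[OF N GHom_eqv]]
  by (auto simp: lin_closed_def dest: GHom_Lin)

lemma fdvs_GHom_space [simp]:
  assumes M: "is_gmod \<Gamma> M" and N: "is_gmod \<Gamma> N"
  shows "fdvs (GHom_space \<Gamma> M N)"
  unfolding GHom_space_def
  by (rule subspace_retraction(1)[OF fdvs_Lin_space[OF is_gmodD(1)[OF M] is_gmodD(1)[OF N]] GHom_lin_closed[OF M N]])

lemma GHom_eval_mhom: "v \<in> carrier M \<Longrightarrow> (\<lambda>f. f v) \<in> mhom (GHom_space \<Gamma> M N) N"
  by (rule mhomI) (auto intro: Lin_closed[OF GHom_Lin])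

text \<open>Operations on spaces of maps are pointwise, so linearity may be tested at each
  \<open>w\<close>.\<close>

lemma mhom_GHom_spaceI:
  assumes U: "vs U" and T: "\<And>u. u \<in> carrier U \<Longrightarrow> T u \<in> GHom \<Gamma> M N"
    and e: "\<And>w. w \<in> carrier M \<Longrightarrow> (\<lambda>u. T u w) \<in> mhom U N"
  shows "T \<in> mhom U (GHom_space \<Gamma> M N)"
proof (rule mhomI)
  fix u u' assume u: "u \<in> carrier U" "u' \<in> carrier U"
  have "T (u \<oplus>\<^bsub>U\<^esub> u') \<in> extensional (carrier M)" using T[of "u \<oplus>\<^bsub>U\<^esub> u'"] u U by (simp add: GHom_iff)
  then show "T (u \<oplus>\<^bsub>U\<^esub> u') = T u \<oplus>\<^bsub>GHom_space \<Gamma> M N\<^esub> T u'"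
    by (rule extensionalityI) (use mhom_add[OF e u] in auto)
next
  fix u a assume u: "u \<in> carrier U"
  have "T (a \<odot>\<^bsub>U\<^esub> u) \<in> extensional (carrier M)" using T[of "a \<odot>\<^bsub>U\<^esub> u"] u U by (simp add: GHom_iff)
  then show "T (a \<odot>\<^bsub>U\<^esub> u) = a \<odot>\<^bsub>GHom_space \<Gamma> M N\<^esub> T u"
    by (rule extensionalityI) (use mhom_smult[OF e u] in auto)
qed (use T in simp)

text \<open>\<open>tmap\<close> depends linearly on its second map. Applied to the family of all
  equivariant maps it shows that the arrow maps of the second functor are linear.\<close>

lemma tmap_family_mhom:
  assumes V: "fdvs V" and W: "fdvs W" and V': "fdvs V'" and W': "fdvs W'" and U: "vs U" and a: "a \<in> mhom V V'"
    and F: "\<And>u. u \<in> carrier U \<Longrightarrow> F u \<in> mhom W W'" and e: "\<And>w. w \<in> carrier W \<Longrightarrow> (\<lambda>u. F u w) \<in> mhom U W'"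
    and t: "t \<in> carrier (tensor V W)"
  shows "(\<lambda>u. tmap V W V' W' a (F u) t) \<in> mhom U (tensor V' W')"
proof (rule mhomI)
  note T = tmap_mhom[OF V W V' W' a F] and TP = tmap_pure[OF V W V' W' a F]
  have T': "vs (tensor V' W')" using V' W' by simp
  { fix u assume u: "u \<in> carrier U"
    show "tmap V W V' W' a (F u) t \<in> carrier (tensor V' W')" by (rule mhom_closed[OF T[OF u] t]) }
  { fix u u' assume u: "u \<in> carrier U" "u' \<in> carrier U"
    then have uu: "u \<oplus>\<^bsub>U\<^esub> u' \<in> carrier U" using U by simp
    show "tmap V W V' W' a (F (u \<oplus>\<^bsub>U\<^esub> u')) t = tmap V W V' W' a (F u) t \<oplus>\<^bsub>tensor V' W'\<^esub> tmap V W V' W' a (F u') t"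
    proof (rule tensor_eqI[OF V W T' T[OF uu] mhom_plus[OF T' T[OF u(1)] T[OF u(2)]] _ t])
      fix v w assume c: "v \<in> carrier V" "w \<in> carrier W"
      show "tmap V W V' W' a (F (u \<oplus>\<^bsub>U\<^esub> u')) (pure V W v w) =
          tmap V W V' W' a (F u) (pure V W v w) \<oplus>\<^bsub>tensor V' W'\<^esub> tmap V W V' W' a (F u') (pure V W v w)"
        unfolding TP[OF uu c] TP[OF u(1) c] TP[OF u(2) c] mhom_add[OF e[OF c(2)] u]
        by (rule pure_add_right[OF fdvs_vs[OF V'] fdvs_vs[OF W'] mhom_closed[OF a c(1)] mhom_closed[OF F[OF u(1)] c(2)] mhom_closed[OF F[OF u(2)] c(2)]])
    qed }
  { fix z u assume u: "u \<in> carrier U"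
    then have zu: "z \<odot>\<^bsub>U\<^esub> u \<in> carrier U" using U by simp
    show "tmap V W V' W' a (F (z \<odot>\<^bsub>U\<^esub> u)) t = z \<odot>\<^bsub>tensor V' W'\<^esub> tmap V W V' W' a (F u) t"
    proof (rule tensor_eqI[OF V W T' T[OF zu] mhom_const_smult[OF T' T[OF u]] _ t])
      fix v w assume c: "v \<in> carrier V" "w \<in> carrier W"
      show "tmap V W V' W' a (F (z \<odot>\<^bsub>U\<^esub> u)) (pure V W v w) = z \<odot>\<^bsub>tensor V' W'\<^esub> tmap V W V' W' a (F u) (pure V W v w)"
        unfolding TP[OF zu c] TP[OF u c] mhom_smult[OF e[OF c(2)] u]
        by (rule pure_smult_right[OF fdvs_vs[OF V'] fdvs_vs[OF W'] mhom_closed[OF a c(1)] mhom_closed[OF F[OF u] c(2)]])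
    qed }
qed

lemma tmap_eqv:
  assumes M: "is_gmod \<Gamma> M" "is_gmod \<Gamma> M'" and N: "is_gmod \<Gamma> N" "is_gmod \<Gamma> N'" and a: "a \<in> eqv \<Gamma> M M'" and b: "b \<in> eqv \<Gamma> N N'"
  shows "tmap M N M' N' a b \<in> eqv \<Gamma> (gtensor M N) (gtensor M' N')"
proof (rule eqvI)
  note f = is_gmodD(1)[OF M(1)] is_gmodD(1)[OF N(1)] is_gmodD(1)[OF M(2)] is_gmodD(1)[OF N(2)]
  note m = eqv_mhom[OF a] eqv_mhom[OF b]
  show "tmap M N M' N' a b \<in> mhom (gtensor M N) (gtensor M' N')" using tmap_mhom[OF f m] by simp
  fix g t assume g: "g \<in> \<Gamma>" and "t \<in> carrier (gtensor M N)"
  then have t: "t \<in> carrier (tensor M N)" by simp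
  note g1 = is_gmodD(3)[OF M(1) g] is_gmodD(3)[OF N(1) g] and g2 = is_gmodD(3)[OF M(2) g] is_gmodD(3)[OF N(2) g]
  have "tmap M N M' N' a b (tmap M N M N (act M g) (act N g) t) = tmap M N M' N' (\<lambda>v. a (act M g v)) (\<lambda>w. b (act N g w)) t"
    by (rule tmap_comp[OF f(1,2) f(1,2) f(3,4) g1 m t])
  also have "\<dots> = tmap M N M' N' (\<lambda>v. act M' g (a v)) (\<lambda>w. act N' g (b w)) t"
    by (rule fun_cong[OF tmap_cong[OF f mhom_comp[OF g1(1) m(1)] mhom_comp[OF g1(2) m(2)]]]) (use eqv_act[OF a g] eqv_act[OF b g] in auto)
  also have "\<dots> = tmap M' N' M' N' (act M' g) (act N' g) (tmap M N M' N' a b t)"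
    by (rule tmap_comp[OF f(1,2) f(3,4) f(3,4) m g2 t, symmetric])
  finally show "tmap M N M' N' a b (act (gtensor M N) g t) = act (gtensor M' N') g (tmap M N M' N' a b t)" by simp
qed

lemma compose_GHom_mhom:
  assumes M: "is_gmod \<Gamma> M" and N: "is_gmod \<Gamma> N" and N': "is_gmod \<Gamma> N'" and \<Phi>: "\<Phi> \<in> GHom \<Gamma> N N'"
  shows "(\<lambda>f. compose (carrier M) \<Phi> f) \<in> mhom (GHom_space \<Gamma> M N) (GHom_space \<Gamma> M N')"
proof (rule mhom_GHom_spaceI)
  show "vs (GHom_space \<Gamma> M N)" using fdvs_vs[OF fdvs_GHom_space[OF M N]] .
  show "compose (carrier M) \<Phi> u \<in> GHom \<Gamma> M N'" if "u \<in> carrier (GHom_space \<Gamma> M N)" for u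
    using GHom_compose[OF M _ \<Phi>] that by simp
  show "(\<lambda>u. compose (carrier M) \<Phi> u w) \<in> mhom (GHom_space \<Gamma> M N) N'" if w: "w \<in> carrier M" for w
    using mhom_comp[OF GHom_eval_mhom[OF w] Lin_mhom[OF GHom_Lin[OF \<Phi>]]] w by (simp add: compose_eq)
qed

context irreducibles
begin

lemma copy_map_enc: "fdvs V \<Longrightarrow> v \<in> carrier V \<Longrightarrow> copy_map V W T (enc V v :: 'u) = (enc W (T v) :: 'u)"
  by (simp add: copy_map_def)

lemma copy_map_Lin:
  assumes V: "fdvs V" and W: "fdvs W" and T: "T \<in> mhom V W"
  shows "(copy_map V W T :: 'u \<Rightarrow> 'u) \<in> Lin (copy V) (copy W)"
  unfolding copy_map_def
  by (rule restrict_Lin[OF vs_copy mhom_comp[OF mhom_comp[OF dec_mhom T] enc_mhom]]) (use V W in auto)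

lemma copy_cases:
  fixes a :: 'u
  assumes "a \<in> carrier (copy V)"
  obtains v where "v \<in> carrier V" "a = enc V v"
  using assms by auto

lemma copy_map_id:
  assumes "fdvs V" "\<And>v. v \<in> carrier V \<Longrightarrow> T v = v"
  shows "copy_map V V T = (\<lambda>a\<in>carrier (copy V :: (complex, 'u) module). a)"
  unfolding copy_map_def using assms by (intro restrict_ext) auto

lemma copy_map_comp:
  assumes V: "fdvs V" and W: "fdvs W" and T: "T \<in> mhom V W" and e: "\<And>v. v \<in> carrier V \<Longrightarrow> S v = T' (T v)"
  shows "(copy_map V Z S :: 'u \<Rightarrow> 'u) = compose (carrier (copy V :: (complex, 'u) module)) (copy_map W Z T') (copy_map V W T)"
proof
  fix a :: 'u
  show "copy_map V Z S a = compose (carrier (copy V :: (complex, 'u) module)) (copy_map W Z T') (copy_map V W T) a"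
  proof (cases "a \<in> carrier (copy V)")
    case True
    then obtain v where v: "v \<in> carrier V" "a = enc V v" by (rule copy_cases)
    show ?thesis using True by (simp add: v compose_eq copy_map_enc V W e mhom_closed[OF T])
  qed (simp add: copy_map_def compose_def)
qed

end

context mckay_choice
begin

text \<open>The map at the arrow \<open>h\<close> between spaces of equivariant maps, before source
  and target are copied into \<open>'u\<close>.\<close>

definition Gx :: "'u mck \<Rightarrow> arrow \<Rightarrow> ('u \<Rightarrow> 'u) \<Rightarrow> 'u \<Rightarrow> 'u" where
  "Gx N h f = (\<lambda>w\<in>carrier (X (head (mckay_quiver TYPE('u) \<Gamma>) h)).
     MD N (tmap Xstd (X (tail (mckay_quiver TYPE('u) \<Gamma>) h)) Xstd (MM N) (\<lambda>s. s) f (yt h w)))"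

lemma Gx_mhom:
  assumes N: "is_mck \<Gamma> N" and h: "h \<in> arcs (mckay_quiver TYPE('u) \<Gamma>)"
  shows "Gx N h \<in> mhom (GHom_space \<Gamma> (X (tail (mckay_quiver TYPE('u) \<Gamma>) h)) (MM N)) (GHom_space \<Gamma> (X (head (mckay_quiver TYPE('u) \<Gamma>) h)) (MM N))"
proof (rule mhom_GHom_spaceI)
  let ?i = "tail (mckay_quiver TYPE('u) \<Gamma>) h" and ?j = "head (mckay_quiver TYPE('u) \<Gamma>) h"
  note n = is_mckD[OF N] and Xi = irrD[OF arcs_tail_head(1)[OF h]] and Xj = irrD[OF arcs_tail_head(2)[OF h]]
  show "vs (GHom_space \<Gamma> (X ?i) (MM N))" using fdvs_vs[OF fdvs_GHom_space[OF Xi(3) n(1)]] .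
  show "Gx N h f \<in> GHom \<Gamma> (X ?j) (MM N)" if "f \<in> carrier (GHom_space \<Gamma> (X ?i) (MM N))" for f
    unfolding Gx_def
    by (rule restrict_GHom[OF Xj(3) eqv_comp[OF eqv_comp[OF arrow_maps(2)[OF h] tmap_eqv[OF gmod_Xstd gmod_Xstd Xi(3) n(1) eqv_id]] GHom_eqv[OF n(3)]]])
      (use that in \<open>auto intro: GHom_eqv\<close>)
  show "(\<lambda>f. Gx N h f w) \<in> mhom (GHom_space \<Gamma> (X ?i) (MM N)) (MM N)" if w: "w \<in> carrier (X ?j)" for w
  proof -
    have "(\<lambda>f. tmap Xstd (X ?i) Xstd (MM N) (\<lambda>s. s) f (yt h w)) \<in> mhom (GHom_space \<Gamma> (X ?i) (MM N)) (tensor Xstd (MM N))"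
      by (rule tmap_family_mhom[OF fdvs_Xstd Xi(4) fdvs_Xstd n(6) _ mhom_id _ GHom_eval_mhom mhom_closed[OF y_mhom(2)[OF h] w]])
        (use fdvs_vs[OF fdvs_GHom_space[OF Xi(3) n(1)]] in \<open>auto dest: Lin_mhom[OF GHom_Lin]\<close>)
    from mhom_comp[OF this n(8)] show ?thesis using w by (simp add: Gx_def)
  qed
qed

lemma G_ob_simps:
  "\<chi> \<in> Irr TYPE('u) \<Gamma> \<Longrightarrow> RV (G_ob \<Gamma> X yt N) \<chi> = copy (GHom_space \<Gamma> (X \<chi>) (MM N))"
  "\<chi> \<in> Irr TYPE('u) \<Gamma> \<Longrightarrow> RVf (G_ob \<Gamma> X yt N) \<chi> = copy (GHom_space \<Gamma> (X \<chi>) (MMf N))"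
  "h \<in> arcs (mckay_quiver TYPE('u) \<Gamma>) \<Longrightarrow> Rx (G_ob \<Gamma> X yt N) h =
     copy_map (GHom_space \<Gamma> (X (tail (mckay_quiver TYPE('u) \<Gamma>) h)) (MM N)) (GHom_space \<Gamma> (X (head (mckay_quiver TYPE('u) \<Gamma>) h)) (MM N)) (Gx N h)"
  "\<chi> \<in> Irr TYPE('u) \<Gamma> \<Longrightarrow> Rv1 (G_ob \<Gamma> X yt N) \<chi> = copy_map (GHom_space \<Gamma> (X \<chi>) (MMf N)) (GHom_space \<Gamma> (X \<chi>) (MM N))
     (\<lambda>f. \<lambda>w\<in>carrier (X \<chi>). delta X \<chi> \<odot>\<^bsub>MM N\<^esub> MZ1 N (f w))"
  "\<chi> \<in> Irr TYPE('u) \<Gamma> \<Longrightarrow> Rv2 (G_ob \<Gamma> X yt N) \<chi> = copy_map (GHom_space \<Gamma> (X \<chi>) (MM N)) (GHom_space \<Gamma> (X \<chi>) (MMf N))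
     (\<lambda>f. compose (carrier (X \<chi>)) (MZ2 N) f)"
  by (simp_all add: G_ob_def Let_def Gx_def[abs_def] compose_def)

lemma GZ1_mhom:
  assumes N: "is_mck \<Gamma> N" and \<chi>: "\<chi> \<in> Irr TYPE('u) \<Gamma>"
  shows "(\<lambda>f. \<lambda>w\<in>carrier (X \<chi>). delta X \<chi> \<odot>\<^bsub>MM N\<^esub> MZ1 N (f w)) \<in> mhom (GHom_space \<Gamma> (X \<chi>) (MMf N)) (GHom_space \<Gamma> (X \<chi>) (MM N))"
proof (rule mhom_GHom_spaceI)
  note n = is_mckD[OF N] and x = irrD[OF \<chi>]
  show "vs (GHom_space \<Gamma> (X \<chi>) (MMf N))" using fdvs_vs[OF fdvs_GHom_space[OF x(3) n(2)]] .
  show "(\<lambda>w\<in>carrier (X \<chi>). delta X \<chi> \<odot>\<^bsub>MM N\<^esub> MZ1 N (f w)) \<in> GHom \<Gamma> (X \<chi>) (MM N)" if "f \<in> carrier (GHom_space \<Gamma> (X \<chi>) (MMf N))" for f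
    by (rule restrict_GHom[OF x(3) eqv_smult[OF n(1) eqv_comp[OF GHom_eqv GHom_eqv[OF n(4)]]]]) (use that in simp)
  show "(\<lambda>f. (\<lambda>w\<in>carrier (X \<chi>). delta X \<chi> \<odot>\<^bsub>MM N\<^esub> MZ1 N (f w)) w) \<in> mhom (GHom_space \<Gamma> (X \<chi>) (MMf N)) (MM N)" if w: "w \<in> carrier (X \<chi>)" for w
    using mhom_const_smult[OF fdvs_vs[OF n(6)] mhom_comp[OF GHom_eval_mhom[OF w] n(9)]] w by simp
qed

lemma fdvs_HS:
  assumes N: "is_mck \<Gamma> N" and \<chi>: "\<chi> \<in> Irr TYPE('u) \<Gamma>"
  shows "fdvs (GHom_space \<Gamma> (X \<chi>) (MM N))" "fdvs (GHom_space \<Gamma> (X \<chi>) (MMf N))"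
  using fdvs_GHom_space[OF irrD(3)[OF \<chi>] is_mckD(1)[OF N]] fdvs_GHom_space[OF irrD(3)[OF \<chi>] is_mckD(2)[OF N]] .

lemma G_ob_qrep:
  assumes N: "is_mck \<Gamma> N"
  shows "is_qrep \<Gamma> (G_ob \<Gamma> X yt N)"
proof -
  let ?R = "G_ob \<Gamma> X yt N" and ?Q = "mckay_quiver TYPE('u) \<Gamma>"
  note n = is_mckD[OF N] and H = fdvs_HS[OF N]
  have "RV ?R \<chi> = undefined" "RVf ?R \<chi> = undefined" "Rv1 ?R \<chi> = undefined" "Rv2 ?R \<chi> = undefined" if "\<chi> \<notin> Irr TYPE('u) \<Gamma>" for \<chi>
    using that by (simp_all add: G_ob_def Let_def)
  moreover have "Rx ?R h = undefined" if "h \<notin> arcs ?Q" for h using that by (simp add: G_ob_def Let_def)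
  moreover have "fdvs (RV ?R \<chi>)" "fdvs (RVf ?R \<chi>)" if "\<chi> \<in> Irr TYPE('u) \<Gamma>" for \<chi>
    unfolding G_ob_simps(1,2)[OF that] by (intro fdvs_copy encodable H that)+
  moreover have "Rx ?R h \<in> Lin (RV ?R (tail ?Q h)) (RV ?R (head ?Q h))" if h: "h \<in> arcs ?Q" for h
    unfolding G_ob_simps(1)[OF arcs_tail_head(1)[OF h]] G_ob_simps(1)[OF arcs_tail_head(2)[OF h]] G_ob_simps(3)[OF h]
    by (rule copy_map_Lin[OF H(1) H(1) Gx_mhom[OF N h]]) (use arcs_tail_head[OF h] in auto)
  moreover have "Rv1 ?R \<chi> \<in> Lin (RVf ?R \<chi>) (RV ?R \<chi>)" if c: "\<chi> \<in> Irr TYPE('u) \<Gamma>" for \<chi>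
    unfolding G_ob_simps(1,2,4)[OF that] by (rule copy_map_Lin[OF H(2)[OF c] H(1)[OF c] GZ1_mhom[OF N c]])
  moreover have "Rv2 ?R \<chi> \<in> Lin (RV ?R \<chi>) (RVf ?R \<chi>)" if c: "\<chi> \<in> Irr TYPE('u) \<Gamma>" for \<chi>
    unfolding G_ob_simps(1,2,5)[OF that] by (rule copy_map_Lin[OF H(1)[OF c] H(2)[OF c] compose_GHom_mhom[OF irrD(3)[OF c] n(1,2,5)]])
  ultimately show ?thesis unfolding is_qrep_def Let_def by (simp add: PiE_iff extensional_def)
qed

lemma G_functor_simps:
  "onOb (G_functor \<Gamma> X yt) = G_ob \<Gamma> X yt"
  "onMor (G_functor \<Gamma> X yt) N N' (\<Phi>, \<Psi>) =
     (\<lambda>\<chi>\<in>Irr TYPE('u) \<Gamma>. copy_map (GHom_space \<Gamma> (X \<chi>) (MM N)) (GHom_space \<Gamma> (X \<chi>) (MM N')) (\<lambda>f. compose (carrier (X \<chi>)) \<Phi> f),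
      \<lambda>\<chi>\<in>Irr TYPE('u) \<Gamma>. copy_map (GHom_space \<Gamma> (X \<chi>) (MMf N)) (GHom_space \<Gamma> (X \<chi>) (MMf N')) (\<lambda>f. compose (carrier (X \<chi>)) \<Psi> f))"
  by (simp_all add: G_functor_def)

text \<open>This is the compatibility of \<open>\<Phi>\<close> with \<open>MD\<close> together with
  functoriality of \<open>tmap\<close>; \<open>tmap_cong\<close> removes the difference between
  plain and extensional composites.\<close>

lemma Gx_natural:
  assumes N: "is_mck \<Gamma> N" and N': "is_mck \<Gamma> N'" and F: "(\<Phi>, \<Psi>) \<in> mck_mor \<Gamma> N N'" and h: "h \<in> arcs (mckay_quiver TYPE('u) \<Gamma>)"
    and f: "f \<in> GHom \<Gamma> (X (tail (mckay_quiver TYPE('u) \<Gamma>) h)) (MM N)"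
  shows "compose (carrier (X (head (mckay_quiver TYPE('u) \<Gamma>) h))) \<Phi> (Gx N h f) =
    Gx N' h (compose (carrier (X (tail (mckay_quiver TYPE('u) \<Gamma>) h))) \<Phi> f)"
  unfolding Gx_def compose_def
proof (rule restrict_ext)
  let ?i = "tail (mckay_quiver TYPE('u) \<Gamma>) h" and ?j = "head (mckay_quiver TYPE('u) \<Gamma>) h"
  note n = is_mckD[OF N] and n' = is_mckD[OF N'] and Xi = irrD[OF arcs_tail_head(1)[OF h]] and D = mck_morD[OF F] and fm = Lin_mhom[OF GHom_Lin[OF f]]
  fix w assume w: "w \<in> carrier (X ?j)"
  note t = mhom_closed[OF y_mhom(2)[OF h] w]
  note T = tmap_mhom[OF fdvs_Xstd Xi(4) fdvs_Xstd n(6) mhom_id fm]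
  have "\<Phi> (MD N (tmap Xstd (X ?i) Xstd (MM N) (\<lambda>s. s) f (yt h w))) = MD N' (tmap Xstd (MM N) Xstd (MM N') (\<lambda>s. s) \<Phi> (tmap Xstd (X ?i) Xstd (MM N) (\<lambda>s. s) f (yt h w)))"
    by (rule D(3)[OF mhom_closed[OF T t]])
  also have "tmap Xstd (MM N) Xstd (MM N') (\<lambda>s. s) \<Phi> (tmap Xstd (X ?i) Xstd (MM N) (\<lambda>s. s) f (yt h w)) = tmap Xstd (X ?i) Xstd (MM N') (\<lambda>s. s) (\<lambda>w. \<Phi> (f w)) (yt h w)"
    by (rule tmap_comp[OF fdvs_Xstd Xi(4) fdvs_Xstd n(6) fdvs_Xstd n'(6) mhom_id fm mhom_id D(6) t])
  also have "\<dots> = tmap Xstd (X ?i) Xstd (MM N') (\<lambda>s. s) (\<lambda>w\<in>carrier (X ?i). \<Phi> (f w)) (yt h w)"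
    by (rule fun_cong[OF tmap_cong[OF fdvs_Xstd Xi(4) fdvs_Xstd n'(6) mhom_id mhom_comp[OF fm D(6)]]]) auto
  finally show "\<Phi> ((\<lambda>w\<in>carrier (X ?j). MD N (tmap Xstd (X ?i) Xstd (MM N) (\<lambda>s. s) f (yt h w))) w) =
      MD N' (tmap Xstd (X ?i) Xstd (MM N') (\<lambda>s. s) (\<lambda>w\<in>carrier (X ?i). \<Phi> (f w)) (yt h w))" using w by simp
qed

lemma G_mor_qrep:
  assumes N: "is_mck \<Gamma> N" and N': "is_mck \<Gamma> N'" and F: "(\<Phi>, \<Psi>) \<in> mck_mor \<Gamma> N N'"
  shows "onMor (G_functor \<Gamma> X yt) N N' (\<Phi>, \<Psi>) \<in> qrep_mor \<Gamma> (G_ob \<Gamma> X yt N) (G_ob \<Gamma> X yt N')"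
  unfolding G_functor_simps
proof (rule qrep_morI)
  note n = is_mckD[OF N] and n' = is_mckD[OF N'] and D = mck_morD[OF F] and H = fdvs_HS[OF N] and H' = fdvs_HS[OF N']
  let ?Q = "mckay_quiver TYPE('u) \<Gamma>" and ?R = "G_ob \<Gamma> X yt N" and ?R' = "G_ob \<Gamma> X yt N'"
  let ?\<phi> = "\<lambda>\<chi>. copy_map (GHom_space \<Gamma> (X \<chi>) (MM N)) (GHom_space \<Gamma> (X \<chi>) (MM N')) (\<lambda>f. compose (carrier (X \<chi>)) \<Phi> f) :: 'u \<Rightarrow> 'u"
  let ?\<psi> = "\<lambda>\<chi>. copy_map (GHom_space \<Gamma> (X \<chi>) (MMf N)) (GHom_space \<Gamma> (X \<chi>) (MMf N')) (\<lambda>f. compose (carrier (X \<chi>)) \<Psi> f) :: 'u \<Rightarrow> 'u"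
  have L: "?\<phi> \<chi> \<in> Lin (RV ?R \<chi>) (RV ?R' \<chi>)" "?\<psi> \<chi> \<in> Lin (RVf ?R \<chi>) (RVf ?R' \<chi>)" if c: "\<chi> \<in> Irr TYPE('u) \<Gamma>" for \<chi>
    unfolding G_ob_simps(1,2)[OF c]
    by (rule copy_map_Lin[OF H(1)[OF c] H'(1)[OF c] compose_GHom_mhom[OF irrD(3)[OF c] n(1) n'(1) D(1)]]
             copy_map_Lin[OF H(2)[OF c] H'(2)[OF c] compose_GHom_mhom[OF irrD(3)[OF c] n(2) n'(2) D(2)]])+
  show "(\<lambda>\<chi>\<in>Irr TYPE('u) \<Gamma>. ?\<phi> \<chi>) \<in> (\<Pi>\<^sub>E \<chi>\<in>Irr TYPE('u) \<Gamma>. Lin (RV ?R \<chi>) (RV ?R' \<chi>))" using L(1) by (simp add: PiE_iff)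
  show "(\<lambda>\<chi>\<in>Irr TYPE('u) \<Gamma>. ?\<psi> \<chi>) \<in> (\<Pi>\<^sub>E \<chi>\<in>Irr TYPE('u) \<Gamma>. Lin (RVf ?R \<chi>) (RVf ?R' \<chi>))" using L(2) by (simp add: PiE_iff)
  fix v
  {
    fix h assume h: "h \<in> arcs ?Q" and "v \<in> carrier (RV ?R (tail ?Q h))"
    note i = arcs_tail_head(1)[OF h] and j = arcs_tail_head(2)[OF h]
    from \<open>v \<in> _\<close>[unfolded G_ob_simps(1)[OF i]] obtain f where f: "f \<in> GHom \<Gamma> (X (tail ?Q h)) (MM N)" "v = enc (GHom_space \<Gamma> (X (tail ?Q h)) (MM N)) f"
      by (rule copy_cases) simp
    have G: "Gx N h f \<in> GHom \<Gamma> (X (head ?Q h)) (MM N)" using mhom_closed[OF Gx_mhom[OF N h]] f(1) by simp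
    have C: "compose (carrier (X (tail ?Q h))) \<Phi> f \<in> GHom \<Gamma> (X (tail ?Q h)) (MM N')" by (rule GHom_compose[OF irrD(3)[OF i] f(1) D(1)])
    show "(\<lambda>\<chi>\<in>Irr TYPE('u) \<Gamma>. ?\<phi> \<chi>) (head ?Q h) (Rx ?R h v) = Rx ?R' h ((\<lambda>\<chi>\<in>Irr TYPE('u) \<Gamma>. ?\<phi> \<chi>) (tail ?Q h) v)"
      unfolding G_ob_simps(3)[OF h] f(2) restrict_apply'[OF i] restrict_apply'[OF j]
      using f(1) G C by (simp add: copy_map_enc H[OF i] H[OF j] H'[OF i] Gx_natural[OF N N' F h f(1)])
  next
    fix \<chi> assume c: "\<chi> \<in> Irr TYPE('u) \<Gamma>" and "v \<in> carrier (RVf ?R \<chi>)"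
    from this(2)[unfolded G_ob_simps(2)[OF c]] obtain f where f: "f \<in> GHom \<Gamma> (X \<chi>) (MMf N)" "v = enc (GHom_space \<Gamma> (X \<chi>) (MMf N)) f"
      by (rule copy_cases) simp
    let ?g = "\<lambda>w\<in>carrier (X \<chi>). delta X \<chi> \<odot>\<^bsub>MM N\<^esub> MZ1 N (f w)"
    have G: "?g \<in> GHom \<Gamma> (X \<chi>) (MM N)" using mhom_closed[OF GZ1_mhom[OF N c]] f(1) by simp
    have C: "compose (carrier (X \<chi>)) \<Psi> f \<in> GHom \<Gamma> (X \<chi>) (MMf N')" by (rule GHom_compose[OF irrD(3)[OF c] f(1) D(2)])
    have e: "compose (carrier (X \<chi>)) \<Phi> ?g = (\<lambda>w\<in>carrier (X \<chi>). delta X \<chi> \<odot>\<^bsub>MM N'\<^esub> MZ1 N' (compose (carrier (X \<chi>)) \<Psi> f w))"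
      unfolding compose_def
      by (rule restrict_ext) (use Lin_closed[OF GHom_Lin[OF f(1)]] in \<open>simp add: mhom_smult[OF D(6)] mhom_closed[OF n(9)] D(5)\<close>)
    show "(\<lambda>\<chi>\<in>Irr TYPE('u) \<Gamma>. ?\<phi> \<chi>) \<chi> (Rv1 ?R \<chi> v) = Rv1 ?R' \<chi> ((\<lambda>\<chi>\<in>Irr TYPE('u) \<Gamma>. ?\<psi> \<chi>) \<chi> v)"
      unfolding G_ob_simps(4)[OF c] f(2) restrict_apply'[OF c]
      using f(1) G C by (simp add: copy_map_enc H[OF c] H'[OF c] e)
  next
    fix \<chi> assume c: "\<chi> \<in> Irr TYPE('u) \<Gamma>" and "v \<in> carrier (RV ?R \<chi>)"
    from this(2)[unfolded G_ob_simps(1)[OF c]] obtain f where f: "f \<in> GHom \<Gamma> (X \<chi>) (MM N)" "v = enc (GHom_space \<Gamma> (X \<chi>) (MM N)) f"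
      by (rule copy_cases) simp
    have G: "compose (carrier (X \<chi>)) (MZ2 N) f \<in> GHom \<Gamma> (X \<chi>) (MMf N)" by (rule GHom_compose[OF irrD(3)[OF c] f(1) n(5)])
    have C: "compose (carrier (X \<chi>)) \<Phi> f \<in> GHom \<Gamma> (X \<chi>) (MM N')" by (rule GHom_compose[OF irrD(3)[OF c] f(1) D(1)])
    have e: "compose (carrier (X \<chi>)) \<Psi> (compose (carrier (X \<chi>)) (MZ2 N) f) = compose (carrier (X \<chi>)) (MZ2 N') (compose (carrier (X \<chi>)) \<Phi> f)"
      unfolding compose_def
      by (rule restrict_ext) (use Lin_closed[OF GHom_Lin[OF f(1)]] in \<open>simp add: D(4)\<close>)
    show "(\<lambda>\<chi>\<in>Irr TYPE('u) \<Gamma>. ?\<psi> \<chi>) \<chi> (Rv2 ?R \<chi> v) = Rv2 ?R' \<chi> ((\<lambda>\<chi>\<in>Irr TYPE('u) \<Gamma>. ?\<phi> \<chi>) \<chi> v)"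
      unfolding G_ob_simps(5)[OF c] f(2) restrict_apply'[OF c]
      using f(1) G C by (simp add: copy_map_enc H[OF c] H'[OF c] e)
  }
qed

lemma functor_G: "is_functor (McK \<Gamma>) (Rep \<Gamma>) (G_functor \<Gamma> X yt)"
  unfolding is_functor_def
proof (intro conjI ballI)
  fix N :: "'u mck" assume "N \<in> Ob (McK \<Gamma>)"
  then have N: "is_mck \<Gamma> N" by simp
  note n = is_mckD[OF N] and H = fdvs_HS[OF N]
  show "onOb (G_functor \<Gamma> X yt) N \<in> Ob (Rep \<Gamma>)" using G_ob_qrep[OF N] by (simp add: G_functor_simps)
  have e: "compose (carrier (X \<chi>)) (\<lambda>m\<in>carrier M. m) f = f" if "f \<in> carrier (GHom_space \<Gamma> (X \<chi>) M)" for \<chi> f and M :: "'u gmod"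
    using Lin_compose_id(2)[OF GHom_Lin] that by simp
  have "(\<lambda>\<chi>\<in>Irr TYPE('u) \<Gamma>. copy_map (GHom_space \<Gamma> (X \<chi>) (MM N)) (GHom_space \<Gamma> (X \<chi>) (MM N)) (\<lambda>f. compose (carrier (X \<chi>)) (\<lambda>m\<in>carrier (MM N). m) f)) =
     (\<lambda>\<chi>\<in>Irr TYPE('u) \<Gamma>. \<lambda>v\<in>carrier (RV (G_ob \<Gamma> X yt N) \<chi>). v)"
    by (rule restrict_ext) (simp only: G_ob_simps copy_map_id[OF H(1) e])
  moreover have "(\<lambda>\<chi>\<in>Irr TYPE('u) \<Gamma>. copy_map (GHom_space \<Gamma> (X \<chi>) (MMf N)) (GHom_space \<Gamma> (X \<chi>) (MMf N)) (\<lambda>f. compose (carrier (X \<chi>)) (\<lambda>m\<in>carrier (MMf N). m) f)) =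
     (\<lambda>\<chi>\<in>Irr TYPE('u) \<Gamma>. \<lambda>v\<in>carrier (RVf (G_ob \<Gamma> X yt N) \<chi>). v)"
    by (rule restrict_ext) (simp only: G_ob_simps copy_map_id[OF H(2) e])
  ultimately show "onMor (G_functor \<Gamma> X yt) N N (Idt (McK \<Gamma>) N) = Idt (Rep \<Gamma>) (onOb (G_functor \<Gamma> X yt) N)"
    unfolding McK_simps G_functor_simps Rep_simps by (intro arg_cong2[of _ _ _ _ Pair])
next
  fix N N' :: "'u mck" and f assume "N \<in> Ob (McK \<Gamma>)" "N' \<in> Ob (McK \<Gamma>)" and f: "f \<in> Mor (McK \<Gamma>) N N'"
  then have N: "is_mck \<Gamma> N" "is_mck \<Gamma> N'" by simp_all
  obtain \<Phi> \<Psi> where e: "f = (\<Phi>, \<Psi>)" by (metis surj_pair)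
  show "onMor (G_functor \<Gamma> X yt) N N' f \<in> Mor (Rep \<Gamma>) (onOb (G_functor \<Gamma> X yt) N) (onOb (G_functor \<Gamma> X yt) N')"
    using G_mor_qrep[OF N f[unfolded e McK_simps]] unfolding e Rep_simps G_functor_simps(1) .
next
  fix N N' N'' :: "'u mck" and f g assume "N \<in> Ob (McK \<Gamma>)" "N' \<in> Ob (McK \<Gamma>)" "N'' \<in> Ob (McK \<Gamma>)"
    and f: "f \<in> Mor (McK \<Gamma>) N N'" and g: "g \<in> Mor (McK \<Gamma>) N' N''"
  then have N: "is_mck \<Gamma> N" "is_mck \<Gamma> N'" "is_mck \<Gamma> N''" by simp_all
  obtain \<Phi> \<Psi> \<Phi>' \<Psi>' where e: "f = (\<Phi>, \<Psi>)" "g = (\<Phi>', \<Psi>')" by (metis surj_pair)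
  note F = mck_morD[OF f[unfolded e McK_simps]]
  note n = is_mckD[OF N(1)] and n' = is_mckD[OF N(2)]
  have c: "copy_map (GHom_space \<Gamma> (X \<chi>) M) Z (compose (carrier (X \<chi>)) (compose (carrier M) \<Phi>' \<Phi>)) =
      compose (carrier (copy (GHom_space \<Gamma> (X \<chi>) M) :: (complex, 'u) module)) (copy_map (GHom_space \<Gamma> (X \<chi>) M') Z (compose (carrier (X \<chi>)) \<Phi>'))
        (copy_map (GHom_space \<Gamma> (X \<chi>) M) (GHom_space \<Gamma> (X \<chi>) M') (compose (carrier (X \<chi>)) \<Phi>))"
    if \<chi>: "\<chi> \<in> Irr TYPE('u) \<Gamma>" and M: "is_gmod \<Gamma> M" "is_gmod \<Gamma> M'" and \<Phi>: "\<Phi> \<in> GHom \<Gamma> M M'"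
    for \<chi> \<Phi> \<Phi>' and Z :: "(complex, 'u \<Rightarrow> 'u) module" and M M' :: "'u gmod"
  proof (rule copy_map_comp[OF fdvs_GHom_space[OF irrD(3)[OF \<chi>] M(1)] fdvs_GHom_space[OF irrD(3)[OF \<chi>] M(2)] compose_GHom_mhom[OF irrD(3)[OF \<chi>] M \<Phi>]])
    fix v assume "v \<in> carrier (GHom_space \<Gamma> (X \<chi>) M)"
    then show "compose (carrier (X \<chi>)) (compose (carrier M) \<Phi>' \<Phi>) v = compose (carrier (X \<chi>)) \<Phi>' (compose (carrier (X \<chi>)) \<Phi> v)"
      unfolding GHom_space_simps by (rule Lin_compose_assoc[OF GHom_Lin, symmetric])
  qed
  show "onMor (G_functor \<Gamma> X yt) N N'' (Cmp (McK \<Gamma>) N N' N'' g f) =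
     Cmp (Rep \<Gamma>) (onOb (G_functor \<Gamma> X yt) N) (onOb (G_functor \<Gamma> X yt) N') (onOb (G_functor \<Gamma> X yt) N'')
       (onMor (G_functor \<Gamma> X yt) N' N'' g) (onMor (G_functor \<Gamma> X yt) N N' f)"
    unfolding e McK_simps G_functor_simps Rep_simps
  proof (intro arg_cong2[of _ _ _ _ Pair] restrict_ext)
    fix \<chi> assume x: "\<chi> \<in> Irr TYPE('u) \<Gamma>"
    show "copy_map (GHom_space \<Gamma> (X \<chi>) (MM N)) (GHom_space \<Gamma> (X \<chi>) (MM N'')) (compose (carrier (X \<chi>)) (compose (carrier (MM N)) \<Phi>' \<Phi>)) =
      compose (carrier (RV (G_ob \<Gamma> X yt N) \<chi>))
       ((\<lambda>\<chi>\<in>Irr TYPE('u) \<Gamma>. copy_map (GHom_space \<Gamma> (X \<chi>) (MM N')) (GHom_space \<Gamma> (X \<chi>) (MM N'')) (compose (carrier (X \<chi>)) \<Phi>')) \<chi>)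
       ((\<lambda>\<chi>\<in>Irr TYPE('u) \<Gamma>. copy_map (GHom_space \<Gamma> (X \<chi>) (MM N)) (GHom_space \<Gamma> (X \<chi>) (MM N')) (compose (carrier (X \<chi>)) \<Phi>)) \<chi>)"
      unfolding restrict_apply'[OF x] G_ob_simps(1)[OF x] by (rule c[OF x n(1) n'(1) F(1)])
    show "copy_map (GHom_space \<Gamma> (X \<chi>) (MMf N)) (GHom_space \<Gamma> (X \<chi>) (MMf N'')) (compose (carrier (X \<chi>)) (compose (carrier (MMf N)) \<Psi>' \<Psi>)) =
      compose (carrier (RVf (G_ob \<Gamma> X yt N) \<chi>))
       ((\<lambda>\<chi>\<in>Irr TYPE('u) \<Gamma>. copy_map (GHom_space \<Gamma> (X \<chi>) (MMf N')) (GHom_space \<Gamma> (X \<chi>) (MMf N'')) (compose (carrier (X \<chi>)) \<Psi>')) \<chi>)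
       ((\<lambda>\<chi>\<in>Irr TYPE('u) \<Gamma>. copy_map (GHom_space \<Gamma> (X \<chi>) (MMf N)) (GHom_space \<Gamma> (X \<chi>) (MMf N')) (compose (carrier (X \<chi>)) \<Psi>)) \<chi>)"
      unfolding restrict_apply'[OF x] G_ob_simps(2)[OF x] by (rule c[OF x n(2) n'(2) F(2)])
  qed
qed

end

section \<open>The unit\<close>

context irreducibles
begin

text \<open>The identification of \<open>V \<chi>\<close> with the multiplicity space of
  \<open>X \<chi>\<close> in the total module, before transport into \<open>'u\<close>.\<close>

definition coev :: "(cfun \<Rightarrow> (complex, 'u) module) \<Rightarrow> cfun \<Rightarrow> 'u \<Rightarrow> 'u \<Rightarrow> 'u" where
  "coev V \<chi> v = (\<lambda>w\<in>carrier (X \<chi>). inn V \<chi> v w)"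

lemma coev_GHom:
  assumes V: "fdfam V" and c: "\<chi> \<in> Irr TYPE('u) \<Gamma>" and v: "v \<in> carrier (V \<chi>)"
  shows "coev V \<chi> v \<in> GHom \<Gamma> (X \<chi>) (gcopy (total \<Gamma> X V))"
  unfolding coev_def
  by (rule restrict_GHom[OF irrD(3)[OF c] eqvI[OF bilinearD(1)[OF inn_bilinear[OF V c] v]]]) (rule inn_act[OF V c v, symmetric])

lemma coev_mhom:
  assumes V: "fdfam V" and c: "\<chi> \<in> Irr TYPE('u) \<Gamma>"
  shows "coev V \<chi> \<in> mhom (V \<chi>) (GHom_space \<Gamma> (X \<chi>) (gcopy (total \<Gamma> X V)))"
proof (rule mhom_GHom_spaceI[OF fdvs_vs[OF fdfamD[OF V c]] coev_GHom[OF V c]])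
  fix w assume w: "w \<in> carrier (X \<chi>)"
  show "(\<lambda>v. coev V \<chi> v w) \<in> mhom (V \<chi>) (gcopy (total \<Gamma> X V))"
    using bilinearD(2)[OF inn_bilinear[OF V c] w] w by (simp add: coev_def)
qed

text \<open>The functional \<open>c\<close> tensored with the identity of \<open>X \<chi>\<close>,
  and zero on the other summands. Such maps recover the coordinates of \<open>V \<chi>\<close> by
  equivariant means, which brings Schur's lemma to bear.\<close>

lemma slice_exists:
  assumes V: "fdfam V" and \<chi>: "\<chi> \<in> Irr TYPE('u) \<Gamma>" and c: "c \<in> mhom (V \<chi>) Cline"
  obtains p where "p \<in> eqv \<Gamma> (gcopy (total \<Gamma> X V)) (X \<chi>)"
    "\<And>\<kappa> v w. \<kappa> \<in> Irr TYPE('u) \<Gamma> \<Longrightarrow> v \<in> carrier (V \<kappa>) \<Longrightarrow> w \<in> carrier (X \<kappa>) \<Longrightarrow>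
       p (inn V \<kappa> v w) = (if \<kappa> = \<chi> then c v \<odot>\<^bsub>X \<chi>\<^esub> w else \<zero>\<^bsub>X \<chi>\<^esub>)"
proof -
  note x = irrD[OF \<chi>] and M = is_gmodD[OF FM_gmod[OF V]]
  let ?b = "\<lambda>\<kappa> v w. if \<kappa> = \<chi> then c v \<odot>\<^bsub>X \<chi>\<^esub> w else \<zero>\<^bsub>X \<chi>\<^esub>"
  have "bilinear (V \<kappa>) (X \<kappa>) (X \<chi>) (?b \<kappa>)" for \<kappa>
  proof (cases "\<kappa> = \<chi>")
    case True
    then show ?thesis using mhom_const_smult[OF x(5) mhom_id] mhom_scale[OF x(5) _ c] by (simp add: bilinear_def)
  next
    case False
    then show ?thesis by (simp add: bilinear_def mhom_const_zero[OF x(5)])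
  qed
  then have b: "\<forall>\<kappa>\<in>Irr TYPE('u) \<Gamma>. bilinear (V \<kappa>) (X \<kappa>) (X \<chi>) (?b \<kappa>)" by blast
  obtain p where p: "p \<in> mhom (gcopy (total \<Gamma> X V) :: 'u gmod) (X \<chi>)"
    and pi: "\<And>\<kappa> v w. \<kappa> \<in> Irr TYPE('u) \<Gamma> \<Longrightarrow> v \<in> carrier (V \<kappa>) \<Longrightarrow> w \<in> carrier (X \<kappa>) \<Longrightarrow> p (inn V \<kappa> v w) = ?b \<kappa> v w"
    using FM_lift[OF V x(5) b] by blast
  have "p \<in> eqv \<Gamma> (gcopy (total \<Gamma> X V)) (X \<chi>)"
  proof (rule eqvI[OF p])
    fix g m assume g: "g \<in> \<Gamma>" and m: "m \<in> carrier (gcopy (total \<Gamma> X V) :: 'u gmod)"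
    show "p (act (gcopy (total \<Gamma> X V)) g m) = act (X \<chi>) g (p m)"
    proof (rule FM_eqI[OF V x(5) mhom_comp[OF M(3)[OF g] p] mhom_comp[OF p is_gmodD(3)[OF x(3) g]] _ m])
      fix \<kappa> v w assume k: "\<kappa> \<in> Irr TYPE('u) \<Gamma>" "v \<in> carrier (V \<kappa>)" "w \<in> carrier (X \<kappa>)"
      note gw = is_gmodD(4)[OF irrD(3)[OF k(1)] g k(3)]
      show "p (act (gcopy (total \<Gamma> X V)) g (inn V \<kappa> v w)) = act (X \<chi>) g (p (inn V \<kappa> v w))"
        unfolding inn_act[OF V k g] pi[OF k(1,2) gw] pi[OF k]
        using k(3) by (auto simp: mhom_smult[OF is_gmodD(3)[OF x(3) g]] mhom_zero[OF x(5,5) is_gmodD(3)[OF x(3) g]])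
    qed
  qed
  then show ?thesis using pi that by blast
qed

text \<open>Scalars move across the tensor sign.\<close>

lemma inn_sum:
  assumes V: "fdfam V" and c: "\<chi> \<in> Irr TYPE('u) \<Gamma>" and A: "finite A" and e: "\<And>i. i \<in> A \<Longrightarrow> e i \<in> carrier (V \<chi>)" and w: "w \<in> carrier (X \<chi>)"
  shows "finsum (gcopy (total \<Gamma> X V)) (\<lambda>i. inn V \<chi> (e i) (a i \<odot>\<^bsub>X \<chi>\<^esub> w)) A = inn V \<chi> (finsum (V \<chi>) (\<lambda>i. a i \<odot>\<^bsub>V \<chi>\<^esub> e i) A) w"
proof -
  note Vv = fdvs_vs[OF fdfamD[OF V c]] and M = is_gmodD(2)[OF FM_gmod[OF V]] and b = inn_bilinear[OF V c]
  have "inn V \<chi> (finsum (V \<chi>) (\<lambda>i. a i \<odot>\<^bsub>V \<chi>\<^esub> e i) A) w = finsum (gcopy (total \<Gamma> X V)) (\<lambda>i. inn V \<chi> (a i \<odot>\<^bsub>V \<chi>\<^esub> e i) w) A"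
    by (rule mhom_finsum[OF Vv M bilinearD(2)[OF b w] A]) (use e Vv in auto)
  also have "\<dots> = finsum (gcopy (total \<Gamma> X V)) (\<lambda>i. inn V \<chi> (e i) (a i \<odot>\<^bsub>X \<chi>\<^esub> w)) A"
  proof (rule vfinsum_cong[OF M refl])
    fix i assume i: "i \<in> A"
    show "inn V \<chi> (a i \<odot>\<^bsub>V \<chi>\<^esub> e i) w = inn V \<chi> (e i) (a i \<odot>\<^bsub>X \<chi>\<^esub> w)"
      unfolding mhom_smult[OF bilinearD(2)[OF b w] e[OF i]] mhom_smult[OF bilinearD(1)[OF b e[OF i]] w] ..
    show "inn V \<chi> (e i) (a i \<odot>\<^bsub>X \<chi>\<^esub> w) \<in> carrier (gcopy (total \<Gamma> X V))"
      by (rule inn_closed[OF V c e[OF i]]) (use w irrD(5)[OF c] in simp)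
  qed
  finally show ?thesis ..
qed

text \<open>With \<open>e\<close> a basis of \<open>V \<kappa>\<close> and \<open>p\<close> the
  slices along the dual basis, the identity of the total module is resolved into maps through
  irreducible modules. Only the equivariance of \<open>p\<close> and the resolution itself are
  kept.\<close>

lemma slice_system:
  assumes V: "fdfam V"
  shows "\<exists>(n :: cfun \<Rightarrow> nat) e p. (\<forall>\<kappa>\<in>Irr TYPE('u) \<Gamma>. \<forall>i<n \<kappa>. e \<kappa> i \<in> carrier (V \<kappa>) \<and> p \<kappa> i \<in> eqv \<Gamma> (gcopy (total \<Gamma> X V)) (X \<kappa>)) \<and>
    (\<forall>m\<in>carrier (gcopy (total \<Gamma> X V) :: 'u gmod).
       finsum (gcopy (total \<Gamma> X V)) (\<lambda>\<kappa>. finsum (gcopy (total \<Gamma> X V)) (\<lambda>i. inn V \<kappa> (e \<kappa> i) (p \<kappa> i m)) {..<n \<kappa>}) (Irr TYPE('u) \<Gamma>) = m)"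
proof -
  let ?M = "gcopy (total \<Gamma> X V) :: 'u gmod" and ?I = "Irr TYPE('u) \<Gamma>"
  note M = is_gmodD[OF FM_gmod[OF V]]
  define S where "S \<kappa> c p \<longleftrightarrow> p \<in> eqv \<Gamma> ?M (X \<kappa>) \<and> (\<forall>\<kappa>'\<in>?I. \<forall>v\<in>carrier (V \<kappa>'). \<forall>w\<in>carrier (X \<kappa>').
     p (inn V \<kappa>' v w) = (if \<kappa>' = \<kappa> then c v \<odot>\<^bsub>X \<kappa>\<^esub> w else \<zero>\<^bsub>X \<kappa>\<^esub>))" for \<kappa> c p
  define Q where "Q \<kappa> n e p \<longleftrightarrow> (\<exists>c. frame (V \<kappa>) {..<n::nat} e c \<and> (\<forall>i<n. S \<kappa> (c i) (p i)))" for \<kappa> n e p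
  have "\<exists>n e p. Q \<kappa> n e p" if k: "\<kappa> \<in> ?I" for \<kappa>
  proof -
    obtain e c and n :: nat where F: "frame (V \<kappa>) {..<n} e c" using fdvs_frame[OF fdfamD[OF V k]] by blast
    have "\<exists>p. S \<kappa> (c i) p" if "i < n" for i
      using slice_exists[OF V k frameD(3)[OF F], of i] that unfolding S_def by (metis lessThan_iff)
    then obtain p where "\<forall>i<n. S \<kappa> (c i) (p i)" by metis
    then show ?thesis using F unfolding Q_def by blast
  qed
  then obtain n e p where Q: "\<And>\<kappa>. \<kappa> \<in> ?I \<Longrightarrow> Q \<kappa> (n \<kappa>) (e \<kappa>) (p \<kappa>)" by metis
  then obtain c where F: "\<And>\<kappa>. \<kappa> \<in> ?I \<Longrightarrow> frame (V \<kappa>) {..<n \<kappa>} (e \<kappa>) (c \<kappa>)"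
    and S: "\<And>\<kappa> i. \<kappa> \<in> ?I \<Longrightarrow> i < n \<kappa> \<Longrightarrow> S \<kappa> (c \<kappa> i) (p \<kappa> i)" unfolding Q_def by metis
  have ec: "e \<kappa> i \<in> carrier (V \<kappa>)" if "\<kappa> \<in> ?I" "i < n \<kappa>" for \<kappa> i using frameD(2)[OF F] that by simp
  have pe: "p \<kappa> i \<in> eqv \<Gamma> ?M (X \<kappa>)" if "\<kappa> \<in> ?I" "i < n \<kappa>" for \<kappa> i using S that by (simp add: S_def)
  note pm = eqv_mhom[OF pe]
  have t: "(\<lambda>m. inn V \<kappa> (e \<kappa> i) (p \<kappa> i m)) \<in> mhom ?M ?M" if "\<kappa> \<in> ?I" "i < n \<kappa>" for \<kappa> i
    by (rule mhom_comp[OF pm[OF that] bilinearD(1)[OF inn_bilinear[OF V that(1)] ec[OF that]]])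
  have s: "(\<lambda>m. finsum ?M (\<lambda>i. inn V \<kappa> (e \<kappa> i) (p \<kappa> i m)) {..<n \<kappa>}) \<in> mhom ?M ?M" if "\<kappa> \<in> ?I" for \<kappa>
    by (rule mhom_sum[OF M(2) finite_lessThan]) (use t[OF that] in simp)
  have u: "(\<lambda>m. finsum ?M (\<lambda>\<kappa>. finsum ?M (\<lambda>i. inn V \<kappa> (e \<kappa> i) (p \<kappa> i m)) {..<n \<kappa>}) ?I) \<in> mhom ?M ?M"
    by (rule mhom_sum[OF M(2) finite_irr s])
  show ?thesis
  proof (intro exI conjI ballI allI impI)
    show "e \<kappa> i \<in> carrier (V \<kappa>)" "p \<kappa> i \<in> eqv \<Gamma> ?M (X \<kappa>)" if "\<kappa> \<in> ?I" "i < n \<kappa>" for \<kappa> i using ec[OF that] pe[OF that] .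
    fix m assume m: "m \<in> carrier ?M"
    show "finsum ?M (\<lambda>\<kappa>. finsum ?M (\<lambda>i. inn V \<kappa> (e \<kappa> i) (p \<kappa> i m)) {..<n \<kappa>}) ?I = m"
    proof (rule FM_eqI[OF V M(2) u mhom_id _ m])
      fix \<chi> v w assume c: "\<chi> \<in> ?I" "v \<in> carrier (V \<chi>)" "w \<in> carrier (X \<chi>)"
      let ?m = "inn V \<chi> v w"
      have P: "p \<kappa> i ?m = (if \<chi> = \<kappa> then c \<kappa> i v \<odot>\<^bsub>X \<kappa>\<^esub> w else \<zero>\<^bsub>X \<kappa>\<^esub>)" if "\<kappa> \<in> ?I" "i < n \<kappa>" for \<kappa> i
        using S[OF that] c by (simp add: S_def)
      have "finsum ?M (\<lambda>\<kappa>. finsum ?M (\<lambda>i. inn V \<kappa> (e \<kappa> i) (p \<kappa> i ?m)) {..<n \<kappa>}) ?I = finsum ?M (\<lambda>i. inn V \<chi> (e \<chi> i) (p \<chi> i ?m)) {..<n \<chi>}"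
      proof (rule vfinsum_single[OF M(2) finite_irr c(1)])
        show "finsum ?M (\<lambda>i. inn V \<chi> (e \<chi> i) (p \<chi> i ?m)) {..<n \<chi>} \<in> carrier ?M"
          by (rule mhom_closed[OF s[OF c(1)] inn_closed[OF V c]])
        fix \<kappa> assume k: "\<kappa> \<in> ?I" "\<kappa> \<noteq> \<chi>"
        show "finsum ?M (\<lambda>i. inn V \<kappa> (e \<kappa> i) (p \<kappa> i ?m)) {..<n \<kappa>} = \<zero>\<^bsub>?M\<^esub>"
        proof (rule vfinsum_zero[OF M(2)])
          fix i assume "i \<in> {..<n \<kappa>}"
          then have i: "i < n \<kappa>" by simp
          show "inn V \<kappa> (e \<kappa> i) (p \<kappa> i ?m) = \<zero>\<^bsub>?M\<^esub>"
            unfolding P[OF k(1) i] using k(2) mhom_zero[OF irrD(5)[OF k(1)] M(2) bilinearD(1)[OF inn_bilinear[OF V k(1)] ec[OF k(1) i]]] by auto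
        qed
      qed
      also have "\<dots> = finsum ?M (\<lambda>i. inn V \<chi> (e \<chi> i) (c \<chi> i v \<odot>\<^bsub>X \<chi>\<^esub> w)) {..<n \<chi>}"
      proof (rule vfinsum_cong[OF M(2) refl])
        fix i assume "i \<in> {..<n \<chi>}"
        then have i: "i < n \<chi>" by simp
        show "inn V \<chi> (e \<chi> i) (p \<chi> i ?m) = inn V \<chi> (e \<chi> i) (c \<chi> i v \<odot>\<^bsub>X \<chi>\<^esub> w)" using P[OF c(1) i] by simp
        show "inn V \<chi> (e \<chi> i) (c \<chi> i v \<odot>\<^bsub>X \<chi>\<^esub> w) \<in> carrier ?M"
          by (rule inn_closed[OF V c(1) ec[OF c(1) i]]) (use c irrD(5) in simp)
      qed
      also have "\<dots> = inn V \<chi> (finsum (V \<chi>) (\<lambda>i. c \<chi> i v \<odot>\<^bsub>V \<chi>\<^esub> e \<chi> i) {..<n \<chi>}) w"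
        by (rule inn_sum[OF V c(1) finite_lessThan _ c(3)]) (use ec[OF c(1)] in simp)
      also have "\<dots> = ?m" unfolding frameD(5)[OF F[OF c(1)] c(2)] ..
      finally show "finsum ?M (\<lambda>\<kappa>. finsum ?M (\<lambda>i. inn V \<kappa> (e \<kappa> i) (p \<kappa> i ?m)) {..<n \<kappa>}) ?I = ?m" .
    qed
  qed
qed

text \<open>Slicing along an arbitrary functional \<open>c\<close> and evaluating at one nonzero
  \<open>w\<close> gives \<open>c v = c v'\<close>, and functionals separate points.\<close>

lemma coev_inj:
  assumes V: "fdfam V" and \<chi>: "\<chi> \<in> Irr TYPE('u) \<Gamma>"
  shows "inj_on (coev V \<chi>) (carrier (V \<chi>))"
proof (rule inj_onI)
  note x = irrD[OF \<chi>]
  fix v v' assume v: "v \<in> carrier (V \<chi>)" "v' \<in> carrier (V \<chi>)" and e: "coev V \<chi> v = coev V \<chi> v'"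
  obtain w where w: "w \<in> carrier (X \<chi>)" "w \<noteq> \<zero>\<^bsub>X \<chi>\<^esub>" using irreducible_nonzero[OF x(1)] by blast
  have i: "inn V \<chi> v w = inn V \<chi> v' w" using fun_cong[OF e, of w] w by (simp add: coev_def)
  show "v = v'"
  proof (rule vec_eqI[OF fdfamD[OF V \<chi>] v])
    fix c assume c: "c \<in> mhom (V \<chi>) Cline"
    obtain p where p: "\<And>\<kappa> v w. \<kappa> \<in> Irr TYPE('u) \<Gamma> \<Longrightarrow> v \<in> carrier (V \<kappa>) \<Longrightarrow> w \<in> carrier (X \<kappa>) \<Longrightarrow>
       p (inn V \<kappa> v w) = (if \<kappa> = \<chi> then c v \<odot>\<^bsub>X \<chi>\<^esub> w else \<zero>\<^bsub>X \<chi>\<^esub>)"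
      using slice_exists[OF V \<chi> c] by metis
    have "c v \<odot>\<^bsub>X \<chi>\<^esub> w = c v' \<odot>\<^bsub>X \<chi>\<^esub> w" using p[OF \<chi> v(1) w(1)] p[OF \<chi> v(2) w(1)] i by simp
    then have "(c v + (- 1) * c v') \<odot>\<^bsub>X \<chi>\<^esub> w = \<zero>\<^bsub>X \<chi>\<^esub>"
      unfolding vadd_smult[OF x(5) w(1)] vsmult_smult[OF x(5) w(1), symmetric] using vneg[OF x(5), of "c v' \<odot>\<^bsub>X \<chi>\<^esub> w"] vsmult_closed[OF x(5) w(1)] by metis
    then show "c v = c v'" using vsmult_eq_zero[OF x(5) w(1)] w(2) by fastforce
  qed
qed

text \<open>Composed with the slices, \<open>f\<close> becomes a map between irreducible modules:
  zero for \<open>\<kappa> \<noteq> \<chi>\<close> and a scalar \<open>a i\<close> for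
  \<open>\<kappa> = \<chi>\<close>. The resolution of the identity reassembles \<open>f\<close> from
  the vector with coordinates \<open>a i\<close>.\<close>

lemma coev_surj:
  assumes V: "fdfam V" and \<chi>: "\<chi> \<in> Irr TYPE('u) \<Gamma>" and f: "f \<in> GHom \<Gamma> (X \<chi>) (gcopy (total \<Gamma> X V))"
  obtains v where "v \<in> carrier (V \<chi>)" "f = coev V \<chi> v"
proof -
  let ?M = "gcopy (total \<Gamma> X V) :: 'u gmod" and ?I = "Irr TYPE('u) \<Gamma>"
  note M = is_gmodD[OF FM_gmod[OF V]] and x = irrD[OF \<chi>]
  obtain n :: "cfun \<Rightarrow> nat" and e p where S: "(\<forall>\<kappa>\<in>?I. \<forall>i<n \<kappa>. e \<kappa> i \<in> carrier (V \<kappa>) \<and> p \<kappa> i \<in> eqv \<Gamma> ?M (X \<kappa>)) \<and>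
    (\<forall>m\<in>carrier ?M. finsum ?M (\<lambda>\<kappa>. finsum ?M (\<lambda>i. inn V \<kappa> (e \<kappa> i) (p \<kappa> i m)) {..<n \<kappa>}) ?I = m)"
    using slice_system[OF V] by (elim exE) (rule that)
  have ec: "\<And>\<kappa> i. \<kappa> \<in> ?I \<Longrightarrow> i < n \<kappa> \<Longrightarrow> e \<kappa> i \<in> carrier (V \<kappa>)"
    and pe: "\<And>\<kappa> i. \<kappa> \<in> ?I \<Longrightarrow> i < n \<kappa> \<Longrightarrow> p \<kappa> i \<in> eqv \<Gamma> ?M (X \<kappa>)"
    and sum: "\<And>m. m \<in> carrier ?M \<Longrightarrow> finsum ?M (\<lambda>\<kappa>. finsum ?M (\<lambda>i. inn V \<kappa> (e \<kappa> i) (p \<kappa> i m)) {..<n \<kappa>}) ?I = m"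
    using conjunct1[OF S] conjunct2[OF S] by (blast, blast, elim bspec)
  have z: "p \<kappa> i (f w) = \<zero>\<^bsub>X \<kappa>\<^esub>" if "\<kappa> \<in> ?I" "i < n \<kappa>" "\<kappa> \<noteq> \<chi>" "w \<in> carrier (X \<chi>)" for \<kappa> i w
    by (rule Schur_zero[OF x(1) irrD(1)[OF that(1)] _ eqv_comp[OF GHom_eqv[OF f] pe[OF that(1,2)]] that(4)])
      (use that x(2) irrD(2)[OF that(1)] in simp)
  have "\<exists>a. \<forall>w\<in>carrier (X \<chi>). p \<chi> i (f w) = a \<odot>\<^bsub>X \<chi>\<^esub> w" if "i < n \<chi>" for i
    by (rule Schur_scalar[OF x(1) eqv_comp[OF GHom_eqv[OF f] pe[OF \<chi> that]]])
  then obtain a where a: "\<And>i w. i < n \<chi> \<Longrightarrow> w \<in> carrier (X \<chi>) \<Longrightarrow> p \<chi> i (f w) = a i \<odot>\<^bsub>X \<chi>\<^esub> w" by metis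
  define v where "v = finsum (V \<chi>) (\<lambda>i. a i \<odot>\<^bsub>V \<chi>\<^esub> e \<chi> i) {..<n \<chi>}"
  have v: "v \<in> carrier (V \<chi>)" unfolding v_def using fdvs_vs[OF fdfamD[OF V \<chi>]] ec[OF \<chi>] by (intro vfinsum_closed) auto
  have "f w = coev V \<chi> v w" if w: "w \<in> carrier (X \<chi>)" for w
  proof -
    note fw = Lin_closed[OF GHom_Lin[OF f] w]
    have ic: "inn V \<chi> (e \<chi> i) (a i \<odot>\<^bsub>X \<chi>\<^esub> w) \<in> carrier ?M" if "i < n \<chi>" for i
      by (rule inn_closed[OF V \<chi> ec[OF \<chi> that]]) (use w x(5) in simp)
    have "f w = finsum ?M (\<lambda>\<kappa>. finsum ?M (\<lambda>i. inn V \<kappa> (e \<kappa> i) (p \<kappa> i (f w))) {..<n \<kappa>}) ?I" using sum[OF fw] ..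
    also have "\<dots> = finsum ?M (\<lambda>i. inn V \<chi> (e \<chi> i) (p \<chi> i (f w))) {..<n \<chi>}"
    proof (rule vfinsum_single[OF M(2) finite_irr \<chi>])
      show "finsum ?M (\<lambda>i. inn V \<chi> (e \<chi> i) (p \<chi> i (f w))) {..<n \<chi>} \<in> carrier ?M"
        by (rule vfinsum_closed[OF M(2)]) (use a[OF _ w] ic in auto)
      fix \<kappa> assume k: "\<kappa> \<in> ?I" "\<kappa> \<noteq> \<chi>"
      show "finsum ?M (\<lambda>i. inn V \<kappa> (e \<kappa> i) (p \<kappa> i (f w))) {..<n \<kappa>} = \<zero>\<^bsub>?M\<^esub>"
      proof (rule vfinsum_zero[OF M(2)])
        fix i assume "i \<in> {..<n \<kappa>}"
        then have i: "i < n \<kappa>" by simp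
        show "inn V \<kappa> (e \<kappa> i) (p \<kappa> i (f w)) = \<zero>\<^bsub>?M\<^esub>"
          unfolding z[OF k(1) i k(2) w] by (rule mhom_zero[OF irrD(5)[OF k(1)] M(2) bilinearD(1)[OF inn_bilinear[OF V k(1)] ec[OF k(1) i]]])
      qed
    qed
    also have "\<dots> = finsum ?M (\<lambda>i. inn V \<chi> (e \<chi> i) (a i \<odot>\<^bsub>X \<chi>\<^esub> w)) {..<n \<chi>}"
      by (rule vfinsum_cong[OF M(2) refl]) (use a[OF _ w] ic in auto)
    also have "\<dots> = inn V \<chi> v w" unfolding v_def
      by (rule inn_sum[OF V \<chi> finite_lessThan _ w]) (use ec[OF \<chi>] in simp)
    finally show ?thesis using w by (simp add: coev_def)
  qed
  then have "f = coev V \<chi> v" by (rule Lin_eqI[OF GHom_Lin[OF f] GHom_Lin[OF coev_GHom[OF V \<chi> v]]])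
  with v that show ?thesis by blast
qed

definition unit :: "(cfun \<Rightarrow> (complex, 'u) module) \<Rightarrow> cfun \<Rightarrow> 'u \<Rightarrow> 'u" where
  "unit V \<chi> = (\<lambda>v\<in>carrier (V \<chi>). enc (GHom_space \<Gamma> (X \<chi>) (gcopy (total \<Gamma> X V))) (coev V \<chi> v))"

lemma fdvs_FM_GHom:
  assumes "fdfam V" "\<chi> \<in> Irr TYPE('u) \<Gamma>"
  shows "fdvs (GHom_space \<Gamma> (X \<chi>) (gcopy (total \<Gamma> X V) :: 'u gmod))"
  by (rule fdvs_GHom_space[OF irrD(3)[OF assms(2)] FM_gmod[OF assms(1)]])

lemma unit_Lin:
  assumes V: "fdfam V" and c: "\<chi> \<in> Irr TYPE('u) \<Gamma>"
  shows "unit V \<chi> \<in> Lin (V \<chi>) (copy (GHom_space \<Gamma> (X \<chi>) (gcopy (total \<Gamma> X V) :: 'u gmod)))"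
  unfolding unit_def
proof (rule restrict_Lin[OF fdvs_vs[OF fdfamD[OF V c]]])
  show "(\<lambda>v. enc (GHom_space \<Gamma> (X \<chi>) (gcopy (total \<Gamma> X V))) (coev V \<chi> v) :: 'u) \<in> mhom (V \<chi>) (copy (GHom_space \<Gamma> (X \<chi>) (gcopy (total \<Gamma> X V) :: 'u gmod)))"
    by (rule mhom_comp[OF coev_mhom[OF V c] enc_mhom[OF encodable[OF fdvs_FM_GHom[OF V c]]]])
qed

lemma unit_bij:
  assumes V: "fdfam V" and c: "\<chi> \<in> Irr TYPE('u) \<Gamma>"
  shows "bij_betw (unit V \<chi>) (carrier (V \<chi>)) (carrier (copy (GHom_space \<Gamma> (X \<chi>) (gcopy (total \<Gamma> X V) :: 'u gmod))))"
proof -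
  let ?H = "GHom_space \<Gamma> (X \<chi>) (gcopy (total \<Gamma> X V) :: 'u gmod)"
  have "coev V \<chi> ` carrier (V \<chi>) = carrier ?H" 
    unfolding GHom_space_simps using coev_GHom[OF V c] by (auto elim!: coev_surj[OF V c])
  then have "bij_betw (coev V \<chi>) (carrier (V \<chi>)) (carrier ?H)" using coev_inj[OF V c] by (simp add: bij_betw_def)
  moreover have "bij_betw (enc ?H :: _ \<Rightarrow> 'u) (carrier ?H) (carrier (copy ?H))"
    using enc_inj[OF encodable[OF fdvs_FM_GHom[OF V c]]] by (simp add: bij_betw_def)
  ultimately have "bij_betw ((enc ?H :: _ \<Rightarrow> 'u) \<circ> coev V \<chi>) (carrier (V \<chi>)) (carrier (copy ?H))" by (rule bij_betw_trans)
  then show ?thesis by (rule bij_betw_cong[THEN iffD1, rotated]) (simp add: unit_def)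
qed

end

context mckay_choice
begin

lemma unit_apply: "v \<in> carrier (V \<chi>) \<Longrightarrow> unit V \<chi> v = enc (GHom_space \<Gamma> (X \<chi>) (gcopy (total \<Gamma> X V) :: 'u gmod)) (coev V \<chi> v)"
  by (simp add: unit_def)

text \<open>The values of \<open>yt h\<close> need not be pure tensors, so \<open>MD_F_pure\<close>
  is extended by linearity to the whole tensor product.\<close>

lemma MD_F_coev:
  assumes R: "is_qrep \<Gamma> (R :: 'u qrep)" and \<chi>: "\<chi> \<in> Irr TYPE('u) \<Gamma>" and v: "v \<in> carrier (RV R \<chi>)" and t: "t \<in> carrier (tensor Xstd (X \<chi>))"
  shows "MD (F_ob \<Gamma> X y R) (tmap Xstd (X \<chi>) Xstd (gcopy (total \<Gamma> X (RV R))) (\<lambda>s. s) (coev (RV R) \<chi> v) t) =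
    finsum (gcopy (total \<Gamma> X (RV R))) (\<lambda>h. inn (RV R) (head (mckay_quiver TYPE('u) \<Gamma>) h) (Rx R h v) (y h t))
      {h \<in> arcs (mckay_quiver TYPE('u) \<Gamma>). tail (mckay_quiver TYPE('u) \<Gamma>) h = \<chi>}"
proof -
  let ?Q = "mckay_quiver TYPE('u) \<Gamma>" and ?M = "gcopy (total \<Gamma> X (RV R)) :: 'u gmod"
  let ?A = "{h \<in> arcs ?Q. tail ?Q h = \<chi>}"
  note V = fdfam_RV(1)[OF R] and r = is_qrepD[OF R] and x = irrD[OF \<chi>]
  note M = is_gmodD[OF FM_gmod[OF V]]
  note cm = Lin_mhom[OF GHom_Lin[OF coev_GHom[OF V \<chi> v]]]
  have f: "(\<lambda>t. MD (F_ob \<Gamma> X y R) (tmap Xstd (X \<chi>) Xstd ?M (\<lambda>s. s) (coev (RV R) \<chi> v) t)) \<in> mhom (tensor Xstd (X \<chi>)) ?M"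
    by (rule mhom_comp[OF tmap_mhom[OF fdvs_Xstd x(4) fdvs_Xstd M(1) mhom_id cm] Lin_mhom[OF MD_F_Lin[OF R]]])
  have g: "(\<lambda>t. finsum ?M (\<lambda>h. inn (RV R) (head ?Q h) (Rx R h v) (y h t)) ?A) \<in> mhom (tensor Xstd (X \<chi>)) ?M"
  proof (rule mhom_sum[OF M(2)])
    fix h assume "h \<in> ?A"
    then have h: "h \<in> arcs ?Q" "tail ?Q h = \<chi>" by auto
    show "(\<lambda>t. inn (RV R) (head ?Q h) (Rx R h v) (y h t)) \<in> mhom (tensor Xstd (X \<chi>)) ?M"
      by (rule mhom_comp[OF y_mhom(1)[OF h(1), unfolded h(2)] bilinearD(1)[OF inn_bilinear[OF V arcs_tail_head(2)[OF h(1)]] mhom_closed[OF r(3)[OF h(1), unfolded h(2)] v]]])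
  qed simp
  show ?thesis
  proof (rule tensor_eqI[OF fdvs_Xstd x(4) M(2) f g _ t])
    fix s w assume s: "s \<in> carrier Xstd" and w: "w \<in> carrier (X \<chi>)"
    have "coev (RV R) \<chi> v w = inn (RV R) \<chi> v w" using w by (simp add: coev_def)
    then show "MD (F_ob \<Gamma> X y R) (tmap Xstd (X \<chi>) Xstd ?M (\<lambda>s. s) (coev (RV R) \<chi> v) (pure Xstd (X \<chi>) s w)) =
        finsum ?M (\<lambda>h. inn (RV R) (head ?Q h) (Rx R h v) (y h (pure Xstd (X \<chi>) s w))) ?A"
      unfolding tmap_pure[OF fdvs_Xstd x(4) fdvs_Xstd M(1) mhom_id cm s w] using MD_F_pure[OF R s \<chi> v w] by simp
  qed
qed

text \<open>\<open>MD_F_coev\<close> yields a sum over all arrows with the source of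
  \<open>h\<close>; \<open>y_yt\<close> leaves only the term of \<open>h\<close>, and there it
  cancels \<open>y h\<close> against \<open>yt h\<close>.\<close>

lemma Gx_coev:
  assumes R: "is_qrep \<Gamma> (R :: 'u qrep)" and h: "h \<in> arcs (mckay_quiver TYPE('u) \<Gamma>)"
    and v: "v \<in> carrier (RV R (tail (mckay_quiver TYPE('u) \<Gamma>) h))"
  shows "Gx (F_ob \<Gamma> X y R) h (coev (RV R) (tail (mckay_quiver TYPE('u) \<Gamma>) h) v) = coev (RV R) (head (mckay_quiver TYPE('u) \<Gamma>) h) (Rx R h v)"
  unfolding Gx_def coev_def[of _ "head _ _"]
proof (rule restrict_ext)
  let ?Q = "mckay_quiver TYPE('u) \<Gamma>" and ?M = "gcopy (total \<Gamma> X (RV R)) :: 'u gmod"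
  let ?A = "{g \<in> arcs ?Q. tail ?Q g = tail ?Q h}"
  note V = fdfam_RV(1)[OF R] and r = is_qrepD[OF R] and j = arcs_tail_head(2)[OF h]
  note M = is_gmodD[OF FM_gmod[OF V]]
  fix w assume w: "w \<in> carrier (X (head ?Q h))"
  note xv = mhom_closed[OF r(3)[OF h] v]
  have "MD (F_ob \<Gamma> X y R) (tmap Xstd (X (tail ?Q h)) Xstd ?M (\<lambda>s. s) (coev (RV R) (tail ?Q h) v) (yt h w)) =
      finsum ?M (\<lambda>g. inn (RV R) (head ?Q g) (Rx R g v) (y g (yt h w))) ?A"
    by (rule MD_F_coev[OF R arcs_tail_head(1)[OF h] v mhom_closed[OF y_mhom(2)[OF h] w]])
  also have "\<dots> = inn (RV R) (head ?Q h) (Rx R h v) (y h (yt h w))"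
  proof (rule vfinsum_single[OF M(2)])
    show "inn (RV R) (head ?Q h) (Rx R h v) (y h (yt h w)) \<in> carrier ?M"
      using inn_closed[OF V j xv w] unfolding y_yt[OF h h refl w] by simp
    fix g assume "g \<in> ?A" and ne: "g \<noteq> h"
    then have g: "g \<in> arcs ?Q" "tail ?Q g = tail ?Q h" by auto
    note xg = mhom_closed[OF r(3)[OF g(1), unfolded g(2)] v] and jg = arcs_tail_head(2)[OF g(1)]
    have y0: "y g (yt h w) = \<zero>\<^bsub>X (head ?Q g)\<^esub>" using y_yt[OF g(1) h g(2) w] ne by presburger
    show "inn (RV R) (head ?Q g) (Rx R g v) (y g (yt h w)) = \<zero>\<^bsub>?M\<^esub>"
      unfolding y0 by (rule mhom_zero[OF irrD(5)[OF jg] M(2) bilinearD(1)[OF inn_bilinear[OF V jg] xg]])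
  qed (use h in auto)
  also have "\<dots> = inn (RV R) (head ?Q h) (Rx R h v) w" unfolding y_yt[OF h h refl w] by simp
  finally show "MD (F_ob \<Gamma> X y R) (tmap Xstd (X (tail ?Q h)) Xstd (MM (F_ob \<Gamma> X y R)) (\<lambda>s. s) (coev (RV R) (tail ?Q h) v) (yt h w)) =
      inn (RV R) (head ?Q h) (Rx R h v) w" unfolding F_ob_simps(1) .
qed

lemma delta_nonzero: "\<chi> \<in> Irr TYPE('u) \<Gamma> \<Longrightarrow> delta X \<chi> \<noteq> 0"
  using irr_dim_pos by (simp add: delta_def)

lemma GZ1_coev:
  assumes R: "is_qrep \<Gamma> (R :: 'u qrep)" and c: "\<chi> \<in> Irr TYPE('u) \<Gamma>" and v: "v \<in> carrier (RVf R \<chi>)"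
  shows "(\<lambda>w\<in>carrier (X \<chi>). delta X \<chi> \<odot>\<^bsub>gcopy (total \<Gamma> X (RV R))\<^esub> MZ1 (F_ob \<Gamma> X y R) (coev (RVf R) \<chi> v w)) = coev (RV R) \<chi> (Rv1 R \<chi> v)"
  unfolding coev_def[of "RV R"]
proof (rule restrict_ext)
  let ?M = "gcopy (total \<Gamma> X (RV R)) :: 'u gmod"
  note V = fdfam_RV[OF R] and r = is_qrepD[OF R] and x = irrD[OF c]
  fix w assume w: "w \<in> carrier (X \<chi>)"
  note vv = mhom_closed[OF r(4)[OF c] v]
  have w': "(1 / delta X \<chi>) \<odot>\<^bsub>X \<chi>\<^esub> w \<in> carrier (X \<chi>)" using w x(5) by simp
  have "MZ1 (F_ob \<Gamma> X y R) (coev (RVf R) \<chi> v w) = inn (RV R) \<chi> (Rv1 R \<chi> v) ((1 / delta X \<chi>) \<odot>\<^bsub>X \<chi>\<^esub> w)"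
    using total_map_inn[OF V(2,1) is_qrep_all(1)[OF R] scale_eqv[of "\<lambda>\<chi>. 1 / delta X \<chi>"] c v w] w by (simp add: coev_def)
  \<comment> \<open>The scalar is moved into the second tensor factor, where it meets its
    inverse.\<close>
  moreover have "inn (RV R) \<chi> (Rv1 R \<chi> v) (delta X \<chi> \<odot>\<^bsub>X \<chi>\<^esub> ((1 / delta X \<chi>) \<odot>\<^bsub>X \<chi>\<^esub> w)) =
      delta X \<chi> \<odot>\<^bsub>?M\<^esub> inn (RV R) \<chi> (Rv1 R \<chi> v) ((1 / delta X \<chi>) \<odot>\<^bsub>X \<chi>\<^esub> w)"
    by (rule mhom_smult[OF bilinearD(1)[OF inn_bilinear[OF V(1) c] vv] w'])
  moreover have "delta X \<chi> \<odot>\<^bsub>X \<chi>\<^esub> ((1 / delta X \<chi>) \<odot>\<^bsub>X \<chi>\<^esub> w) = w" using w x(5) delta_nonzero[OF c] by simp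
  ultimately show "delta X \<chi> \<odot>\<^bsub>?M\<^esub> MZ1 (F_ob \<Gamma> X y R) (coev (RVf R) \<chi> v w) = inn (RV R) \<chi> (Rv1 R \<chi> v) w" by metis
qed

lemma GZ2_coev:
  assumes R: "is_qrep \<Gamma> (R :: 'u qrep)" and c: "\<chi> \<in> Irr TYPE('u) \<Gamma>" and v: "v \<in> carrier (RV R \<chi>)"
  shows "compose (carrier (X \<chi>)) (MZ2 (F_ob \<Gamma> X y R)) (coev (RV R) \<chi> v) = coev (RVf R) \<chi> (Rv2 R \<chi> v)"
  unfolding coev_def[of "RVf R"] compose_def
  by (rule restrict_ext)
    (use total_map_inn[OF fdfam_RV[OF R] is_qrep_all(2)[OF R] id_eqv c v] in \<open>simp add: coev_def\<close>)

lemma unit_mor: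
  assumes R: "is_qrep \<Gamma> (R :: 'u qrep)"
  shows "(\<lambda>\<chi>\<in>Irr TYPE('u) \<Gamma>. unit (RV R) \<chi>, \<lambda>\<chi>\<in>Irr TYPE('u) \<Gamma>. unit (RVf R) \<chi>) \<in> qrep_mor \<Gamma> R (G_ob \<Gamma> X yt (F_ob \<Gamma> X y R))"
proof (rule qrep_morI)
  let ?Q = "mckay_quiver TYPE('u) \<Gamma>" and ?N = "F_ob \<Gamma> X y R" and ?I = "Irr TYPE('u) \<Gamma>"
  note V = fdfam_RV[OF R] and r = is_qrepD[OF R] and N = F_ob_mck[OF R]
  note H = fdvs_HS[OF N, unfolded F_ob_simps(1,2)] and co = coev_GHom[OF V(1)] coev_GHom[OF V(2)]
  show "(\<lambda>\<chi>\<in>?I. unit (RV R) \<chi>) \<in> (\<Pi>\<^sub>E \<chi>\<in>?I. Lin (RV R \<chi>) (RV (G_ob \<Gamma> X yt ?N) \<chi>))"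
    using unit_Lin[OF V(1)] by (simp add: PiE_iff G_ob_simps)
  show "(\<lambda>\<chi>\<in>?I. unit (RVf R) \<chi>) \<in> (\<Pi>\<^sub>E \<chi>\<in>?I. Lin (RVf R \<chi>) (RVf (G_ob \<Gamma> X yt ?N) \<chi>))"
    using unit_Lin[OF V(2)] by (simp add: PiE_iff G_ob_simps)
  fix v
  {
    fix h assume h: "h \<in> arcs ?Q" and v: "v \<in> carrier (RV R (tail ?Q h))"
    note i = arcs_tail_head(1)[OF h] and j = arcs_tail_head(2)[OF h] and xv = mhom_closed[OF r(3)[OF h] v]
    have "copy_map (GHom_space \<Gamma> (X (tail ?Q h)) (MM ?N)) (GHom_space \<Gamma> (X (head ?Q h)) (MM ?N)) (Gx ?N h) (enc (GHom_space \<Gamma> (X (tail ?Q h)) (MM ?N)) (coev (RV R) (tail ?Q h) v) :: 'u) =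
        (enc (GHom_space \<Gamma> (X (head ?Q h)) (MM ?N)) (Gx ?N h (coev (RV R) (tail ?Q h) v)) :: 'u)"
      by (rule copy_map_enc) (use H(1)[OF i] co(1)[of "tail ?Q h", OF i v] in \<open>simp_all\<close>)
    then show "(\<lambda>\<chi>\<in>?I. unit (RV R) \<chi>) (head ?Q h) (Rx R h v) = Rx (G_ob \<Gamma> X yt ?N) h ((\<lambda>\<chi>\<in>?I. unit (RV R) \<chi>) (tail ?Q h) v)"
      unfolding restrict_apply'[OF i] restrict_apply'[OF j] G_ob_simps(3)[OF h] unit_apply[of _ "RV R" "tail ?Q h", OF v] unit_apply[of _ "RV R" "head ?Q h", OF xv]
        Gx_coev[OF R h v] F_ob_simps(1) by (rule sym)
  next
    fix \<chi> assume c: "\<chi> \<in> ?I" and v: "v \<in> carrier (RVf R \<chi>)"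
    note vv = mhom_closed[OF r(4)[OF c] v]
    have "copy_map (GHom_space \<Gamma> (X \<chi>) (MMf ?N)) (GHom_space \<Gamma> (X \<chi>) (MM ?N)) (\<lambda>f. \<lambda>w\<in>carrier (X \<chi>). delta X \<chi> \<odot>\<^bsub>MM ?N\<^esub> MZ1 ?N (f w))
          (enc (GHom_space \<Gamma> (X \<chi>) (MMf ?N)) (coev (RVf R) \<chi> v) :: 'u) =
        (enc (GHom_space \<Gamma> (X \<chi>) (MM ?N)) (\<lambda>w\<in>carrier (X \<chi>). delta X \<chi> \<odot>\<^bsub>MM ?N\<^esub> MZ1 ?N (coev (RVf R) \<chi> v w)) :: 'u)"
      by (rule copy_map_enc) (use H(2)[OF c] co(2)[of \<chi>, OF c v] in \<open>simp_all\<close>)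
    then show "(\<lambda>\<chi>\<in>?I. unit (RV R) \<chi>) \<chi> (Rv1 R \<chi> v) = Rv1 (G_ob \<Gamma> X yt ?N) \<chi> ((\<lambda>\<chi>\<in>?I. unit (RVf R) \<chi>) \<chi> v)"
      unfolding restrict_apply'[OF c] G_ob_simps(4)[OF c] unit_apply[of _ "RVf R" \<chi>, OF v] unit_apply[of _ "RV R" \<chi>, OF vv]
        F_ob_simps(1,2) GZ1_coev[OF R c v] by (rule sym)
  next
    fix \<chi> assume c: "\<chi> \<in> ?I" and v: "v \<in> carrier (RV R \<chi>)"
    note vv = mhom_closed[OF r(5)[OF c] v]
    have "copy_map (GHom_space \<Gamma> (X \<chi>) (MM ?N)) (GHom_space \<Gamma> (X \<chi>) (MMf ?N)) (compose (carrier (X \<chi>)) (MZ2 ?N))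
          (enc (GHom_space \<Gamma> (X \<chi>) (MM ?N)) (coev (RV R) \<chi> v) :: 'u) =
        (enc (GHom_space \<Gamma> (X \<chi>) (MMf ?N)) (compose (carrier (X \<chi>)) (MZ2 ?N) (coev (RV R) \<chi> v)) :: 'u)"
      by (rule copy_map_enc) (use H(1)[OF c] co(1)[of \<chi>, OF c v] in \<open>simp_all\<close>)
    then show "(\<lambda>\<chi>\<in>?I. unit (RVf R) \<chi>) \<chi> (Rv2 R \<chi> v) = Rv2 (G_ob \<Gamma> X yt ?N) \<chi> ((\<lambda>\<chi>\<in>?I. unit (RV R) \<chi>) \<chi> v)"
      unfolding restrict_apply'[OF c] G_ob_simps(5)[OF c] unit_apply[of _ "RV R" \<chi>, OF v] unit_apply[of _ "RVf R" \<chi>, OF vv]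
        GZ2_coev[OF R c v] F_ob_simps(1,2) by (rule sym)
  }
qed

lemma unit_natural:
  assumes U: "fdfam U" and V: "fdfam V" and f: "\<forall>\<chi>\<in>Irr TYPE('u) \<Gamma>. f \<chi> \<in> mhom (U \<chi>) (V \<chi>)" and c: "\<chi> \<in> Irr TYPE('u) \<Gamma>"
  shows "compose (carrier (U \<chi>)) (unit V \<chi>) (f \<chi>) = compose (carrier (U \<chi>))
    (copy_map (GHom_space \<Gamma> (X \<chi>) (gcopy (total \<Gamma> X U) :: 'u gmod)) (GHom_space \<Gamma> (X \<chi>) (gcopy (total \<Gamma> X V) :: 'u gmod))
       (\<lambda>a. compose (carrier (X \<chi>)) (total_map \<Gamma> X U V f (\<lambda>\<chi> w. w)) a)) (unit U \<chi>)"
  unfolding compose_def[of "carrier (U \<chi>)"]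
proof (rule restrict_ext)
  fix v assume v: "v \<in> carrier (U \<chi>)"
  note fv = mhom_closed[OF bspec[OF f c] v]
  have e: "compose (carrier (X \<chi>)) (total_map \<Gamma> X U V f (\<lambda>\<chi> w. w)) (coev U \<chi> v) = coev V \<chi> (f \<chi> v)"
    unfolding coev_def compose_def by (rule restrict_ext) (use total_map_inn[OF U V f id_eqv c v] in simp)
  have "copy_map (GHom_space \<Gamma> (X \<chi>) (gcopy (total \<Gamma> X U) :: 'u gmod)) (GHom_space \<Gamma> (X \<chi>) (gcopy (total \<Gamma> X V) :: 'u gmod))
       (\<lambda>a. compose (carrier (X \<chi>)) (total_map \<Gamma> X U V f (\<lambda>\<chi> w. w)) a) (enc (GHom_space \<Gamma> (X \<chi>) (gcopy (total \<Gamma> X U) :: 'u gmod)) (coev U \<chi> v)) =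
     (enc (GHom_space \<Gamma> (X \<chi>) (gcopy (total \<Gamma> X V) :: 'u gmod)) (compose (carrier (X \<chi>)) (total_map \<Gamma> X U V f (\<lambda>\<chi> w. w)) (coev U \<chi> v)) :: 'u)"
    by (rule copy_map_enc[OF fdvs_FM_GHom[OF U c]]) (use coev_GHom[of U \<chi>, OF U c v] in simp)
  then show "unit V \<chi> (f \<chi> v) = copy_map (GHom_space \<Gamma> (X \<chi>) (gcopy (total \<Gamma> X U) :: 'u gmod)) (GHom_space \<Gamma> (X \<chi>) (gcopy (total \<Gamma> X V) :: 'u gmod))
       (\<lambda>a. compose (carrier (X \<chi>)) (total_map \<Gamma> X U V f (\<lambda>\<chi> w. w)) a) (unit U \<chi> v)"
    unfolding unit_apply[of _ V \<chi>, OF fv] unit_apply[of _ U \<chi>, OF v] e by (rule sym)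
qed

lemma unit_iso: "naturally_isomorphic (Rep \<Gamma>) (Rep \<Gamma>) id_functor (comp_functor (G_functor \<Gamma> X yt) (F_functor \<Gamma> X y))"
  unfolding naturally_isomorphic_def
proof (intro exI[of _ "\<lambda>R. (\<lambda>\<chi>\<in>Irr TYPE('u) \<Gamma>. unit (RV R) \<chi>, \<lambda>\<chi>\<in>Irr TYPE('u) \<Gamma>. unit (RVf R) \<chi>)"] conjI ballI)
  let ?I = "Irr TYPE('u) \<Gamma>"
  {
    fix R :: "'u qrep" assume "R \<in> Ob (Rep \<Gamma>)"
    then have R: "is_qrep \<Gamma> R" by simp
    note V = fdfam_RV[OF R]
    have "is_iso (Rep \<Gamma>) R (G_ob \<Gamma> X yt (F_ob \<Gamma> X y R)) (\<lambda>\<chi>\<in>?I. unit (RV R) \<chi>, \<lambda>\<chi>\<in>?I. unit (RVf R) \<chi>)"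
      by (rule rep_isoI[OF R G_ob_qrep[OF F_ob_mck[OF R]] unit_mor[OF R]])
        (use unit_bij[OF V(1)] unit_bij[OF V(2)] in \<open>simp_all only: G_ob_simps F_ob_simps restrict_apply'\<close>)
    then show "is_iso (Rep \<Gamma>) (onOb id_functor R) (onOb (comp_functor (G_functor \<Gamma> X yt) (F_functor \<Gamma> X y)) R) (\<lambda>\<chi>\<in>?I. unit (RV R) \<chi>, \<lambda>\<chi>\<in>?I. unit (RVf R) \<chi>)"
      by (simp add: id_functor_def comp_functor_def G_functor_simps)
  }
  fix R R' :: "'u qrep" and f assume "R \<in> Ob (Rep \<Gamma>)" "R' \<in> Ob (Rep \<Gamma>)" and f: "f \<in> Mor (Rep \<Gamma>) R R'"
  then have R: "is_qrep \<Gamma> R" and R': "is_qrep \<Gamma> R'" by simp_all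
  note V = fdfam_RV[OF R] and V' = fdfam_RV[OF R']
  obtain \<phi> \<psi> where e: "f = (\<phi>, \<psi>)" by (metis surj_pair)
  note F = qrep_mor_all[OF f[unfolded e Rep_simps]]
  show "Cmp (Rep \<Gamma>) (onOb id_functor R) (onOb id_functor R') (onOb (comp_functor (G_functor \<Gamma> X yt) (F_functor \<Gamma> X y)) R')
      (\<lambda>\<chi>\<in>?I. unit (RV R') \<chi>, \<lambda>\<chi>\<in>?I. unit (RVf R') \<chi>) (onMor id_functor R R' f) =
    Cmp (Rep \<Gamma>) (onOb id_functor R) (onOb (comp_functor (G_functor \<Gamma> X yt) (F_functor \<Gamma> X y)) R) (onOb (comp_functor (G_functor \<Gamma> X yt) (F_functor \<Gamma> X y)) R')
      (onMor (comp_functor (G_functor \<Gamma> X yt) (F_functor \<Gamma> X y)) R R' f) (\<lambda>\<chi>\<in>?I. unit (RV R) \<chi>, \<lambda>\<chi>\<in>?I. unit (RVf R) \<chi>)"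
    unfolding e id_functor_def comp_functor_def fctr.simps F_functor_simps G_functor_simps Rep_simps F_ob_simps
    by (intro arg_cong2[of _ _ _ _ Pair] restrict_ext; unfold restrict_apply')
      (rule unit_natural[OF V(1) V'(1) F(1)] unit_natural[OF V(2) V'(2) F(2)], assumption)+
qed

end

section \<open>The counit\<close>

context irreducibles
begin

text \<open>The multiplicity spaces of a single module, so that the same results serve both modules
  of an object. The restriction to \<open>Irr\<close> makes the equations \<open>G_ob_HV\<close>
  hold between functions.\<close>

definition HV :: "'u gmod \<Rightarrow> cfun \<Rightarrow> (complex, 'u) module" where
  "HV M = (\<lambda>\<chi>\<in>Irr TYPE('u) \<Gamma>. copy (GHom_space \<Gamma> (X \<chi>) M))"

lemma HV_simp: "\<chi> \<in> Irr TYPE('u) \<Gamma> \<Longrightarrow> HV M \<chi> = copy (GHom_space \<Gamma> (X \<chi>) M)"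
  by (simp add: HV_def)

context
  fixes M :: "'u gmod"
  assumes M: "is_gmod \<Gamma> M"
begin

lemma fdvs_HM: "\<chi> \<in> Irr TYPE('u) \<Gamma> \<Longrightarrow> fdvs (GHom_space \<Gamma> (X \<chi>) M)"
  by (rule fdvs_GHom_space[OF irrD(3) M])

lemma fdfam_HV: "fdfam (HV M)"
  unfolding fdfam_def using fdvs_copy[OF encodable[OF fdvs_HM] fdvs_HM] by (simp add: HV_simp)

lemma HV_cases:
  assumes "\<chi> \<in> Irr TYPE('u) \<Gamma>" "v \<in> carrier (HV M \<chi>)"
  obtains f where "f \<in> GHom \<Gamma> (X \<chi>) M" "v = enc (GHom_space \<Gamma> (X \<chi>) M) f"
  using assms by (auto simp: HV_simp)

lemma HV_enc: "\<chi> \<in> Irr TYPE('u) \<Gamma> \<Longrightarrow> f \<in> GHom \<Gamma> (X \<chi>) M \<Longrightarrow> enc (GHom_space \<Gamma> (X \<chi>) M) f \<in> carrier (HV M \<chi>)"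
  by (simp add: HV_simp)

lemma HV_eqI:
  assumes Z: "vs Z" and f: "f \<in> mhom (gcopy (total \<Gamma> X (HV M)) :: 'u gmod) Z" and g: "g \<in> mhom (gcopy (total \<Gamma> X (HV M)) :: 'u gmod) Z"
    and eq: "\<And>\<chi> a w. \<chi> \<in> Irr TYPE('u) \<Gamma> \<Longrightarrow> a \<in> GHom \<Gamma> (X \<chi>) M \<Longrightarrow> w \<in> carrier (X \<chi>) \<Longrightarrow>
      f (inn (HV M) \<chi> (enc (GHom_space \<Gamma> (X \<chi>) M) a) w) = g (inn (HV M) \<chi> (enc (GHom_space \<Gamma> (X \<chi>) M) a) w)"
    and m: "m \<in> carrier (gcopy (total \<Gamma> X (HV M)) :: 'u gmod)"
  shows "f m = g m"
proof (rule FM_eqI[OF fdfam_HV Z f g _ m])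
  fix \<chi> v w assume c: "\<chi> \<in> Irr TYPE('u) \<Gamma>" "v \<in> carrier (HV M \<chi>)" "w \<in> carrier (X \<chi>)"
  obtain a where a: "a \<in> GHom \<Gamma> (X \<chi>) M" "v = enc (GHom_space \<Gamma> (X \<chi>) M) a" using HV_cases[OF c(1,2)] .
  show "f (inn (HV M) \<chi> v w) = g (inn (HV M) \<chi> v w)" unfolding a(2) by (rule eq[OF c(1) a(1) c(3)])
qed

definition is_counit :: "('u \<Rightarrow> 'u) \<Rightarrow> bool" where
  "is_counit L \<longleftrightarrow> L \<in> GHom \<Gamma> (gcopy (total \<Gamma> X (HV M))) M \<and> (\<forall>\<chi>\<in>Irr TYPE('u) \<Gamma>. \<forall>f\<in>GHom \<Gamma> (X \<chi>) M. \<forall>w\<in>carrier (X \<chi>).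
     L (inn (HV M) \<chi> (enc (GHom_space \<Gamma> (X \<chi>) M) f) w) = f w)"

text \<open>Evaluation is linear in the map and in the vector, so \<open>FM_lift\<close> provides
  \<open>L\<close>, and \<open>L\<close> is equivariant because every \<open>f\<close> is. The map
  is extensional and by \<open>HV_eqI\<close> determined on generators, so the choice in
  \<open>counit\<close> is unique.\<close>

lemma counit_exists: "\<exists>L. is_counit L"
proof -
  let ?F = "gcopy (total \<Gamma> X (HV M)) :: 'u gmod" and ?I = "Irr TYPE('u) \<Gamma>"
  note V = fdfam_HV and m = is_gmodD[OF M] and F = is_gmodD[OF FM_gmod[OF fdfam_HV]]
  have "bilinear (HV M \<chi>) (X \<chi>) M (\<lambda>a w. dec (GHom_space \<Gamma> (X \<chi>) M) a w)" if c: "\<chi> \<in> ?I" for \<chi>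
    unfolding bilinear_def HV_simp[OF c]
  proof (intro conjI ballI)
    fix a assume "a \<in> carrier (copy (GHom_space \<Gamma> (X \<chi>) M) :: (complex, 'u) module)"
    from dec_closed[OF this] show "dec (GHom_space \<Gamma> (X \<chi>) M) a \<in> mhom (X \<chi>) M" by (simp add: Lin_mhom[OF GHom_Lin])
  next
    fix w assume "w \<in> carrier (X \<chi>)"
    then show "(\<lambda>a. dec (GHom_space \<Gamma> (X \<chi>) M) a w) \<in> mhom (copy (GHom_space \<Gamma> (X \<chi>) M) :: (complex, 'u) module) M"
      by (rule mhom_comp[OF dec_mhom[OF encodable[OF fdvs_HM[OF c]] fdvs_vs[OF fdvs_HM[OF c]]] GHom_eval_mhom])
  qed
  then have b: "\<forall>\<chi>\<in>?I. bilinear (HV M \<chi>) (X \<chi>) M (\<lambda>a w. dec (GHom_space \<Gamma> (X \<chi>) M) a w)" by blast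
  obtain L where L: "L \<in> mhom ?F M"
    and Li: "\<And>\<chi> v w. \<chi> \<in> ?I \<Longrightarrow> v \<in> carrier (HV M \<chi>) \<Longrightarrow> w \<in> carrier (X \<chi>) \<Longrightarrow> L (inn (HV M) \<chi> v w) = dec (GHom_space \<Gamma> (X \<chi>) M) v w"
    using FM_lift[OF V m(2) b] by blast
  have Lf: "L (inn (HV M) \<chi> (enc (GHom_space \<Gamma> (X \<chi>) M) f) w) = f w" if "\<chi> \<in> ?I" "f \<in> GHom \<Gamma> (X \<chi>) M" "w \<in> carrier (X \<chi>)" for \<chi> f w
    using Li[OF that(1) HV_enc[OF that(1,2)] that(3)] that(2) fdvs_HM[OF that(1)] by simp
  have "L \<in> eqv \<Gamma> ?F M"
  proof (rule eqvI[OF L])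
    fix g a assume g: "g \<in> \<Gamma>" and a: "a \<in> carrier ?F"
    show "L (act ?F g a) = act M g (L a)"
    proof (rule HV_eqI[OF m(2) mhom_comp[OF F(3)[OF g] L] mhom_comp[OF L m(3)[OF g]] _ a])
      fix \<chi> f w assume c: "\<chi> \<in> ?I" and f: "f \<in> GHom \<Gamma> (X \<chi>) M" and w: "w \<in> carrier (X \<chi>)"
      show "L (act ?F g (inn (HV M) \<chi> (enc (GHom_space \<Gamma> (X \<chi>) M) f) w)) = act M g (L (inn (HV M) \<chi> (enc (GHom_space \<Gamma> (X \<chi>) M) f) w))"
        unfolding inn_act[OF V c HV_enc[OF c f] w g] Lf[OF c f w] Lf[OF c f is_gmodD(4)[OF irrD(3)[OF c] g w]] by (rule eqv_act[OF GHom_eqv[OF f] g w])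
    qed
  qed
  from restrict_GHom[OF FM_gmod[OF V] this] have "is_counit (restrict L (carrier ?F))"
    unfolding is_counit_def using Lf inn_closed[OF V _ HV_enc] by (simp del: gcopy_simps)
  then show ?thesis by (rule exI[where P = is_counit])
qed

end

definition counit :: "'u gmod \<Rightarrow> 'u \<Rightarrow> 'u" where
  "counit M = (SOME L. is_counit M L)"

context
  fixes M :: "'u gmod"
  assumes M: "is_gmod \<Gamma> M"
begin

lemma counit_GHom: "counit M \<in> GHom \<Gamma> (gcopy (total \<Gamma> X (HV M))) M"
  and counit_inn: "\<chi> \<in> Irr TYPE('u) \<Gamma> \<Longrightarrow> f \<in> GHom \<Gamma> (X \<chi>) M \<Longrightarrow> w \<in> carrier (X \<chi>) \<Longrightarrow>
     counit M (inn (HV M) \<chi> (enc (GHom_space \<Gamma> (X \<chi>) M) f) w) = f w"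
  using someI_ex[OF counit_exists[OF M]] unfolding counit_def is_counit_def[OF M] by blast+

text \<open>An irreducible summand of the kernel is included by some \<open>coev v\<close>, where
  \<open>v\<close> encodes an equivariant map into \<open>M\<close>; this map is the counit after
  the inclusion, hence zero, so the summand cannot exist. Surjectivity follows from a decomposition
  of \<open>M\<close>, whose inclusions are themselves elements of the multiplicity spaces.\<close>

lemma counit_bij: "bij_betw (counit M) (carrier (gcopy (total \<Gamma> X (HV M)) :: 'u gmod)) (carrier M)"
proof -
  let ?F = "gcopy (total \<Gamma> X (HV M)) :: 'u gmod" and ?I = "Irr TYPE('u) \<Gamma>" and ?L = "counit M"
  note V = fdfam_HV[OF M] and m = is_gmodD[OF M] and F = is_gmodD[OF FM_gmod[OF fdfam_HV[OF M]]]
  note L = Lin_mhom[OF GHom_Lin[OF counit_GHom]]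
  let ?K = "{a \<in> carrier ?F. ?L a = \<zero>\<^bsub>M\<^esub>}"
  have K: "gsub \<Gamma> ?F ?K" by (rule kernel_gsub[OF FM_gmod[OF V] M GHom_eqv[OF counit_GHom]])
  note KM = gsub_gmod[OF FM_gmod[OF V] K]
  have ker: "a = \<zero>\<^bsub>?F\<^esub>" if a: "a \<in> ?K" for a
  proof -
    obtain n k f g where d: "isodecomp (?F\<lparr>carrier := ?K\<rparr>) n k f g" using isodecomp_exists[OF KM(1)] by blast
    have z: "f i w = \<zero>\<^bsub>?F\<^esub>" if i: "i < n" and w: "w \<in> carrier (X (k i))" for i w
    proof -
      note x = irrD[OF isodecompD(1)[OF d i]] and c = isodecompD(1)[OF d i]
      note fe = eqv_comp[OF isodecompD(2)[OF d i] KM(2)]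
      have "restrict (f i) (carrier (X (k i))) \<in> GHom \<Gamma> (X (k i)) ?F" by (rule restrict_GHom[OF x(3) fe])
      then obtain v where v: "v \<in> carrier (HV M (k i))" and fv: "restrict (f i) (carrier (X (k i))) = coev (HV M) (k i) v"
        by (rule coev_surj[OF V c])
      from HV_cases[OF M c v] obtain b where b: "b \<in> GHom \<Gamma> (X (k i)) M" "v = enc (GHom_space \<Gamma> (X (k i)) M) b" .
      \<comment> \<open>\<open>b u\<close> is the counit at \<open>f i u\<close>, an element of its
        kernel.\<close>
      have "b u = \<zero>\<^bsub>M\<^esub>" if u: "u \<in> carrier (X (k i))" for u
      proof -
        have "f i u = inn (HV M) (k i) v u" using fun_cong[OF fv, of u] u by (simp add: coev_def)
        moreover have "f i u \<in> ?K" using eqv_closed[OF isodecompD(2)[OF d i] u] by simp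
        ultimately show ?thesis using counit_inn[OF c b(1) u] b(2) by simp
      qed
      then have "b = \<zero>\<^bsub>GHom_space \<Gamma> (X (k i)) M\<^esub>"
        unfolding GHom_space_simps by (intro extensionalityI[of b "carrier (X (k i))"]) (use b(1) in \<open>auto simp: GHom_iff\<close>)
      then have v0: "v = \<zero>\<^bsub>HV M (k i)\<^esub>" unfolding b(2) HV_simp[OF c] by simp
      have "f i w = inn (HV M) (k i) v w" using fun_cong[OF fv, of w] w by (simp add: coev_def)
      also have "\<dots> = \<zero>\<^bsub>?F\<^esub>" unfolding v0
        by (rule mhom_zero[OF fdvs_vs[OF fdfamD[OF V c]] F(2) bilinearD(2)[OF inn_bilinear[OF V c] w]])
      finally show ?thesis .
    qed
    have "a = finsum (?F\<lparr>carrier := ?K\<rparr>) (\<lambda>i. f i (g i a)) {..<n}" using isodecompD(6)[OF d] a by simp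
    also have "\<dots> = \<zero>\<^bsub>?F\<lparr>carrier := ?K\<rparr>\<^esub>"
    proof (rule vfinsum_zero[OF is_gmodD(2)[OF KM(1)]])
      fix i assume "i \<in> {..<n}"
      then have i: "i < n" by simp
      have "g i a \<in> carrier (X (k i))" by (rule eqv_closed[OF isodecompD(3)[OF d i]]) (use a in simp)
      from z[OF i this] show "f i (g i a) = \<zero>\<^bsub>?F\<lparr>carrier := ?K\<rparr>\<^esub>" by simp
    qed
    finally show ?thesis by simp
  qed
  have inj: "inj_on ?L (carrier ?F)"
  proof (rule inj_onI)
    fix a b assume ab: "a \<in> carrier ?F" "b \<in> carrier ?F" "?L a = ?L b"
    have mb: "(-1) \<odot>\<^bsub>?F\<^esub> b \<in> carrier ?F" by (rule vsmult_closed[OF F(2) ab(2)])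
    have "?L (a \<oplus>\<^bsub>?F\<^esub> (-1) \<odot>\<^bsub>?F\<^esub> b) = ?L a \<oplus>\<^bsub>M\<^esub> (-1) \<odot>\<^bsub>M\<^esub> ?L b"
      unfolding mhom_add[OF L ab(1) mb] mhom_smult[OF L ab(2)] ..
    also have "\<dots> = \<zero>\<^bsub>M\<^esub>" unfolding ab(3) by (rule vneg[OF m(2) mhom_closed[OF L ab(2)]])
    finally have "a \<oplus>\<^bsub>?F\<^esub> (-1) \<odot>\<^bsub>?F\<^esub> b = \<zero>\<^bsub>?F\<^esub>" by (intro ker CollectI conjI vadd_closed[OF F(2) ab(1) mb])
    then show "a = b" using vsub_eq_zero[OF F(2) ab(1,2)] by metis
  qed
  have "u \<in> ?L ` carrier ?F" if u: "u \<in> carrier M" for u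
  proof -
    obtain n k f g where d: "isodecomp M n k f g" using isodecomp_exists[OF M] by blast
    \<comment> \<open>A preimage of the component \<open>f i (g i u)\<close>: the inclusion
      \<open>f i\<close>, as an element of the multiplicity space, paired with the vector
      \<open>g i u\<close>.\<close>
    define t where "t i = inn (HV M) (k i) (enc (GHom_space \<Gamma> (X (k i)) M) (restrict (f i) (carrier (X (k i))))) (g i u)" for i
    have gu: "g i u \<in> carrier (X (k i))" if "i < n" for i by (rule eqv_closed[OF isodecompD(3)[OF d that] u])
    have r: "restrict (f i) (carrier (X (k i))) \<in> GHom \<Gamma> (X (k i)) M" if "i < n" for i
      by (rule restrict_GHom[OF irrD(3)[OF isodecompD(1)[OF d that]] isodecompD(2)[OF d that]])
    have tc: "t i \<in> carrier ?F" if "i < n" for i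
      unfolding t_def by (rule inn_closed[OF V isodecompD(1)[OF d that] HV_enc[OF M isodecompD(1)[OF d that] r[OF that]] gu[OF that]])
    have Lt: "?L (t i) = f i (g i u)" if "i < n" for i
      unfolding t_def counit_inn[OF isodecompD(1)[OF d that] r[OF that] gu[OF that]] using gu[OF that] by simp
    have tP: "t \<in> {..<n} \<rightarrow> carrier ?F" using tc by blast
    have "?L (finsum ?F t {..<n}) = finsum M (\<lambda>i. ?L (t i)) {..<n}"
      by (rule mhom_finsum[OF F(2) m(2) L finite_lessThan tP])
    also have "\<dots> = finsum M (\<lambda>i. f i (g i u)) {..<n}"
    proof (rule vfinsum_cong[OF m(2) refl])
      fix i assume "i \<in> {..<n}"
      then have i: "i < n" by simp
      show "?L (t i) = f i (g i u)" by (rule Lt[OF i])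
      show "f i (g i u) \<in> carrier M" by (rule eqv_closed[OF isodecompD(2)[OF d i] gu[OF i]])
    qed
    also have "\<dots> = u" by (rule isodecompD(6)[OF d u])
    finally show ?thesis using vfinsum_closed[OF F(2) tP] by (metis image_eqI)
  qed
  then have "?L ` carrier ?F = carrier M" using mhom_closed[OF L] by blast
  with inj show ?thesis by (simp add: bij_betw_def)
qed

end

end

context mckay_choice
begin

lemma G_ob_HV: "RV (G_ob \<Gamma> X yt N) = HV (MM N)" "RVf (G_ob \<Gamma> X yt N) = HV (MMf N)"
  by (simp_all add: G_ob_def Let_def HV_def)

text \<open>On a generator the left side is a sum of terms \<open>MD N (?T (yt h (y h ?p)))\<close>,
  with \<open>?T\<close> the map induced by \<open>f\<close> and \<open>?p\<close> the pure tensor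
  of \<open>s\<close> and \<open>w\<close>. Linearity gathers the sum inside \<open>?T\<close>,
  where \<open>yt_y\<close> replaces it by \<open>?p\<close>.\<close>

lemma counit_Delta:
  assumes N: "is_mck \<Gamma> N" and s: "s \<in> carrier Xstd" and c: "\<chi> \<in> Irr TYPE('u) \<Gamma>" and f: "f \<in> GHom \<Gamma> (X \<chi>) (MM N)" and w: "w \<in> carrier (X \<chi>)"
  shows "counit (MM N) (MD (F_ob \<Gamma> X y (G_ob \<Gamma> X yt N)) (pure Xstd (gcopy (total \<Gamma> X (HV (MM N)))) s (inn (HV (MM N)) \<chi> (enc (GHom_space \<Gamma> (X \<chi>) (MM N)) f) w)))
    = MD N (pure Xstd (MM N) s (f w))"
proof -
  let ?M = "MM N" and ?R = "G_ob \<Gamma> X yt N" and ?F = "gcopy (total \<Gamma> X (HV (MM N))) :: 'u gmod" and ?Q = "mckay_quiver TYPE('u) \<Gamma>"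
  let ?A = "{h \<in> arcs ?Q. tail ?Q h = \<chi>}"
  note n = is_mckD[OF N] and R = G_ob_qrep[OF N] and V = fdfam_HV[OF n(1)] and x = irrD[OF c]
  note L = Lin_mhom[OF GHom_Lin[OF counit_GHom[OF n(1)]]] and F = is_gmodD[OF FM_gmod[OF V]] and fm = Lin_mhom[OF GHom_Lin[OF f]]
  let ?v = "enc (GHom_space \<Gamma> (X \<chi>) ?M) f :: 'u"
  let ?p = "pure Xstd (X \<chi>) s w"
  have p: "?p \<in> carrier (tensor Xstd (X \<chi>))" by (rule pure_closed[OF fdvs_vs[OF fdvs_Xstd] x(5) s w])
  have v: "?v \<in> carrier (HV ?M \<chi>)" by (rule HV_enc[OF n(1) c f])
  let ?T = "tmap Xstd (X \<chi>) Xstd ?M (\<lambda>s. s) f"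
  have T: "(\<lambda>t. MD N (?T t)) \<in> mhom (tensor Xstd (X \<chi>)) ?M"
    by (rule mhom_comp[OF tmap_mhom[OF fdvs_Xstd x(4) fdvs_Xstd n(6) mhom_id fm] n(8)])
  let ?t = "\<lambda>h. inn (HV ?M) (head ?Q h) (Rx ?R h ?v) (y h ?p)"
  have h: "?t h \<in> carrier ?F \<and> counit ?M (?t h) = MD N (?T (yt h (y h ?p)))" if "h \<in> ?A" for h
  proof -
    from that have h: "h \<in> arcs ?Q" "tail ?Q h = \<chi>" by auto
    note j = arcs_tail_head(2)[OF h(1)]
    have G: "Gx N h f \<in> GHom \<Gamma> (X (head ?Q h)) ?M" using mhom_closed[OF Gx_mhom[OF N h(1)]] f h(2) by simp
    have yp: "y h ?p \<in> carrier (X (head ?Q h))" by (rule mhom_closed[OF y_mhom(1)[OF h(1), unfolded h(2)] p])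
    have r: "Rx ?R h ?v = enc (GHom_space \<Gamma> (X (head ?Q h)) ?M) (Gx N h f)"
      unfolding G_ob_simps(3)[OF h(1)] h(2) by (rule copy_map_enc[OF fdvs_HM[OF n(1) c]]) (use f in simp)
    have "counit ?M (?t h) = Gx N h f (y h ?p)" unfolding r by (rule counit_inn[OF n(1) j G yp])
    also have "\<dots> = MD N (?T (yt h (y h ?p)))" using yp by (simp add: Gx_def h(2))
    finally show ?thesis using inn_closed[OF V j HV_enc[OF n(1) j G] yp] unfolding r by blast
  qed
  have tP: "?t \<in> ?A \<rightarrow> carrier ?F" using h by blast
  have yc: "yt h (y h ?p) \<in> carrier (tensor Xstd (X \<chi>))" if "h \<in> ?A" for h
  proof -
    from that have h: "h \<in> arcs ?Q" "tail ?Q h = \<chi>" by auto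
    show ?thesis by (rule mhom_closed[OF y_mhom(2)[OF h(1), unfolded h(2)] mhom_closed[OF y_mhom(1)[OF h(1), unfolded h(2)] p]])
  qed
  have yP: "(\<lambda>h. yt h (y h ?p)) \<in> ?A \<rightarrow> carrier (tensor Xstd (X \<chi>))" using yc by blast
  have fin: "finite ?A" by simp
  have "counit ?M (MD (F_ob \<Gamma> X y ?R) (pure Xstd ?F s (inn (HV ?M) \<chi> ?v w))) = counit ?M (finsum ?F ?t ?A)"
    using MD_F_pure[OF R s c _ w, unfolded G_ob_HV, OF v] by (rule arg_cong)
  also have "\<dots> = finsum ?M (\<lambda>h. counit ?M (?t h)) ?A" by (rule mhom_finsum[OF F(2) fdvs_vs[OF n(6)] L fin tP])
  also have "\<dots> = finsum ?M (\<lambda>h. MD N (?T (yt h (y h ?p)))) ?A"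
  proof (rule vfinsum_cong[OF fdvs_vs[OF n(6)] refl])
    fix i assume i: "i \<in> ?A"
    show "counit ?M (?t i) = MD N (?T (yt i (y i ?p)))" using h[OF i] by (rule conjunct2)
    show "MD N (?T (yt i (y i ?p))) \<in> carrier ?M" by (rule mhom_closed[OF T yc[OF i]])
  qed
  also have "\<dots> = MD N (?T (finsum (tensor Xstd (X \<chi>)) (\<lambda>h. yt h (y h ?p)) ?A))"
    by (rule mhom_finsum[OF fdvs_vs[OF fdvs_tensor[OF fdvs_Xstd x(4)]] fdvs_vs[OF n(6)] T fin yP, symmetric])
  also have "\<dots> = MD N (?T ?p)" unfolding yt_y[OF c p] ..
  also have "?T ?p = pure Xstd ?M s (f w)" by (rule tmap_pure[OF fdvs_Xstd x(4) fdvs_Xstd n(6) mhom_id fm s w])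
  finally show ?thesis .
qed

lemma counit_mor:
  assumes N: "is_mck \<Gamma> N"
  shows "(counit (MM N), counit (MMf N)) \<in> mck_mor \<Gamma> (F_ob \<Gamma> X y (G_ob \<Gamma> X yt N)) N"
proof (rule mck_mor_pureI[OF F_ob_mck[OF G_ob_qrep[OF N]] N], unfold F_ob_simps(1,2) G_ob_HV)
  let ?R = "G_ob \<Gamma> X yt N" and ?F = "gcopy (total \<Gamma> X (HV (MM N))) :: 'u gmod" and ?Ff = "gcopy (total \<Gamma> X (HV (MMf N))) :: 'u gmod"
  let ?N = "F_ob \<Gamma> X y ?R"
  note n = is_mckD[OF N] and R = G_ob_qrep[OF N] and V = fdfam_HV[OF n(1)] fdfam_HV[OF n(2)]
  note n' = is_mckD[OF F_ob_mck[OF R], unfolded F_ob_simps(1,2) G_ob_HV]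
  note L = Lin_mhom[OF GHom_Lin[OF counit_GHom[OF n(1)]]] and Lf = Lin_mhom[OF GHom_Lin[OF counit_GHom[OF n(2)]]]
  note F = is_gmodD[OF FM_gmod[OF V(1)]]
  show "counit (MM N) \<in> GHom \<Gamma> ?F (MM N)" "counit (MMf N) \<in> GHom \<Gamma> ?Ff (MMf N)"
    by (rule counit_GHom[OF n(1)] counit_GHom[OF n(2)])+
  fix m
  {
    fix s assume s: "s \<in> carrier Xstd" and m: "m \<in> carrier ?F"
    note p = pure_mhom_right[OF fdvs_vs[OF fdvs_Xstd] F(2) s] and p' = pure_mhom_right[OF fdvs_vs[OF fdvs_Xstd] fdvs_vs[OF n(6)] s]
    show "counit (MM N) (MD ?N (pure Xstd ?F s m)) = MD N (pure Xstd (MM N) s (counit (MM N) m))"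
    proof (rule HV_eqI[OF n(1) fdvs_vs[OF n(6)] mhom_comp[OF mhom_comp[OF p n'(8)] L] mhom_comp[OF mhom_comp[OF L p'] n(8)] _ m])
      fix \<chi> f w assume c: "\<chi> \<in> Irr TYPE('u) \<Gamma>" "f \<in> GHom \<Gamma> (X \<chi>) (MM N)" "w \<in> carrier (X \<chi>)"
      show "counit (MM N) (MD ?N (pure Xstd ?F s (inn (HV (MM N)) \<chi> (enc (GHom_space \<Gamma> (X \<chi>) (MM N)) f) w))) =
          MD N (pure Xstd (MM N) s (counit (MM N) (inn (HV (MM N)) \<chi> (enc (GHom_space \<Gamma> (X \<chi>) (MM N)) f) w)))"
        unfolding counit_inn[OF n(1) c] by (rule counit_Delta[OF N s c])
    qed
  next
    assume m: "m \<in> carrier ?F"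
    show "counit (MMf N) (MZ2 ?N m) = MZ2 N (counit (MM N) m)"
    proof (rule HV_eqI[OF n(1) fdvs_vs[OF n(7)] mhom_comp[OF n'(10) Lf] mhom_comp[OF L n(10)] _ m])
      fix \<chi> f w assume c: "\<chi> \<in> Irr TYPE('u) \<Gamma>" "f \<in> GHom \<Gamma> (X \<chi>) (MM N)" "w \<in> carrier (X \<chi>)"
      have r: "Rv2 ?R \<chi> (enc (GHom_space \<Gamma> (X \<chi>) (MM N)) f) = enc (GHom_space \<Gamma> (X \<chi>) (MMf N)) (compose (carrier (X \<chi>)) (MZ2 N) f)"
        unfolding G_ob_simps(5)[OF c(1)] by (rule copy_map_enc[OF fdvs_HM[OF n(1) c(1)]]) (use c in simp)
      have C: "compose (carrier (X \<chi>)) (MZ2 N) f \<in> GHom \<Gamma> (X \<chi>) (MMf N)" by (rule GHom_compose[OF irrD(3)[OF c(1)] c(2) n(5)])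
      have "MZ2 ?N (inn (HV (MM N)) \<chi> (enc (GHom_space \<Gamma> (X \<chi>) (MM N)) f) w) =
          inn (HV (MMf N)) \<chi> (enc (GHom_space \<Gamma> (X \<chi>) (MMf N)) (compose (carrier (X \<chi>)) (MZ2 N) f)) w"
        unfolding F_ob_simps G_ob_HV r[symmetric]
        by (rule total_map_inn[OF V is_qrep_all(2)[OF R, unfolded G_ob_HV] id_eqv c(1) HV_enc[OF n(1) c(1,2)] c(3)])
      then show "counit (MMf N) (MZ2 ?N (inn (HV (MM N)) \<chi> (enc (GHom_space \<Gamma> (X \<chi>) (MM N)) f) w)) =
          MZ2 N (counit (MM N) (inn (HV (MM N)) \<chi> (enc (GHom_space \<Gamma> (X \<chi>) (MM N)) f) w))"
        using counit_inn[OF n(2) c(1) C c(3)] counit_inn[OF n(1) c] c(3) by (simp add: compose_eq)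
    qed
  next
    assume m: "m \<in> carrier ?Ff"
    show "counit (MM N) (MZ1 ?N m) = MZ1 N (counit (MMf N) m)"
    proof (rule HV_eqI[OF n(2) fdvs_vs[OF n(6)] mhom_comp[OF n'(9) L] mhom_comp[OF Lf n(9)] _ m])
      fix \<chi> f w assume c: "\<chi> \<in> Irr TYPE('u) \<Gamma>" "f \<in> GHom \<Gamma> (X \<chi>) (MMf N)" "w \<in> carrier (X \<chi>)"
      let ?g = "\<lambda>w\<in>carrier (X \<chi>). delta X \<chi> \<odot>\<^bsub>MM N\<^esub> MZ1 N (f w)" and ?w = "(1 / delta X \<chi>) \<odot>\<^bsub>X \<chi>\<^esub> w"
      note x = irrD[OF c(1)] and fm = Lin_mhom[OF GHom_Lin[OF c(2)]]
      have w: "?w \<in> carrier (X \<chi>)" using c(3) x(5) by simp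
      have r: "Rv1 ?R \<chi> (enc (GHom_space \<Gamma> (X \<chi>) (MMf N)) f) = enc (GHom_space \<Gamma> (X \<chi>) (MM N)) ?g"
        unfolding G_ob_simps(4)[OF c(1)] by (rule copy_map_enc[OF fdvs_HM[OF n(2) c(1)]]) (use c in simp)
      have C: "?g \<in> GHom \<Gamma> (X \<chi>) (MM N)" using mhom_closed[OF GZ1_mhom[OF N c(1)]] c(2) by simp
      have "MZ1 ?N (inn (HV (MMf N)) \<chi> (enc (GHom_space \<Gamma> (X \<chi>) (MMf N)) f) w) = inn (HV (MM N)) \<chi> (enc (GHom_space \<Gamma> (X \<chi>) (MM N)) ?g) ?w"
        unfolding F_ob_simps G_ob_HV r[symmetric]
        by (rule total_map_inn[OF V(2,1) is_qrep_all(1)[OF R, unfolded G_ob_HV] scale_eqv c(1) HV_enc[OF n(2) c(1,2)] c(3)])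
      then have "counit (MM N) (MZ1 ?N (inn (HV (MMf N)) \<chi> (enc (GHom_space \<Gamma> (X \<chi>) (MMf N)) f) w)) = ?g ?w"
        using counit_inn[OF n(1) c(1) C w] by simp
      also have "\<dots> = delta X \<chi> \<odot>\<^bsub>MM N\<^esub> MZ1 N (f ?w)" using w by simp
      \<comment> \<open>The factor \<open>delta X \<chi>\<close> is moved inside \<open>MZ1\<close>
        and \<open>f\<close> by linearity, where it cancels against the inverse factor on
        \<open>w\<close>.\<close>
      also have "\<dots> = MZ1 N (f (delta X \<chi> \<odot>\<^bsub>X \<chi>\<^esub> ?w))"
        unfolding mhom_smult[OF fm w] mhom_smult[OF n(9) mhom_closed[OF fm w]] ..
      also have "delta X \<chi> \<odot>\<^bsub>X \<chi>\<^esub> ?w = w" using c(3) x(5) delta_nonzero[OF c(1)] by simp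
      finally show "counit (MM N) (MZ1 ?N (inn (HV (MMf N)) \<chi> (enc (GHom_space \<Gamma> (X \<chi>) (MMf N)) f) w)) =
          MZ1 N (counit (MMf N) (inn (HV (MMf N)) \<chi> (enc (GHom_space \<Gamma> (X \<chi>) (MMf N)) f) w))"
        unfolding counit_inn[OF n(2) c] .
    qed
  }
qed

text \<open>Both sides send the generator given by \<open>f\<close> and \<open>w\<close> to
  \<open>\<Phi> (f w)\<close>.\<close>

lemma counit_natural:
  assumes M: "is_gmod \<Gamma> M" and M': "is_gmod \<Gamma> M'" and \<Phi>: "\<Phi> \<in> GHom \<Gamma> M M'"
  shows "compose (carrier (gcopy (total \<Gamma> X (HV M)) :: 'u gmod)) (counit M')
      (total_map \<Gamma> X (HV M) (HV M') (\<lambda>\<chi>\<in>Irr TYPE('u) \<Gamma>. copy_map (GHom_space \<Gamma> (X \<chi>) M) (GHom_space \<Gamma> (X \<chi>) M') (\<lambda>f. compose (carrier (X \<chi>)) \<Phi> f)) (\<lambda>\<chi> w. w)) =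
    compose (carrier (gcopy (total \<Gamma> X (HV M)) :: 'u gmod)) \<Phi> (counit M)"
  unfolding compose_def[of "carrier (gcopy _)"]
proof (rule restrict_ext)
  let ?F = "gcopy (total \<Gamma> X (HV M)) :: 'u gmod"
  define J where "J = (\<lambda>\<chi>\<in>Irr TYPE('u) \<Gamma>. copy_map (GHom_space \<Gamma> (X \<chi>) M) (GHom_space \<Gamma> (X \<chi>) M') (\<lambda>f. compose (carrier (X \<chi>)) \<Phi> f) :: 'u \<Rightarrow> 'u)"
  note V = fdfam_HV[OF M] fdfam_HV[OF M'] and m' = is_gmodD(2)[OF M']
  have Je: "J \<chi> = copy_map (GHom_space \<Gamma> (X \<chi>) M) (GHom_space \<Gamma> (X \<chi>) M') (\<lambda>f. compose (carrier (X \<chi>)) \<Phi> f)" if "\<chi> \<in> Irr TYPE('u) \<Gamma>" for \<chi>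
    unfolding J_def by (rule restrict_apply'[OF that])
  have J: "\<forall>\<chi>\<in>Irr TYPE('u) \<Gamma>. J \<chi> \<in> mhom (HV M \<chi>) (HV M' \<chi>)"
  proof
    fix \<chi> assume c: "\<chi> \<in> Irr TYPE('u) \<Gamma>"
    show "J \<chi> \<in> mhom (HV M \<chi>) (HV M' \<chi>)"
      unfolding Je[OF c] HV_simp[OF c]
      by (rule Lin_mhom[OF copy_map_Lin[OF fdvs_HM[OF M c] fdvs_HM[OF M' c] compose_GHom_mhom[OF irrD(3)[OF c] M M' \<Phi>]]])
  qed
  note L = Lin_mhom[OF GHom_Lin[OF counit_GHom[OF M]]] and L' = Lin_mhom[OF GHom_Lin[OF counit_GHom[OF M']]]
  note T = Lin_mhom[OF GHom_Lin[OF total_map_GHom[OF V J id_eqv]]]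
  fix a assume a: "a \<in> carrier ?F"
  have "counit M' (total_map \<Gamma> X (HV M) (HV M') J (\<lambda>\<chi> w. w) a) = \<Phi> (counit M a)"
  proof (rule HV_eqI[OF M m' mhom_comp[OF T L'] mhom_comp[OF L Lin_mhom[OF GHom_Lin[OF \<Phi>]]] _ a])
    fix \<chi> f w assume c: "\<chi> \<in> Irr TYPE('u) \<Gamma>" "f \<in> GHom \<Gamma> (X \<chi>) M" "w \<in> carrier (X \<chi>)"
    have e: "J \<chi> (enc (GHom_space \<Gamma> (X \<chi>) M) f) = enc (GHom_space \<Gamma> (X \<chi>) M') (compose (carrier (X \<chi>)) \<Phi> f)"
      unfolding Je[OF c(1)] by (rule copy_map_enc[OF fdvs_HM[OF M c(1)]]) (use c in simp)
    show "counit M' (total_map \<Gamma> X (HV M) (HV M') J (\<lambda>\<chi> w. w) (inn (HV M) \<chi> (enc (GHom_space \<Gamma> (X \<chi>) M) f) w)) =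
        \<Phi> (counit M (inn (HV M) \<chi> (enc (GHom_space \<Gamma> (X \<chi>) M) f) w))"
      unfolding total_map_inn[OF V J id_eqv c(1) HV_enc[OF M c(1,2)] c(3)] e counit_inn[OF M c]
        counit_inn[OF M' c(1) GHom_compose[OF irrD(3)[OF c(1)] c(2) \<Phi>] c(3)] by (rule compose_eq[OF c(3)])
  qed
  then show "counit M' (total_map \<Gamma> X (HV M) (HV M') (\<lambda>\<chi>\<in>Irr TYPE('u) \<Gamma>. copy_map (GHom_space \<Gamma> (X \<chi>) M) (GHom_space \<Gamma> (X \<chi>) M') (\<lambda>f. compose (carrier (X \<chi>)) \<Phi> f)) (\<lambda>\<chi> w. w) a) =
      \<Phi> (counit M a)" unfolding J_def .
qed

lemma counit_iso: "naturally_isomorphic (McK \<Gamma>) (McK \<Gamma>) (comp_functor (F_functor \<Gamma> X y) (G_functor \<Gamma> X yt)) id_functor"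
  unfolding naturally_isomorphic_def
proof (intro exI[of _ "\<lambda>N. (counit (MM N), counit (MMf N))"] conjI ballI)
  {
    fix N :: "'u mck" assume "N \<in> Ob (McK \<Gamma>)"
    then have N: "is_mck \<Gamma> N" by simp
    note n = is_mckD[OF N]
    have "is_iso (McK \<Gamma>) (F_ob \<Gamma> X y (G_ob \<Gamma> X yt N)) N (counit (MM N), counit (MMf N))"
      by (rule mck_isoI[OF F_ob_mck[OF G_ob_qrep[OF N]] N counit_mor[OF N]], unfold F_ob_simps(1,2) G_ob_HV)
        (rule counit_bij[OF n(1)] counit_bij[OF n(2)])+
    then show "is_iso (McK \<Gamma>) (onOb (comp_functor (F_functor \<Gamma> X y) (G_functor \<Gamma> X yt)) N) (onOb id_functor N) (counit (MM N), counit (MMf N))"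
      by (simp add: id_functor_def comp_functor_def G_functor_simps)
  }
  fix N N' :: "'u mck" and f assume "N \<in> Ob (McK \<Gamma>)" "N' \<in> Ob (McK \<Gamma>)" and f: "f \<in> Mor (McK \<Gamma>) N N'"
  then have N: "is_mck \<Gamma> N" and N': "is_mck \<Gamma> N'" by simp_all
  note n = is_mckD[OF N] and n' = is_mckD[OF N']
  obtain \<Phi> \<Psi> where e: "f = (\<Phi>, \<Psi>)" by (metis surj_pair)
  note D = mck_morD[OF f[unfolded e McK_simps]]
  show "Cmp (McK \<Gamma>) (onOb (comp_functor (F_functor \<Gamma> X y) (G_functor \<Gamma> X yt)) N) (onOb (comp_functor (F_functor \<Gamma> X y) (G_functor \<Gamma> X yt)) N') (onOb id_functor N')
      (counit (MM N'), counit (MMf N')) (onMor (comp_functor (F_functor \<Gamma> X y) (G_functor \<Gamma> X yt)) N N' f) =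
    Cmp (McK \<Gamma>) (onOb (comp_functor (F_functor \<Gamma> X y) (G_functor \<Gamma> X yt)) N) (onOb id_functor N) (onOb id_functor N')
      (onMor id_functor N N' f) (counit (MM N), counit (MMf N))"
    unfolding e id_functor_def comp_functor_def fctr.simps F_functor_simps G_functor_simps McK_simps F_ob_simps G_ob_HV
    by (intro arg_cong2[of _ _ _ _ Pair] counit_natural n n' D)
qed

end

theorem proposition2p15:
  fixes \<Gamma> :: "complex mat set"
    and X :: "cfun \<Rightarrow> 'u gmod"
    and y :: "arrow \<Rightarrow> (complex vec, 'u) tens \<Rightarrow> 'u"
    and yt :: "arrow \<Rightarrow> 'u \<Rightarrow> (complex vec, 'u) tens"
  assumes universe: "\<exists>f :: complex \<Rightarrow> 'u. inj f"
    and "subgroup \<Gamma> SL2" and "finite \<Gamma>" and nontrivial: "\<Gamma> \<noteq> {1\<^sub>m 2}"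
    and "irr_choice \<Gamma> X"
    and "arrow_choice \<Gamma> X y yt"
  shows "equivalence_of_categories (Rep \<Gamma>) (McK \<Gamma>) (F_functor \<Gamma> X y) (G_functor \<Gamma> X yt)"
proof -
  interpret mckay_choice \<Gamma> X y yt 
    by (intro mckay_choice.intro irreducibles.intro finite_SL2.intro irreducibles_axioms.intro mckay_choice_axioms.intro assms)
  show ?thesis
    unfolding equivalence_of_categories_def
    by (intro conjI category_Rep category_McK functor_F functor_G unit_iso counit_iso)
qed

end
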